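(* Let $S\approx (a,b)\times S^1$ be a smooth two-dimensional surface with coordinates $(r,\varphi \bmod 2\pi)$ and Riemannian metric $ds^2=dr^2+f^2(r)\,d\varphi^2$, where $-\infty\le a<b\le\infty$ and $f$ is $C^\infty$ and positive on $(a,b)$. Suppose that $f$ does not satisfy the identity $f''f-(f')^2=-\xi^2$ for any rational $\xi>0$, and that $f$ has no critical points on $(a,b)$. Then there exists at most one (up to additive and multiplicative constants) semilocally closing (respectively locally closing, closing, strongly closing, weakly closing) central potential on $S$. Moreover, there is exactly one such potential (up to additive and multiplicative constants) if and only if there exists a smooth function $\theta=\theta(r)$ without zeros on $(a,b)$ such that $\theta'(r)>0$ and the Riemannian metric in the coordinates $(\theta,\varphi\bmod 2\pi)$ has the form $$ds^2=\frac{d\theta^2}{(\theta^2+c-d\theta^{-2})^2}+\frac{d\varphi^2}{\mu^2(\theta^2+c-d\theta^{-2})},$$ where $\mu$ is a positive rational constant, $d$ is a nonzero real constant and $c$ is an arbitrary real constant. In this case the function $\theta(r)$ and the triple $(\mu,c,d)$ are unique (if they exist), and the closing potential is the generalized oscillator one, i.e. it has the form $V_2(r)=\frac{A}{2\theta^2(r)}+B$, where $A,B\in\mathbb{R}$ and $A(\theta^4(r)+d)>0$. The corresponding nonsingular noncircular bounded orbits are given by periodic functions $r=r(\varphi)$ with minimal positive period $\Phi=\pi\mu$. On the phase trajectory corresponding to a circular orbit $\{r\}\times S^1\subset(a,b)\times S^1$ the value of the angular momentum is $K=\pm\frac1\mu\sqrt{\frac{A}{\theta^4(r)+d}}$. The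 boundary circle $\{r_0\}\times S^1$ at which $\inf f(r)$ (i.e. $\sup A|\theta(r)|$) is attained is an attracting centre of the field with closing potential $V_2$ (i.e. $\inf V_2(r)$ is attained there).
   Context: A central potential is a $C^\infty$ function $V=V(r)$ on $(a,b)$. A point moves on $S$ with Lagrangian $L=\frac12(\dot r^2+f^2(r)\dot\varphi^2)-V(r)$; first integrals are the energy $\frac12(\dot r^2+f^2\dot\varphi^2)+V$ and the angular momentum $K=f^2(r)\dot\varphi$. A trajectory is a solution defined on a maximal time interval; its orbit is its image in $S$; the phase trajectory is the trajectory with its velocity in $TS$. An orbit (trajectory) is circular if it is an orbit $\{r_0\}\times S^1$ of the rotation group. A circular orbit is strongly stable if on it the effective potential $V(r)+\frac{K_0^2}{2f^2(r)}$ has a nondegenerate local minimum for some $K_0\ne0$. A closed orbit is orbitally stable if the corresponding phase trajectory is orbitally stable for the restriction of the system to the level set of $K$ containing it. A trajectory (orbit) is bounded if it is defined for all $t\in\mathbb{R}$ and its image lies in a compact set $[r_1,r_2]\times S^1\subset(a,b)\times S^1$. It is singular if $K=0$ on it (i.e. $\varphi=\mathrm{const}$). Conditions on $V$: ($\exists$) there exists a nonsingular bounded noncircular orbit $\gamma$ in $S$; ($\forall$) every nonsingular bounded orbit in $S$ is closed; ($\exists$)$^{\rm loc}$ there exists a strongly stable circular orbit in $S$; ($\forall$)$^{\rm loc}$ for every strongly stable circular orbit $\{r_0\}\times S^1$ there is $\varepsilon>0$ such that every nonsingular bounded orbit contained in $[r_0-\varepsilon,r_0+\varepsilon]\times S^1$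 with angular momentum in $(K_0-\varepsilon,K_0+\varepsilon)$ is closed, where $K_0$ is the angular momentum of the corresponding circular trajectory; ($\forall$)$^{\rm s-loc}$ every nonsingular bounded orbit in the annulus $[a',b']\times S^1$ with angular momentum $\hat K$ is closed, where $a'=\inf r|_\gamma$, $b'=\sup r|_\gamma$, $\gamma$ is the orbit from ($\exists$) and $\hat K$ is its angular momentum. $V$ is called: closing if ($\exists$) and ($\forall$) hold; locally closing if ($\exists$)$^{\rm loc}$ and ($\forall$)$^{\rm loc}$ hold; semilocally closing if ($\exists$), ($\forall$)$^{\rm loc}$ and ($\forall$)$^{\rm s-loc}$ hold; strongly (resp. weakly) closing if ($\forall$)$^{\rm loc}$ (resp. its analogue for every orbitally stable circular orbit) holds and every circle $\{r\}\times S^1$ is a strongly stable (resp. orbitally stable) circular orbit. A boundary circle is $\{r_0\}\times S^1$ with $r_0\in\{a,b\}$; infima and suprema are "attained" there in the sense of limits as $r\to r_0$. *)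

theory Defs
  imports "HOL-Analysis.Analysis"
begin

text \<open>
  The surface with the metric of the form \<open>dr\<^sup>2 + f(r)\<^sup>2 d\<phi>\<^sup>2\<close> is given by the open interval
  \<open>einterval a b\<close> (\<open>a\<close>, \<open>b\<close> extended reals) and the function \<open>f\<close>. Functions on the interval are
  total functions on the reals; nothing below depends on their values outside it.
\<close>

section \<open>Smooth functions on an open interval\<close>

definition smooth_on_interval :: "ereal \<Rightarrow> ereal \<Rightarrow> (real \<Rightarrow> real) \<Rightarrow> bool" where
  "smooth_on_interval a b g \<longleftrightarrow>
     (\<forall>n. \<forall>x \<in> einterval a b. ((deriv ^^ n) g) differentiable (at x))"

definition central_potential :: "ereal \<Rightarrow> ereal \<Rightarrow> (real \<Rightarrow> real) \<Rightarrow> bool" where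
  "central_potential a b V \<longleftrightarrow> smooth_on_interval a b V"

section \<open>Dynamics\<close>

definition lagrangian ::
  "(real \<Rightarrow> real) \<Rightarrow> (real \<Rightarrow> real) \<Rightarrow> real \<Rightarrow> real \<Rightarrow> real \<Rightarrow> real \<Rightarrow> real" where
  "lagrangian f V r \<phi> vr v\<phi> = (vr\<^sup>2 + (f r)\<^sup>2 * v\<phi>\<^sup>2) / 2 - V r"

text \<open>
  A curve on the surface is written with a real-valued lift of its angle \<open>\<phi>\<close>. The last two clauses
  are the two Euler--Lagrange equations.
\<close>

definition is_solution ::
  "ereal \<Rightarrow> ereal \<Rightarrow> (real \<Rightarrow> real) \<Rightarrow> (real \<Rightarrow> real) \<Rightarrow>
   real set \<Rightarrow> (real \<Rightarrow> real) \<Rightarrow> (real \<Rightarrow> real) \<Rightarrow> bool" where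
  "is_solution a b f V I r \<phi> \<longleftrightarrow>
     open I \<and> is_interval I \<and> I \<noteq> {} \<and>
     (\<forall>t\<in>I. r t \<in> einterval a b \<and> r differentiable (at t) \<and> \<phi> differentiable (at t) \<and>
        ((\<lambda>s. deriv (\<lambda>u. lagrangian f V (r s) (\<phi> s) u (deriv \<phi> s)) (deriv r s))
           has_real_derivative
           deriv (\<lambda>x. lagrangian f V x (\<phi> t) (deriv r t) (deriv \<phi> t)) (r t)) (at t) \<and>
        ((\<lambda>s. deriv (\<lambda>u. lagrangian f V (r s) (\<phi> s) (deriv r s) u) (deriv \<phi> s))
           has_real_derivative
           deriv (\<lambda>y. lagrangian f V (r t) y (deriv r t) (deriv \<phi> t)) (\<phi> t)) (at t))"

definition is_trajectory ::
  "ereal \<Rightarrow> ereal \<Rightarrow> (real \<Rightarrow> real) \<Rightarrow> (real \<Rightarrow> real) \<Rightarrow>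
   real set \<Rightarrow> (real \<Rightarrow> real) \<Rightarrow> (real \<Rightarrow> real) \<Rightarrow> bool" where
  "is_trajectory a b f V I r \<phi> \<longleftrightarrow>
     is_solution a b f V I r \<phi> \<and>
     (\<forall>J s \<psi>. is_solution a b f V J s \<psi> \<and> I \<subseteq> J \<and> (\<forall>t\<in>I. s t = r t \<and> \<psi> t = \<phi> t) \<longrightarrow> J = I)"

text \<open>Points of the circle are complex numbers of modulus 1.\<close>

definition orbit :: "real set \<Rightarrow> (real \<Rightarrow> real) \<Rightarrow> (real \<Rightarrow> real) \<Rightarrow> (real \<times> complex) set" where
  "orbit I r \<phi> = (\<lambda>t. (r t, cis (\<phi> t))) ` I"

definition phase_point ::
  "(real \<Rightarrow> real) \<Rightarrow> (real \<Rightarrow> real) \<Rightarrow> real \<Rightarrow> real \<times> complex \<times> real \<times> real" where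
  "phase_point r \<phi> t = (r t, cis (\<phi> t), deriv r t, deriv \<phi> t)"

definition has_angular_momentum ::
  "(real \<Rightarrow> real) \<Rightarrow> real set \<Rightarrow> (real \<Rightarrow> real) \<Rightarrow> (real \<Rightarrow> real) \<Rightarrow> real \<Rightarrow> bool" where
  "has_angular_momentum f I r \<phi> K \<longleftrightarrow> (\<forall>t\<in>I. (f (r t))\<^sup>2 * deriv \<phi> t = K)"

definition singular :: "(real \<Rightarrow> real) \<Rightarrow> real set \<Rightarrow> (real \<Rightarrow> real) \<Rightarrow> (real \<Rightarrow> real) \<Rightarrow> bool" where
  "singular f I r \<phi> \<longleftrightarrow> has_angular_momentum f I r \<phi> 0"

definition coordinate_circle :: "real \<Rightarrow> (real \<times> complex) set" where
  "coordinate_circle r0 = {r0} \<times> sphere 0 1"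

definition circular :: "real set \<Rightarrow> (real \<Rightarrow> real) \<Rightarrow> (real \<Rightarrow> real) \<Rightarrow> bool" where
  "circular I r \<phi> \<longleftrightarrow> (\<exists>r0. orbit I r \<phi> = coordinate_circle r0)"

definition bounded_trajectory ::
  "ereal \<Rightarrow> ereal \<Rightarrow> (real \<Rightarrow> real) \<Rightarrow> (real \<Rightarrow> real) \<Rightarrow> (real \<Rightarrow> real) \<Rightarrow> (real \<Rightarrow> real) \<Rightarrow> bool" where
  "bounded_trajectory a b f V r \<phi> \<longleftrightarrow>
     is_trajectory a b f V UNIV r \<phi> \<and>
     (\<exists>r1 r2. {r1..r2} \<subseteq> einterval a b \<and> orbit UNIV r \<phi> \<subseteq> {r1..r2} \<times> sphere 0 1)"

definition nonsingular_bounded ::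
  "ereal \<Rightarrow> ereal \<Rightarrow> (real \<Rightarrow> real) \<Rightarrow> (real \<Rightarrow> real) \<Rightarrow> (real \<Rightarrow> real) \<Rightarrow> (real \<Rightarrow> real) \<Rightarrow> bool" where
  "nonsingular_bounded a b f V r \<phi> \<longleftrightarrow> bounded_trajectory a b f V r \<phi> \<and> \<not> singular f UNIV r \<phi>"

definition closed_orbit :: "(real \<Rightarrow> real) \<Rightarrow> (real \<Rightarrow> real) \<Rightarrow> bool" where
  "closed_orbit r \<phi> \<longleftrightarrow> (\<exists>T>0. \<forall>t. r (t + T) = r t \<and> cis (\<phi> (t + T)) = cis (\<phi> t))"

section \<open>Circular orbits and their stability\<close>

definition circular_trajectory_at ::
  "ereal \<Rightarrow> ereal \<Rightarrow> (real \<Rightarrow> real) \<Rightarrow> (real \<Rightarrow> real) \<Rightarrow> real \<Rightarrow> real \<Rightarrow>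
   real set \<Rightarrow> (real \<Rightarrow> real) \<Rightarrow> (real \<Rightarrow> real) \<Rightarrow> bool" where
  "circular_trajectory_at a b f V r0 K I r \<phi> \<longleftrightarrow>
     is_trajectory a b f V I r \<phi> \<and> orbit I r \<phi> = coordinate_circle r0 \<and>
     has_angular_momentum f I r \<phi> K"

definition effective_potential ::
  "(real \<Rightarrow> real) \<Rightarrow> (real \<Rightarrow> real) \<Rightarrow> real \<Rightarrow> real \<Rightarrow> real" where
  "effective_potential f V K r = V r + K\<^sup>2 / (2 * (f r)\<^sup>2)"

definition strongly_stable_circular ::
  "ereal \<Rightarrow> ereal \<Rightarrow> (real \<Rightarrow> real) \<Rightarrow> (real \<Rightarrow> real) \<Rightarrow> real \<Rightarrow> real \<Rightarrow> bool" where
  "strongly_stable_circular a b f V r0 K0 \<longleftrightarrow>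
     (\<exists>I r \<phi>. circular_trajectory_at a b f V r0 K0 I r \<phi>) \<and> K0 \<noteq> 0 \<and>
     (\<forall>\<^sub>F r in nhds r0. effective_potential f V K0 r0 \<le> effective_potential f V K0 r) \<and>
     deriv (deriv (effective_potential f V K0)) r0 \<noteq> 0"

text \<open>
  Lyapunov stability of the phase curve as a subset of the phase space, among the trajectories with
  the same angular momentum. When the phase curve is compact, trajectories that stay near it exist
  for all later times, so restricting to the times of the maximal interval \<open>J\<close> loses nothing.
\<close>

definition orbitally_stable ::
  "ereal \<Rightarrow> ereal \<Rightarrow> (real \<Rightarrow> real) \<Rightarrow> (real \<Rightarrow> real) \<Rightarrow> real \<Rightarrow>
   real set \<Rightarrow> (real \<Rightarrow> real) \<Rightarrow> (real \<Rightarrow> real) \<Rightarrow> bool" where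
  "orbitally_stable a b f V K I r \<phi> \<longleftrightarrow>
     (\<forall>U. open U \<and> phase_point r \<phi> ` I \<subseteq> U \<longrightarrow>
       (\<exists>W. open W \<and> phase_point r \<phi> ` I \<subseteq> W \<and>
         (\<forall>J s \<psi> t0. is_trajectory a b f V J s \<psi> \<and> has_angular_momentum f J s \<psi> K \<and>
            t0 \<in> J \<and> phase_point s \<psi> t0 \<in> W \<longrightarrow>
            (\<forall>t\<in>J. t0 \<le> t \<longrightarrow> phase_point s \<psi> t \<in> U))))"

definition orbitally_stable_circular ::
  "ereal \<Rightarrow> ereal \<Rightarrow> (real \<Rightarrow> real) \<Rightarrow> (real \<Rightarrow> real) \<Rightarrow> real \<Rightarrow> real \<Rightarrow> bool" where
  "orbitally_stable_circular a b f V r0 K0 \<longleftrightarrow>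
     (\<exists>I r \<phi>. circular_trajectory_at a b f V r0 K0 I r \<phi> \<and> orbitally_stable a b f V K0 I r \<phi>)"

section \<open>Closing potentials\<close>

definition cond_exists ::
  "ereal \<Rightarrow> ereal \<Rightarrow> (real \<Rightarrow> real) \<Rightarrow> (real \<Rightarrow> real) \<Rightarrow> bool" where
  "cond_exists a b f V \<longleftrightarrow>
     (\<exists>r \<phi>. nonsingular_bounded a b f V r \<phi> \<and> \<not> circular UNIV r \<phi>)"

definition cond_all ::
  "ereal \<Rightarrow> ereal \<Rightarrow> (real \<Rightarrow> real) \<Rightarrow> (real \<Rightarrow> real) \<Rightarrow> bool" where
  "cond_all a b f V \<longleftrightarrow> (\<forall>r \<phi>. nonsingular_bounded a b f V r \<phi> \<longrightarrow> closed_orbit r \<phi>)"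

definition cond_exists_loc ::
  "ereal \<Rightarrow> ereal \<Rightarrow> (real \<Rightarrow> real) \<Rightarrow> (real \<Rightarrow> real) \<Rightarrow> bool" where
  "cond_exists_loc a b f V \<longleftrightarrow> (\<exists>r0 K0. strongly_stable_circular a b f V r0 K0)"

definition closed_near ::
  "ereal \<Rightarrow> ereal \<Rightarrow> (real \<Rightarrow> real) \<Rightarrow> (real \<Rightarrow> real) \<Rightarrow> real \<Rightarrow> real \<Rightarrow> bool" where
  "closed_near a b f V r0 K0 \<longleftrightarrow>
     (\<exists>\<epsilon>>0. \<forall>r \<phi> K. nonsingular_bounded a b f V r \<phi> \<and>
        orbit UNIV r \<phi> \<subseteq> {r0 - \<epsilon>..r0 + \<epsilon>} \<times> sphere 0 1 \<and>
        has_angular_momentum f UNIV r \<phi> K \<and> K \<in> {K0 - \<epsilon><..<K0 + \<epsilon>} \<longrightarrow> closed_orbit r \<phi>)"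

definition cond_all_loc ::
  "ereal \<Rightarrow> ereal \<Rightarrow> (real \<Rightarrow> real) \<Rightarrow> (real \<Rightarrow> real) \<Rightarrow> bool" where
  "cond_all_loc a b f V \<longleftrightarrow>
     (\<forall>r0 K0. strongly_stable_circular a b f V r0 K0 \<longrightarrow> closed_near a b f V r0 K0)"

definition cond_all_weak_loc ::
  "ereal \<Rightarrow> ereal \<Rightarrow> (real \<Rightarrow> real) \<Rightarrow> (real \<Rightarrow> real) \<Rightarrow> bool" where
  "cond_all_weak_loc a b f V \<longleftrightarrow>
     (\<forall>r0 K0. orbitally_stable_circular a b f V r0 K0 \<longrightarrow> closed_near a b f V r0 K0)"

text \<open>Here \<open>(r\<gamma>, \<phi>\<gamma>)\<close> is the trajectory whose existence is asserted by \<open>cond_exists\<close>.\<close>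

definition cond_all_sloc ::
  "ereal \<Rightarrow> ereal \<Rightarrow> (real \<Rightarrow> real) \<Rightarrow> (real \<Rightarrow> real) \<Rightarrow> (real \<Rightarrow> real) \<Rightarrow> (real \<Rightarrow> real) \<Rightarrow> bool" where
  "cond_all_sloc a b f V r\<gamma> \<phi>\<gamma> \<longleftrightarrow>
     (\<forall>r \<phi> K. nonsingular_bounded a b f V r \<phi> \<and>
        orbit UNIV r \<phi> \<subseteq> {(INF t. r\<gamma> t)..(SUP t. r\<gamma> t)} \<times> sphere 0 1 \<and>
        has_angular_momentum f UNIV r\<gamma> \<phi>\<gamma> K \<and> has_angular_momentum f UNIV r \<phi> K
        \<longrightarrow> closed_orbit r \<phi>)"

definition closing ::
  "ereal \<Rightarrow> ereal \<Rightarrow> (real \<Rightarrow> real) \<Rightarrow> (real \<Rightarrow> real) \<Rightarrow> bool" where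
  "closing a b f V \<longleftrightarrow> cond_exists a b f V \<and> cond_all a b f V"

definition locally_closing ::
  "ereal \<Rightarrow> ereal \<Rightarrow> (real \<Rightarrow> real) \<Rightarrow> (real \<Rightarrow> real) \<Rightarrow> bool" where
  "locally_closing a b f V \<longleftrightarrow> cond_exists_loc a b f V \<and> cond_all_loc a b f V"

definition semilocally_closing ::
  "ereal \<Rightarrow> ereal \<Rightarrow> (real \<Rightarrow> real) \<Rightarrow> (real \<Rightarrow> real) \<Rightarrow> bool" where
  "semilocally_closing a b f V \<longleftrightarrow>
     (\<exists>r\<gamma> \<phi>\<gamma>. nonsingular_bounded a b f V r\<gamma> \<phi>\<gamma> \<and> \<not> circular UNIV r\<gamma> \<phi>\<gamma> \<and>
        cond_all_sloc a b f V r\<gamma> \<phi>\<gamma>) \<and>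
     cond_all_loc a b f V"

definition strongly_closing ::
  "ereal \<Rightarrow> ereal \<Rightarrow> (real \<Rightarrow> real) \<Rightarrow> (real \<Rightarrow> real) \<Rightarrow> bool" where
  "strongly_closing a b f V \<longleftrightarrow>
     cond_all_loc a b f V \<and>
     (\<forall>r0 \<in> einterval a b. \<exists>K0. strongly_stable_circular a b f V r0 K0)"

definition weakly_closing ::
  "ereal \<Rightarrow> ereal \<Rightarrow> (real \<Rightarrow> real) \<Rightarrow> (real \<Rightarrow> real) \<Rightarrow> bool" where
  "weakly_closing a b f V \<longleftrightarrow>
     cond_all_weak_loc a b f V \<and>
     (\<forall>r0 \<in> einterval a b. \<exists>K0. orbitally_stable_circular a b f V r0 K0)"

section \<open>Uniqueness up to additive and multiplicative constants\<close>

text \<open>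
  The multiplicative constant is positive: this is the rescaling (of time) that preserves each of
  the closing properties.
\<close>

definition potentials_equivalent ::
  "ereal \<Rightarrow> ereal \<Rightarrow> (real \<Rightarrow> real) \<Rightarrow> (real \<Rightarrow> real) \<Rightarrow> bool" where
  "potentials_equivalent a b V W \<longleftrightarrow>
     (\<exists>\<alpha>>0. \<exists>\<beta>. \<forall>r \<in> einterval a b. W r = \<alpha> * V r + \<beta>)"

definition at_most_one_potential ::
  "ereal \<Rightarrow> ereal \<Rightarrow> ((real \<Rightarrow> real) \<Rightarrow> bool) \<Rightarrow> bool" where
  "at_most_one_potential a b P \<longleftrightarrow>
     (\<forall>V W. central_potential a b V \<and> P V \<and> central_potential a b W \<and> P W
        \<longrightarrow> potentials_equivalent a b V W)"

definition exactly_one_potential ::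
  "ereal \<Rightarrow> ereal \<Rightarrow> ((real \<Rightarrow> real) \<Rightarrow> bool) \<Rightarrow> bool" where
  "exactly_one_potential a b P \<longleftrightarrow>
     (\<exists>V. central_potential a b V \<and> P V) \<and> at_most_one_potential a b P"

section \<open>The normal form of the metric and the generalized oscillator potential\<close>

text \<open>
  The last clause compares the two quadratic forms on the tangent vector with components \<open>u\<close>, \<open>v\<close>
  in the coordinates \<open>(r, \<phi>)\<close>, whose components in the coordinates \<open>(\<theta>, \<phi>)\<close> are \<open>\<theta>' u\<close>, \<open>v\<close>.
  A vanishing denominator is impossible there, since it would give \<open>f r = 0\<close>.
\<close>

definition metric_normal_form ::
  "ereal \<Rightarrow> ereal \<Rightarrow> (real \<Rightarrow> real) \<Rightarrow> (real \<Rightarrow> real) \<Rightarrow> real \<Rightarrow> real \<Rightarrow> real \<Rightarrow> bool" where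
  "metric_normal_form a b f \<theta> \<mu> c d \<longleftrightarrow>
     smooth_on_interval a b \<theta> \<and>
     (\<forall>r \<in> einterval a b. \<theta> r \<noteq> 0 \<and> deriv \<theta> r > 0) \<and>
     \<mu> \<in> \<rat> \<and> \<mu> > 0 \<and> d \<noteq> 0 \<and>
     (\<forall>r \<in> einterval a b. \<forall>u v :: real.
        u\<^sup>2 + (f r)\<^sup>2 * v\<^sup>2 =
          (deriv \<theta> r * u)\<^sup>2 / ((\<theta> r)\<^sup>2 + c - d / (\<theta> r)\<^sup>2)\<^sup>2 +
          v\<^sup>2 / (\<mu>\<^sup>2 * ((\<theta> r)\<^sup>2 + c - d / (\<theta> r)\<^sup>2)))"

definition oscillator_potential :: "(real \<Rightarrow> real) \<Rightarrow> real \<Rightarrow> real \<Rightarrow> real \<Rightarrow> real" where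
  "oscillator_potential \<theta> A B r = A / (2 * (\<theta> r)\<^sup>2) + B"

definition minimal_positive_period :: "(real \<Rightarrow> real) \<Rightarrow> real \<Rightarrow> bool" where
  "minimal_positive_period g \<Phi> \<longleftrightarrow>
     \<Phi> > 0 \<and> (\<forall>x. g (x + \<Phi>) = g x) \<and> (\<forall>T>0. (\<forall>x. g (x + T) = g x) \<longrightarrow> \<Phi> \<le> T)"

section \<open>Extrema attained at a boundary circle\<close>

text \<open>
  \<open>r0\<close> is meant to be an end point \<open>a\<close> or \<open>b\<close>, possibly infinite; the limit and the extremum are
  taken in the extended reals.
\<close>

definition boundary_limit ::
  "ereal \<Rightarrow> ereal \<Rightarrow> ereal \<Rightarrow> (real \<Rightarrow> real) \<Rightarrow> ereal \<Rightarrow> bool" where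
  "boundary_limit a b r0 g l \<longleftrightarrow>
     ((\<lambda>x. ereal (g (real_of_ereal x))) \<longlongrightarrow> l) (at r0 within {a<..<b})"

definition inf_attained_at :: "ereal \<Rightarrow> ereal \<Rightarrow> (real \<Rightarrow> real) \<Rightarrow> ereal \<Rightarrow> bool" where
  "inf_attained_at a b g r0 \<longleftrightarrow>
     r0 \<in> {a, b} \<and> boundary_limit a b r0 g (INF r \<in> einterval a b. ereal (g r))"

definition sup_attained_at :: "ereal \<Rightarrow> ereal \<Rightarrow> (real \<Rightarrow> real) \<Rightarrow> ereal \<Rightarrow> bool" where
  "sup_attained_at a b g r0 \<longleftrightarrow>
     r0 \<in> {a, b} \<and> boundary_limit a b r0 g (SUP r \<in> einterval a b. ereal (g r))"

definition attracting_centre :: "ereal \<Rightarrow> ereal \<Rightarrow> (real \<Rightarrow> real) \<Rightarrow> ereal \<Rightarrow> bool" where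
  "attracting_centre a b V r0 \<longleftrightarrow> inf_attained_at a b V r0"

end

(*
  In the coordinate w with dw = dr / f^2, and with the angle as time, a trajectory of angular
  momentum K moves in the one-dimensional potential W = V / K^2 + 1 / (2 f^2). Orbits are closed
  iff the period of this motion is a rational multiple of 2 pi; the period depends continuously on
  the orbit, so it is constant on families of closed orbits. Near a nondegenerate minimum this
  gives W'' = omega^2 with rational omega and 5 W'''^2 = 3 W'' W''''. Since the circular orbit
  at r has K^2 = nu(r) with nu = f^3 V' / f', the first condition is a linear equation for nu,
  which propagates it to the whole interval; the second one becomes the equation
  3 P s' = (4 s - omega^2) (s - omega^2) for P = - f' / f and s = dP/dw = f'^2 - f f''.
  The constant solutions are the excluded metrics f'' f - f'^2 = - xi^2, and the other solutions are
  the stated normal form. Conversely, theta^2 is a harmonic oscillation in the angle.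
*)
theory Submission
  imports Defs
begin

section \<open>Smooth functions and elementary analysis\<close>

text \<open>The period integral is singular at the turning points, and its dependence on the well is
  needed all the way down to a minimum. Writing the depth of a well as the product of the distances
  to both turning points and a second divided difference removes the singularity; the divided
  difference stays continuous when its nodes merge. The five closing notions start from different
  data. The local ones provide a nondegenerate minimum at once. Semilocally only one noncircular
  orbit is known: a common period in its annulus excludes a separatrix, because motions close to one
  are arbitrarily slow, and so the family of wells must shrink to a single minimum. In the weak case
  stability could be degenerate: if the second derivative were nowhere positive, every circle would
  lie at a global maximum of its effective potential, from which trajectories escape. The choice
  \<open>\<theta> = 3 P / (4 - \<mu>\<^sup>2 s)\<close> with \<mu> = 2 / \<omega> is forced by the
  normal form; d, c, A and B then appear as constants of integration.\<close>

primrec ndiff :: "real set \<Rightarrow> nat \<Rightarrow> (real \<Rightarrow> real) \<Rightarrow> bool" where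
  "ndiff S 0 g \<longleftrightarrow> True"
| "ndiff S (Suc n) g \<longleftrightarrow> (\<forall>x\<in>S. g differentiable (at x)) \<and> ndiff S n (deriv g)"

text \<open>\<open>ndiff\<close> takes off the innermost derivative, whereas smoothness is stated
  with iterates of \<open>deriv\<close>. The recursive form admits induction on the order with the
  function generalised, as the product and quotient rules require, since they mix functions with
  their derivatives.\<close>

lemma ndiff_iff: "ndiff S n g \<longleftrightarrow> (\<forall>m<n. \<forall>x\<in>S. ((deriv ^^ m) g) differentiable (at x))"
proof (induction n arbitrary: g)
  case (Suc n)
  show ?case
    unfolding ndiff.simps Suc.IH All_less_Suc2
    by (simp add: funpow_Suc_right del: funpow.simps(2))
qed simp

lemma smooth_on_interval_iff: "smooth_on_interval a b g \<longleftrightarrow> (\<forall>n. ndiff (einterval a b) n g)"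
  unfolding smooth_on_interval_def ndiff_iff by auto

lemma deriv_cong_open:
  fixes g h :: "real \<Rightarrow> real"
  assumes "open S" "\<And>x. x \<in> S \<Longrightarrow> g x = h x" "x \<in> S"
  shows "deriv g x = deriv h x"
  by (rule deriv_cong_ev) (use assms eventually_nhds in blast)+

lemma differentiable_cong_open:
  fixes g h :: "real \<Rightarrow> real"
  assumes "open S" "\<And>x. x \<in> S \<Longrightarrow> g x = h x" "x \<in> S" "g differentiable (at x)"
  shows "h differentiable (at x)"
  using assms has_field_derivative_transform_within_open[of g _ x S h]
  unfolding real_differentiable_def by metis

lemma ndiff_cong:
  assumes "open S" "\<And>x. x \<in> S \<Longrightarrow> g x = h x" "ndiff S n g"
  shows "ndiff S n h"
  using assms
proof (induction n arbitrary: g h)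
  case (Suc n)
  have "ndiff S n (deriv h)"
    by (rule Suc.IH[of "deriv g"]) (use Suc.prems deriv_cong_open[of S g h] in auto)
  with Suc.prems show ?case using differentiable_cong_open[of S g h] by auto
qed simp

lemma ndiff_Suc_D: "ndiff S (Suc n) g \<Longrightarrow> ndiff S n g"
  unfolding ndiff_iff by auto

lemma ndiff_const: "ndiff S n (\<lambda>x. c)"
proof (induction n arbitrary: c)
  case (Suc n)
  have "deriv (\<lambda>x::real. c) = (\<lambda>x. 0)" by auto
  with Suc show ?case by simp
qed simp

lemma ndiff_add:
  assumes "open S" "ndiff S n g" "ndiff S n h"
  shows "ndiff S n (\<lambda>x. g x + h x)"
  using assms
proof (induction n arbitrary: g h)
  case (Suc n)
  have "ndiff S n (deriv (\<lambda>x. g x + h x))"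
    by (rule ndiff_cong[where g="\<lambda>x. deriv g x + deriv h x"])
      (use Suc in \<open>auto intro!: DERIV_imp_deriv[symmetric] DERIV_add simp: DERIV_deriv_iff_real_differentiable\<close>)
  with Suc.prems show ?case by (auto intro!: differentiable_add)
qed simp

lemma ndiff_mult:
  assumes "open S" "ndiff S n g" "ndiff S n h"
  shows "ndiff S n (\<lambda>x. g x * h x)"
  using assms
proof (induction n arbitrary: g h)
  case (Suc n)
  have *: "ndiff S n (\<lambda>x. deriv g x * h x + deriv h x * g x)"
    by (intro ndiff_add Suc.IH) (use Suc.prems ndiff_Suc_D in auto)
  have "ndiff S n (deriv (\<lambda>x. g x * h x))"
    by (rule ndiff_cong[OF _ _ *])
      (use Suc in \<open>auto intro!: DERIV_imp_deriv[symmetric] DERIV_mult simp: DERIV_deriv_iff_real_differentiable\<close>)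
  with Suc.prems show ?case by (auto intro!: differentiable_mult)
qed simp

lemma ndiff_inverse:
  assumes "open S" "ndiff S n g" "\<And>x. x \<in> S \<Longrightarrow> g x \<noteq> 0"
  shows "ndiff S n (\<lambda>x. inverse (g x))"
  using assms
proof (induction n arbitrary: g)
  case (Suc n)
  \<comment> \<open>The derivative of 1/g contains 1/g itself, so the order available for 1/g has to
    be secured first.\<close>
  have IH: "ndiff S n (\<lambda>x. inverse (g x))"
    by (rule Suc.IH) (use Suc.prems ndiff_Suc_D in auto)
  have *: "ndiff S n (\<lambda>x. (-1) * (deriv g x * (inverse (g x) * inverse (g x))))"
    by (intro ndiff_mult ndiff_const IH) (use Suc.prems in auto)
  have d: "((\<lambda>x. inverse (g x)) has_real_derivative
      (-1) * (deriv g x * (inverse (g x) * inverse (g x)))) (at x)" if "x \<in> S" for x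
  proof -
    have "(g has_real_derivative deriv g x) (at x)"
      using Suc.prems that by (auto simp: DERIV_deriv_iff_real_differentiable)
    from DERIV_inverse'[OF this] Suc.prems(3)[OF that] show ?thesis
      by (auto simp: algebra_simps)
  qed
  have "ndiff S n (deriv (\<lambda>x. inverse (g x)))"
    by (rule ndiff_cong[OF _ _ *]) (use Suc.prems(1) DERIV_imp_deriv[OF d] in simp_all)
  with d show ?case by (auto simp: real_differentiable_def)
qed simp

lemma smooth_has_derivative:
  assumes "smooth_on_interval a b g" "x \<in> einterval a b"
  shows "(g has_real_derivative deriv g x) (at x)"
proof -
  have "g differentiable (at x)"
    using assms(1)[unfolded smooth_on_interval_iff, rule_format, of 1] assms(2) by simp
  then show ?thesis by (simp add: DERIV_deriv_iff_real_differentiable)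
qed

lemma smooth_const: "smooth_on_interval a b (\<lambda>x. c)"
  by (simp add: smooth_on_interval_iff ndiff_const)

lemma smooth_deriv: "smooth_on_interval a b g \<Longrightarrow> smooth_on_interval a b (deriv g)"
  unfolding smooth_on_interval_iff using ndiff.simps(2) by blast

lemma smooth_add:
  "smooth_on_interval a b g \<Longrightarrow> smooth_on_interval a b h \<Longrightarrow> smooth_on_interval a b (\<lambda>x. g x + h x)"
  by (simp add: smooth_on_interval_iff ndiff_add)

lemma smooth_mult:
  "smooth_on_interval a b g \<Longrightarrow> smooth_on_interval a b h \<Longrightarrow> smooth_on_interval a b (\<lambda>x. g x * h x)"
  by (simp add: smooth_on_interval_iff ndiff_mult)

lemma smooth_minus: "smooth_on_interval a b g \<Longrightarrow> smooth_on_interval a b (\<lambda>x. - g x)"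
  using smooth_mult[OF smooth_const[of a b "-1"], of g] by simp

lemma smooth_diff:
  "smooth_on_interval a b g \<Longrightarrow> smooth_on_interval a b h \<Longrightarrow> smooth_on_interval a b (\<lambda>x. g x - h x)"
  using smooth_add[OF _ smooth_minus, of a b g h] by simp

lemma smooth_power: "smooth_on_interval a b g \<Longrightarrow> smooth_on_interval a b (\<lambda>x. g x ^ n)"
  by (induction n) (auto intro: smooth_const smooth_mult)

lemma smooth_divide:
  "smooth_on_interval a b g \<Longrightarrow> smooth_on_interval a b h \<Longrightarrow>
   (\<And>x. x \<in> einterval a b \<Longrightarrow> h x \<noteq> 0) \<Longrightarrow> smooth_on_interval a b (\<lambda>x. g x / h x)"
  unfolding divide_inverse
  by (rule smooth_mult) (simp_all add: smooth_on_interval_iff ndiff_inverse)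

lemmas smooth_intros = smooth_const smooth_deriv smooth_add smooth_mult smooth_minus smooth_diff
  smooth_power smooth_divide

lemma smooth_isCont: "smooth_on_interval a b g \<Longrightarrow> x \<in> einterval a b \<Longrightarrow> isCont g x"
  using smooth_has_derivative DERIV_isCont by blast

lemma smooth_continuous_on: "smooth_on_interval a b g \<Longrightarrow> continuous_on (einterval a b) g"
  using smooth_isCont continuous_at_imp_continuous_on by blast

section \<open>Open intervals with extended real end points, and primitives and linear equations on
  them\<close>

lemma is_interval_einterval: "is_interval (einterval a b)"
proof -
  have "z \<in> einterval a b"
    if "x \<in> einterval a b" "y \<in> einterval a b" "x \<le> z" "z \<le> y" for x y z
  proof -
    have "ereal x \<le> ereal z" "ereal z \<le> ereal y" using that by auto
    with that(1,2) show ?thesis unfolding einterval_iff by (meson less_le_trans le_less_trans)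
  qed
  then show ?thesis unfolding is_interval_1 by blast
qed

lemma einterval_Icc_subset: "x \<in> einterval a b \<Longrightarrow> y \<in> einterval a b \<Longrightarrow> {x..y} \<subseteq> einterval a b"
proof
  fix z assume "x \<in> einterval a b" "y \<in> einterval a b" "z \<in> {x..y}"
  then show "z \<in> einterval a b"
    using mem_is_interval_1_I[OF is_interval_einterval, of x a b y z] by simp
qed

lemma einterval_obtain_Icc:
  assumes "x \<in> einterval a b" "0 < e"
  obtains d where "0 < d" "d < e" "{x - d..x + d} \<subseteq> einterval a b"
proof -
  obtain d where "d > 0" "cball x d \<subseteq> einterval a b"
    using open_contains_cball[of "einterval a b"] assms by auto
  then show ?thesis using that[of "min d (e/2)"] assms by (force simp: cball_eq_atLeastAtMost)
qed

lemma derivative_zero_imp_eq: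
  fixes g :: "real \<Rightarrow> real"
  assumes "is_interval S" "\<And>x. x \<in> S \<Longrightarrow> (g has_real_derivative 0) (at x)" "x \<in> S" "y \<in> S"
  shows "g x = g y"
proof -
  have "\<exists>c. \<forall>x\<in>S. g x = c"
    by (rule has_field_derivative_zero_constant)
      (use assms is_interval_convex in \<open>auto intro: has_field_derivative_at_within\<close>)
  then show ?thesis using assms by auto
qed

lemma einterval_primitive:
  assumes "a < b" "continuous_on (einterval a b) g"
  obtains G where "\<And>x. x \<in> einterval a b \<Longrightarrow> (G has_real_derivative g x) (at x)"
proof -
  have "isCont g x" if "a < ereal x" "ereal x < b" for x
    using assms(2) that continuous_on_eq_continuous_at[OF open_einterval, of a b g] by (simp add: einterval_iff)
  from einterval_antiderivative[OF assms(1) this] that show ?thesis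
    by (auto simp: has_real_derivative_iff_has_vector_derivative einterval_def)
qed

text \<open>The integrating factor \<open>exp (- G x)\<close> makes the product constant, so one
  zero propagates to the whole interval. In this way a function that meets an equilibrium value of
  its equation once keeps it everywhere.\<close>

lemma linear_ode_unique:
  assumes "a < b" "continuous_on (einterval a b) g"
    "\<And>x. x \<in> einterval a b \<Longrightarrow> (z has_real_derivative g x * z x) (at x)"
    "x0 \<in> einterval a b" "z x0 = 0" "x \<in> einterval a b"
  shows "z x = 0"
proof -
  obtain G where G: "\<And>x. x \<in> einterval a b \<Longrightarrow> (G has_real_derivative g x) (at x)"
    using einterval_primitive[OF assms(1,2)] by blast
  have "z x * exp (- G x) = z x0 * exp (- G x0)"
    by (rule derivative_zero_imp_eq[OF is_interval_einterval _ assms(6,4)])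
      (auto intro!: derivative_eq_intros G assms(3) simp: algebra_simps)
  then show ?thesis using assms(5) by simp
qed

text \<open>Changes of the independent variable on the whole line. The lower bound c makes the
  primitive grow at least linearly, hence onto; this is used to pass between phase, polar angle and
  time.\<close>

lemma positive_primitive_bij:
  fixes g :: "real \<Rightarrow> real"
  assumes "continuous_on UNIV g" "0 < c" "\<And>x. c \<le> g x"
  obtains H Hi where "\<And>x. (H has_real_derivative g x) (at x)" "H 0 = 0" "strict_mono H"
    "\<And>x. Hi (H x) = x" "\<And>y. H (Hi y) = y"
    "\<And>y. (Hi has_real_derivative 1 / g (Hi y)) (at y)"
proof -
  obtain G where G: "\<And>x. (G has_real_derivative g x) (at x)"
    using einterval_primitive[of "-\<infinity>" "\<infinity>" g] assms by auto
  define H where "H x = G x - G 0" for x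
  have H: "(H has_real_derivative g x) (at x)" for x
    unfolding H_def by (auto intro!: derivative_eq_intros G)
  have grow: "c * (y - x) \<le> H y - H x" if "x \<le> y" for x y
  proof -
    have "H x - c * x \<le> H y - c * y"
      by (rule DERIV_nonneg_imp_nondecreasing[OF that])
        (use H assms(3) in \<open>force intro!: derivative_eq_intros\<close>)
    then show ?thesis by (simp add: algebra_simps)
  qed
  have sm: "strict_mono H"
  proof (rule strict_monoI)
    fix x y :: real assume "x < y"
    then have "0 < c * (y - x)" using assms by simp
    then show "H x < H y" using grow[of x y] \<open>x < y\<close> by simp
  qed
  have cont: "isCont H x" for x using H DERIV_isCont by blast
  have surj: "\<exists>x. H x = y" for y
  proof -
    \<comment> \<open>Chosen with c M = |y|, so that linear growth places y between the values of H
      at -M and M.\<close>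
    define M where "M = \<bar>y\<bar> / c"
    have M: "0 \<le> M" "c * M = \<bar>y\<bar>" using assms by (auto simp: M_def)
    have "H (-M) \<le> y" "y \<le> H M"
      using grow[of "-M" 0] grow[of 0 M] M by (auto simp: H_def)
    then show ?thesis using IVT'[of H "-M" y M] M cont
      by (meson continuous_at_imp_continuous_on neg_le_0_iff_le order_trans)
  qed
  define Hi where "Hi = inv H"
  have "inj H" "surj H" using sm surj strict_mono_imp_inj_on unfolding surj_def by metis+
  then have i: "Hi (H x) = x" "H (Hi y) = y" for x y
    by (simp_all add: Hi_def surj_f_inv_f)
  have "isCont Hi y" for y
  proof -
    have "isCont Hi (H (Hi y))"
      by (rule isCont_inverse_function[where d=1]) (auto simp: i cont)
    then show ?thesis by (simp add: i)
  qed
  moreover have "g x \<noteq> 0" for x using assms(2) assms(3)[of x] by linarith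
  ultimately have "(Hi has_real_derivative inverse (g (Hi y))) (at y)" for y
    by (intro DERIV_inverse_function[where a="y-1" and b="y+1" and f=H]) (use H i in simp_all)
  then show ?thesis using that[of H Hi] H sm i by (simp add: inverse_eq_divide H_def)
qed

text \<open>A connected set of reals with two points is uncountable, while the rationals are
  countable. The constancy of periods, of frequencies and of winding numbers rests on this.\<close>

lemma rational_valued_imp_constant:
  fixes g :: "real \<Rightarrow> real"
  assumes "connected S" "continuous_on S g" "\<And>x. x \<in> S \<Longrightarrow> g x \<in> \<rat>" "x \<in> S" "y \<in> S"
  shows "g x = g y"
proof (rule ccontr)
  assume "g x \<noteq> g y"
  then have "uncountable (g ` S)"
    using connected_uncountable[OF connected_continuous_image[OF assms(2,1)]] assms(4,5) by blast
  moreover have "countable (g ` S)"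
    by (rule countable_subset[of _ \<rat>]) (use assms(3) countable_rat in auto)
  ultimately show False by simp
qed

lemma strict_local_min:
  fixes g g' :: "real \<Rightarrow> real"
  assumes "open S" "x0 \<in> S" "\<And>x. x \<in> S \<Longrightarrow> (g has_real_derivative g' x) (at x)"
    "g' x0 = 0" "(g' has_real_derivative c) (at x0)" "0 < c"
  obtains d where "0 < d" "{x0 - d..x0 + d} \<subseteq> S"
    "\<And>x. x0 - d \<le> x \<Longrightarrow> x < x0 \<Longrightarrow> g' x < 0" "\<And>x. x0 < x \<Longrightarrow> x \<le> x0 + d \<Longrightarrow> 0 < g' x"
    "\<And>x. x \<in> {x0 - d..x0 + d} \<Longrightarrow> x \<noteq> x0 \<Longrightarrow> g x0 < g x"
proof -
  obtain d1 where d1: "d1 > 0" "\<And>h. h > 0 \<Longrightarrow> h < d1 \<Longrightarrow> g' x0 < g' (x0 + h)"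
    using DERIV_pos_inc_right[OF assms(5,6)] by auto
  obtain d2 where d2: "d2 > 0" "\<And>h. h > 0 \<Longrightarrow> h < d2 \<Longrightarrow> g' (x0 - h) < g' x0"
    using DERIV_pos_inc_left[OF assms(5,6)] by auto
  obtain d3 where d3: "d3 > 0" "cball x0 d3 \<subseteq> S"
    using assms(1,2) open_contains_cball by blast
  define d where "d = min d3 (min (d1/2) (d2/2))"
  have d: "d > 0" "d < d1" "d < d2" using d1 d2 d3 by (auto simp: d_def)
  have sub: "{x0 - d..x0 + d} \<subseteq> S"
    using d3 by (force simp: d_def cball_eq_atLeastAtMost)
  have neg: "g' x < 0" if "x0 - d \<le> x" "x < x0" for x
    using d2(2)[of "x0 - x"] that d assms(4) by auto
  have pos: "0 < g' x" if "x0 < x" "x \<le> x0 + d" for x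
    using d1(2)[of "x - x0"] that d assms(4) by auto
  have "g x0 < g x" if "x \<in> {x0 - d..x0 + d}" "x \<noteq> x0" for x
  proof (cases "x < x0")
    case True
    have "\<exists>z>x. z < x0 \<and> g x0 - g x = (x0 - x) * g' z"
      by (rule MVT2[OF True], rule assms(3), rule subsetD[OF sub]) (use that d in auto)
    then obtain z where z: "x < z" "z < x0" "g x0 - g x = (x0 - x) * g' z" by blast
    then have "g' z < 0" using neg[of z] that by auto
    with z True have "(x0 - x) * g' z < 0" by (simp add: mult_pos_neg)
    with z show ?thesis by simp
  next
    case False
    then have F: "x0 < x" using that by simp
    have "\<exists>z>x0. z < x \<and> g x - g x0 = (x - x0) * g' z"
      by (rule MVT2[OF F], rule assms(3), rule subsetD[OF sub]) (use that d in auto)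
    then obtain z where z: "x0 < z" "z < x" "g x - g x0 = (x - x0) * g' z" by blast
    then have "0 < g' z" using pos[of z] that by auto
    with z F have "0 < (x - x0) * g' z" by simp
    with z show ?thesis by simp
  qed
  with d sub neg pos that show ?thesis by blast
qed

section \<open>Second divided differences\<close>

text \<open>Hermite-Genocchi form of the divided difference at the nodes \<alpha>, \<beta>, x of a
  function with second derivative g: the argument runs over the triangle of convex combinations, and
  u is the Jacobian of its parametrisation. Unlike the usual quotient it keeps its meaning and its
  continuity when nodes coincide.\<close>

definition ddiff :: "(real \<Rightarrow> real) \<Rightarrow> real \<Rightarrow> real \<Rightarrow> real \<Rightarrow> real" where
  "ddiff g \<alpha> \<beta> x =
     integral {0..1} (\<lambda>u. integral {0..1} (\<lambda>v. u * g (\<alpha> + u * (\<beta> - \<alpha> + v * (x - \<beta>)))))"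

lemma affine_chain:
  assumes "(F has_real_derivative D) (at (p + u * q))"
  shows "((\<lambda>u. F (p + u * q)) has_real_derivative q * D) (at u within A)"
proof -
  have "((\<lambda>u. p + u * q) has_real_derivative q) (at u within A)"
    by (auto intro!: derivative_eq_intros)
  from DERIV_chain2[of F D "\<lambda>u. p + u * q" u, OF assms this] show ?thesis
    by (simp only: mult.commute)
qed

lemma ddiff_arg_mem:
  assumes "convex S" "\<alpha> \<in> S" "\<beta> \<in> S" "x \<in> S" "u \<in> {0..1}" "v \<in> {0..1}"
  shows "\<alpha> + u * (\<beta> - \<alpha> + v * (x - \<beta>)) \<in> (S :: real set)"
proof -
  have "(1 - v) *\<^sub>R \<beta> + v *\<^sub>R x \<in> S" using assms by (intro convexD) auto
  then have "(1 - u) *\<^sub>R \<alpha> + u *\<^sub>R ((1 - v) *\<^sub>R \<beta> + v *\<^sub>R x) \<in> S"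
    using assms by (intro convexD) auto
  then show ?thesis by (simp add: algebra_simps)
qed

lemma ddiff_continuous_aux:
  fixes g :: "real \<Rightarrow> real"
  assumes "convex S" "continuous_on S g"
  shows "continuous_on ((S \<times> S \<times> S) \<times> {0..1})
      (\<lambda>((\<alpha>, \<beta>, x), u). integral {0..1} (\<lambda>v. u * g (\<alpha> + u * (\<beta> - \<alpha> + v * (x - \<beta>)))))"
proof -
  have "continuous_on (((S \<times> S \<times> S) \<times> {0..1}) \<times> cbox 0 1)
      (\<lambda>(p, v). (\<lambda>((\<alpha>, \<beta>, x), u). \<lambda>v. u * g (\<alpha> + u * (\<beta> - \<alpha> + v * (x - \<beta>)))) p v)"
    unfolding split_beta
    by (intro continuous_intros continuous_on_compose2[OF assms(2)])
      (use ddiff_arg_mem[OF assms(1)] in auto)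
  from integral_continuous_on_param[OF this] show ?thesis
    by (simp add: split_beta cbox_interval)
qed

lemma ddiff_continuous:
  fixes g :: "real \<Rightarrow> real"
  assumes "convex S" "continuous_on S g"
  shows "continuous_on (S \<times> S \<times> S) (\<lambda>(\<alpha>, \<beta>, x). ddiff g \<alpha> \<beta> x)"
proof -
  have "continuous_on ((S \<times> S \<times> S) \<times> cbox 0 1) (\<lambda>(p, u). (\<lambda>(\<alpha>, \<beta>, x). \<lambda>u.
      integral {0..1} (\<lambda>v. u * g (\<alpha> + u * (\<beta> - \<alpha> + v * (x - \<beta>))))) p u)"
    using ddiff_continuous_aux[OF assms] by (simp add: split_beta cbox_interval)
  from integral_continuous_on_param[OF this] show ?thesis
    by (simp add: split_beta cbox_interval ddiff_def)
qed

lemma ddiff_inner_integrable: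
  fixes g :: "real \<Rightarrow> real"
  assumes "convex S" "continuous_on S g" "\<alpha> \<in> S" "\<beta> \<in> S" "x \<in> S" "u \<in> {0..1}"
  shows "(\<lambda>v. u * g (\<alpha> + u * (\<beta> - \<alpha> + v * (x - \<beta>)))) integrable_on {0..1}"
  by (intro integrable_continuous_real continuous_intros continuous_on_compose2[OF assms(2)])
    (use ddiff_arg_mem[OF assms(1)] assms in auto)

lemma ddiff_outer_integrable:
  fixes g :: "real \<Rightarrow> real"
  assumes "convex S" "continuous_on S g" "\<alpha> \<in> S" "\<beta> \<in> S" "x \<in> S"
  shows "(\<lambda>u. integral {0..1} (\<lambda>v. u * g (\<alpha> + u * (\<beta> - \<alpha> + v * (x - \<beta>))))) integrable_on {0..1}"
proof (rule integrable_continuous_real)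
  have "continuous_on {0..1} (\<lambda>u. (\<lambda>((\<alpha>, \<beta>, x), u). integral {0..1} (\<lambda>v. u * g (\<alpha> + u * (\<beta> - \<alpha> + v * (x - \<beta>))))) ((\<alpha>, \<beta>, x), u))"
  proof (rule continuous_on_compose2[OF ddiff_continuous_aux[OF assms(1,2)]])
    show "continuous_on {0..1} (\<lambda>u::real. ((\<alpha>, \<beta>, x), u))" by (intro continuous_intros)
    show "(\<lambda>u. ((\<alpha>, \<beta>, x), u)) ` {0..1} \<subseteq> (S \<times> S \<times> S) \<times> {0..1}" using assms by blast
  qed
  then show "continuous_on {0..1} (\<lambda>u. integral {0..1} (\<lambda>v. u * g (\<alpha> + u * (\<beta> - \<alpha> + v * (x - \<beta>)))))"
    by simp
qed

text \<open>Exact on quadratic polynomials: the bracket with p2 is the complete homogeneous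
  polynomial of degree two in the nodes. An error of at most M in g contributes at most M times the
  area 1/2 of the triangle. Degree two matches the second order in the amplitude to which periods
  are expanded; degree zero already yields crude bounds.\<close>

lemma ddiff_approx:
  fixes g :: "real \<Rightarrow> real"
  assumes "convex S" "continuous_on S g" "\<alpha> \<in> S" "\<beta> \<in> S" "x \<in> S"
    and M: "\<And>y. y \<in> S \<Longrightarrow> \<bar>g y - (p0 + p1 * y + p2 * y\<^sup>2)\<bar> \<le> M"
  shows "\<bar>ddiff g \<alpha> \<beta> x - (p0 / 2 + p1 * (\<alpha> + \<beta> + x) / 6
      + p2 * (\<alpha>\<^sup>2 + \<beta>\<^sup>2 + x\<^sup>2 + \<alpha> * \<beta> + \<alpha> * x + \<beta> * x) / 12)\<bar> \<le> M / 2"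
proof -
  define p where "p y = p0 + p1 * y + p2 * y\<^sup>2" for y
  define I where "I g u = integral {0..1} (\<lambda>v. u * g (\<alpha> + u * (\<beta> - \<alpha> + v * (x - \<beta>))))"
    for g :: "real \<Rightarrow> real" and u
  have inner: "I p u = u * (p0 + p1 * (\<alpha> + u * (\<beta> - \<alpha>) + u * (x - \<beta>) / 2)
      + p2 * ((\<alpha> + u * (\<beta> - \<alpha>))\<^sup>2 + (\<alpha> + u * (\<beta> - \<alpha>)) * (u * (x - \<beta>)) + (u * (x - \<beta>))\<^sup>2 / 3))" for u
  proof -
    define A where "A = \<alpha> + u * (\<beta> - \<alpha>)"
    define B where "B = u * (x - \<beta>)"
    define F where "F v = u * (p0 * v + p1 * (A * v + B * v\<^sup>2 / 2)
      + p2 * (A\<^sup>2 * v + A * B * v\<^sup>2 + B\<^sup>2 * v ^ 3 / 3))" for v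
    have e: "\<alpha> + u * (\<beta> - \<alpha> + v * (x - \<beta>)) = A + B * v" for v
      by (simp add: A_def B_def algebra_simps)
    have "((\<lambda>v. u * p (A + B * v)) has_integral F 1 - F 0) {0..1}"
      by (intro fundamental_theorem_of_calculus)
        (auto simp: F_def p_def has_real_derivative_iff_has_vector_derivative[symmetric] power2_eq_square
          algebra_simps power3_eq_cube intro!: derivative_eq_intros)
    then have "I p u = F 1 - F 0" unfolding I_def e by (rule integral_unique)
    then show ?thesis by (simp add: F_def A_def B_def)
  qed
  define G where "G u = p0 * u\<^sup>2 / 2 + p1 * (\<alpha> * u\<^sup>2 / 2 + u ^ 3 * ((\<beta> - \<alpha>) + (x - \<beta>) / 2) / 3)
    + p2 * (\<alpha>\<^sup>2 * u\<^sup>2 / 2 + (2 * \<alpha> * (\<beta> - \<alpha>) + \<alpha> * (x - \<beta>)) * u ^ 3 / 3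
      + ((\<beta> - \<alpha>)\<^sup>2 + (\<beta> - \<alpha>) * (x - \<beta>) + (x - \<beta>)\<^sup>2 / 3) * u ^ 4 / 4)" for u
  have pint: "(I p has_integral G 1 - G 0) {0..1}"
  proof (intro fundamental_theorem_of_calculus)
    show "(G has_vector_derivative I p u) (at u within {0..1})" for u
      unfolding G_def inner has_real_derivative_iff_has_vector_derivative[symmetric]
      by (auto intro!: derivative_eq_intros) (simp add: power2_eq_square power3_eq_cube field_simps)
  qed simp
  have G: "G 1 - G 0 = p0 / 2 + p1 * (\<alpha> + \<beta> + x) / 6
      + p2 * (\<alpha>\<^sup>2 + \<beta>\<^sup>2 + x\<^sup>2 + \<alpha> * \<beta> + \<alpha> * x + \<beta> * x) / 12"
    by (simp add: G_def power2_eq_square field_simps)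
  have contp: "continuous_on S p" unfolding p_def by (intro continuous_intros)
  have gint: "I g integrable_on {0..1}"
    unfolding I_def using ddiff_outer_integrable[OF assms(1-5)] .
  \<comment> \<open>The weight u stays in the bound, so that the outer integration gives M / 2 and
    not M.\<close>
  have bnd: "\<bar>I g u - I p u\<bar> \<le> u * M" if "u \<in> {0..1}" for u
  proof -
    note i = ddiff_inner_integrable[OF assms(1) _ assms(3-5) that]
    have "norm (integral {0..1} (\<lambda>v. u * g (\<alpha> + u * (\<beta> - \<alpha> + v * (x - \<beta>))) - u * p (\<alpha> + u * (\<beta> - \<alpha> + v * (x - \<beta>)))))
      \<le> integral {0..1} (\<lambda>v::real. u * M)"
    proof (rule integral_norm_bound_integral)
      fix v :: real assume v: "v \<in> {0..1}"
      have "\<bar>u\<bar> * \<bar>g (\<alpha> + u * (\<beta> - \<alpha> + v * (x - \<beta>))) - p (\<alpha> + u * (\<beta> - \<alpha> + v * (x - \<beta>)))\<bar> \<le> \<bar>u\<bar> * M"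
        unfolding p_def by (intro mult_left_mono M ddiff_arg_mem assms v that) simp
      then show "norm (u * g (\<alpha> + u * (\<beta> - \<alpha> + v * (x - \<beta>))) - u * p (\<alpha> + u * (\<beta> - \<alpha> + v * (x - \<beta>)))) \<le> u * M"
        using that by (simp add: abs_mult[symmetric] right_diff_distrib)
    qed (auto intro!: integrable_diff i assms contp)
    then show ?thesis
      unfolding I_def using that by (simp add: integral_diff i assms(2) contp)
  qed
  have "norm (integral {0..1} (\<lambda>u. I g u - I p u)) \<le> integral {0..1} (\<lambda>u. u * M)"
  proof (rule integral_norm_bound_integral)
    show "(\<lambda>u. I g u - I p u) integrable_on {0..1}"
      by (rule integrable_diff[OF gint has_integral_integrable[OF pint]])
    show "(\<lambda>u::real. u * M) integrable_on {0..1}"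
      by (intro integrable_continuous_real continuous_intros)
  qed (use bnd in simp)
  moreover have "integral {0..1} (\<lambda>u. I g u - I p u) = ddiff g \<alpha> \<beta> x - (G 1 - G 0)"
  proof -
    have "ddiff g \<alpha> \<beta> x = integral {0..1} (I g)" unfolding ddiff_def I_def ..
    then show ?thesis using gint pint by (simp add: integral_diff has_integral_integrable integral_unique)
  qed
  moreover have "integral {0..1} (\<lambda>u::real. u * M) = M / 2"
    by (simp add: ident_has_integral[THEN integral_unique])
  ultimately show ?thesis by (simp add: G)
qed

lemma segment_integral:
  fixes W W1 :: "real \<Rightarrow> real"
  assumes "convex S" "\<And>x. x \<in> S \<Longrightarrow> (W has_real_derivative W1 x) (at x)" "\<alpha> \<in> S" "x \<in> S"
  shows "((\<lambda>u. (x - \<alpha>) * W1 (\<alpha> + u * (x - \<alpha>))) has_integral W x - W \<alpha>) {0..1}"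
proof -
  have "((\<lambda>u. (x - \<alpha>) * W1 (\<alpha> + u * (x - \<alpha>))) has_integral W (\<alpha> + 1 * (x - \<alpha>)) - W (\<alpha> + 0 * (x - \<alpha>))) {0..1}"
  proof (intro fundamental_theorem_of_calculus)
    fix u :: real assume u: "u \<in> {0..1}"
    have "\<alpha> + u * (x - \<alpha>) \<in> S"
      using ddiff_arg_mem[OF assms(1,3,4,4) u u] by simp
    from affine_chain[OF assms(2)[OF this]]
    show "((\<lambda>u. W (\<alpha> + u * (x - \<alpha>))) has_vector_derivative (x - \<alpha>) * W1 (\<alpha> + u * (x - \<alpha>))) (at u within {0..1})"
      by (simp add: has_real_derivative_iff_has_vector_derivative[symmetric])
  qed simp
  then show ?thesis by simp
qed

text \<open>For fixed u the inner variable runs along a segment of signed length u (x - \<beta>),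
  where the fundamental theorem applies; the weight u in \<open>ddiff\<close> supplies the missing
  factor.\<close>

lemma ddiff_step:
  assumes "convex S" "\<And>x. x \<in> S \<Longrightarrow> (W1 has_real_derivative W2 x) (at x)" "continuous_on S W2"
    "\<alpha> \<in> S" "\<beta> \<in> S" "x \<in> S"
  shows "(x - \<beta>) * ddiff W2 \<alpha> \<beta> x
    = integral {0..1} (\<lambda>u. W1 (\<alpha> + u * (x - \<alpha>)) - W1 (\<alpha> + u * (\<beta> - \<alpha>)))"
proof -
  have "(x - \<beta>) * integral {0..1} (\<lambda>v. u * W2 (\<alpha> + u * (\<beta> - \<alpha> + v * (x - \<beta>))))
     = W1 (\<alpha> + u * (x - \<alpha>)) - W1 (\<alpha> + u * (\<beta> - \<alpha>))" if u: "u \<in> {0..1}" for u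
  proof -
    define p where "p = \<alpha> + u * (\<beta> - \<alpha>)"
    define q where "q = \<alpha> + u * (x - \<alpha>)"
    have "p \<in> S" "q \<in> S"
      using ddiff_arg_mem[OF assms(1,4,5,6) u, of 0] ddiff_arg_mem[OF assms(1,4,5,6) u, of 1]
      by (auto simp: p_def q_def algebra_simps)
    from segment_integral[OF assms(1,2) this]
    have "integral {0..1} (\<lambda>v. (q - p) * W2 (p + v * (q - p))) = W1 q - W1 p"
      by (rule integral_unique)
    moreover have "(q - p) * W2 (p + v * (q - p)) = (x - \<beta>) * (u * W2 (\<alpha> + u * (\<beta> - \<alpha> + v * (x - \<beta>))))" for v
    proof -
      have "q - p = u * (x - \<beta>)" by (simp add: p_def q_def algebra_simps)
      then show ?thesis by (simp add: p_def algebra_simps)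
    qed
    ultimately have "integral {0..1} (\<lambda>v. (x - \<beta>) * (u * W2 (\<alpha> + u * (\<beta> - \<alpha> + v * (x - \<beta>))))) = W1 q - W1 p"
      by (simp only:)
    then show ?thesis by (simp only: p_def q_def integral_mult_right)
  qed
  then have "integral {0..1} (\<lambda>u. (x - \<beta>) * integral {0..1} (\<lambda>v. u * W2 (\<alpha> + u * (\<beta> - \<alpha> + v * (x - \<beta>)))))
    = integral {0..1} (\<lambda>u. W1 (\<alpha> + u * (x - \<alpha>)) - W1 (\<alpha> + u * (\<beta> - \<alpha>)))"
    by (intro Henstock_Kurzweil_Integration.integral_cong) auto
  then show ?thesis unfolding ddiff_def by simp
qed

context
  fixes S :: "real set" and W W1 W2 :: "real \<Rightarrow> real" and \<alpha> \<beta> :: real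
  assumes S: "convex S" "\<alpha> \<in> S" "\<beta> \<in> S"
    and dW: "\<And>x. x \<in> S \<Longrightarrow> (W has_real_derivative W1 x) (at x)"
    and dW1: "\<And>x. x \<in> S \<Longrightarrow> (W1 has_real_derivative W2 x) (at x)"
    and cW2: "continuous_on S W2"
    and eq: "W \<alpha> = W \<beta>" "\<alpha> \<noteq> \<beta>"
begin

text \<open>Equal values at both ends make the mean slope over the segment vanish, which removes the
  subtracted term of \<open>ddiff_step\<close>.\<close>

lemma mean_force_zero: "((\<lambda>u. W1 (\<alpha> + u * (\<beta> - \<alpha>))) has_integral 0) {0..1}"
proof -
  have "((\<lambda>u. inverse (\<beta> - \<alpha>) * ((\<beta> - \<alpha>) * W1 (\<alpha> + u * (\<beta> - \<alpha>)))) has_integral inverse (\<beta> - \<alpha>) * (W \<beta> - W \<alpha>)) {0..1}"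
    by (intro has_integral_mult_right segment_integral[OF S(1) dW S(2,3)])
  moreover have "inverse (\<beta> - \<alpha>) * ((\<beta> - \<alpha>) * y) = y" for y using eq(2) by simp
  ultimately show ?thesis using eq(1) by (simp only: diff_self mult_zero_right)
qed

lemma segment_force_integrable: "x \<in> S \<Longrightarrow> (\<lambda>u. W1 (\<alpha> + u * (x - \<alpha>))) integrable_on {0..1}"
proof (rule integrable_continuous_real)
  assume x: "x \<in> S"
  have "continuous_on S W1" using dW1 DERIV_continuous_on has_field_derivative_at_within by metis
  moreover have "(\<lambda>u. \<alpha> + u * (x - \<alpha>)) ` {0..1} \<subseteq> S"
    using ddiff_arg_mem[OF S(1,2) x x] by auto
  ultimately show "continuous_on {0..1} (\<lambda>u. W1 (\<alpha> + u * (x - \<alpha>)))"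
    using continuous_on_compose2[of S W1 "{0..1}" "\<lambda>u. \<alpha> + u * (x - \<alpha>)"]
    by (simp add: continuous_intros)
qed

lemma ddiff_step': "x \<in> S \<Longrightarrow> (x - \<beta>) * ddiff W2 \<alpha> \<beta> x = integral {0..1} (\<lambda>u. W1 (\<alpha> + u * (x - \<alpha>)))"
  using ddiff_step[OF S(1) dW1 cW2 S(2,3)] segment_force_integrable mean_force_zero
  by (simp add: integral_diff has_integral_integrable integral_unique)

text \<open>Both nodes are zeros of W - W \<alpha>, and two integrations split off the two factors.
  The cofactor is continuous up to the turning points, which the plain quotient would not
  show.\<close>

lemma ddiff_factor: "x \<in> S \<Longrightarrow> (x - \<alpha>) * (x - \<beta>) * ddiff W2 \<alpha> \<beta> x = W x - W \<alpha>"
  using ddiff_step'[of x] segment_integral[OF S(1) dW S(2), of x]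
  by (simp add: integral_unique mult.assoc flip: integral_mult_right)

lemma ddiff_left: "(\<beta> - \<alpha>) * ddiff W2 \<alpha> \<beta> \<alpha> = - W1 \<alpha>"
  using ddiff_step'[OF S(2)] by (simp add: algebra_simps)

text \<open>At x = \<beta> the relation \<open>ddiff_step'\<close> degenerates to 0 = 0. Integrating
  the derivative of \<open>u * W1 (\<alpha> + u * (\<beta> - \<alpha>))\<close> over the unit
  interval gives the value instead.\<close>

lemma ddiff_right: "(\<beta> - \<alpha>) * ddiff W2 \<alpha> \<beta> \<beta> = W1 \<beta>"
proof -
  have "((\<lambda>u. W1 (\<alpha> + u * (\<beta> - \<alpha>)) + (\<beta> - \<alpha>) * (u * W2 (\<alpha> + u * (\<beta> - \<alpha>))))
     has_integral 1 * W1 (\<alpha> + 1 * (\<beta> - \<alpha>)) - 0 * W1 (\<alpha> + 0 * (\<beta> - \<alpha>))) {0..1}"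
  proof (intro fundamental_theorem_of_calculus)
    fix u :: real assume u: "u \<in> {0..1}"
    have "\<alpha> + u * (\<beta> - \<alpha>) \<in> S"
      using ddiff_arg_mem[OF S(1,2,3,3) u u] by simp
    note affine_chain[OF dW1[OF this], of "{0..1}"]
    then show "((\<lambda>u. u * W1 (\<alpha> + u * (\<beta> - \<alpha>))) has_vector_derivative
        W1 (\<alpha> + u * (\<beta> - \<alpha>)) + (\<beta> - \<alpha>) * (u * W2 (\<alpha> + u * (\<beta> - \<alpha>)))) (at u within {0..1})"
      by (auto simp: has_real_derivative_iff_has_vector_derivative[symmetric] mult_ac add_ac intro!: derivative_eq_intros)
  qed simp
  then have "((\<lambda>u. (\<beta> - \<alpha>) * (u * W2 (\<alpha> + u * (\<beta> - \<alpha>)))) has_integral W1 \<beta>) {0..1}"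
    using has_integral_diff[OF _ mean_force_zero] by fastforce
  then show ?thesis unfolding ddiff_def by (simp add: integral_unique flip: integral_mult_right)
qed

end

section \<open>Motion in a potential well\<close>

text \<open>Product rule at a zero of one factor, where continuity of the other is enough. At a
  turning point the velocity is a multiple of cos times a function only known to be
  continuous.\<close>

lemma derivative_mult_at_zero:
  fixes u c :: "real \<Rightarrow> real"
  assumes "(u has_real_derivative u') (at x)" "u x = 0" "isCont c x"
  shows "((\<lambda>x. u x * c x) has_real_derivative u' * c x) (at x)"
proof -
  obtain g where g: "\<And>z. u z - u x = g z * (z - x)" "isCont g x" "g x = u'"
    using assms(1) unfolding CARAT_DERIV by auto
  have "u z * c z - u x * c x = g z * c z * (z - x)" for z
    using g(1)[of z] assms(2) by simp
  then show ?thesis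
    unfolding CARAT_DERIV
    using g(2,3) assms(3) by (intro exI[of _ "\<lambda>z. g z * c z"]) (auto intro!: continuous_intros)
qed

text \<open>The increment T covers two situations: time advancing by a period while the phase makes
  a full turn, and, with T = 0, plain periodicity.\<close>

lemma shift_by_int_multiples:
  fixes H :: "real \<Rightarrow> real"
  assumes "\<And>x. H (x + p) = H x + T"
  shows "H (x + of_int n * p) = H x + of_int n * T"
proof -
  have nat: "H (x + of_nat k * p) = H x + of_nat k * T" for k :: nat and x
  proof (induction k arbitrary: x)
    case (Suc k)
    show ?case using Suc[of "x + p"] assms[of x] by (simp add: algebra_simps)
  qed simp
  show ?thesis
  proof (cases "0 \<le> n")
    case True
    then show ?thesis using nat[of x "nat n"] by simp
  next
    case False
    then show ?thesis using nat[of "x + of_int n * p" "nat (- n)"] by simp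
  qed
qed

text \<open>Time of a full oscillation, with the position written as midpoint plus half-width times
  sin \<psi>. The factor cos \<psi> in dx cancels the root of (x - \<alpha>) (\<beta> - x), leaving
  an integrand without singularity; a full turn of \<psi> covers the motion there and back.\<close>

definition well_period :: "(real \<Rightarrow> real) \<Rightarrow> real \<Rightarrow> real \<Rightarrow> real" where
  "well_period W2 \<alpha> \<beta> =
     integral {0..2 * pi} (\<lambda>\<psi>. 1 / sqrt (2 * ddiff W2 \<alpha> \<beta> ((\<alpha> + \<beta>) / 2 + (\<beta> - \<alpha>) / 2 * sin \<psi>)))"

text \<open>The slope conditions keep the turning points from being equilibria, which would take
  infinite time to reach.\<close>

locale well =
  fixes W W1 W2 :: "real \<Rightarrow> real" and \<alpha> \<beta> :: real
  assumes \<alpha>\<beta>: "\<alpha> < \<beta>"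
    and dW: "\<And>x. x \<in> {\<alpha>..\<beta>} \<Longrightarrow> (W has_real_derivative W1 x) (at x)"
    and dW1: "\<And>x. x \<in> {\<alpha>..\<beta>} \<Longrightarrow> (W1 has_real_derivative W2 x) (at x)"
    and cW2: "continuous_on {\<alpha>..\<beta>} W2"
    and level: "W \<alpha> = W \<beta>"
    and below: "\<And>x. \<alpha> < x \<Longrightarrow> x < \<beta> \<Longrightarrow> W x < W \<alpha>"
    and slopes: "W1 \<alpha> < 0" "0 < W1 \<beta>"
begin

abbreviation "k \<equiv> ddiff W2 \<alpha> \<beta>"
text \<open>Half-width of the well; \<open>pos\<close> is the position at phase \<psi>, and
  \<open>rate\<close> is dt/d\<psi>.\<close>

definition "hw = (\<beta> - \<alpha>) / 2"
definition "pos \<psi> = (\<alpha> + \<beta>) / 2 + (\<beta> - \<alpha>) / 2 * sin \<psi>"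
definition "rate \<psi> = 1 / sqrt (2 * k (pos \<psi>))"

lemma mem: "convex {\<alpha>..\<beta>}" "\<alpha> \<in> {\<alpha>..\<beta>}" "\<beta> \<in> {\<alpha>..\<beta>}" "\<alpha> \<noteq> \<beta>"
  using \<alpha>\<beta> by auto

lemma k_continuous: "continuous_on {\<alpha>..\<beta>} k"
proof -
  have "continuous_on {\<alpha>..\<beta>} (\<lambda>x. (\<lambda>(\<alpha>, \<beta>, x). ddiff W2 \<alpha> \<beta> x) (\<alpha>, \<beta>, x))"
    by (rule continuous_on_compose2[OF ddiff_continuous[OF mem(1) cW2]])
      (use \<alpha>\<beta> in \<open>auto intro!: continuous_intros\<close>)
  then show ?thesis by simp
qed

lemma k_factor: "x \<in> {\<alpha>..\<beta>} \<Longrightarrow> (x - \<alpha>) * (\<beta> - x) * k x = W \<alpha> - W x"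
  using ddiff_factor[OF mem(1-3) dW dW1 cW2 level mem(4), of x]
  by (simp add: minus_diff_eq[of x \<beta>, symmetric] del: minus_diff_eq)

lemmas k_left = ddiff_left[OF mem(1-3) dW dW1 cW2 level mem(4)]
lemmas k_right = ddiff_right[OF mem(1-3) dW dW1 cW2 level mem(4)]

text \<open>Inside the well k is the positive depth divided by (x - \<alpha>) (\<beta> - x). At the
  ends, where this quotient has no value, k is read off from the slopes.\<close>

lemma k_pos:
  assumes "x \<in> {\<alpha>..\<beta>}"
  shows "0 < k x"
proof -
  consider "x = \<alpha>" | "x = \<beta>" | "\<alpha> < x" "x < \<beta>" using assms by fastforce
  then show ?thesis
  proof cases
    case 1
    then show ?thesis using k_left slopes(1) \<alpha>\<beta> zero_less_mult_pos[of "\<beta> - \<alpha>" "k \<alpha>"] by simp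
  next
    case 2
    then show ?thesis using k_right slopes(2) \<alpha>\<beta> zero_less_mult_pos[of "\<beta> - \<alpha>" "k \<beta>"] by simp
  next
    case 3
    then have "0 < (x - \<alpha>) * (\<beta> - x) * k x" using k_factor[OF assms] below by simp
    moreover have "0 < (x - \<alpha>) * (\<beta> - x)" using 3 by simp
    ultimately show ?thesis by (rule zero_less_mult_pos)
  qed
qed

lemma hw_pos: "0 < hw" using \<alpha>\<beta> by (simp add: hw_def)

lemma pos_mem: "pos \<psi> \<in> {\<alpha>..\<beta>}"
proof -
  have "\<bar>hw * sin \<psi>\<bar> \<le> hw * 1"
    unfolding abs_mult using hw_pos by (intro mult_mono) auto
  then have "hw * sin \<psi> \<le> hw" "- hw \<le> hw * sin \<psi>" by (simp_all add: abs_le_iff)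
  moreover have "pos \<psi> = \<alpha> + hw + hw * sin \<psi>" "\<beta> = \<alpha> + hw + hw"
    unfolding pos_def hw_def by (simp_all add: field_simps)
  ultimately show ?thesis by simp
qed

lemma pos_deriv: "(pos has_real_derivative hw * cos \<psi>) (at \<psi>)"
  unfolding pos_def hw_def by (auto intro!: derivative_eq_intros)

lemma k_pos_continuous: "continuous_on UNIV (\<lambda>\<psi>. k (pos \<psi>))"
  by (rule continuous_on_compose2[OF k_continuous])
    (use pos_mem in \<open>auto simp: pos_def intro!: continuous_intros\<close>)

lemma rate_continuous: "continuous_on UNIV rate"
  unfolding rate_def using k_pos[OF pos_mem]
  by (auto intro!: continuous_intros k_pos_continuous simp: less_imp_neq[symmetric])

lemma rate_pos: "0 < rate \<psi>" using k_pos[OF pos_mem] by (simp add: rate_def)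

lemma rate_lower_bound: obtains c where "0 < c" "\<And>\<psi>. c \<le> rate \<psi>"
proof -
  obtain M where M: "\<And>x. x \<in> {\<alpha>..\<beta>} \<Longrightarrow> k x \<le> M"
    using continuous_attains_sup[OF compact_Icc _ k_continuous] mem(2) by (metis empty_iff)
  have "1 / sqrt (2 * M) \<le> rate \<psi>" for \<psi>
    unfolding rate_def using k_pos[OF pos_mem[of \<psi>]] M[OF pos_mem[of \<psi>]]
    by (intro divide_left_mono mult_pos_pos) simp_all
  moreover have "0 < M" using k_pos[OF mem(2)] M[OF mem(2)] by simp
  ultimately show ?thesis using that[of "1 / sqrt (2 * M)"] by simp
qed

text \<open>Velocity as a function of the phase. The factor cos \<psi> carries the sign, so one
  formula serves both directions of motion.\<close>

definition "speed \<psi> = hw * cos \<psi> * sqrt (2 * k (pos \<psi>))"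

lemma speed_square: "(speed \<psi>)\<^sup>2 = 2 * (W \<alpha> - W (pos \<psi>))"
proof -
  have "(pos \<psi> - \<alpha>) * (\<beta> - pos \<psi>) = hw\<^sup>2 * (1 - (sin \<psi>)\<^sup>2)"
    by (simp add: pos_def hw_def power2_eq_square field_simps)
  also have "\<dots> = (hw * cos \<psi>)\<^sup>2" by (simp add: cos_squared_eq power_mult_distrib)
  finally have *: "(hw * cos \<psi>)\<^sup>2 * k (pos \<psi>) = W \<alpha> - W (pos \<psi>)"
    using k_factor[OF pos_mem[of \<psi>]] by simp
  have "(speed \<psi>)\<^sup>2 = (hw * cos \<psi>)\<^sup>2 * (2 * k (pos \<psi>))"
    unfolding speed_def power_mult_distrib[of "hw * cos \<psi>"] using k_pos[OF pos_mem[of \<psi>]] by simp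
  with * show ?thesis by simp
qed

text \<open>Newton's equation with the phase as parameter. Since k is only known to be continuous,
  the formula for \<open>speed\<close> is not differentiated as it stands: away from turning points
  the root of the energy is differentiated instead, and at a turning point the zero of cos \<psi>
  together with \<open>k_left\<close> and \<open>k_right\<close> gives the derivative.\<close>

lemma speed_deriv: "(speed has_real_derivative - W1 (pos \<psi>) * rate \<psi>) (at \<psi>)"
proof (cases "cos \<psi> = 0")
  case True
  have c: "isCont (\<lambda>\<psi>. sqrt (2 * k (pos \<psi>))) \<psi>"
    using k_pos_continuous by (auto simp: continuous_on_eq_continuous_at intro!: continuous_intros)
  have "((\<lambda>\<psi>. hw * cos \<psi>) has_real_derivative - hw * sin \<psi>) (at \<psi>)"
    by (auto intro!: derivative_eq_intros)
  from derivative_mult_at_zero[OF this _ c] True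
  have "(speed has_real_derivative - hw * sin \<psi> * sqrt (2 * k (pos \<psi>))) (at \<psi>)"
    unfolding speed_def by simp
  moreover have "hw * sin \<psi> * sqrt (2 * k (pos \<psi>)) = W1 (pos \<psi>) * rate \<psi>"
  proof -
    have "sin \<psi> = 1 \<or> sin \<psi> = -1"
      using sin_cos_squared_add[of \<psi>] True by (simp add: power2_eq_1_iff)
    then have W1: "W1 (pos \<psi>) = hw * sin \<psi> * (2 * k (pos \<psi>))"
    proof
      assume "sin \<psi> = 1"
      moreover from this have "pos \<psi> = \<beta>" by (simp add: pos_def field_simps)
      ultimately show ?thesis using k_right by (simp add: hw_def)
    next
      assume "sin \<psi> = -1"
      moreover from this have "pos \<psi> = \<alpha>" by (simp add: pos_def field_simps)
      ultimately show ?thesis using k_left by (simp add: hw_def)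
    qed
    show ?thesis
      unfolding W1 rate_def using k_pos[OF pos_mem[of \<psi>]] real_sqrt_mult_self[of "2 * k (pos \<psi>)"]
      by (simp add: field_simps)
  qed
  ultimately show ?thesis by simp
next
  case False
  define \<sigma> where "\<sigma> = sgn (cos \<psi>)"
  have \<sigma>: "\<sigma> * \<sigma> = 1" using False by (simp add: \<sigma>_def sgn_if)
  \<comment> \<open>Near \<psi> the sign \<sigma> of cos does not change, so the velocity agrees
    there with \<sigma> times the root of twice the kinetic energy, which is differentiable because
    this energy is positive.\<close>
  define F where "F z = \<sigma> * sqrt (2 * (W \<alpha> - W (pos z)))" for z
  have F: "F z = speed z" if "sgn (cos z) = \<sigma>" for z
  proof -
    have "F z = \<sigma> * \<bar>speed z\<bar>" unfolding F_def by (simp only: real_sqrt_abs flip: speed_square)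
    also have "\<bar>speed z\<bar> = \<sigma> * speed z"
      unfolding speed_def using hw_pos k_pos[OF pos_mem[of z]] that
      by (auto simp: abs_mult sgn_if split: if_splits)
    finally show ?thesis using \<sigma> by (simp flip: mult.assoc)
  qed
  have ev: "\<forall>\<^sub>F z in nhds \<psi>. F z = speed z"
  proof -
    have "open {z. 0 < \<sigma> * cos z}"
      by (intro open_Collect_less continuous_intros)
    moreover have "\<psi> \<in> {z. 0 < \<sigma> * cos z}" using False by (auto simp: \<sigma>_def sgn_if)
    moreover have "F z = speed z" if "z \<in> {z. 0 < \<sigma> * cos z}" for z
      by (rule F) (use that False in \<open>auto simp: \<sigma>_def sgn_if zero_less_mult_iff split: if_splits\<close>)
    ultimately show ?thesis unfolding eventually_nhds by blast
  qed
  have speed_nz: "speed \<psi> \<noteq> 0" using False hw_pos k_pos[OF pos_mem[of \<psi>]] by (simp add: speed_def)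
  have p: "0 < 2 * (W \<alpha> - W (pos \<psi>))" unfolding speed_square[symmetric] using speed_nz by simp
  have dWp: "((\<lambda>z. W (pos z)) has_real_derivative W1 (pos \<psi>) * (hw * cos \<psi>)) (at \<psi>)"
    by (rule DERIV_chain2[OF dW[OF pos_mem] pos_deriv])
  have "(F has_real_derivative \<sigma> * (- W1 (pos \<psi>) * (hw * cos \<psi>) / sqrt (2 * (W \<alpha> - W (pos \<psi>))))) (at \<psi>)"
  proof -
    have "((\<lambda>z. 2 * (W \<alpha> - W (pos z))) has_real_derivative 2 * (0 - W1 (pos \<psi>) * (hw * cos \<psi>))) (at \<psi>)"
      by (intro DERIV_cmult DERIV_diff DERIV_const dWp)
    from DERIV_cmult[OF DERIV_chain2[OF DERIV_real_sqrt[OF p] this], of \<sigma>]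
    show ?thesis unfolding F_def by (simp add: field_simps)
  qed
  moreover have "\<sigma> * (- W1 (pos \<psi>) * (hw * cos \<psi>) / sqrt (2 * (W \<alpha> - W (pos \<psi>)))) = - W1 (pos \<psi>) * rate \<psi>"
  proof -
    have "\<sigma> * sqrt (2 * (W \<alpha> - W (pos \<psi>))) = speed \<psi>" using F[of \<psi>] by (simp add: F_def \<sigma>_def)
    then have s: "sqrt (2 * (W \<alpha> - W (pos \<psi>))) = \<sigma> * speed \<psi>" using \<sigma> by (metis mult.assoc mult_1)
    have "\<sigma> * (- W1 (pos \<psi>) * (hw * cos \<psi>) / (\<sigma> * speed \<psi>)) = - W1 (pos \<psi>) * (hw * cos \<psi> / speed \<psi>)"
      using \<sigma> by (auto simp: field_simps)
    also have "hw * cos \<psi> / speed \<psi> = rate \<psi>"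
      using speed_nz False hw_pos unfolding speed_def rate_def by simp
    finally show ?thesis unfolding s .
  qed
  ultimately show ?thesis using DERIV_cong_ev[OF refl ev refl] by simp
qed

text \<open>Integrating \<open>rate\<close> gives time as an increasing bijection of the phase, and
  its inverse carries \<open>pos\<close> and \<open>speed\<close> into a solution. The final clause
  on arbitrary periods is what later turns closedness of an orbit into rationality of the period
  over 2 pi.\<close>

lemma period_pos: "0 < well_period W2 \<alpha> \<beta>"
  and period_motion: "\<exists>X X'. (\<forall>t. (X has_real_derivative X' t) (at t)) \<and>
      (\<forall>t. (X' has_real_derivative - W1 (X t)) (at t)) \<and>
      (\<forall>t. X t \<in> {\<alpha>..\<beta>}) \<and> (\<forall>t. (X' t)\<^sup>2 / 2 + W (X t) = W \<alpha>) \<and>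
      (\<exists>t. X t = \<alpha>) \<and> (\<exists>t. X t = \<beta>) \<and>
      (\<forall>t. X (t + well_period W2 \<alpha> \<beta>) = X t) \<and>
      (\<forall>S. (\<forall>t. X (t + S) = X t) \<longrightarrow> (\<exists>n::int. S = of_int n * well_period W2 \<alpha> \<beta>))"
proof -
  obtain c where c: "0 < c" "\<And>\<psi>. c \<le> rate \<psi>" using rate_lower_bound by blast
  obtain H Hi where H: "\<And>x. (H has_real_derivative rate x) (at x)" "H 0 = 0" "strict_mono H"
    "\<And>x. Hi (H x) = x" "\<And>y. H (Hi y) = y"
    "\<And>y. (Hi has_real_derivative 1 / rate (Hi y)) (at y)"
    using positive_primitive_bij[OF rate_continuous c] by blast
  have "(rate has_integral H (2 * pi) - H 0) {0..2 * pi}"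
    by (rule fundamental_theorem_of_calculus)
      (use H(1) in \<open>auto simp: has_real_derivative_iff_has_vector_derivative[symmetric] intro: has_field_derivative_at_within\<close>)
  then have T: "H (2 * pi) = well_period W2 \<alpha> \<beta>"
    unfolding well_period_def by (simp add: integral_unique H(2) rate_def[abs_def] pos_def)
  define T where "T = well_period W2 \<alpha> \<beta>"
  show "0 < well_period W2 \<alpha> \<beta>" using strict_monoD[OF H(3), of 0 "2*pi"] H(2) T by simp
  have Hper: "H (x + 2 * pi) = H x + T" for x
  proof -
    have "H (x + 2 * pi) - H x = H (0 + 2 * pi) - H 0"
    proof (rule derivative_zero_imp_eq[of UNIV "\<lambda>x. H (x + 2 * pi) - H x"])
      show "((\<lambda>x. H (x + 2 * pi) - H x) has_real_derivative 0) (at x)" for x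
      proof -
        have "((\<lambda>x. H (x + 2 * pi)) has_real_derivative rate (x + 2 * pi)) (at x)"
          using H(1)[of "x + 2 * pi"] by (simp add: DERIV_shift)
        from DERIV_diff[OF this H(1)] show ?thesis by (simp add: rate_def pos_def)
      qed
    qed auto
    then show ?thesis using T H(2) by (simp add: T_def)
  qed
  define X where "X t = pos (Hi t)" for t
  define X' where "X' t = speed (Hi t)" for t
  have "(X has_real_derivative X' t) (at t)" for t
    unfolding X_def
    using DERIV_chain2[OF pos_deriv H(6)] by (simp add: X'_def speed_def rate_def)
  moreover have "(X' has_real_derivative - W1 (X t)) (at t)" for t
    unfolding X'_def
    using DERIV_chain2[OF speed_deriv H(6), of t] rate_pos[of "Hi t"] by (simp add: X_def)
  moreover have "X t \<in> {\<alpha>..\<beta>}" for t unfolding X_def by (rule pos_mem)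
  moreover have "(X' t)\<^sup>2 / 2 + W (X t) = W \<alpha>" for t
    unfolding X'_def X_def speed_square by (simp add: field_simps)
  moreover have "X (H (pi / 2)) = \<beta>" "X (H (- pi / 2)) = \<alpha>"
    by (simp_all add: X_def H(4) pos_def field_simps)
  moreover have "X (t + T) = X t" for t
  proof -
    have "Hi (t + T) = Hi t + 2 * pi" using Hper[of "Hi t"] H(4,5) by metis
    then show ?thesis by (simp add: X_def pos_def)
  qed
  \<comment> \<open>A period returns the position to its maximum \<beta>, which is attained only at
    phases pi / 2 modulo 2 pi.\<close>
  moreover have "\<exists>n::int. S = of_int n * T" if S: "\<And>t. X (t + S) = X t" for S
  proof -
    have "pos (Hi (H (pi / 2) + S)) = pos (pi / 2)" using S[of "H (pi/2)"] by (simp add: X_def H(4))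
    then have "sin (Hi (H (pi / 2) + S)) = 1" using \<alpha>\<beta> by (simp add: pos_def)
    then obtain n :: int where "Hi (H (pi / 2) + S) = (2 * of_int n + 1 / 2) * pi"
      using sin_eq_1 by auto
    then have "H (pi / 2) + S = H (pi / 2 + of_int n * (2 * pi))"
      using H(5)[of "H (pi/2) + S"] by (simp add: algebra_simps)
    also have "\<dots> = H (pi / 2) + of_int n * T" by (rule shift_by_int_multiples[of H, OF Hper])
    finally show ?thesis by auto
  qed
  ultimately show "\<exists>X X'. (\<forall>t. (X has_real_derivative X' t) (at t)) \<and>
      (\<forall>t. (X' has_real_derivative - W1 (X t)) (at t)) \<and>
      (\<forall>t. X t \<in> {\<alpha>..\<beta>}) \<and> (\<forall>t. (X' t)\<^sup>2 / 2 + W (X t) = W \<alpha>) \<and>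
      (\<exists>t. X t = \<alpha>) \<and> (\<exists>t. X t = \<beta>) \<and>
      (\<forall>t. X (t + well_period W2 \<alpha> \<beta>) = X t) \<and>
      (\<forall>S. (\<forall>t. X (t + S) = X t) \<longrightarrow> (\<exists>n::int. S = of_int n * well_period W2 \<alpha> \<beta>))"
    unfolding T_def by (intro exI[of _ X] exI[of _ X']) blast
qed

end

section \<open>Families of wells\<close>

text \<open>On the monotone outer slopes every left turning point has one partner of equal level on
  the right, depending continuously on it. Up to the factor 2 pi the periods form a continuous
  rational-valued function, hence a constant. The core between \<alpha>1 and \<beta>1 may be a
  point, as at a minimum, or an interval on which W does not exceed the common level.\<close>

lemma well_period_family:
  fixes W W1 W2 :: "real \<Rightarrow> real"
  assumes order: "\<alpha>0 < \<alpha>1" "\<alpha>1 \<le> \<beta>1" "\<beta>1 < \<beta>0"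
    and dW: "\<And>x. x \<in> {\<alpha>0..\<beta>0} \<Longrightarrow> (W has_real_derivative W1 x) (at x)"
    and dW1: "\<And>x. x \<in> {\<alpha>0..\<beta>0} \<Longrightarrow> (W1 has_real_derivative W2 x) (at x)"
    and cW2: "continuous_on {\<alpha>0..\<beta>0} W2"
    and neg: "\<And>x. x \<in> {\<alpha>0..<\<alpha>1} \<Longrightarrow> W1 x < 0"
    and pos: "\<And>x. x \<in> {\<beta>1<..\<beta>0} \<Longrightarrow> 0 < W1 x"
    and levels: "W \<alpha>1 = W \<beta>1" "W \<alpha>0 = W \<beta>0"
    and inner: "\<And>x. x \<in> {\<alpha>1..\<beta>1} \<Longrightarrow> W x \<le> W \<alpha>1"
    and rational: "\<And>\<alpha> \<beta>. \<alpha> \<in> {\<alpha>0..<\<alpha>1} \<Longrightarrow> \<beta> \<in> {\<beta>1<..\<beta>0} \<Longrightarrow> well W W1 W2 \<alpha> \<beta> \<Longrightarrow>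
      well_period W2 \<alpha> \<beta> / (2 * pi) \<in> \<rat>"
  obtains B T where "continuous_on {\<alpha>0..\<alpha>1} B" "B \<alpha>1 = \<beta>1"
    "\<And>\<alpha>. \<alpha> \<in> {\<alpha>0..<\<alpha>1} \<Longrightarrow> B \<alpha> \<in> {\<beta>1<..\<beta>0}"
    "\<And>\<alpha>. \<alpha> \<in> {\<alpha>0..<\<alpha>1} \<Longrightarrow> well W W1 W2 \<alpha> (B \<alpha>)"
    "\<And>\<alpha>. \<alpha> \<in> {\<alpha>0..<\<alpha>1} \<Longrightarrow> well_period W2 \<alpha> (B \<alpha>) = T"
proof -
  have cW: "continuous_on {\<alpha>0..\<beta>0} W"
    using dW DERIV_isCont continuous_at_imp_continuous_on by blast
  have dec: "W y < W x" if "\<alpha>0 \<le> x" "x < y" "y \<le> \<alpha>1" for x y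
  proof (rule DERIV_neg_imp_decreasing_open[OF that(2)])
    show "\<exists>d. (W has_real_derivative d) (at z) \<and> d < 0" if "x < z" "z < y" for z
      using dW[of z] neg[of z] order that \<open>\<alpha>0 \<le> x\<close> \<open>y \<le> \<alpha>1\<close> by (intro exI[of _ "W1 z"]) simp
    show "continuous_on {x..y} W" by (rule continuous_on_subset[OF cW]) (use order that in auto)
  qed
  have inc: "W x < W y" if "\<beta>1 \<le> x" "x < y" "y \<le> \<beta>0" for x y
  proof (rule DERIV_pos_imp_increasing_open[OF that(2)])
    show "\<exists>d. (W has_real_derivative d) (at z) \<and> 0 < d" if "x < z" "z < y" for z
      using dW[of z] pos[of z] order that \<open>\<beta>1 \<le> x\<close> \<open>y \<le> \<beta>0\<close> by (intro exI[of _ "W1 z"]) simp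
    show "continuous_on {x..y} W" by (rule continuous_on_subset[OF cW]) (use order that in auto)
  qed
  have inj: "inj_on W {\<beta>1..\<beta>0}"
  proof (rule inj_onI, rule ccontr)
    fix x y assume *: "x \<in> {\<beta>1..\<beta>0}" "y \<in> {\<beta>1..\<beta>0}" "W x = W y" "x \<noteq> y"
    then consider "x < y" | "y < x" by linarith
    then show False using inc[of x y] inc[of y x] * by cases auto
  qed
  \<comment> \<open>Inverse of W on the right slope, applied to the level of \<alpha>.\<close>
  define B where "B \<alpha> = the_inv_into {\<beta>1..\<beta>0} W (W \<alpha>)" for \<alpha>
  have sub: "W \<alpha> \<in> W ` {\<beta>1..\<beta>0}" if "\<alpha> \<in> {\<alpha>0..\<alpha>1}" for \<alpha>
  proof -
    have "W \<alpha> \<le> W \<alpha>0" using dec[of \<alpha>0 \<alpha>] that by (cases "\<alpha> = \<alpha>0") auto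
    moreover have "W \<alpha>1 \<le> W \<alpha>" using dec[of \<alpha> \<alpha>1] that by (cases "\<alpha> = \<alpha>1") auto
    ultimately have "\<exists>x\<ge>\<beta>1. x \<le> \<beta>0 \<and> W x = W \<alpha>"
      using levels order by (intro IVT' continuous_on_subset[OF cW]) auto
    then obtain x where "x \<in> {\<beta>1..\<beta>0}" "W \<alpha> = W x" by auto
    then show ?thesis by blast
  qed
  have B: "B \<alpha> \<in> {\<beta>1..\<beta>0}" "W (B \<alpha>) = W \<alpha>" if "\<alpha> \<in> {\<alpha>0..\<alpha>1}" for \<alpha>
    using the_inv_into_into[OF inj sub[OF that] subset_refl] f_the_inv_into_f[OF inj sub[OF that]]
    by (auto simp: B_def)
  have B\<alpha>1: "B \<alpha>1 = \<beta>1" unfolding B_def levels by (rule the_inv_into_f_f[OF inj]) (use order in auto)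
  have contB: "continuous_on {\<alpha>0..\<alpha>1} B"
    unfolding B_def
  proof (rule continuous_on_compose2[OF continuous_on_inv_into[OF _ _ inj]])
    show "continuous_on {\<beta>1..\<beta>0} W" "continuous_on {\<alpha>0..\<alpha>1} W"
      by (rule continuous_on_subset[OF cW]; use order in auto)+
  qed (use sub in auto)
  have B1: "B \<alpha> \<in> {\<beta>1<..\<beta>0}" if "\<alpha> \<in> {\<alpha>0..<\<alpha>1}" for \<alpha>
  proof -
    have "W \<beta>1 < W (B \<alpha>)" using B(2)[of \<alpha>] dec[of \<alpha> \<alpha>1] levels that by simp
    then have "B \<alpha> \<noteq> \<beta>1" by auto
    then show ?thesis using B(1)[of \<alpha>] that by auto
  qed
  have well: "well W W1 W2 \<alpha> (B \<alpha>)" if \<alpha>: "\<alpha> \<in> {\<alpha>0..<\<alpha>1}" for \<alpha>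
  proof
    have *: "B \<alpha> \<in> {\<beta>1<..\<beta>0}" "W (B \<alpha>) = W \<alpha>" using B1[OF \<alpha>] B(2)[of \<alpha>] \<alpha> by auto
    have sub: "{\<alpha>..B \<alpha>} \<subseteq> {\<alpha>0..\<beta>0}" using * \<alpha> by auto
    show "\<alpha> < B \<alpha>" using * \<alpha> order by auto
    show "(W has_real_derivative W1 x) (at x)" "(W1 has_real_derivative W2 x) (at x)" if "x \<in> {\<alpha>..B \<alpha>}" for x
      using dW dW1 sub that by auto
    show "continuous_on {\<alpha>..B \<alpha>} W2" by (rule continuous_on_subset[OF cW2 sub])
    show "W \<alpha> = W (B \<alpha>)" using * by simp
    show "W x < W \<alpha>" if "\<alpha> < x" "x < B \<alpha>" for x
    proof -
      consider "x < \<alpha>1" | "x \<in> {\<alpha>1..\<beta>1}" | "\<beta>1 < x" by fastforce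
      then show ?thesis
      proof cases
        case 1 then show ?thesis using dec[of \<alpha> x] \<alpha> that by simp
      next
        case 2 then show ?thesis using inner[of x] dec[of \<alpha> \<alpha>1] \<alpha> by auto
      next
        case 3 then show ?thesis using inc[of x "B \<alpha>"] * that by auto
      qed
    qed
    show "W1 \<alpha> < 0" "0 < W1 (B \<alpha>)" using neg[OF \<alpha>] pos[OF *(1)] by auto
  qed
  \<comment> \<open>The divided difference is jointly continuous in its three nodes, so the period
    is an integral depending continuously on a parameter, the turning points included.\<close>
  have cont: "continuous_on {\<alpha>0..<\<alpha>1} (\<lambda>\<alpha>. well_period W2 \<alpha> (B \<alpha>))"
  proof -
    have cB: "continuous_on ({\<alpha>0..<\<alpha>1} \<times> cbox 0 (2 * pi)) (\<lambda>p. B (fst p))"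
      by (rule continuous_on_compose2[OF contB]) (auto intro!: continuous_intros)
    have mem: "(\<alpha>, B \<alpha>, (\<alpha> + B \<alpha>) / 2 + (B \<alpha> - \<alpha>) / 2 * sin \<psi>) \<in> {\<alpha>0..\<beta>0} \<times> {\<alpha>0..\<beta>0} \<times> {\<alpha>0..\<beta>0}"
      if "\<alpha> \<in> {\<alpha>0..<\<alpha>1}" for \<alpha> \<psi>
      using well.pos_mem[OF well[OF that], of \<psi>] B1[OF that] order that
      by (auto simp: well.pos_def[OF well[OF that]])
    have c3: "continuous_on ({\<alpha>0..<\<alpha>1} \<times> cbox 0 (2 * pi))
       (\<lambda>p. (\<lambda>(\<alpha>, \<beta>, x). ddiff W2 \<alpha> \<beta> x) (fst p, B (fst p), (fst p + B (fst p)) / 2 + (B (fst p) - fst p) / 2 * sin (snd p)))"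
    proof (rule continuous_on_compose2[OF ddiff_continuous[OF convex_real_interval(5) cW2]])
      show "continuous_on ({\<alpha>0..<\<alpha>1} \<times> cbox 0 (2 * pi))
         (\<lambda>p. (fst p, B (fst p), (fst p + B (fst p)) / 2 + (B (fst p) - fst p) / 2 * sin (snd p)))"
        by (intro continuous_intros cB) simp_all
    qed (use mem in auto)
    have "0 < ddiff W2 \<alpha> (B \<alpha>) ((\<alpha> + B \<alpha>) / 2 + (B \<alpha> - \<alpha>) / 2 * sin \<psi>)" if "\<alpha> \<in> {\<alpha>0..<\<alpha>1}" for \<alpha> \<psi>
      using well.k_pos[OF well[OF that] well.pos_mem[OF well[OF that]], of \<psi>]
      by (simp add: well.pos_def[OF well[OF that]])
    then have "continuous_on ({\<alpha>0..<\<alpha>1} \<times> cbox 0 (2 * pi))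
      (\<lambda>(\<alpha>, \<psi>). 1 / sqrt (2 * ddiff W2 \<alpha> (B \<alpha>) ((\<alpha> + B \<alpha>) / 2 + (B \<alpha> - \<alpha>) / 2 * sin \<psi>)))"
      using c3 unfolding split_beta by (intro continuous_intros) (force simp: less_imp_neq[symmetric])+
    from integral_continuous_on_param[OF this] show ?thesis
      by (simp add: well_period_def)
  qed
  have "well_period W2 \<alpha> (B \<alpha>) / (2 * pi) = well_period W2 \<alpha>0 (B \<alpha>0) / (2 * pi)" if "\<alpha> \<in> {\<alpha>0..<\<alpha>1}" for \<alpha>
  proof (rule rational_valued_imp_constant[where S="{\<alpha>0..<\<alpha>1}" and g="\<lambda>\<alpha>. well_period W2 \<alpha> (B \<alpha>) / (2 * pi)"])
    show "continuous_on {\<alpha>0..<\<alpha>1} (\<lambda>\<alpha>. well_period W2 \<alpha> (B \<alpha>) / (2 * pi))"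
      by (intro continuous_intros cont) auto
  qed (use that order rational[OF _ B1 well] in auto)
  from this have "well_period W2 \<alpha> (B \<alpha>) = well_period W2 \<alpha>0 (B \<alpha>0)" if "\<alpha> \<in> {\<alpha>0..<\<alpha>1}" for \<alpha>
    using that pi_gt_zero by (metis divide_cancel_right less_irrefl mult_pos_pos zero_less_numeral)
  with that[of B "well_period W2 \<alpha>0 (B \<alpha>0)"] contB B\<alpha>1 B1 well show ?thesis by blast
qed

text \<open>For constant second derivative c the divided difference is c / 2 and the period 2 pi /
  sqrt c. A deviation of at most e moves twice the divided difference by at most e, so the squared
  frequency is trapped between c - e and c + e.\<close>

lemma well_period_bounds:
  assumes "well W W1 W2 \<alpha> \<beta>" "\<And>y. y \<in> {\<alpha>..\<beta>} \<Longrightarrow> \<bar>W2 y - c\<bar> \<le> e"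
  shows "\<bar>(2 * pi / well_period W2 \<alpha> \<beta>)\<^sup>2 - c\<bar> \<le> e"
proof -
  interpret well W W1 W2 \<alpha> \<beta> by fact
  define T where "T = well_period W2 \<alpha> \<beta>"
  have T: "0 < T" using period_pos by (simp add: T_def)
  have k: "c - e \<le> 2 * k x" "2 * k x \<le> c + e" if "x \<in> {\<alpha>..\<beta>}" for x
    using ddiff_approx[OF mem(1) cW2 mem(2,3) that, of c 0 0 e] assms(2)
    by (auto simp: abs_le_iff field_simps)
  have ce: "0 < c + e" using k(2)[OF mem(2)] k_pos[OF mem(2)] by simp
  have int: "(rate has_integral T) {0..2 * pi}"
    unfolding T_def well_period_def rate_def[abs_def] pos_def[symmetric]
    by (rule integrable_integral, rule integrable_continuous_real)
       (use rate_continuous continuous_on_subset in \<open>fastforce simp: rate_def[abs_def]\<close>)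
  have const: "((\<lambda>x. d) has_integral d * (2 * pi)) {0..2 * pi}" for d :: real
    using has_integral_const_real[of d 0 "2 * pi"] by (simp add: mult.commute)
  have "1 / sqrt (c + e) * (2 * pi) \<le> T"
  proof (rule has_integral_le[OF const int])
    show "1 / sqrt (c + e) \<le> rate x" for x
      unfolding rate_def using k(2)[OF pos_mem[of x]] k_pos[OF pos_mem[of x]] ce
      by (intro divide_left_mono mult_pos_pos) auto
  qed
  then have "2 * pi / T \<le> sqrt (c + e)" using T ce by (simp add: field_simps)
  then have "(2 * pi / T)\<^sup>2 \<le> (sqrt (c + e))\<^sup>2" using T by (intro power_mono) auto
  then have up: "(2 * pi / T)\<^sup>2 \<le> c + e" using ce by simp
  have low: "c - e \<le> (2 * pi / T)\<^sup>2"
  proof (cases "c - e \<le> 0")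
    case True
    then show ?thesis using zero_le_power2[of "2 * pi / T"] by linarith
  next
    case False
    have "T \<le> 1 / sqrt (c - e) * (2 * pi)"
    proof (rule has_integral_le[OF int const])
      show "rate x \<le> 1 / sqrt (c - e)" for x
        unfolding rate_def using k(1)[OF pos_mem[of x]] k_pos[OF pos_mem[of x]] False
        by (intro divide_left_mono mult_pos_pos) auto
    qed
    then have "sqrt (c - e) \<le> 2 * pi / T" using T False by (simp add: field_simps)
    then have "(sqrt (c - e))\<^sup>2 \<le> (2 * pi / T)\<^sup>2" using False by (intro power_mono) auto
    then show ?thesis using False by simp
  qed
  show ?thesis using up low by (simp add: T_def abs_le_iff)
qed

text \<open>One integration of a Taylor remainder. Repeated use carries the expansion of the third
  derivative down to the function itself.\<close>

lemma bounded_of_derivative_bound: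
  fixes F F' :: "real \<Rightarrow> real"
  assumes "\<And>y. \<bar>y\<bar> \<le> d \<Longrightarrow> (F has_real_derivative F' y) (at y)" "F 0 = 0"
    "\<And>y. \<bar>y\<bar> \<le> d \<Longrightarrow> \<bar>F' y\<bar> \<le> e * \<bar>y\<bar> ^ n" "0 \<le> e" "\<bar>y\<bar> \<le> d"
  shows "\<bar>F y\<bar> \<le> e * \<bar>y\<bar> ^ Suc n"
proof -
  have "norm (F y - F 0) \<le> (e * \<bar>y\<bar> ^ n) * norm (y - 0)"
  proof (rule field_differentiable_bound[of "cball 0 \<bar>y\<bar>"])
    fix z :: real assume "z \<in> cball 0 \<bar>y\<bar>"
    then have z: "\<bar>z\<bar> \<le> \<bar>y\<bar>" by (simp add: dist_real_def)
    show "(F has_real_derivative F' z) (at z within cball 0 \<bar>y\<bar>)"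
      using assms(1)[of z] z assms(5) has_field_derivative_at_within by force
    have "\<bar>F' z\<bar> \<le> e * \<bar>z\<bar> ^ n" using assms(3)[of z] z assms(5) by simp
    also have "\<dots> \<le> e * \<bar>y\<bar> ^ n" using z assms(4) by (intro mult_left_mono power_mono) auto
    finally show "norm (F' z) \<le> e * \<bar>y\<bar> ^ n" by simp
  qed auto
  then show ?thesis using assms(2) by (simp add: mult_ac)
qed

section \<open>The fourth order condition for isochronous minima\<close>

lemma sin_square_has_integral: "((\<lambda>x. (sin x)\<^sup>2) has_integral pi) {0..2 * pi}"
proof -
  have "((\<lambda>x. (sin x)\<^sup>2) has_integral (2 * pi - sin (2 * pi) * cos (2 * pi)) / 2 - (0 - sin 0 * cos 0) / 2) {0..2 * pi}"
  proof (rule fundamental_theorem_of_calculus)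
    fix x :: real
    have "((\<lambda>x. (x - sin x * cos x) / 2) has_real_derivative (1 - (cos x * cos x - sin x * sin x)) / 2) (at x within {0..2*pi})"
      by (auto intro!: derivative_eq_intros)
    moreover have "(1 - (cos x * cos x - sin x * sin x)) / 2 = (sin x)\<^sup>2"
      using sin_cos_squared_add[of x] by (simp add: power2_eq_square)
    ultimately show "((\<lambda>x. (x - sin x * cos x) / 2) has_vector_derivative (sin x)\<^sup>2) (at x within {0..2*pi})"
      by (simp add: has_real_derivative_iff_has_vector_derivative)
  qed simp
  then show ?thesis by simp
qed

text \<open>Exact second order remainder of the inverse square root. Its coefficient is continuous
  in z and equals the Taylor coefficient 3/8 at z = 0, so both limits and uniform bounds can be
  taken from one formula.\<close>

lemma inverse_sqrt_expansion:
  fixes z :: real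
  assumes "-1 < z"
  defines "w \<equiv> sqrt (1 + z)"
  shows "1 / w - 1 + z / 2 = (w + 2) / (2 * w * (w + 1)\<^sup>2) * z\<^sup>2"
proof -
  have w: "0 < w" "w\<^sup>2 = 1 + z" using assms by (auto simp: w_def)
  then have z: "z = w\<^sup>2 - 1" by simp
  define D where "D = (w + 1)\<^sup>2"
  have D: "D \<noteq> 0" using w by (simp add: D_def)
  have "z\<^sup>2 = (w - 1)\<^sup>2 * D" unfolding z D_def by (simp add: power2_eq_square algebra_simps)
  then have "(w + 2) / (2 * w * (w + 1)\<^sup>2) * z\<^sup>2 = (w + 2) * (w - 1)\<^sup>2 / (2 * w)"
    unfolding D_def[symmetric] using D w(1) by simp
  also have "(w + 2) * (w - 1)\<^sup>2 / (2 * w) = 1 / w - 1 + z / 2"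
    unfolding z using w(1) by (simp add: power2_eq_square field_simps)
  finally show ?thesis by simp
qed

text \<open>Expansion of the period in the half-width h. The first order part of the integrand is a
  multiple of sin \<psi> and averages to zero, so constancy of the period makes the mean of the
  second order part vanish; this is the asserted relation. The wells are not centred at the minimum,
  and the shift of their midpoint enters at the same order.\<close>

lemma fourth_order_condition:
  fixes W W1 W2 W3 :: "real \<Rightarrow> real" and \<alpha> \<beta> :: "nat \<Rightarrow> real"
  assumes \<delta>: "0 < \<delta>"
    and dW: "\<And>y. \<bar>y\<bar> \<le> \<delta> \<Longrightarrow> (W has_real_derivative W1 y) (at y)"
    and dW1: "\<And>y. \<bar>y\<bar> \<le> \<delta> \<Longrightarrow> (W1 has_real_derivative W2 y) (at y)"
    and dW2: "\<And>y. \<bar>y\<bar> \<le> \<delta> \<Longrightarrow> (W2 has_real_derivative W3 y) (at y)"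
    and dW3: "(W3 has_real_derivative b) (at 0)"
    and at0: "W1 0 = 0" "W2 0 = \<omega>\<^sup>2" "W3 0 = a" "0 < \<omega>"
    and sign: "\<And>n. \<alpha> n < 0" "\<And>n. 0 < \<beta> n"
    and lim: "\<alpha> \<longlonglongrightarrow> 0" "\<beta> \<longlonglongrightarrow> 0"
    and wells: "\<And>n. well W W1 W2 (\<alpha> n) (\<beta> n)"
    and period: "\<And>n. well_period W2 (\<alpha> n) (\<beta> n) = 2 * pi / \<omega>"
  shows "5 * a\<^sup>2 = 3 * \<omega>\<^sup>2 * b"
proof -
  define h where "h n = (\<beta> n - \<alpha> n) / 2" for n
  define m where "m n = (\<alpha> n + \<beta> n) / 2" for n
  have endpoints: "\<alpha> n = m n - h n" "\<beta> n = m n + h n" for n by (simp_all add: h_def m_def field_simps)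
  have h_pos: "0 < h n" for n using sign[of n] by (simp add: h_def)
  have h_abs: "\<bar>h n\<bar> = h n" for n using h_pos[of n] by simp
  have mh: "\<bar>m n\<bar> \<le> h n" for n using sign[of n] by (simp add: h_def m_def abs_le_iff)
  have h_lim: "h \<longlonglongrightarrow> 0"
    unfolding h_def using lim by (auto intro!: tendsto_eq_intros)
  have W3_expand: "\<exists>d>0. d \<le> \<delta> \<and> (\<forall>y. \<bar>y\<bar> \<le> d \<longrightarrow> \<bar>W3 y - (a + b * y)\<bar> \<le> e * \<bar>y\<bar>)" if e: "0 < e" for e
  proof -
    have "((\<lambda>y. (W3 y - W3 0) / (y - 0)) \<longlongrightarrow> b) (at 0)"
      using dW3 unfolding has_field_derivative_iff by simp
    from tendstoD[OF this e] obtain d where d: "d > 0"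
      "\<And>y. y \<noteq> 0 \<Longrightarrow> \<bar>y\<bar> < d \<Longrightarrow> \<bar>(W3 y - a) / y - b\<bar> < e"
      unfolding eventually_at by (auto simp: dist_real_def at0)
    have "\<bar>W3 y - (a + b * y)\<bar> \<le> e * \<bar>y\<bar>" if "\<bar>y\<bar> \<le> min \<delta> (d / 2)" for y
    proof (cases "y = 0")
      case True then show ?thesis by (simp add: at0)
    next
      case False
      have "W3 y - (a + b * y) = ((W3 y - a) / y - b) * y" using False by (simp add: field_simps)
      then show ?thesis using d(2)[OF False] d(1) that by (auto simp: abs_mult intro!: mult_right_mono)
    qed
    then show ?thesis using d(1) \<delta> by (intro exI[of _ "min \<delta> (d/2)"]) auto
  qed
  have W2_expand: "\<exists>d>0. d \<le> \<delta> \<and> (\<forall>y. \<bar>y\<bar> \<le> d \<longrightarrow> \<bar>W2 y - (\<omega>\<^sup>2 + a * y + b / 2 * y\<^sup>2)\<bar> \<le> e * y\<^sup>2)" if e: "0 < e" for e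
  proof -
    obtain d where d: "d > 0" "d \<le> \<delta>" "\<And>y. \<bar>y\<bar> \<le> d \<Longrightarrow> \<bar>W3 y - (a + b * y)\<bar> \<le> e * \<bar>y\<bar> ^ 1"
      using W3_expand[OF e] by auto
    have "\<bar>W2 y - (\<omega>\<^sup>2 + a * y + b / 2 * y\<^sup>2)\<bar> \<le> e * \<bar>y\<bar> ^ Suc 1" if "\<bar>y\<bar> \<le> d" for y
      by (rule bounded_of_derivative_bound[OF _ _ d(3) _ that])
        (use d e at0 dW2 in \<open>auto intro!: derivative_eq_intros\<close>)
    then show ?thesis using d by (intro exI[of _ d]) (simp add: power2_eq_square)
  qed
  \<comment> \<open>An error of order four is what the midpoint estimate needs: division by 2 h
    leaves h^3, one order below the term h^2 that matters.\<close>
  have "\<exists>C d. 0 < C \<and> 0 < d \<and> (\<forall>y. \<bar>y\<bar> \<le> d \<longrightarrow> \<bar>W y - (W 0 + \<omega>\<^sup>2 / 2 * y\<^sup>2 + a / 6 * y ^ 3)\<bar> \<le> C * \<bar>y\<bar> ^ 4)"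
  proof -
    obtain d where d: "d > 0" "d \<le> \<delta>" "\<And>y. \<bar>y\<bar> \<le> d \<Longrightarrow> \<bar>W2 y - (\<omega>\<^sup>2 + a * y + b / 2 * y\<^sup>2)\<bar> \<le> 1 * y\<^sup>2"
      using W2_expand[of 1] by auto
    define C where "C = 1 + \<bar>b / 2\<bar>"
    have C: "0 < C" by (simp add: C_def add_pos_nonneg)
    have 2: "\<bar>W2 y - (\<omega>\<^sup>2 + a * y)\<bar> \<le> C * \<bar>y\<bar> ^ 2" if "\<bar>y\<bar> \<le> d" for y
    proof -
      have "\<bar>W2 y - (\<omega>\<^sup>2 + a * y)\<bar> \<le> \<bar>W2 y - (\<omega>\<^sup>2 + a * y + b / 2 * y\<^sup>2)\<bar> + \<bar>b / 2 * y\<^sup>2\<bar>" by simp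
      also have "\<dots> \<le> 1 * y\<^sup>2 + \<bar>b / 2\<bar> * y\<^sup>2" using d(3)[OF that] by (simp add: abs_mult)
      finally show ?thesis by (simp add: C_def algebra_simps)
    qed
    have 1: "\<bar>W1 y - (\<omega>\<^sup>2 * y + a / 2 * y\<^sup>2)\<bar> \<le> C * \<bar>y\<bar> ^ Suc 2" if "\<bar>y\<bar> \<le> d" for y
      by (rule bounded_of_derivative_bound[OF _ _ 2 _ that])
        (use d C at0 dW1 in \<open>auto intro!: derivative_eq_intros\<close>)
    have "\<bar>W y - (W 0 + \<omega>\<^sup>2 / 2 * y\<^sup>2 + a / 6 * y ^ 3)\<bar> \<le> C * \<bar>y\<bar> ^ Suc (Suc 2)" if "\<bar>y\<bar> \<le> d" for y
      by (rule bounded_of_derivative_bound[OF _ _ 1 _ that])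
        (use d C at0 dW in \<open>auto intro!: derivative_eq_intros\<close>)
    then show ?thesis using C d by (intro exI[of _ C] exI[of _ d]) (simp add: eval_nat_numeral)
  qed
  then obtain C d where C: "0 < C" "0 < d"
    "\<And>y. \<bar>y\<bar> \<le> d \<Longrightarrow> \<bar>W y - (W 0 + \<omega>\<^sup>2 / 2 * y\<^sup>2 + a / 6 * y ^ 3)\<bar> \<le> C * \<bar>y\<bar> ^ 4" by blast
  have small: "\<forall>\<^sub>F n in sequentially. 2 * h n \<le> e" if "0 < e" for e
    using order_tendstoD(2)[OF h_lim, of "e / 2"] that by (auto elim!: eventually_mono)
  have bnd: "\<bar>y\<bar> \<le> 2 * h n" if "y \<in> {\<alpha> n..\<beta> n}" for y n
    using that sign[of n] by (auto simp: h_def abs_le_iff)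
  \<comment> \<open>Equality of the two end levels forces the midpoint to drift at second order in the amplitude.\<close>
  have drift: "\<forall>\<^sub>F n in sequentially. \<bar>\<omega>\<^sup>2 * m n + a * (3 * (m n)\<^sup>2 + (h n)\<^sup>2) / 6\<bar> \<le> 16 * C * h n ^ 3"
    using small[OF C(2)]
  proof eventually_elim
    case (elim n)
    have lev: "W (\<alpha> n) = W (\<beta> n)" by (rule well.level[OF wells])
    have b1: "\<bar>W (\<alpha> n) - (W 0 + \<omega>\<^sup>2 / 2 * (\<alpha> n)\<^sup>2 + a / 6 * (\<alpha> n) ^ 3)\<bar> \<le> C * (2 * h n) ^ 4"
      by (rule order_trans[OF C(3) mult_left_mono[OF power_mono]])
        (use bnd[of "\<alpha> n" n] sign[of n] elim C(1) in auto)
    have b2: "\<bar>W (\<beta> n) - (W 0 + \<omega>\<^sup>2 / 2 * (\<beta> n)\<^sup>2 + a / 6 * (\<beta> n) ^ 3)\<bar> \<le> C * (2 * h n) ^ 4"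
      by (rule order_trans[OF C(3) mult_left_mono[OF power_mono]])
        (use bnd[of "\<beta> n" n] sign[of n] elim C(1) in auto)
    have "\<omega>\<^sup>2 / 2 * ((\<beta> n)\<^sup>2 - (\<alpha> n)\<^sup>2) + a / 6 * (\<beta> n ^ 3 - \<alpha> n ^ 3)
       = 2 * h n * (\<omega>\<^sup>2 * m n + a * (3 * (m n)\<^sup>2 + (h n)\<^sup>2) / 6)"
      unfolding endpoints by (simp add: power2_eq_square power3_eq_cube field_simps)
    moreover have "\<bar>\<omega>\<^sup>2 / 2 * ((\<beta> n)\<^sup>2 - (\<alpha> n)\<^sup>2) + a / 6 * (\<beta> n ^ 3 - \<alpha> n ^ 3)\<bar> \<le> 2 * (C * (2 * h n) ^ 4)"
      using b1 b2 lev unfolding right_diff_distrib by linarith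
    ultimately have "\<bar>2 * h n * (\<omega>\<^sup>2 * m n + a * (3 * (m n)\<^sup>2 + (h n)\<^sup>2) / 6)\<bar> \<le> 2 * (C * (2 * h n) ^ 4)"
      by (simp only:)
    moreover have "\<bar>2 * h n * x\<bar> = 2 * h n * \<bar>x\<bar>" for x using h_pos[of n] by (simp add: abs_mult)
    moreover have "2 * (C * (2 * h n) ^ 4) = 2 * h n * (16 * C * h n ^ 3)"
      by (simp add: power4_eq_xxxx power3_eq_cube)
    ultimately have "2 * h n * \<bar>\<omega>\<^sup>2 * m n + a * (3 * (m n)\<^sup>2 + (h n)\<^sup>2) / 6\<bar> \<le> 2 * h n * (16 * C * h n ^ 3)"
      by (simp only:)
    then show ?case using h_pos[of n] mult_le_cancel_left_pos[of "2 * h n"] by simp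
  qed
  \<comment> \<open>Midpoint shift in units of h^2. Its limit - a / (6 \<omega>^2) results from
    dividing the equality of the end levels by powers of h.\<close>
  define \<mu> where "\<mu> n = m n / (h n)\<^sup>2" for n
  have m_eq: "m n = \<mu> n * (h n)\<^sup>2" for n using h_pos[of n] by (simp add: \<mu>_def)
  have drift': "\<forall>\<^sub>F n in sequentially. \<bar>\<omega>\<^sup>2 * \<mu> n + a * (3 * (m n / h n)\<^sup>2 + 1) / 6\<bar> \<le> 16 * C * h n"
    using drift
  proof eventually_elim
    case (elim n)
    have "\<omega>\<^sup>2 * \<mu> n + a * (3 * (m n / h n)\<^sup>2 + 1) / 6 = (\<omega>\<^sup>2 * m n + a * (3 * (m n)\<^sup>2 + (h n)\<^sup>2) / 6) / (h n)\<^sup>2"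
      using h_pos[of n] by (simp add: \<mu>_def power_divide add_divide_distrib algebra_simps)
    then show ?case using elim h_pos[of n]
      by (simp add: abs_divide divide_le_eq power2_eq_square power3_eq_cube mult_ac)
  qed
  have \<mu>_bound: "\<forall>\<^sub>F n in sequentially. \<omega>\<^sup>2 * \<bar>\<mu> n\<bar> \<le> \<bar>a\<bar> + 8 * C"
    using drift' small[OF zero_less_one]
  proof eventually_elim
    case (elim n)
    have "\<bar>m n / h n\<bar> \<le> 1" using mh[of n] h_pos[of n] by (simp add: abs_divide)
    then have q: "(m n / h n)\<^sup>2 \<le> 1" by (simp add: abs_square_le_1)
    have "\<bar>a * (3 * (m n / h n)\<^sup>2 + 1) / 6\<bar> = \<bar>a\<bar> * ((3 * (m n / h n)\<^sup>2 + 1) / 6)"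
      by (simp add: abs_mult)
    also have "\<dots> \<le> \<bar>a\<bar> * 1" using q by (intro mult_left_mono) auto
    finally have "\<bar>\<omega>\<^sup>2 * \<mu> n\<bar> \<le> \<bar>a\<bar> + 16 * C * h n" using elim(1) by linarith
    moreover have "16 * C * h n \<le> 8 * C" using elim(2) C(1) by simp
    ultimately show ?case by (simp add: abs_mult)
  qed
  have \<mu>h: "(\<lambda>n. \<mu> n * h n) \<longlonglongrightarrow> 0"
  proof (rule tendsto_0_le[OF h_lim, of _ "(\<bar>a\<bar> + 8 * C) / \<omega>\<^sup>2"])
    show "\<forall>\<^sub>F n in sequentially. norm (\<mu> n * h n) \<le> norm (h n) * ((\<bar>a\<bar> + 8 * C) / \<omega>\<^sup>2)"
      using \<mu>_bound
    proof eventually_elim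
      case (elim n)
      then have "\<bar>\<mu> n\<bar> \<le> (\<bar>a\<bar> + 8 * C) / \<omega>\<^sup>2" using at0 by (simp add: field_simps)
      from mult_left_mono[OF this, of "h n"] show ?case using h_pos[of n] by (simp add: abs_mult mult.commute)
    qed
  qed
  have \<mu>_lim: "\<mu> \<longlonglongrightarrow> - a / (6 * \<omega>\<^sup>2)"
  proof -
    have A: "(\<lambda>n. \<omega>\<^sup>2 * \<mu> n + a * (3 * (m n / h n)\<^sup>2 + 1) / 6) \<longlonglongrightarrow> 0"
      by (rule tendsto_0_le[OF h_lim, of _ "16 * C"])
        (use drift' in \<open>simp add: h_abs mult.commute\<close>)
    have B: "(\<lambda>n. a * (3 * (m n / h n)\<^sup>2 + 1) / 6) \<longlonglongrightarrow> a * (3 * 0\<^sup>2 + 1) / 6"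
    proof (intro tendsto_intros)
      have "m n / h n = \<mu> n * h n" for n using h_pos[of n] by (simp add: \<mu>_def power2_eq_square)
      then show "(\<lambda>n. m n / h n) \<longlonglongrightarrow> 0" using \<mu>h by simp
    qed simp
    have "\<omega>\<^sup>2 \<noteq> 0" using at0(4) by simp
    from tendsto_divide[OF tendsto_diff[OF A B] tendsto_const this]
    show ?thesis using at0(4) by simp
  qed
  \<comment> \<open>\<open>K\<close> is the inverse square of the rate. \<open>D\<close> is the
    coefficient of h^2 that remains in K / \<omega>^2 once 1 and the sin term are removed, and
    \<open>D0\<close> is what the quadratic Taylor polynomial of W2 gives for it; h^2 times
    \<open>S\<close> is the quadratic form of the nodes in \<open>ddiff_approx\<close>.\<close>
  define S where "S n s = 6 * (\<mu> n * h n)\<^sup>2 + 4 * (\<mu> n * h n) * s + (1 + s\<^sup>2)" for n and s :: real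
  define K where "K n \<psi> = 2 * ddiff W2 (\<alpha> n) (\<beta> n) ((\<alpha> n + \<beta> n) / 2 + (\<beta> n - \<alpha> n) / 2 * sin \<psi>)" for n \<psi>
  define D where "D n \<psi> = (K n \<psi> / \<omega>\<^sup>2 - 1 - a / (3 * \<omega>\<^sup>2) * (h n * sin \<psi>)) / (h n)\<^sup>2" for n \<psi>
  define D0 where "D0 n \<psi> = a / \<omega>\<^sup>2 * \<mu> n + b / (12 * \<omega>\<^sup>2) * S n (sin \<psi>)" for n \<psi>
  have K_pos: "0 < K n \<psi>" for n \<psi>
    using well.k_pos[OF wells well.pos_mem[OF wells], of n \<psi>]
    by (simp add: K_def well.pos_def[OF wells])
  have D_approx: "\<forall>\<^sub>F n in sequentially. \<forall>\<psi>. \<bar>D n \<psi> - D0 n \<psi>\<bar> \<le> e" if "0 < e" for e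
  proof -
    define e' where "e' = e * \<omega>\<^sup>2 / 4"
    have e': "0 < e'" using that at0 by (simp add: e'_def)
    obtain d where d: "d > 0" "d \<le> \<delta>" "\<And>y. \<bar>y\<bar> \<le> d \<Longrightarrow> \<bar>W2 y - (\<omega>\<^sup>2 + a * y + b / 2 * y\<^sup>2)\<bar> \<le> e' * y\<^sup>2"
      using W2_expand[OF e'] by auto
    show ?thesis
      using small[OF d(1)]
    proof eventually_elim
      case (elim n)
      interpret well W W1 W2 "\<alpha> n" "\<beta> n" by (rule wells)
      have P: "pos \<psi> = m n + h n * sin \<psi>" for \<psi>
        unfolding pos_def by (simp add: m_def h_def)
      have "\<bar>K n \<psi> - (\<omega>\<^sup>2 + a * (3 * m n + h n * sin \<psi>) / 3 + b * ((h n)\<^sup>2 * S n (sin \<psi>)) / 12)\<bar> \<le> e' * (2 * h n)\<^sup>2" for \<psi>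
      proof -
        define X where "X = pos \<psi>"
        have Xeq: "X = m n + h n * sin \<psi>" by (simp add: X_def P)
        have KX: "K n \<psi> = 2 * k X" by (simp add: K_def X_def pos_def)
        have "\<bar>k X - (\<omega>\<^sup>2 / 2 + a * (\<alpha> n + \<beta> n + X) / 6
             + b / 2 * ((\<alpha> n)\<^sup>2 + (\<beta> n)\<^sup>2 + X\<^sup>2 + \<alpha> n * \<beta> n + \<alpha> n * X + \<beta> n * X) / 12)\<bar> \<le> e' * (2 * h n)\<^sup>2 / 2"
        proof (rule ddiff_approx[OF mem(1) cW2 mem(2,3)])
          show "X \<in> {\<alpha> n..\<beta> n}" unfolding X_def by (rule pos_mem)
          fix y assume y: "y \<in> {\<alpha> n..\<beta> n}"
          have "\<bar>W2 y - (\<omega>\<^sup>2 + a * y + b / 2 * y\<^sup>2)\<bar> \<le> e' * \<bar>y\<bar>\<^sup>2" using d(3)[of y] bnd[OF y] elim by simp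
          also have "\<dots> \<le> e' * (2 * h n)\<^sup>2" using bnd[OF y] e' by (intro mult_left_mono power_mono) auto
          finally show "\<bar>W2 y - (\<omega>\<^sup>2 + a * y + b / 2 * y\<^sup>2)\<bar> \<le> e' * (2 * h n)\<^sup>2" .
        qed
        moreover have "\<alpha> n + \<beta> n + X = 3 * m n + h n * sin \<psi>" unfolding endpoints Xeq by simp
        moreover have "(\<alpha> n)\<^sup>2 + (\<beta> n)\<^sup>2 + X\<^sup>2 + \<alpha> n * \<beta> n + \<alpha> n * X + \<beta> n * X = (h n)\<^sup>2 * S n (sin \<psi>)"
        proof -
          have "(\<alpha> n)\<^sup>2 + (\<beta> n)\<^sup>2 + X\<^sup>2 + \<alpha> n * \<beta> n + \<alpha> n * X + \<beta> n * X
            = 6 * (m n)\<^sup>2 + 4 * m n * h n * sin \<psi> + (h n)\<^sup>2 * (1 + (sin \<psi>)\<^sup>2)"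
            unfolding endpoints Xeq by (simp add: power2_eq_square algebra_simps)
          also have "\<dots> = (h n)\<^sup>2 * S n (sin \<psi>)"
            unfolding S_def m_eq by (simp add: power2_eq_square algebra_simps)
          finally show ?thesis .
        qed
        ultimately have "\<bar>2 * (k X - (\<omega>\<^sup>2 / 2 + a * (3 * m n + h n * sin \<psi>) / 6 + b / 2 * ((h n)\<^sup>2 * S n (sin \<psi>)) / 12))\<bar> \<le> e' * (2 * h n)\<^sup>2"
          unfolding abs_mult by simp
        moreover have "2 * (k X - (\<omega>\<^sup>2 / 2 + a * (3 * m n + h n * sin \<psi>) / 6 + b / 2 * ((h n)\<^sup>2 * S n (sin \<psi>)) / 12))
          = K n \<psi> - (\<omega>\<^sup>2 + a * (3 * m n + h n * sin \<psi>) / 3 + b * ((h n)\<^sup>2 * S n (sin \<psi>)) / 12)"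
          unfolding KX by (simp add: field_simps)
        ultimately show ?thesis by simp
      qed
      moreover have "D n \<psi> - D0 n \<psi> = (K n \<psi> - (\<omega>\<^sup>2 + a * (3 * m n + h n * sin \<psi>) / 3 + b * ((h n)\<^sup>2 * S n (sin \<psi>)) / 12)) / (\<omega>\<^sup>2 * (h n)\<^sup>2)" for \<psi>
        unfolding D_def D0_def m_eq using at0 h_pos[of n] by (simp add: field_simps)
      ultimately show ?case
        using at0 h_pos[of n] by (auto simp: abs_divide divide_le_eq e'_def power_mult_distrib mult_ac)
    qed
  qed
  have S_lim: "(\<lambda>n. S n s) \<longlonglongrightarrow> 1 + s\<^sup>2" for s
  proof -
    have "(\<lambda>n. S n s) \<longlonglongrightarrow> 6 * 0\<^sup>2 + 4 * 0 * s + (1 + s\<^sup>2)"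
      unfolding S_def by (intro tendsto_intros \<mu>h)
    then show ?thesis by simp
  qed
  define L where "L \<psi> = a / \<omega>\<^sup>2 * (- a / (6 * \<omega>\<^sup>2)) + b / (12 * \<omega>\<^sup>2) * (1 + (sin \<psi>)\<^sup>2)" for \<psi>
  have D0_lim: "(\<lambda>n. D0 n \<psi>) \<longlonglongrightarrow> L \<psi>" for \<psi>
    unfolding D0_def L_def by (intro tendsto_intros \<mu>_lim S_lim)
  have D_lim: "(\<lambda>n. D n \<psi>) \<longlonglongrightarrow> L \<psi>" for \<psi>
  proof -
    have "(\<lambda>n. D n \<psi> - D0 n \<psi>) \<longlonglongrightarrow> 0"
    proof (rule tendstoI)
      fix e :: real assume e: "0 < e"
      then have "0 < e / 2" by simp
      from D_approx[OF this] show "\<forall>\<^sub>F n in sequentially. dist (D n \<psi> - D0 n \<psi>) 0 < e"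
      proof eventually_elim
        case (elim n)
        then have "\<bar>D n \<psi> - D0 n \<psi>\<bar> \<le> e / 2" by blast
        then show ?case using e by (simp add: dist_real_def)
      qed
    qed
    from tendsto_add[OF this D0_lim[of \<psi>]] show ?thesis by simp
  qed
  \<comment> \<open>Bounds uniform in \<psi>, to serve as dominating constants: 1 for the Taylor
    error, (|a| + 8 C) / \<omega>^2 for the midpoint shift, and 12 = 6 + 4 + 2 for
    \<open>S\<close>.\<close>
  define C1 where "C1 = 1 + \<bar>a / \<omega>\<^sup>2\<bar> * ((\<bar>a\<bar> + 8 * C) / \<omega>\<^sup>2) + \<bar>b / (12 * \<omega>\<^sup>2)\<bar> * 12"
  have D_bound: "\<forall>\<^sub>F n in sequentially. \<forall>\<psi>. \<bar>D n \<psi>\<bar> \<le> C1"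
    using D_approx[of 1, OF zero_less_one] \<mu>_bound
  proof eventually_elim
    case (elim n)
    show ?case
    proof
      fix \<psi>
      have 1: "\<bar>\<mu> n\<bar> \<le> (\<bar>a\<bar> + 8 * C) / \<omega>\<^sup>2" using elim(2) at0 by (simp add: field_simps)
      have "\<mu> n * h n = m n / h n" using h_pos[of n] by (simp add: \<mu>_def power2_eq_square)
      then have q: "\<bar>\<mu> n * h n\<bar> \<le> 1" using mh[of n] h_pos[of n] by (simp add: abs_divide)
      then have q2: "(\<mu> n * h n)\<^sup>2 \<le> 1" by (simp add: abs_square_le_1)
      have q3: "\<bar>\<mu> n * h n * sin \<psi>\<bar> \<le> 1 * 1" unfolding abs_mult[of "\<mu> n * h n"] by (intro mult_mono q) auto
      have q4: "(sin \<psi>)\<^sup>2 \<le> 1" by (simp add: abs_square_le_1)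
      have "\<bar>S n (sin \<psi>)\<bar> \<le> 12"
        using q2 q3 q4 zero_le_power2[of "\<mu> n * h n"] zero_le_power2[of "sin \<psi>"]
        unfolding S_def abs_le_iff mult.assoc by linarith
      note S12 = this
      have "\<bar>D0 n \<psi>\<bar> \<le> \<bar>a / \<omega>\<^sup>2\<bar> * ((\<bar>a\<bar> + 8 * C) / \<omega>\<^sup>2) + \<bar>b / (12 * \<omega>\<^sup>2)\<bar> * 12"
        unfolding D0_def
        by (intro order_trans[OF abs_triangle_ineq] add_mono)
          (simp_all only: abs_mult[of "a / \<omega>\<^sup>2"] abs_mult[of "b / (12 * \<omega>\<^sup>2)"] mult_left_mono abs_ge_zero 1 S12)
      then show "\<bar>D n \<psi>\<bar> \<le> C1" using elim(1)[rule_format, of \<psi>] unfolding C1_def by linarith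
    qed
  qed
  define z where "z n \<psi> = K n \<psi> / \<omega>\<^sup>2 - 1" for n \<psi>
  have z_gt: "-1 < z n \<psi>" for n \<psi> using K_pos[of n \<psi>] at0 by (simp add: z_def)
  have z_eq: "z n \<psi> / h n = a / (3 * \<omega>\<^sup>2) * sin \<psi> + h n * D n \<psi>" for n \<psi>
    unfolding z_def D_def using h_pos[of n] by (simp add: field_simps power2_eq_square)
  have zh_lim: "(\<lambda>n. z n \<psi> / h n) \<longlonglongrightarrow> a / (3 * \<omega>\<^sup>2) * sin \<psi>" for \<psi>
  proof -
    have "(\<lambda>n. a / (3 * \<omega>\<^sup>2) * sin \<psi> + h n * D n \<psi>) \<longlonglongrightarrow> a / (3 * \<omega>\<^sup>2) * sin \<psi> + 0 * L \<psi>"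
      by (intro tendsto_intros h_lim D_lim)
    then show ?thesis by (simp add: z_eq)
  qed
  define C2 where "C2 = \<bar>a / (3 * \<omega>\<^sup>2)\<bar> + C1"
  have C1: "0 < C1" using C(1) by (auto simp: C1_def intro!: add_pos_nonneg)
  have C2: "0 < C2" using C1 by (simp add: C2_def add_nonneg_pos)
  have zh_bound: "\<forall>\<^sub>F n in sequentially. \<forall>\<psi>. \<bar>z n \<psi> / h n\<bar> \<le> C2"
    using D_bound small[of 1, OF zero_less_one]
  proof eventually_elim
    case (elim n)
    show ?case
    proof
      fix \<psi>
      have "\<bar>z n \<psi> / h n\<bar> \<le> \<bar>a / (3 * \<omega>\<^sup>2)\<bar> * \<bar>sin \<psi>\<bar> + \<bar>h n\<bar> * \<bar>D n \<psi>\<bar>"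
        unfolding z_eq abs_mult[symmetric] by (rule abs_triangle_ineq)
      also have "\<dots> \<le> \<bar>a / (3 * \<omega>\<^sup>2)\<bar> * 1 + 1 * C1"
        using elim h_pos[of n] by (intro add_mono mult_mono) auto
      finally show "\<bar>z n \<psi> / h n\<bar> \<le> C2" by (simp add: C2_def)
    qed
  qed
  \<comment> \<open>With |z| at most 3/4 the root of 1 + z is at least 1/2, which bounds the
    remainder coefficient q.\<close>
  have z_small: "\<forall>\<^sub>F n in sequentially. \<forall>\<psi>. \<bar>z n \<psi>\<bar> \<le> 3 / 4"
    using zh_bound small[OF divide_pos_pos[OF zero_less_one C2]]
  proof eventually_elim
    case (elim n)
    show ?case
    proof
      fix \<psi>
      have "\<bar>z n \<psi>\<bar> \<le> C2 * h n" using elim(1)[rule_format, of \<psi>] h_pos[of n] by (simp add: abs_divide divide_le_eq)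
      also have "\<dots> \<le> 1 / 2" using elim(2) C2 by (simp add: field_simps)
      finally show "\<bar>z n \<psi>\<bar> \<le> 3 / 4" by simp
    qed
  qed
  have z_lim: "(\<lambda>n. z n \<psi>) \<longlonglongrightarrow> 0" for \<psi>
  proof -
    have "(\<lambda>n. z n \<psi> / h n * h n) \<longlonglongrightarrow> a / (3 * \<omega>\<^sup>2) * sin \<psi> * 0"
      by (intro tendsto_mult zh_lim h_lim)
    then show ?thesis using h_pos by (simp add: less_imp_neq[symmetric])
  qed
  define q where "q x = (sqrt (1 + x) + 2) / (2 * sqrt (1 + x) * (sqrt (1 + x) + 1)\<^sup>2)" for x :: real
  \<comment> \<open>Coefficient of h^2 in \<omega> times the rate. Its integral is zero for every n,
    because the period is exactly 2 pi / \<omega> and sin has mean zero; what is left is to identify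
    its limit.\<close>
  define E where "E n \<psi> = (1 / sqrt (1 + z n \<psi>) - 1 + a / (6 * \<omega>\<^sup>2) * (h n * sin \<psi>)) / (h n)\<^sup>2" for n \<psi>
  have E_eq: "E n \<psi> = q (z n \<psi>) * (z n \<psi> / h n)\<^sup>2 - D n \<psi> / 2" for n \<psi>
  proof -
    have "1 / sqrt (1 + z n \<psi>) - 1 = q (z n \<psi>) * (z n \<psi>)\<^sup>2 - z n \<psi> / 2"
      using inverse_sqrt_expansion[OF z_gt[of n \<psi>]] by (simp add: q_def)
    moreover have "D n \<psi> = (z n \<psi> - a / (3 * \<omega>\<^sup>2) * (h n * sin \<psi>)) / (h n)\<^sup>2" by (simp add: D_def z_def)
    moreover have "a / (6 * \<omega>\<^sup>2) = a / (3 * \<omega>\<^sup>2) / 2" by simp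
    ultimately have "1 / sqrt (1 + z n \<psi>) - 1 + a / (6 * \<omega>\<^sup>2) * (h n * sin \<psi>)
        = q (z n \<psi>) * (z n \<psi>)\<^sup>2 - (z n \<psi> - a / (3 * \<omega>\<^sup>2) * (h n * sin \<psi>)) / 2"
      and D': "D n \<psi> = (z n \<psi> - a / (3 * \<omega>\<^sup>2) * (h n * sin \<psi>)) / (h n)\<^sup>2"
      by (simp_all add: diff_divide_distrib del: divide_divide_eq_left)
    then have "E n \<psi> = (q (z n \<psi>) * (z n \<psi>)\<^sup>2 - (z n \<psi> - a / (3 * \<omega>\<^sup>2) * (h n * sin \<psi>)) / 2) / (h n)\<^sup>2"
      unfolding E_def by (simp only:)
    then show ?thesis unfolding D' by (simp only: power_divide diff_divide_distrib times_divide_eq_right) (simp add: mult.commute)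
  qed
  define E0 where "E0 \<psi> = 3 / 8 * (a / (3 * \<omega>\<^sup>2) * sin \<psi>)\<^sup>2 - L \<psi> / 2" for \<psi>
  have E_lim: "(\<lambda>n. E n \<psi>) \<longlonglongrightarrow> E0 \<psi>" for \<psi>
  proof -
    have "(\<lambda>n. q (z n \<psi>)) \<longlonglongrightarrow> (sqrt (1 + 0) + 2) / (2 * sqrt (1 + 0) * (sqrt (1 + 0) + 1)\<^sup>2)"
      unfolding q_def by (intro tendsto_intros z_lim) auto
    then have "(\<lambda>n. q (z n \<psi>)) \<longlonglongrightarrow> 3 / 8" by simp
    then show ?thesis unfolding E_eq E0_def by (intro tendsto_intros zh_lim D_lim) auto
  qed
  have E_bound: "\<forall>\<^sub>F n in sequentially. \<forall>\<psi>. \<bar>E n \<psi>\<bar> \<le> 5 * C2\<^sup>2 + C1"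
    using zh_bound z_small D_bound
  proof eventually_elim
    case (elim n)
    show ?case
    proof
      fix \<psi>
      define w where "w = sqrt (1 + z n \<psi>)"
      have "1 / 4 \<le> 1 + z n \<psi>" using elim(2)[rule_format, of \<psi>] by (simp add: abs_le_iff)
      then have "sqrt (1 / 4) \<le> w" unfolding w_def by (rule real_sqrt_le_mono)
      then have w: "1 / 2 \<le> w" by (simp add: real_sqrt_divide)
      have "w + 2 \<le> 5 * (2 * w * (w + 1)\<^sup>2)"
      proof -
        have "1 * 1 \<le> (w + 1) * (w + 1)" using w by (intro mult_mono) auto
        then have "w * 1 \<le> w * (w + 1)\<^sup>2" using w by (intro mult_left_mono) (auto simp: power2_eq_square)
        moreover have "5 * (2 * w * (w + 1)\<^sup>2) = 10 * (w * (w + 1)\<^sup>2)" by simp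
        ultimately show ?thesis using w by linarith
      qed
      then have "0 \<le> q (z n \<psi>)" "q (z n \<psi>) \<le> 5"
        using w unfolding q_def w_def[symmetric] by (auto simp: divide_le_eq zero_less_mult_iff)
      moreover have "(z n \<psi> / h n)\<^sup>2 \<le> C2\<^sup>2"
        using power_mono[OF elim(1)[rule_format, of \<psi>] abs_ge_zero, of 2] by (simp only: power2_abs)
      ultimately have "\<bar>q (z n \<psi>) * (z n \<psi> / h n)\<^sup>2\<bar> \<le> 5 * C2\<^sup>2"
        unfolding abs_mult by (intro mult_mono) auto
      then show "\<bar>E n \<psi>\<bar> \<le> 5 * C2\<^sup>2 + C1"
        using elim(3)[rule_format, of \<psi>] C1 unfolding E_eq by linarith
    qed
  qed
  then obtain N where N: "\<And>n \<psi>. N \<le> n \<Longrightarrow> \<bar>E n \<psi>\<bar> \<le> 5 * C2\<^sup>2 + C1"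
    unfolding eventually_sequentially by auto
  have E_int: "(E n has_integral 0) {0..2 * pi}" for n
  proof -
    interpret well W W1 W2 "\<alpha> n" "\<beta> n" by (rule wells)
    have "(rate has_integral 2 * pi / \<omega>) {0..2 * pi}"
      unfolding period[of n, symmetric] well_period_def rate_def[abs_def] pos_def[symmetric]
      by (rule integrable_integral, rule integrable_continuous_real)
         (use rate_continuous continuous_on_subset in \<open>fastforce simp: rate_def[abs_def]\<close>)
    moreover have "rate \<psi> = 1 / (\<omega> * sqrt (1 + z n \<psi>))" for \<psi>
    proof -
      have "2 * k (pos \<psi>) = \<omega>\<^sup>2 * (1 + z n \<psi>)"
        using at0 by (simp add: z_def K_def pos_def)
      then show ?thesis using at0 by (simp add: rate_def real_sqrt_mult)
    qed
    ultimately have "((\<lambda>\<psi>. \<omega> * (1 / (\<omega> * sqrt (1 + z n \<psi>)))) has_integral \<omega> * (2 * pi / \<omega>)) {0..2 * pi}"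
      using has_integral_mult_right[of rate "2 * pi / \<omega>" "{0..2 * pi}" \<omega>] by (simp only:)
    then have 1: "((\<lambda>\<psi>. 1 / sqrt (1 + z n \<psi>)) has_integral 2 * pi) {0..2 * pi}" using at0 by simp
    have 2: "((\<lambda>\<psi>::real. 1::real) has_integral 2 * pi) {0..2 * pi}"
      using has_integral_const_real[of "1::real" 0 "2 * pi"] by simp
    have 3: "(sin has_integral - cos (2 * pi) - - cos 0) {0..2 * pi}"
      by (rule fundamental_theorem_of_calculus)
        (auto simp: has_real_derivative_iff_has_vector_derivative[symmetric] intro!: derivative_eq_intros)
    have "((\<lambda>\<psi>. (1 / (h n)\<^sup>2) * (1 / sqrt (1 + z n \<psi>) - 1 + a / (6 * \<omega>\<^sup>2) * h n * sin \<psi>))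
      has_integral (1 / (h n)\<^sup>2) * (2 * pi - 2 * pi + a / (6 * \<omega>\<^sup>2) * h n * (- cos (2 * pi) - - cos 0))) {0..2 * pi}"
      by (intro has_integral_mult_right has_integral_add has_integral_diff 1 2 3)
    then show ?thesis unfolding E_def by (simp add: mult.assoc)
  qed
  \<comment> \<open>Dominated convergence carries the vanishing integrals over to the limit
    \<open>E0\<close>; the shift by N skips the indices at which the uniform bound may fail.\<close>
  have "(\<lambda>n. integral {0..2 * pi} (E (n + N))) \<longlonglongrightarrow> integral {0..2 * pi} E0"
    by (rule dominated_convergence(2)[where h="\<lambda>_. 5 * C2\<^sup>2 + C1"])
      (use E_int N LIMSEQ_ignore_initial_segment[OF E_lim] in \<open>auto intro: has_integral_integrable integrable_const_ivl\<close>)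
  then have int0: "integral {0..2 * pi} E0 = 0"
    by (simp add: LIMSEQ_const_iff integral_unique[OF E_int])
  have c: "((\<lambda>x. d) has_integral d * (2 * pi)) {0..2 * pi}" for d :: real
    using has_integral_const_real[of d 0 "2 * pi"] by (simp add: mult.commute)
  \<comment> \<open>The limit has the form p + r sin^2, with integral pi (2 p + r) over a full
    turn.\<close>
  define p where "p = a\<^sup>2 / (12 * \<omega> ^ 4) - b / (24 * \<omega>\<^sup>2)"
  define r where "r = a\<^sup>2 / (24 * \<omega> ^ 4) - b / (24 * \<omega>\<^sup>2)"
  have "E0 \<psi> = p + r * (sin \<psi>)\<^sup>2" for \<psi>
    unfolding E0_def L_def p_def r_def using at0 by (simp add: power2_eq_square power4_eq_xxxx field_simps)
  then have E0: "E0 = (\<lambda>\<psi>. p + r * (sin \<psi>)\<^sup>2)" by auto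
  have "(E0 has_integral p * (2 * pi) + r * pi) {0..2 * pi}"
    unfolding E0 by (intro has_integral_add c has_integral_mult_right sin_square_has_integral)
  then have "p * (2 * pi) + r * pi = 0" using int0 by (simp add: integral_unique)
  then have "pi * (2 * p + r) = 0" by (simp add: algebra_simps)
  then have "2 * p + r = 0" by simp
  then have "24 * \<omega> ^ 4 * (2 * p + r) = 0" by simp
  moreover have "24 * \<omega> ^ 4 * (2 * p + r) = 5 * a\<^sup>2 - 3 * \<omega>\<^sup>2 * b"
    unfolding p_def r_def using at0 by (simp add: power2_eq_square power4_eq_xxxx field_simps)
  ultimately show ?thesis by simp
qed

section \<open>Isochronous minima and wells\<close>

text \<open>On wells shrinking to c the oscillation of W2 tends to zero, so
  \<open>well_period_bounds\<close> squeezes the constant squared frequency onto the value of W2 at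
  c.\<close>

lemma limit_well_period:
  fixes \<alpha> \<beta> :: "nat \<Rightarrow> real"
  assumes "\<And>n. well W W1 W2 (\<alpha> n) (\<beta> n)" "\<And>n. well_period W2 (\<alpha> n) (\<beta> n) = T"
    "\<alpha> \<longlonglongrightarrow> c" "\<beta> \<longlonglongrightarrow> c" "isCont W2 c"
  shows "W2 c = (2 * pi / T)\<^sup>2" "0 < T"
proof -
  show "0 < T" using well.period_pos[OF assms(1)] assms(2) by metis
  have "\<bar>(2 * pi / T)\<^sup>2 - W2 c\<bar> \<le> e" if "0 < e" for e
  proof -
    have "\<exists>d>0. \<forall>y. dist y c < d \<longrightarrow> dist (W2 y) (W2 c) < e"
      using assms(5)[unfolded continuous_at_eps_delta, rule_format, OF that] .
    then obtain d where d: "0 < d" "\<And>y. \<bar>y - c\<bar> < d \<Longrightarrow> \<bar>W2 y - W2 c\<bar> < e"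
      by (auto simp: dist_real_def)
    have "\<forall>\<^sub>F n in sequentially. c - d < \<alpha> n \<and> \<beta> n < c + d"
      using order_tendstoD(1)[OF assms(3), of "c - d"] order_tendstoD(2)[OF assms(4), of "c + d"] d
      by (simp add: eventually_conj)
    then obtain n where n: "c - d < \<alpha> n" "\<beta> n < c + d"
      using eventually_happens'[OF sequentially_bot] by auto
    have "\<bar>W2 y - W2 c\<bar> \<le> e" if "y \<in> {\<alpha> n..\<beta> n}" for y
      using d(2)[of y] n that by (simp add: abs_less_iff less_imp_le)
    from well_period_bounds[OF assms(1) this] show ?thesis by (simp add: assms(2))
  qed
  then have "\<bar>(2 * pi / T)\<^sup>2 - W2 c\<bar> \<le> 0" by (rule field_le_epsilon) simp
  then show "W2 c = (2 * pi / T)\<^sup>2" by simp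
qed

lemma levels_around_minimum:
  fixes W W1 W2 :: "real \<Rightarrow> real"
  assumes \<delta>: "0 < \<delta>"
    and dW: "\<And>y. \<bar>y\<bar> \<le> \<delta> \<Longrightarrow> (W has_real_derivative W1 y) (at y)"
    and dW1: "\<And>y. \<bar>y\<bar> \<le> \<delta> \<Longrightarrow> (W1 has_real_derivative W2 y) (at y)"
    and at0: "W1 0 = 0" "0 < W2 0"
  obtains \<alpha>0 \<beta>0 where "-\<delta> \<le> \<alpha>0" "\<alpha>0 < 0" "0 < \<beta>0" "\<beta>0 \<le> \<delta>" "W \<alpha>0 = W \<beta>0"
    "\<And>x. x \<in> {\<alpha>0..<0} \<Longrightarrow> W1 x < 0" "\<And>x. x \<in> {0<..\<beta>0} \<Longrightarrow> 0 < W1 x"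
proof -
  obtain d where d: "0 < d" "{0 - d..0 + d} \<subseteq> {-\<delta><..<\<delta>}"
    "\<And>x. 0 - d \<le> x \<Longrightarrow> x < 0 \<Longrightarrow> W1 x < 0" "\<And>x. 0 < x \<Longrightarrow> x \<le> 0 + d \<Longrightarrow> 0 < W1 x"
    "\<And>x. x \<in> {0 - d..0 + d} \<Longrightarrow> x \<noteq> 0 \<Longrightarrow> W 0 < W x"
    by (rule strict_local_min[of "{-\<delta><..<\<delta>}" 0 W W1 "W2 0"])
      (use \<delta> dW dW1[of 0] at0 in auto)
  have "d \<in> {-\<delta><..<\<delta>}" using d(1) by (intro subsetD[OF d(2)]) auto
  then have d\<delta>: "\<bar>y\<bar> \<le> d \<Longrightarrow> \<bar>y\<bar> \<le> \<delta>" for y by auto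
  have cW: "continuous_on S W" if "S \<subseteq> {-d..d}" for S
  proof (intro continuous_at_imp_continuous_on ballI)
    fix x assume "x \<in> S"
    then have "x \<in> {-d..d}" using that by blast
    then have "\<bar>x\<bar> \<le> d" by (simp add: abs_le_iff)
    from dW[OF d\<delta>[OF this]] show "isCont W x" by (rule DERIV_isCont)
  qed
  \<comment> \<open>The lower of the two end levels is reached on both sides of the minimum; being
    above \<open>W 0\<close>, it is not reached at the minimum itself.\<close>
  define l where "l = min (W (-d)) (W d)"
  have l: "W 0 < l" using d(1) d(5)[of d] d(5)[of "-d"] by (simp add: l_def)
  have "\<exists>x\<ge>-d. x \<le> 0 \<and> W x = l"
    by (rule IVT2') (use l d(1) cW in \<open>auto simp: l_def\<close>)
  then obtain \<alpha>0 where \<alpha>0: "-d \<le> \<alpha>0" "\<alpha>0 \<le> 0" "W \<alpha>0 = l" by blast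
  have "\<exists>x\<ge>0. x \<le> d \<and> W x = l"
    by (rule IVT') (use l d(1) cW in \<open>auto simp: l_def\<close>)
  then obtain \<beta>0 where \<beta>0: "\<beta>0 \<le> d" "0 \<le> \<beta>0" "W \<beta>0 = l" by blast
  have ne: "\<alpha>0 < 0" "0 < \<beta>0" using \<alpha>0 \<beta>0 l by (metis less_irrefl less_eq_real_def)+
  show ?thesis
    by (rule that[of \<alpha>0 \<beta>0]) (use ne \<alpha>0 \<beta>0 d(3,4) d\<delta>[of \<alpha>0] d\<delta>[of \<beta>0] in auto)
qed

lemma well_around_minimum:
  fixes W W1 W2 :: "real \<Rightarrow> real"
  assumes \<delta>: "0 < \<delta>"
    and dW: "\<And>y. \<bar>y\<bar> \<le> \<delta> \<Longrightarrow> (W has_real_derivative W1 y) (at y)"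
    and dW1: "\<And>y. \<bar>y\<bar> \<le> \<delta> \<Longrightarrow> (W1 has_real_derivative W2 y) (at y)"
    and cW2: "continuous_on {-\<delta>..\<delta>} W2"
    and at0: "W1 0 = 0" "0 < W2 0"
  obtains \<alpha> \<beta> where "-\<delta> \<le> \<alpha>" "\<beta> \<le> \<delta>" "well W W1 W2 \<alpha> \<beta>"
proof -
  obtain \<alpha> \<beta> where *: "-\<delta> \<le> \<alpha>" "\<alpha> < 0" "0 < \<beta>" "\<beta> \<le> \<delta>" "W \<alpha> = W \<beta>"
    "\<And>x. x \<in> {\<alpha>..<0} \<Longrightarrow> W1 x < 0" "\<And>x. x \<in> {0<..\<beta>} \<Longrightarrow> 0 < W1 x"
    by (rule levels_around_minimum[OF \<delta> dW dW1 at0], assumption+, rule that)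
  have in\<delta>: "\<bar>x\<bar> \<le> \<delta>" if "x \<in> {\<alpha>..\<beta>}" for x using that * by (auto simp: abs_le_iff)
  have cW: "continuous_on {x..y} W" if "\<alpha> \<le> x" "y \<le> \<beta>" for x y
  proof (intro continuous_at_imp_continuous_on ballI)
    fix z assume "z \<in> {x..y}"
    then have "z \<in> {\<alpha>..\<beta>}" using that by simp
    from dW[OF in\<delta>[OF this]] show "isCont W z" by (rule DERIV_isCont)
  qed
  have "well W W1 W2 \<alpha> \<beta>"
  proof
    show "W x < W \<alpha>" if x: "\<alpha> < x" "x < \<beta>" for x
    proof (cases "x \<le> 0")
      case True
      show ?thesis
      proof (rule DERIV_neg_imp_decreasing_open[OF x(1)])
        show "\<exists>d. (W has_real_derivative d) (at z) \<and> d < 0" if "\<alpha> < z" "z < x" for z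
          using dW[of z] in\<delta>[of z] *(6)[of z] that x True by (intro exI[of _ "W1 z"]) auto
      qed (use x cW in auto)
    next
      case False
      have "W x < W \<beta>"
      proof (rule DERIV_pos_imp_increasing_open[OF x(2)])
        show "\<exists>d. (W has_real_derivative d) (at z) \<and> 0 < d" if "x < z" "z < \<beta>" for z
          using dW[of z] in\<delta>[of z] *(7)[of z] that x False by (intro exI[of _ "W1 z"]) auto
      qed (use x cW in auto)
      then show ?thesis using *(5) by simp
    qed
  qed (use * in\<delta> dW dW1 in \<open>auto intro: continuous_on_subset[OF cW2]\<close>)
  then show ?thesis using that * by blast
qed

text \<open>Near a critical point the energy difference is quadratic in the distance, so a motion on
  that level has speed at most proportional to the distance. This is the source of the lower bounds
  for passage times.\<close>

lemma quadratic_bound: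
  fixes W W1 W2 :: "real \<Rightarrow> real"
  assumes dW: "\<And>x. x \<in> {p..q} \<Longrightarrow> (W has_real_derivative W1 x) (at x)"
    and dW1: "\<And>x. x \<in> {p..q} \<Longrightarrow> (W1 has_real_derivative W2 x) (at x)"
    and M: "\<And>x. x \<in> {p..q} \<Longrightarrow> \<bar>W2 x\<bar> \<le> M" "0 < M"
    and c: "c \<in> {p..q}" "W1 c = 0" and x: "x \<in> {p..q}"
  shows "\<bar>W x - W c\<bar> \<le> M * (x - c)\<^sup>2"
proof -
  have M1: "\<bar>W1 z\<bar> \<le> M * \<bar>z - c\<bar>" if "z \<in> {p..q}" for z
  proof -
    have "norm (W1 z - W1 c) \<le> M * norm (z - c)"
      by (rule field_differentiable_bound[of "{p..q}" W1 W2])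
        (use M dW1 that c in \<open>auto intro: has_field_derivative_at_within\<close>)
    then show ?thesis using c by simp
  qed
  have seg: "closed_segment c x \<subseteq> {p..q}"
    using x c by (intro closed_segment_subset) auto
  have "norm (W x - W c) \<le> (M * \<bar>x - c\<bar>) * norm (x - c)"
  proof (rule field_differentiable_bound[of "closed_segment c x" W W1])
    fix z assume z: "z \<in> closed_segment c x"
    show "(W has_real_derivative W1 z) (at z within closed_segment c x)"
      using dW seg z has_field_derivative_at_within by blast
    have "\<bar>z - c\<bar> \<le> \<bar>x - c\<bar>" using z by (auto simp: closed_segment_eq_real_ivl split: if_splits)
    then have "M * \<bar>z - c\<bar> \<le> M * \<bar>x - c\<bar>" using M by (intro mult_left_mono) auto
    then show "norm (W1 z) \<le> M * \<bar>x - c\<bar>" using M1[of z] seg z by force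
  qed auto
  also have "(M * \<bar>x - c\<bar>) * norm (x - c) = M * (\<bar>x - c\<bar> * \<bar>x - c\<bar>)" by simp
  also have "\<dots> = M * (x - c)\<^sup>2" unfolding abs_mult_self_eq power2_eq_square ..
  finally show ?thesis by simp
qed

lemma continuous_on_Icc_bound:
  fixes g :: "real \<Rightarrow> real"
  assumes "continuous_on {p..q} g"
  obtains M where "0 < M" "\<And>x. x \<in> {p..q} \<Longrightarrow> \<bar>g x\<bar> \<le> M"
proof -
  have "compact (g ` {p..q})" by (intro compact_continuous_image assms compact_Icc)
  then obtain M where "\<forall>x \<in> g ` {p..q}. norm x \<le> M"
    using compact_imp_bounded bounded_iff by blast
  then show ?thesis using that[of "max M 1"] by (auto simp: le_max_iff_disj)
qed

lemma isochronous_minimum: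
  fixes W W1 W2 W3 :: "real \<Rightarrow> real"
  assumes \<delta>: "0 < \<delta>"
    and dW: "\<And>y. \<bar>y\<bar> \<le> \<delta> \<Longrightarrow> (W has_real_derivative W1 y) (at y)"
    and dW1: "\<And>y. \<bar>y\<bar> \<le> \<delta> \<Longrightarrow> (W1 has_real_derivative W2 y) (at y)"
    and dW2: "\<And>y. \<bar>y\<bar> \<le> \<delta> \<Longrightarrow> (W2 has_real_derivative W3 y) (at y)"
    and dW3: "(W3 has_real_derivative b) (at 0)"
    and at0: "W1 0 = 0" "0 < W2 0"
    and rational: "\<And>\<alpha> \<beta>. -\<delta> \<le> \<alpha> \<Longrightarrow> \<alpha> < 0 \<Longrightarrow> 0 < \<beta> \<Longrightarrow> \<beta> \<le> \<delta> \<Longrightarrow> well W W1 W2 \<alpha> \<beta> \<Longrightarrow>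
      well_period W2 \<alpha> \<beta> / (2 * pi) \<in> \<rat>"
  obtains \<omega> where "\<omega> \<in> \<rat>" "0 < \<omega>" "W2 0 = \<omega>\<^sup>2" "5 * (W3 0)\<^sup>2 = 3 * \<omega>\<^sup>2 * b"
proof -
  obtain \<alpha>0 \<beta>0 where ne: "\<alpha>0 < 0" "0 < \<beta>0" and \<alpha>0: "-\<delta> \<le> \<alpha>0" and \<beta>0: "\<beta>0 \<le> \<delta>" "W \<alpha>0 = W \<beta>0"
    and sgn: "\<And>x. x \<in> {\<alpha>0..<0} \<Longrightarrow> W1 x < 0" "\<And>x. x \<in> {0<..\<beta>0} \<Longrightarrow> 0 < W1 x"
    by (rule levels_around_minimum[OF \<delta> dW dW1 at0], assumption+, rule that)
  have in\<delta>: "\<bar>x\<bar> \<le> \<delta>" if "x \<in> {\<alpha>0..\<beta>0}" for x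
    using that \<alpha>0 \<beta>0 by (auto simp: abs_le_iff)
  have cW2: "isCont W2 x" if "\<bar>x\<bar> \<le> \<delta>" for x using dW2[OF that] by (rule DERIV_isCont)
  obtain B T where BT: "continuous_on {\<alpha>0..0} B" "B 0 = 0"
    "\<And>\<alpha>. \<alpha> \<in> {\<alpha>0..<0} \<Longrightarrow> B \<alpha> \<in> {0<..\<beta>0}"
    "\<And>\<alpha>. \<alpha> \<in> {\<alpha>0..<0} \<Longrightarrow> well W W1 W2 \<alpha> (B \<alpha>)"
    "\<And>\<alpha>. \<alpha> \<in> {\<alpha>0..<0} \<Longrightarrow> well_period W2 \<alpha> (B \<alpha>) = T"
  proof (rule well_period_family[of \<alpha>0 0 0 \<beta>0 W W1 W2])
    show "continuous_on {\<alpha>0..\<beta>0} W2"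
      using cW2 in\<delta> by (intro continuous_at_imp_continuous_on) blast
    show "well_period W2 \<alpha> \<beta> / (2 * pi) \<in> \<rat>"
      if "\<alpha> \<in> {\<alpha>0..<0}" "\<beta> \<in> {0<..\<beta>0}" "well W W1 W2 \<alpha> \<beta>" for \<alpha> \<beta>
      using rational[of \<alpha> \<beta>] that in\<delta>[of \<alpha>] in\<delta>[of \<beta>] ne by (auto simp: abs_le_iff)
  qed (use ne \<alpha>0 \<beta>0 dW dW1 in\<delta> sgn in auto)
  \<comment> \<open>A sequence of wells running into the minimum inside the family of common period
    T; the limit identifies the frequency, and the same sequence feeds the fourth order
    condition.\<close>
  define \<alpha> where "\<alpha> n = \<alpha>0 * inverse (real (Suc n))" for n
  have \<alpha>: "\<alpha> n \<in> {\<alpha>0..<0}" for n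
  proof -
    have "\<alpha>0 * 1 \<le> \<alpha>0 * inverse (real (Suc n))"
      using ne by (intro mult_left_mono_neg) (auto simp: inverse_eq_divide)
    then show ?thesis using ne by (auto simp: \<alpha>_def mult_less_0_iff simp del: of_nat_Suc)
  qed
  have \<alpha>_lim: "\<alpha> \<longlonglongrightarrow> 0"
    unfolding \<alpha>_def using tendsto_mult_right_zero[OF LIMSEQ_inverse_real_of_nat] by simp
  have "(\<lambda>n. B (\<alpha> n)) \<longlonglongrightarrow> B 0"
    by (rule continuous_on_tendsto_compose[OF BT(1) \<alpha>_lim]) (use \<alpha> ne in \<open>auto simp: less_imp_le\<close>)
  then have \<beta>_lim: "(\<lambda>n. B (\<alpha> n)) \<longlonglongrightarrow> 0" by (simp add: BT(2))
  note lw = limit_well_period[OF BT(4)[OF \<alpha>] BT(5)[OF \<alpha>] \<alpha>_lim \<beta>_lim cW2]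
  define \<omega> where "\<omega> = 2 * pi / T"
  have T: "0 < T" and W20: "W2 0 = \<omega>\<^sup>2" using lw \<delta> by (simp_all add: \<omega>_def)
  have \<omega>: "0 < \<omega>" "T = 2 * pi / \<omega>" using T by (auto simp: \<omega>_def)
  have "T / (2 * pi) \<in> \<rat>"
    using rational[of "\<alpha> 0" "B (\<alpha> 0)"] \<alpha>[of 0] BT(3-5)[OF \<alpha>[of 0]] in\<delta>[of "\<alpha> 0"] in\<delta>[of "B (\<alpha> 0)"] ne
    by (auto simp: abs_le_iff)
  then have "inverse (T / (2 * pi)) \<in> \<rat>" by (rule Rats_inverse)
  then have "\<omega> \<in> \<rat>" by (simp add: \<omega>_def)
  moreover have "5 * (W3 0)\<^sup>2 = 3 * \<omega>\<^sup>2 * b"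
    by (rule fourth_order_condition[OF \<delta> dW dW1 dW2 dW3 at0(1) W20 refl \<omega>(1) _ _ \<alpha>_lim \<beta>_lim BT(4)[OF \<alpha>]])
      (use \<alpha> BT(3)[OF \<alpha>] BT(5)[OF \<alpha>] \<omega>(2) in auto)
  ultimately show ?thesis using that \<omega>(1) W20 by blast
qed

text \<open>The critical point c0 of highest level is examined. Above its level the well consists of
  two monotone slopes, so all these wells share one period T. If the set below that level spread
  over more than one point, motions of slightly larger energy would linger near c0 for an unbounded
  time, against T. Hence the wells shrink to c0, and the second derivative there is (2 pi /
  T)^2.\<close>

lemma isochronous_well_minimum:
  fixes W W1 W2 :: "real \<Rightarrow> real"
  assumes "well W W1 W2 a' b'"
    and rational: "\<And>\<alpha> \<beta>. a' \<le> \<alpha> \<Longrightarrow> \<beta> \<le> b' \<Longrightarrow> well W W1 W2 \<alpha> \<beta> \<Longrightarrow> well_period W2 \<alpha> \<beta> / (2 * pi) \<in> \<rat>"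
  obtains c where "a' < c" "c < b'" "W1 c = 0" "0 < W2 c"
proof -
  interpret outer: well W W1 W2 a' b' by fact
  have cW: "continuous_on {a'..b'} W"
    using outer.dW DERIV_isCont continuous_at_imp_continuous_on by blast
  have cW1: "continuous_on {a'..b'} W1"
    using outer.dW1 DERIV_isCont continuous_at_imp_continuous_on by blast
  define Z where "Z = {x \<in> {a'..b'}. W1 x = 0}"
  have "compact Z"
  proof -
    have "Z = {a'..b'} \<inter> W1 -` {0}" by (auto simp: Z_def)
    then have "closed Z" using continuous_closed_preimage[OF cW1, of "{0}"] by simp
    moreover have "bounded Z" by (rule bounded_subset[of "{a'..b'}"]) (auto simp: Z_def)
    ultimately show ?thesis by (simp add: compact_eq_bounded_closed)
  qed
  moreover have "Z \<noteq> {}"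
  proof -
    have "\<exists>x\<ge>a'. x \<le> b' \<and> W1 x = 0"
      by (rule IVT') (use outer.slopes outer.\<alpha>\<beta> cW1 in auto)
    then show ?thesis by (auto simp: Z_def)
  qed
  moreover have "continuous_on Z W" by (rule continuous_on_subset[OF cW]) (auto simp: Z_def)
  ultimately obtain c0 where c0: "c0 \<in> Z" "\<And>x. x \<in> Z \<Longrightarrow> W x \<le> W c0"
    using continuous_attains_sup by metis
  \<comment> \<open>Highest critical level inside the well. Every critical point lies at or below
    it, so the slope has no zero where W exceeds E1.\<close>
  define E1 where "E1 = W c0"
  have c0': "c0 \<in> {a'..b'}" "W1 c0 = 0" using c0(1) by (auto simp: Z_def)
  then have "c0 \<noteq> a'" "c0 \<noteq> b'" using outer.slopes by auto
  then have c0_in: "a' < c0" "c0 < b'" using c0'(1) by auto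
  then have E1: "E1 < W a'" unfolding E1_def by (rule outer.below)
  define L where "L = {x \<in> {a'..b'}. W x \<le> E1}"
  have "compact L"
  proof -
    have "L = {a'..b'} \<inter> W -` {..E1}" by (auto simp: L_def)
    then have "closed L" using continuous_closed_preimage[OF cW, of "{..E1}"] by simp
    moreover have "bounded L" by (rule bounded_subset[of "{a'..b'}"]) (auto simp: L_def)
    ultimately show ?thesis by (simp add: compact_eq_bounded_closed)
  qed
  moreover have c0L: "c0 \<in> L" using c0' by (simp add: L_def E1_def)
  ultimately obtain \<alpha>1 \<beta>1 where \<alpha>1: "\<alpha>1 \<in> L" "\<And>x. x \<in> L \<Longrightarrow> \<alpha>1 \<le> x"
    and \<beta>1: "\<beta>1 \<in> L" "\<And>x. x \<in> L \<Longrightarrow> x \<le> \<beta>1"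
    using compact_attains_inf[of L] compact_attains_sup[of L] by (metis empty_iff)
  have \<alpha>1_in: "a' < \<alpha>1" and \<beta>1_in: "\<beta>1 < b'"
  proof -
    have "\<alpha>1 \<noteq> a'" "\<beta>1 \<noteq> b'" using \<alpha>1(1) \<beta>1(1) E1 outer.level by (auto simp: L_def)
    then show "a' < \<alpha>1" "\<beta>1 < b'" using \<alpha>1(1) \<beta>1(1) by (auto simp: L_def)
  qed
  have order: "\<alpha>1 \<le> c0" "c0 \<le> \<beta>1" "\<alpha>1 \<le> \<beta>1" using \<alpha>1(2)[OF c0L] \<beta>1(2)[OF c0L] by auto
  have W\<alpha>1: "W \<alpha>1 = E1"
  proof -
    have "\<exists>x\<ge>a'. x \<le> \<alpha>1 \<and> W x = E1"
      by (rule IVT2') (use \<alpha>1 \<alpha>1_in E1 cW in \<open>auto simp: L_def intro: continuous_on_subset\<close>)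
    then obtain x where "a' \<le> x" "x \<le> \<alpha>1" "W x = E1" by blast
    moreover from this have "x \<in> L" using \<alpha>1(1) by (auto simp: L_def)
    ultimately show ?thesis using \<alpha>1(2)[of x] by auto
  qed
  have W\<beta>1: "W \<beta>1 = E1"
  proof -
    have "\<exists>x\<ge>\<beta>1. x \<le> b' \<and> W x = E1"
      by (rule IVT') (use \<beta>1 \<beta>1_in E1 cW outer.level in \<open>auto simp: L_def intro: continuous_on_subset\<close>)
    then obtain x where "x \<le> b'" "\<beta>1 \<le> x" "W x = E1" by blast
    moreover from this have "x \<in> L" using \<beta>1(1) by (auto simp: L_def)
    ultimately show ?thesis using \<beta>1(2)[of x] by auto
  qed
  have nz: "W1 x \<noteq> 0" if "x \<in> {a'..b'}" "x \<notin> L" for x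
    using c0(2)[of x] that by (auto simp: Z_def L_def E1_def)
  have neg: "W1 x < 0" if "x \<in> {a'..<\<alpha>1}" for x
  proof (rule ccontr)
    assume "\<not> W1 x < 0"
    then have "\<exists>y\<ge>a'. y \<le> x \<and> W1 y = 0"
      using that \<alpha>1_in \<beta>1_in order outer.slopes
      by (intro IVT') (auto intro: continuous_on_subset[OF cW1])
    then obtain y where "a' \<le> y" "y \<le> x" "W1 y = 0" by blast
    moreover from this have "y \<notin> L" using \<alpha>1(2)[of y] that by auto
    ultimately show False using nz[of y] that \<beta>1_in order by auto
  qed
  have pos: "0 < W1 x" if "x \<in> {\<beta>1<..b'}" for x
  proof (rule ccontr)
    assume "\<not> 0 < W1 x"
    then have "\<exists>y\<ge>x. y \<le> b' \<and> W1 y = 0"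
      using that \<alpha>1_in \<beta>1_in order outer.slopes
      by (intro IVT') (auto intro: continuous_on_subset[OF cW1])
    then obtain y where "x \<le> y" "y \<le> b'" "W1 y = 0" by blast
    moreover from this have "y \<notin> L" using \<beta>1(2)[of y] that by auto
    ultimately show False using nz[of y] that \<alpha>1_in order by auto
  qed
  \<comment> \<open>A larger value between the outermost points of the sublevel set would give an
    interior maximum, that is, a critical point above the highest critical level.\<close>
  have inner: "W x \<le> W \<alpha>1" if x: "x \<in> {\<alpha>1..\<beta>1}" for x
  proof (rule ccontr)
    assume "\<not> W x \<le> W \<alpha>1"
    then have hi: "E1 < W x" by (simp add: W\<alpha>1)
    have "continuous_on {\<alpha>1..\<beta>1} W" by (rule continuous_on_subset[OF cW]) (use \<alpha>1_in \<beta>1_in in auto)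
    then obtain y where y: "y \<in> {\<alpha>1..\<beta>1}" "\<And>z. z \<in> {\<alpha>1..\<beta>1} \<Longrightarrow> W z \<le> W y"
      using continuous_attains_sup[of "{\<alpha>1..\<beta>1}" W] x by auto
    then have "E1 < W y" using hi x by fastforce
    then have "y \<noteq> \<alpha>1" "y \<noteq> \<beta>1" using W\<alpha>1 W\<beta>1 by auto
    then have "\<alpha>1 < y" "y < \<beta>1" using y(1) by auto
    moreover have "y \<in> {a'..b'}" using y(1) \<alpha>1_in \<beta>1_in by auto
    moreover have "W1 y = 0"
    proof (rule DERIV_local_max[OF outer.dW])
      show "y \<in> {a'..b'}" "0 < min (y - \<alpha>1) (\<beta>1 - y)" by fact (use calculation in simp)
      show "\<forall>z. \<bar>y - z\<bar> < min (y - \<alpha>1) (\<beta>1 - y) \<longrightarrow> W z \<le> W y"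
        by (intro allI impI y(2)) (simp add: abs_less_iff)
    qed
    ultimately show False using c0(2)[of y] \<open>E1 < W y\<close> by (auto simp: Z_def E1_def)
  qed
  obtain B T where BT: "continuous_on {a'..\<alpha>1} B" "B \<alpha>1 = \<beta>1"
    "\<And>\<alpha>. \<alpha> \<in> {a'..<\<alpha>1} \<Longrightarrow> B \<alpha> \<in> {\<beta>1<..b'}"
    "\<And>\<alpha>. \<alpha> \<in> {a'..<\<alpha>1} \<Longrightarrow> well W W1 W2 \<alpha> (B \<alpha>)"
    "\<And>\<alpha>. \<alpha> \<in> {a'..<\<alpha>1} \<Longrightarrow> well_period W2 \<alpha> (B \<alpha>) = T"
  proof (rule well_period_family[of a' \<alpha>1 \<beta>1 b' W W1 W2])
    show "well_period W2 \<alpha> \<beta> / (2 * pi) \<in> \<rat>"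
      if "\<alpha> \<in> {a'..<\<alpha>1}" "\<beta> \<in> {\<beta>1<..b'}" "well W W1 W2 \<alpha> \<beta>" for \<alpha> \<beta>
      using rational[of \<alpha> \<beta>] that by auto
  qed (use \<alpha>1_in \<beta>1_in order outer.dW outer.dW1 outer.cW2 outer.level neg pos inner W\<alpha>1 W\<beta>1 in auto)
  define \<alpha> where "\<alpha> n = \<alpha>1 - (\<alpha>1 - a') * inverse (real (Suc n))" for n
  have \<alpha>: "\<alpha> n \<in> {a'..<\<alpha>1}" for n
  proof -
    have "(\<alpha>1 - a') * inverse (real (Suc n)) \<le> (\<alpha>1 - a') * 1"
      using \<alpha>1_in by (intro mult_left_mono) (auto simp: inverse_eq_divide)
    moreover have "0 < (\<alpha>1 - a') * inverse (real (Suc n))" using \<alpha>1_in by simp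
    ultimately show ?thesis by (auto simp: \<alpha>_def)
  qed
  have \<alpha>_lim: "\<alpha> \<longlonglongrightarrow> \<alpha>1"
    using tendsto_diff[OF tendsto_const[of \<alpha>1] tendsto_mult_right_zero[OF LIMSEQ_inverse_real_of_nat, of "\<alpha>1 - a'"]]
    by (simp add: \<alpha>_def[abs_def])
  have "(\<lambda>n. B (\<alpha> n)) \<longlonglongrightarrow> B \<alpha>1"
    by (rule continuous_on_tendsto_compose[OF BT(1) \<alpha>_lim]) (use \<alpha> \<alpha>1_in in \<open>auto simp: less_imp_le\<close>)
  then have \<beta>_lim: "(\<lambda>n. B (\<alpha> n)) \<longlonglongrightarrow> \<beta>1" by (simp add: BT(2))
  have T: "0 < T" using well.period_pos[OF BT(4)[OF \<alpha>[of 0]]] BT(5)[OF \<alpha>[of 0]] by simp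
  show ?thesis
  proof (cases "\<alpha>1 = \<beta>1")
    case True
    then have c: "\<alpha>1 = c0" "\<beta>1 = c0" using order by auto
    have "continuous_on {a'<..<b'} W2" by (rule continuous_on_subset[OF outer.cW2]) auto
    then have "isCont W2 c0" using c0_in continuous_on_eq_continuous_at[of "{a'<..<b'}" W2] by simp
    from limit_well_period(1)[OF BT(4)[OF \<alpha>] BT(5)[OF \<alpha>] \<alpha>_lim[unfolded c] \<beta>_lim[unfolded c] this]
    have "0 < W2 c0" using T by simp
    then show ?thesis using that c0_in c0'(2) by blast
  next
    case False
    obtain d where d: "d \<in> {\<alpha>1, \<beta>1}" "d \<noteq> c0" using False by auto
    obtain M where M: "0 < M" "\<And>x. x \<in> {a'..b'} \<Longrightarrow> \<bar>W2 x\<bar> \<le> M"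
      using continuous_on_Icc_bound[OF outer.cW2] by blast
    have M0: "E1 - W x \<le> M * (x - c0)\<^sup>2" if x: "x \<in> {a'..b'}" for x
      using quadratic_bound[OF outer.dW outer.dW1 M(2,1) c0' x] by (simp add: E1_def abs_le_iff)
    define N where "N = 2 * M"
    have N: "0 < N" using M by (simp add: N_def)
    \<comment> \<open>Slow passage: with energy excess over E1 tending to zero, a motion started at
      c0 covers the distance to d only if an exponential of T outweighs the excess.\<close>
    have key: "N * (d - c0)\<^sup>2 \<le> 2 * (W \<alpha>' - E1) * exp ((1 + N) * T)" if \<alpha>': "\<alpha>' \<in> {a'..<\<alpha>1}" for \<alpha>'
    proof -
      interpret w: well W W1 W2 \<alpha>' "B \<alpha>'" by (rule BT(4)[OF \<alpha>'])
      define \<epsilon> where "\<epsilon> = W \<alpha>' - E1"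
      have \<epsilon>: "0 < \<epsilon>"
        using w.below[of \<alpha>1] BT(3)[OF \<alpha>'] \<alpha>' order by (auto simp: \<epsilon>_def W\<alpha>1)
      obtain X X' where X: "\<And>t. (X has_real_derivative X' t) (at t)"
        "\<And>t. X t \<in> {\<alpha>'..B \<alpha>'}" "\<And>t. (X' t)\<^sup>2 / 2 + W (X t) = W \<alpha>'"
        "\<exists>t. X t = \<alpha>'" "\<exists>t. X t = B \<alpha>'" "\<And>t. X (t + T) = X t"
        using w.period_motion BT(5)[OF \<alpha>'] by metis
      obtain ta tb where tab: "X ta = \<alpha>'" "X tb = B \<alpha>'" using X(4,5) by blast
      have attained: "\<exists>t. X t = x" if "x \<in> {\<alpha>'..B \<alpha>'}" for x
      proof -
        have "connected (range X)"
          by (intro connected_continuous_image continuous_at_imp_continuous_on ballI DERIV_isCont[OF X(1)] connected_UNIV)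
        then have "{X ta..X tb} \<subseteq> range X" by (rule connected_contains_Icc) auto
        then show ?thesis using that tab by auto
      qed
      have sub: "c0 \<in> {\<alpha>'..B \<alpha>'}" "d \<in> {\<alpha>'..B \<alpha>'}"
        using \<alpha>' BT(3)[OF \<alpha>'] order d(1) by auto
      obtain t1 t2 where t1: "X t1 = c0" and t2: "X t2 = d" using attained sub by metis
      \<comment> \<open>A shift by whole periods brings the visit to d to within time T after the
        visit to c0.\<close>
      define n where "n = - \<lfloor>(t2 - t1) / T\<rfloor>"
      define t3 where "t3 = t2 + of_int n * T"
      have t3: "X t3 = d"
        unfolding t3_def using shift_by_int_multiples[of X T 0 t2 n] X(6) t2 by simp
      have "t3 - t1 = ((t2 - t1) / T - of_int \<lfloor>(t2 - t1) / T\<rfloor>) * T"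
        using T by (simp add: t3_def n_def field_simps)
      moreover have "0 \<le> (t2 - t1) / T - of_int \<lfloor>(t2 - t1) / T\<rfloor>" "(t2 - t1) / T - of_int \<lfloor>(t2 - t1) / T\<rfloor> \<le> 1"
        by linarith+
      ultimately have t13: "t1 \<le> t3" "t3 - t1 \<le> T"
        using T mult_right_mono[of "(t2 - t1) / T - of_int \<lfloor>(t2 - t1) / T\<rfloor>" 1 T]
        by (metis diff_ge_0_iff_ge less_imp_le mult_nonneg_nonneg, simp)
      \<comment> \<open>This quantity dominates both the squared speed and N times the squared
        distance from c0, so its growth rate is at most 1 + N.\<close>
      define g where "g t = 2 * \<epsilon> + N * (X t - c0)\<^sup>2" for t
      have slow: "2 * N * (X t - c0) * X' t \<le> (1 + N) * g t" for t
      proof -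
        have "X t \<in> {a'..b'}" using X(2)[of t] \<alpha>' BT(3)[OF \<alpha>'] by auto
        from M0[OF this] have v: "(X' t)\<^sup>2 \<le> g t"
          using X(3)[of t] by (simp add: g_def \<epsilon>_def N_def)
        have u: "N * (X t - c0)\<^sup>2 \<le> g t" using \<epsilon> by (simp add: g_def)
        have "2 * ((X t - c0) * X' t) \<le> (X t - c0)\<^sup>2 + (X' t)\<^sup>2"
          using sum_squares_bound[of "X t - c0" "X' t"] by (simp only: mult.assoc)
        then have "N * (2 * ((X t - c0) * X' t)) \<le> N * ((X t - c0)\<^sup>2 + (X' t)\<^sup>2)"
          using N by (intro mult_left_mono) auto
        also have "\<dots> \<le> g t + N * g t" using add_mono[OF u mult_left_mono[OF v, of N]] N by (simp only: distrib_left less_imp_le)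
        finally show ?thesis by (simp add: algebra_simps)
      qed
      have "g t3 * exp (- (1 + N) * t3) \<le> g t1 * exp (- (1 + N) * t1)"
      proof (rule DERIV_nonpos_imp_nonincreasing[OF t13(1)])
        fix t
        have "((\<lambda>t. g t * exp (- (1 + N) * t)) has_real_derivative
           (2 * N * (X t - c0) * X' t - (1 + N) * g t) * exp (- (1 + N) * t)) (at t)"
          unfolding g_def
          by (auto intro!: derivative_eq_intros X(1)) (simp add: algebra_simps)
        moreover have "(2 * N * (X t - c0) * X' t - (1 + N) * g t) * exp (- (1 + N) * t) \<le> 0"
          using slow[of t] by (simp add: mult_le_0_iff)
        ultimately show "\<exists>y. ((\<lambda>t. g t * exp (- (1 + N) * t)) has_real_derivative y) (at t) \<and> y \<le> 0" by blast
      qed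
      then have "g t3 * exp (- (1 + N) * t3) * exp ((1 + N) * t3) \<le> g t1 * exp (- (1 + N) * t1) * exp ((1 + N) * t3)"
        by (intro mult_right_mono) auto
      then have "g t3 \<le> g t1 * exp ((1 + N) * (t3 - t1))"
        by (simp add: mult.assoc algebra_simps flip: exp_add)
      also have "\<dots> \<le> g t1 * exp ((1 + N) * T)"
        using t13 N \<epsilon> by (intro mult_left_mono) (auto simp: g_def)
      finally show ?thesis using \<epsilon> by (simp add: g_def t1 t3 \<epsilon>_def)
    qed
    have "(\<lambda>n. W (\<alpha> n)) \<longlonglongrightarrow> W \<alpha>1"
    proof (rule continuous_on_tendsto_compose[OF cW \<alpha>_lim])
      show "\<alpha>1 \<in> {a'..b'}" using \<alpha>1_in \<beta>1_in order by simp
      have "\<alpha> n \<in> {a'..b'}" for n using \<alpha>[of n] \<beta>1_in order by simp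
      then show "\<forall>\<^sub>F n in sequentially. \<alpha> n \<in> {a'..b'}" by simp
    qed
    then have "(\<lambda>n. 2 * (W (\<alpha> n) - E1) * exp ((1 + N) * T)) \<longlonglongrightarrow> 2 * (W \<alpha>1 - E1) * exp ((1 + N) * T)"
      by (intro tendsto_intros)
    then have "N * (d - c0)\<^sup>2 \<le> 2 * (W \<alpha>1 - E1) * exp ((1 + N) * T)"
      by (rule LIMSEQ_le_const) (use key \<alpha> in blast)
    then have "N * (d - c0)\<^sup>2 \<le> 0" by (simp add: W\<alpha>1)
    moreover have "0 < N * (d - c0)\<^sup>2" using N d by simp
    ultimately show ?thesis by simp
  qed
qed

section \<open>Dynamics on the surface\<close>

text \<open>A primitive of the positive density q is an increasing coordinate whose range is an open
  interval. Two densities are used: 1 / f^2, which gives w, and the inverse radial speed, for which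
  the coordinate is time.\<close>

lemma einterval_chart:
  fixes a b :: ereal and q :: "real \<Rightarrow> real"
  assumes ab: "a < b" and cont_q: "continuous_on (einterval a b) q"
    and q_pos: "\<And>r. r \<in> einterval a b \<Longrightarrow> 0 < q r" and r0: "r0 \<in> einterval a b"
  obtains w R J where "open J" "is_interval J" "(0::real) \<in> J" "R 0 = r0" "w r0 = 0"
    "\<And>r. r \<in> einterval a b \<Longrightarrow> w r \<in> J" "\<And>r. r \<in> einterval a b \<Longrightarrow> R (w r) = r"
    "\<And>x. x \<in> J \<Longrightarrow> R x \<in> einterval a b" "\<And>x. x \<in> J \<Longrightarrow> w (R x) = x"
    "\<And>x y. x \<in> J \<Longrightarrow> y \<in> J \<Longrightarrow> x < y \<Longrightarrow> R x < R y"
    "\<And>x. x \<in> J \<Longrightarrow> (R has_real_derivative 1 / q (R x)) (at x)"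
proof -
  let ?I = "einterval a b"
  obtain G where G: "\<And>r. r \<in> ?I \<Longrightarrow> (G has_real_derivative q r) (at r)"
    using einterval_primitive[OF ab cont_q] by blast
  define w where "w r = G r - G r0" for r
  have w: "(w has_real_derivative q r) (at r)" if "r \<in> ?I" for r
    unfolding w_def using G[OF that] by (auto intro!: derivative_eq_intros)
  have mono: "w x < w y" if "x \<in> ?I" "y \<in> ?I" "x < y" for x y
  proof (rule DERIV_pos_imp_increasing[OF that(3)])
    fix z assume "x \<le> z" "z \<le> y"
    then have "z \<in> ?I" using einterval_Icc_subset[OF that(1,2)] by auto
    then show "\<exists>d. (w has_real_derivative d) (at z) \<and> 0 < d"
      using w q_pos by (intro exI[of _ "q z"]) auto
  qed
  have inj: "inj_on w ?I"
    by (rule linorder_inj_onI') (use mono in force)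
  have cont: "continuous_on ?I w"
    using w DERIV_isCont continuous_at_imp_continuous_on by blast
  define J where "J = w ` ?I"
  define R where "R = inv_into ?I w"
  have R: "R x \<in> ?I" "w (R x) = x" if "x \<in> J" for x
    using that by (auto simp: J_def R_def inv_into_into f_inv_into_f)
  have Rw: "R (w r) = r" if "r \<in> ?I" for r
    using inv_into_f_f[OF inj that] by (simp add: R_def)
  have J: "open J"
    unfolding J_def by (rule injective_into_1d_imp_open_map_UNIV[OF open_einterval cont inj subset_refl])
  have Jint: "is_interval J"
    using connected_continuous_image[OF cont] is_interval_einterval[of a b]
    by (simp add: J_def is_interval_connected_1)
  have Rmono: "R x < R y" if "x \<in> J" "y \<in> J" "x < y" for x y
    using mono[OF R(1)[OF that(2)] R(1)[OF that(1)]] R(2) that by (metis linorder_neqE_linordered_idom less_asym)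
  have Rder: "(R has_real_derivative 1 / q (R x)) (at x)" if x: "x \<in> J" for x
  proof -
    obtain d where d: "0 < d" "{R x - d..R x + d} \<subseteq> ?I"
      using einterval_obtain_Icc[OF R(1)[OF x], of 1] by auto
    have "isCont R (w (R x))"
    proof (rule isCont_inverse_function[where f=w and x="R x", OF d(1)])
      fix z assume "\<bar>z - R x\<bar> \<le> d"
      then have "z \<in> ?I" using d(2) by (auto simp: abs_le_iff)
      then show "R (w z) = z" "isCont w z" using Rw DERIV_isCont[OF w] by auto
    qed
    then have c: "isCont R x" using R(2)[OF x] by simp
    obtain e where e: "0 < e" "ball x e \<subseteq> J" using J x open_contains_ball by blast
    have "(R has_real_derivative inverse (q (R x))) (at x)"
    proof (rule DERIV_inverse_function[where a="x - e" and b="x + e" and f=w])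
      show "(w has_real_derivative q (R x)) (at (R x))" by (rule w[OF R(1)[OF x]])
      show "q (R x) \<noteq> 0" using q_pos[OF R(1)[OF x]] by simp
      show "w (R y) = y" if "x - e < y" "y < x + e" for y
        using e(2) that by (intro R(2)) (auto simp: subset_eq dist_real_def abs_less_iff)
    qed (use e c in auto)
    then show ?thesis by (simp add: inverse_eq_divide)
  qed
  have "0 \<in> J" "R 0 = r0" using Rw[OF r0] r0 by (auto simp: J_def w_def image_iff)
  then show ?thesis using that[of J R w] J Jint R Rw Rmono Rder by (auto simp: J_def w_def)
qed

section \<open>Equations of motion and first integrals of a central field\<close>

locale central_field =
  fixes a b :: ereal and f V :: "real \<Rightarrow> real"
  assumes ab: "a < b"
    and smooth_f: "smooth_on_interval a b f"
    and f_pos: "\<And>r. r \<in> einterval a b \<Longrightarrow> 0 < f r"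
    and smooth_V: "smooth_on_interval a b V"
begin

abbreviation "I \<equiv> einterval a b"
abbreviation "f' \<equiv> deriv f"
abbreviation "V' \<equiv> deriv V"

lemma f_nonzero: "r \<in> I \<Longrightarrow> f r \<noteq> 0" using f_pos[of r] by auto

lemmas f_deriv = smooth_has_derivative[OF smooth_f]
lemmas V_deriv = smooth_has_derivative[OF smooth_V]

lemma lagrangian_derivs:
  "deriv (\<lambda>u. lagrangian f V x y u w) v = v"
  "deriv (\<lambda>u. lagrangian f V x y v u) w = (f x)\<^sup>2 * w"
  "x \<in> I \<Longrightarrow> deriv (\<lambda>x. lagrangian f V x y v w) x = f x * f' x * w\<^sup>2 - V' x"
  "deriv (\<lambda>y. lagrangian f V x y v w) y = 0"
  unfolding lagrangian_def
  by (rule DERIV_imp_deriv; auto intro!: derivative_eq_intros f_deriv V_deriv)+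

lemma is_solution_iff:
  "is_solution a b f V J r \<phi> \<longleftrightarrow> open J \<and> is_interval J \<and> J \<noteq> {} \<and>
    (\<forall>t\<in>J. r t \<in> I \<and> r differentiable (at t) \<and> \<phi> differentiable (at t) \<and>
       (deriv r has_real_derivative f (r t) * f' (r t) * (deriv \<phi> t)\<^sup>2 - V' (r t)) (at t) \<and>
       ((\<lambda>s. (f (r s))\<^sup>2 * deriv \<phi> s) has_real_derivative 0) (at t))"
  unfolding is_solution_def lagrangian_derivs(1,2,4) by (auto simp: lagrangian_derivs(3))

text \<open>At fixed K a radial equation together with a quadrature for the angle yields the
  Euler-Lagrange equations, so trajectories can be assembled from one-dimensional motions.\<close>

lemma solutionI:
  assumes J: "open J" "is_interval J" "J \<noteq> {}"
    and mem: "\<And>t. t \<in> J \<Longrightarrow> r t \<in> I"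
    and r: "\<And>t. t \<in> J \<Longrightarrow> (r has_real_derivative v t) (at t)"
    and v: "\<And>t. t \<in> J \<Longrightarrow> (v has_real_derivative K\<^sup>2 * f' (r t) / f (r t) ^ 3 - V' (r t)) (at t)"
    and \<phi>: "\<And>t. t \<in> J \<Longrightarrow> (\<phi> has_real_derivative K / (f (r t))\<^sup>2) (at t)"
  shows "is_solution a b f V J r \<phi>" "has_angular_momentum f J r \<phi> K"
proof -
  have dr: "deriv r t = v t" and d\<phi>: "deriv \<phi> t = K / (f (r t))\<^sup>2" if "t \<in> J" for t
    using r[OF that] \<phi>[OF that] by (auto intro: DERIV_imp_deriv)
  have mom: "(f (r t))\<^sup>2 * deriv \<phi> t = K" if "t \<in> J" for t
    using d\<phi>[OF that] f_nonzero[OF mem[OF that]] by simp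
  then show "has_angular_momentum f J r \<phi> K" by (simp add: has_angular_momentum_def)
  show "is_solution a b f V J r \<phi>"
    unfolding is_solution_iff
  proof (intro conjI ballI J)
    fix t assume t: "t \<in> J"
    show "r t \<in> I" "r differentiable (at t)" "\<phi> differentiable (at t)"
      using mem r \<phi> t real_differentiable_def by blast+
    have "f (r t) * f' (r t) * (deriv \<phi> t)\<^sup>2 = K\<^sup>2 * f' (r t) / f (r t) ^ 3"
      unfolding d\<phi>[OF t] using f_nonzero[OF mem[OF t]]
      by (simp add: power2_eq_square power3_eq_cube field_simps)
    then show "(deriv r has_real_derivative f (r t) * f' (r t) * (deriv \<phi> t)\<^sup>2 - V' (r t)) (at t)"
      using has_field_derivative_transform_within_open[OF v[OF t] J(1) t] dr by simp
    have "((\<lambda>_. K) has_real_derivative 0) (at t)" by simp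
    from has_field_derivative_transform_within_open[OF this J(1) t]
    show "((\<lambda>s. (f (r s))\<^sup>2 * deriv \<phi> s) has_real_derivative 0) (at t)" using mom by simp
  qed
qed

lemma UNIV_trajectory: "is_solution a b f V UNIV r \<phi> \<Longrightarrow> is_trajectory a b f V UNIV r \<phi>"
  by (auto simp: is_trajectory_def)

lemma solution_angular_momentum:
  assumes "is_solution a b f V J r \<phi>"
  obtains K where "has_angular_momentum f J r \<phi> K"
proof -
  obtain t0 where "t0 \<in> J" using assms by (auto simp: is_solution_def)
  then have "(f (r t))\<^sup>2 * deriv \<phi> t = (f (r t0))\<^sup>2 * deriv \<phi> t0" if "t \<in> J" for t
    using assms that by (intro derivative_zero_imp_eq[of J]) (auto simp: is_solution_iff)
  then show ?thesis using that by (auto simp: has_angular_momentum_def)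
qed

lemma effective_potential_deriv:
  "x \<in> I \<Longrightarrow> (effective_potential f V K has_real_derivative V' x - K\<^sup>2 * f' x / f x ^ 3) (at x)"
  unfolding effective_potential_def[abs_def]
  by (auto intro!: derivative_eq_intros f_deriv V_deriv simp: f_nonzero)
    (simp add: power2_eq_square power3_eq_cube power4_eq_xxxx f_nonzero)

context
  fixes J r \<phi> K
  assumes sol: "is_solution a b f V J r \<phi>" and mom: "has_angular_momentum f J r \<phi> K"
begin

lemma solution_mem: "t \<in> J \<Longrightarrow> r t \<in> I"
  using sol by (auto simp: is_solution_iff)

lemma solution_J: "open J" "is_interval J" "J \<noteq> {}"
  using sol by (auto simp: is_solution_iff)

lemma solution_r: "t \<in> J \<Longrightarrow> (r has_real_derivative deriv r t) (at t)"
  using sol by (auto simp: is_solution_iff DERIV_deriv_iff_real_differentiable)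

lemma solution_deriv_\<phi>: "t \<in> J \<Longrightarrow> deriv \<phi> t = K / (f (r t))\<^sup>2"
  using mom f_nonzero[OF solution_mem[of t]] by (auto simp: has_angular_momentum_def field_simps)

lemma solution_\<phi>: "t \<in> J \<Longrightarrow> (\<phi> has_real_derivative K / (f (r t))\<^sup>2) (at t)"
  using sol solution_deriv_\<phi>[of t]
  by (auto simp: is_solution_iff simp flip: DERIV_deriv_iff_real_differentiable)

lemma solution_v:
  assumes t: "t \<in> J"
  shows "(deriv r has_real_derivative K\<^sup>2 * f' (r t) / f (r t) ^ 3 - V' (r t)) (at t)"
proof -
  have "f (r t) * f' (r t) * (deriv \<phi> t)\<^sup>2 = K\<^sup>2 * f' (r t) / f (r t) ^ 3"
    unfolding solution_deriv_\<phi>[OF t] using f_nonzero[OF solution_mem[OF t]]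
    by (simp add: power2_eq_square power3_eq_cube field_simps)
  then show ?thesis using sol t by (auto simp: is_solution_iff)
qed

lemma solution_energy:
  assumes "t \<in> J" "s \<in> J"
  shows "(deriv r t)\<^sup>2 / 2 + effective_potential f V K (r t) = (deriv r s)\<^sup>2 / 2 + effective_potential f V K (r s)"
proof (rule derivative_zero_imp_eq[OF solution_J(2) _ assms])
  fix t assume t: "t \<in> J"
  have "((\<lambda>t. effective_potential f V K (r t)) has_real_derivative
     (V' (r t) - K\<^sup>2 * f' (r t) / f (r t) ^ 3) * deriv r t) (at t)"
    by (rule DERIV_chain2[OF effective_potential_deriv[OF solution_mem[OF t]] solution_r[OF t]])
  moreover have "((\<lambda>t. (deriv r t)\<^sup>2 / 2) has_real_derivative
     deriv r t * (K\<^sup>2 * f' (r t) / f (r t) ^ 3 - V' (r t))) (at t)"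
  proof -
    have "((\<lambda>t. (v t)\<^sup>2 / 2) has_real_derivative v t * F) (at t)"
      if "(v has_real_derivative F) (at t)" for v :: "real \<Rightarrow> real" and F
      by (auto intro!: derivative_eq_intros that)
    from this[OF solution_v[OF t]] show ?thesis .
  qed
  ultimately have "((\<lambda>t. (deriv r t)\<^sup>2 / 2 + effective_potential f V K (r t)) has_real_derivative
     deriv r t * (K\<^sup>2 * f' (r t) / f (r t) ^ 3 - V' (r t)) + (V' (r t) - K\<^sup>2 * f' (r t) / f (r t) ^ 3) * deriv r t) (at t)"
    by (rule DERIV_add[rotated])
  then show "((\<lambda>t. (deriv r t)\<^sup>2 / 2 + effective_potential f V K (r t)) has_real_derivative 0) (at t)"
    by (simp add: algebra_simps)
qed

end

lemma range_cis_linear: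
  assumes "c \<noteq> 0"
  shows "range (\<lambda>t. cis (c * t)) = sphere 0 1"
proof (intro equalityI subsetI)
  fix z :: complex assume "z \<in> sphere 0 1"
  then have "z = cis (c * (Arg z / c))" using assms cis_Arg[of z] by (cases "z = 0") (auto simp: sgn_eq)
  then show "z \<in> range (\<lambda>t. cis (c * t))" by blast
qed auto

lemma circular_trajectory:
  assumes "r0 \<in> I" "K \<noteq> 0" "V' r0 = K\<^sup>2 * f' r0 / f r0 ^ 3"
  shows "circular_trajectory_at a b f V r0 K UNIV (\<lambda>t. r0) (\<lambda>t. K / (f r0)\<^sup>2 * t)"
proof -
  have d: "((\<lambda>t. K / (f r0)\<^sup>2 * t) has_real_derivative K / (f r0)\<^sup>2) (at t)" for t
    using DERIV_cmult_Id by blast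
  have "is_solution a b f V UNIV (\<lambda>t. r0) (\<lambda>t. K / (f r0)\<^sup>2 * t)"
    and "has_angular_momentum f UNIV (\<lambda>t. r0) (\<lambda>t. K / (f r0)\<^sup>2 * t) K"
    by (rule solutionI[OF _ _ _ _ _ _ d, where v="\<lambda>_. 0"]; use assms in simp)+
  moreover have "orbit UNIV (\<lambda>t. r0) (\<lambda>t. K / (f r0)\<^sup>2 * t) = coordinate_circle r0"
  proof -
    have "orbit UNIV (\<lambda>t. r0) (\<lambda>t. K / (f r0)\<^sup>2 * t) = Pair r0 ` range (\<lambda>t. cis (K / (f r0)\<^sup>2 * t))"
      by (auto simp: orbit_def)
    also have "\<dots> = coordinate_circle r0"
      using range_cis_linear[of "K / (f r0)\<^sup>2"] assms f_nonzero by (auto simp: coordinate_circle_def)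
    finally show ?thesis .
  qed
  ultimately show ?thesis unfolding circular_trajectory_at_def using UNIV_trajectory by blast
qed

lemma circular_trajectory_imp:
  assumes "circular_trajectory_at a b f V r0 K J r \<phi>"
  shows "r0 \<in> I" "K \<noteq> 0" "V' r0 = K\<^sup>2 * f' r0 / f r0 ^ 3" "\<And>t. t \<in> J \<Longrightarrow> r t = r0"
    "\<And>t. t \<in> J \<Longrightarrow> deriv r t = 0"
proof -
  have sol: "is_solution a b f V J r \<phi>" and mom: "has_angular_momentum f J r \<phi> K"
    and orb: "orbit J r \<phi> = coordinate_circle r0"
    using assms by (auto simp: circular_trajectory_at_def is_trajectory_def)
  note J = solution_J[OF sol mom]
  obtain t0 where t0: "t0 \<in> J" using J by blast
  have r: "r t = r0" if "t \<in> J" for t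
  proof -
    have "(r t, cis (\<phi> t)) \<in> coordinate_circle r0" using orb that by (auto simp: orbit_def)
    then show ?thesis by (simp add: coordinate_circle_def)
  qed
  show "r0 \<in> I" using solution_mem[OF sol mom t0] r[OF t0] by simp
  show "r t = r0" if "t \<in> J" for t by (rule r[OF that])
  have dr: "deriv r t = 0" if t: "t \<in> J" for t
  proof -
    have "deriv r t = deriv (\<lambda>_. r0) t" by (rule deriv_cong_open[OF J(1) r t])
    then show ?thesis by simp
  qed
  then show "deriv r t = 0" if "t \<in> J" for t using that .
  have "(deriv r has_real_derivative 0) (at t0)"
    by (rule has_field_derivative_transform_within_open[of "\<lambda>_. 0", OF _ J(1) t0]) (use dr in auto)
  with solution_v[OF sol mom t0] have "K\<^sup>2 * f' (r t0) / f (r t0) ^ 3 - V' (r t0) = 0"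
    by (rule DERIV_unique)
  then show "V' r0 = K\<^sup>2 * f' r0 / f r0 ^ 3" using r[OF t0] by simp
  \<comment> \<open>Without angular momentum the angle is constant and the orbit a single point,
    whereas the circle contains both 1 and -1.\<close>
  show "K \<noteq> 0"
  proof
    assume "K = 0"
    then have "(\<phi> has_real_derivative 0) (at t)" if "t \<in> J" for t
      using solution_\<phi>[OF sol mom that] by simp
    then have "\<phi> t = \<phi> t0" if "t \<in> J" for t
      using derivative_zero_imp_eq[OF J(2) _ that t0] by blast
    then have "orbit J r \<phi> \<subseteq> {(r0, cis (\<phi> t0))}" using r by (auto simp: orbit_def)
    then have *: "coordinate_circle r0 \<subseteq> {(r0, cis (\<phi> t0))}" using orb by simp
    have "(r0, 1) \<in> coordinate_circle r0" "(r0, -1) \<in> coordinate_circle r0"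
      by (auto simp: coordinate_circle_def)
    then have "(r0, 1::complex) = (r0, cis (\<phi> t0))" "(r0, -1) = (r0, cis (\<phi> t0))"
      using * by (meson singletonD subsetD)+
    then have "(1::complex) = -1" by simp
    then show False by simp
  qed
qed

lemma circular_trajectory_iff:
  "(\<exists>J r \<phi>. circular_trajectory_at a b f V r0 K J r \<phi>) \<longleftrightarrow>
     r0 \<in> I \<and> K \<noteq> 0 \<and> V' r0 = K\<^sup>2 * f' r0 / f r0 ^ 3"
  using circular_trajectory circular_trajectory_imp(1-3) by metis

text \<open>The derivative with respect to the coordinate \<open>w\<close> with \<open>dw = dr / f\<^sup>2\<close>, in which the angle
  plays the role of time and the equation of motion is \<open>d\<^sup>2w/d\<phi>\<^sup>2 = - d/dw (V / K\<^sup>2 + 1 / (2 f\<^sup>2))\<close>.\<close>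

definition D :: "(real \<Rightarrow> real) \<Rightarrow> real \<Rightarrow> real" where "D g r = (f r)\<^sup>2 * deriv g r"

lemma smooth_D: "smooth_on_interval a b g \<Longrightarrow> smooth_on_interval a b (D g)"
  unfolding D_def[abs_def] by (intro smooth_intros smooth_f)

lemma D_eqI: "r \<in> I \<Longrightarrow> (g has_real_derivative g' / (f r)\<^sup>2) (at r) \<Longrightarrow> D g r = g'"
  using DERIV_imp_deriv[of g _ r] f_nonzero[of r] by (simp add: D_def)

lemma D_deriv: "smooth_on_interval a b g \<Longrightarrow> r \<in> I \<Longrightarrow> (g has_real_derivative D g r / (f r)\<^sup>2) (at r)"
  using smooth_has_derivative[of a b g r] f_nonzero[of r] by (simp add: D_def)

lemma D_cong: "(\<And>r. r \<in> I \<Longrightarrow> g r = h r) \<Longrightarrow> r \<in> I \<Longrightarrow> D g r = D h r"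
  unfolding D_def using deriv_cong_open[OF open_einterval] by metis

definition W0 :: "real \<Rightarrow> real \<Rightarrow> real" where "W0 K r = effective_potential f V K r / K\<^sup>2"
definition "W1 K = D (W0 K)"
definition "W2 K = D (W1 K)"
definition "W3 K = D (W2 K)"
definition "W4 K = D (W3 K)"

lemma smooth_W0: "smooth_on_interval a b (W0 K)"
proof -
  have "smooth_on_interval a b (\<lambda>r. (V r + K\<^sup>2 / (2 * (f r)\<^sup>2)) * inverse (K\<^sup>2))"
    by (intro smooth_intros smooth_V smooth_f) (simp add: f_nonzero)
  then show ?thesis unfolding W0_def[abs_def] effective_potential_def by (simp only: divide_inverse)
qed

lemma smooth_W: "smooth_on_interval a b (W1 K)" "smooth_on_interval a b (W2 K)"
  "smooth_on_interval a b (W3 K)" "smooth_on_interval a b (W4 K)"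
  unfolding W4_def W3_def W2_def W1_def by (intro smooth_D smooth_W0)+

lemma W1_eq: "r \<in> I \<Longrightarrow> W1 K r = (f r)\<^sup>2 * (V' r - K\<^sup>2 * f' r / f r ^ 3) / K\<^sup>2"
  unfolding W1_def D_def
  using DERIV_imp_deriv[OF DERIV_cdivide[OF effective_potential_deriv[of r K]], of "K\<^sup>2"]
  by (simp add: W0_def[abs_def])

end

section \<open>The coordinate w around a base radius, and trajectories lifted from motions in
  it\<close>

locale w_chart = central_field +
  fixes J :: "real set" and R w :: "real \<Rightarrow> real" and r0 :: real
  assumes J: "open J" "is_interval J"
    and base: "0 \<in> J" "R 0 = r0" "w r0 = 0"
    and w_mem: "\<And>r. r \<in> I \<Longrightarrow> w r \<in> J"
    and R_w: "\<And>r. r \<in> I \<Longrightarrow> R (w r) = r"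
    and R_mem: "\<And>x. x \<in> J \<Longrightarrow> R x \<in> I"
    and w_R: "\<And>x. x \<in> J \<Longrightarrow> w (R x) = x"
    and R_mono: "\<And>x y. x \<in> J \<Longrightarrow> y \<in> J \<Longrightarrow> x < y \<Longrightarrow> R x < R y"
    and R_deriv: "\<And>x. x \<in> J \<Longrightarrow> (R has_real_derivative (f (R x))\<^sup>2) (at x)"
begin

lemma pullback_deriv:
  assumes "smooth_on_interval a b g" "x \<in> J"
  shows "((\<lambda>x. g (R x)) has_real_derivative D g (R x)) (at x)"
  using DERIV_chain2[OF D_deriv[OF assms(1) R_mem[OF assms(2)]] R_deriv[OF assms(2)]]
    f_nonzero[OF R_mem[OF assms(2)]] by simp

lemma R_mono': "x \<in> J \<Longrightarrow> y \<in> J \<Longrightarrow> x \<le> y \<Longrightarrow> R x \<le> R y"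
  using R_mono[of x y] by (cases "x = y") auto

lemma J_Icc: "x \<in> J \<Longrightarrow> y \<in> J \<Longrightarrow> {x..y} \<subseteq> J"
proof
  fix z assume "x \<in> J" "y \<in> J" "z \<in> {x..y}"
  then show "z \<in> J" using mem_is_interval_1_I[OF J(2), of x y z] by simp
qed

text \<open>The motion X has the angle as its time, and physical time is recovered by integrating
  f^2 / |K|. On the compact range of X the function f^2 has a positive minimum, so time and angle
  both run over the whole line. If the orbit closes, the angle gains a fixed nonzero multiple of 2
  pi, which must then be a period of X.\<close>

lemma lift_motion:
  assumes K: "K \<noteq> 0" and sub: "{\<alpha>..\<beta>} \<subseteq> J"
    and X: "\<And>t. (X has_real_derivative X' t) (at t)"
      "\<And>t. (X' has_real_derivative - W1 K (R (X t))) (at t)" "\<And>t. X t \<in> {\<alpha>..\<beta>}"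
  obtains r \<phi> where "is_solution a b f V UNIV r \<phi>" "has_angular_momentum f UNIV r \<phi> K"
    "\<And>t. r t = R (X (\<phi> t))" "surj \<phi>"
    "closed_orbit r \<phi> \<longrightarrow> (\<exists>n::int. n \<noteq> 0 \<and> (\<forall>x. X (x + 2 * pi * of_int n) = X x))"
proof -
  \<comment> \<open>The sign of K is split off to keep the density relating angle to time positive;
    negative K runs through the angle backwards.\<close>
  define \<sigma> where "\<sigma> = sgn K"
  have \<sigma>: "\<sigma> * \<sigma> = 1" "\<sigma> * \<bar>K\<bar> = K" using K by (auto simp: \<sigma>_def sgn_if)
  have XJ: "X t \<in> J" for t using X(3) sub by blast
  define g where "g x = (f (R (X (\<sigma> * x))))\<^sup>2 / \<bar>K\<bar>" for x
  have cX: "continuous_on UNIV X"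
    using X(1) DERIV_isCont continuous_at_imp_continuous_on by blast
  have cF: "continuous_on J (\<lambda>x. (f (R x))\<^sup>2)"
    by (intro continuous_at_imp_continuous_on ballI DERIV_isCont[OF pullback_deriv[OF smooth_power[OF smooth_f]]])
  have cg: "continuous_on UNIV g"
    unfolding g_def
    by (intro continuous_on_divide continuous_on_compose2[OF cF] continuous_on_compose2[OF cX] continuous_intros)
      (use K XJ in auto)
  have ne: "{\<alpha>..\<beta>} \<noteq> {}" using X(3)[of 0] by auto
  obtain x0 where x0: "x0 \<in> {\<alpha>..\<beta>}" "\<And>x. x \<in> {\<alpha>..\<beta>} \<Longrightarrow> (f (R x0))\<^sup>2 \<le> (f (R x))\<^sup>2"
    using continuous_attains_inf[OF compact_Icc ne continuous_on_subset[OF cF sub]] by blast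
  have c: "0 < (f (R x0))\<^sup>2 / \<bar>K\<bar>" "\<And>x. (f (R x0))\<^sup>2 / \<bar>K\<bar> \<le> g x"
    using K f_nonzero[OF R_mem] x0 sub X(3) unfolding g_def
    by (auto intro!: divide_pos_pos divide_right_mono)
  obtain H Hi where H: "\<And>x. (H has_real_derivative g x) (at x)" "H 0 = 0" "strict_mono H"
    "\<And>x. Hi (H x) = x" "\<And>y. H (Hi y) = y" "\<And>y. (Hi has_real_derivative 1 / g (Hi y)) (at y)"
    using positive_primitive_bij[OF cg c] by blast
  define \<phi> where "\<phi> t = \<sigma> * Hi t" for t
  define r where "r t = R (X (\<phi> t))" for t
  have d\<phi>: "(\<phi> has_real_derivative K / (f (r t))\<^sup>2) (at t)" for t
  proof -
    have "\<sigma> * (1 / g (Hi t)) = K / (f (r t))\<^sup>2"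
      using \<sigma>(2) by (simp add: g_def r_def \<phi>_def)
    then show ?thesis unfolding \<phi>_def using DERIV_cmult[OF H(6)[of t], of \<sigma>] by simp
  qed
  have fr: "f (r t) \<noteq> 0" "r t \<in> I" for t
    unfolding r_def using f_nonzero[OF R_mem[OF XJ]] R_mem[OF XJ] by auto
  have dr: "(r has_real_derivative K * X' (\<phi> t)) (at t)" for t
  proof -
    have "((\<lambda>t. R (X (\<phi> t))) has_real_derivative (f (R (X (\<phi> t))))\<^sup>2 * (X' (\<phi> t) * (K / (f (r t))\<^sup>2))) (at t)"
      by (rule DERIV_chain2[OF R_deriv[OF XJ] DERIV_chain2[OF X(1) d\<phi>]])
    then show ?thesis using fr(1)[of t] by (simp add: r_def[symmetric] r_def[abs_def, symmetric] mult.commute)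
  qed
  have dv: "((\<lambda>t. K * X' (\<phi> t)) has_real_derivative K\<^sup>2 * f' (r t) / f (r t) ^ 3 - V' (r t)) (at t)" for t
  proof -
    have "K * (- W1 K (R (X (\<phi> t))) * (K / (f (r t))\<^sup>2)) = K\<^sup>2 * f' (r t) / f (r t) ^ 3 - V' (r t)"
      unfolding r_def[symmetric] W1_eq[OF fr(2)] using fr(1)[of t] K
      by (simp add: power2_eq_square field_simps)
    then show ?thesis using DERIV_cmult[OF DERIV_chain2[OF X(2) d\<phi>], of K t] by simp
  qed
  have sol: "is_solution a b f V UNIV r \<phi>" and mom: "has_angular_momentum f UNIV r \<phi> K"
    by (rule solutionI[OF _ _ _ _ dr dv d\<phi>]; use fr in simp)+
  have surj: "surj \<phi>"
  proof (rule surjI)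
    show "\<phi> (H (\<sigma> * x)) = x" for x unfolding \<phi>_def H(4) using \<sigma>(1) by (simp flip: mult.assoc)
  qed
  have "\<exists>n::int. n \<noteq> 0 \<and> (\<forall>x. X (x + 2 * pi * of_int n) = X x)" if closed: "closed_orbit r \<phi>"
  proof -
    obtain T where T: "0 < T" "\<And>t. r (t + T) = r t" "\<And>t. cis (\<phi> (t + T)) = cis (\<phi> t)"
      using closed unfolding closed_orbit_def by blast
    \<comment> \<open>Number of turns gained during T. It is integer-valued and continuous in t,
      hence constant.\<close>
    define u where "u t = (\<phi> (t + T) - \<phi> t) / (2 * pi)" for t
    have u: "\<exists>n::int. u t = of_int n" for t
    proof -
      have "sin (\<phi> (t + T)) = sin (\<phi> t)" "cos (\<phi> (t + T)) = cos (\<phi> t)"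
        using T(3)[of t] by (auto simp: cis.ctr)
      then obtain n :: int where "\<phi> (t + T) = \<phi> t + 2 * pi * of_int n"
        using sin_cos_eq_iff[of "\<phi> (t + T)" "\<phi> t"] by auto
      then show ?thesis by (intro exI[of _ n]) (simp add: u_def)
    qed
    have c\<phi>: "continuous_on UNIV \<phi>"
      using d\<phi> DERIV_isCont continuous_at_imp_continuous_on by blast
    have "u t = u 0" for t
    proof (rule rational_valued_imp_constant[of UNIV u])
      show "continuous_on UNIV u" unfolding u_def
        by (intro continuous_intros continuous_on_compose2[OF c\<phi>]) auto
      show "u x \<in> \<rat>" for x using u[of x] by auto
    qed auto
    moreover obtain n :: int where n: "u 0 = of_int n" using u by blast
    ultimately have "\<phi> (t + T) - \<phi> t = of_int n * (2 * pi)" for t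
      by (simp add: u_def divide_eq_eq)
    note u_eq = this
    have shift: "\<phi> (t + T) = \<phi> t + 2 * pi * of_int n" for t
      using u_eq[of t] by (simp add: algebra_simps)
    have "n \<noteq> 0"
    proof
      assume "n = 0"
      then have "\<sigma> * (\<sigma> * Hi T) = \<sigma> * (\<sigma> * Hi 0)" using shift[of 0] by (simp add: \<phi>_def)
      then have "Hi T = Hi 0" using \<sigma>(1) by (simp flip: mult.assoc)
      then show False using H(5)[of T] H(5)[of 0] T(1) by simp
    qed
    moreover have "X (x + 2 * pi * of_int n) = X x" for x
    proof -
      obtain t where t: "x = \<phi> t" using surj by blast
      have "R (X (\<phi> t + 2 * pi * of_int n)) = R (X (\<phi> t))" using T(2)[of t] shift[of t] by (simp add: r_def)
      then have "w (R (X (\<phi> t + 2 * pi * of_int n))) = w (R (X (\<phi> t)))" by simp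
      then show ?thesis using w_R[OF XJ] t by simp
    qed
    ultimately show ?thesis by blast
  qed
  then show ?thesis using that[OF sol mom _ surj] by (simp add: r_def)
qed

abbreviation "pw0 K \<equiv> (\<lambda>x. W0 K (R x))"
abbreviation "pw1 K \<equiv> (\<lambda>x. W1 K (R x))"
abbreviation "pw2 K \<equiv> (\<lambda>x. W2 K (R x))"
abbreviation "pw3 K \<equiv> (\<lambda>x. W3 K (R x))"

lemma pw_deriv:
  assumes "x \<in> J"
  shows "(pw0 K has_real_derivative pw1 K x) (at x)" "(pw1 K has_real_derivative pw2 K x) (at x)"
    "(pw2 K has_real_derivative pw3 K x) (at x)" "(pw3 K has_real_derivative W4 K (R x)) (at x)"
  by (rule pullback_deriv[OF smooth_W0 assms, folded W1_def] pullback_deriv[OF smooth_W(1) assms, folded W2_def]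
      pullback_deriv[OF smooth_W(2) assms, folded W3_def] pullback_deriv[OF smooth_W(3) assms, folded W4_def])+

text \<open>All periods of the motion in the well are integer multiples of T, so a nonzero period 2
  pi n forces T / (2 pi) to be a quotient of integers. The orbit is not circular because both
  turning points are reached.\<close>

lemma well_orbit:
  assumes K: "K \<noteq> 0" and sub: "{\<alpha>..\<beta>} \<subseteq> J" and well: "well (pw0 K) (pw1 K) (pw2 K) \<alpha> \<beta>"
  obtains r \<phi> where "nonsingular_bounded a b f V r \<phi>" "has_angular_momentum f UNIV r \<phi> K"
    "orbit UNIV r \<phi> \<subseteq> {R \<alpha>..R \<beta>} \<times> sphere 0 1" "\<not> circular UNIV r \<phi>"
    "closed_orbit r \<phi> \<longrightarrow> well_period (pw2 K) \<alpha> \<beta> / (2 * pi) \<in> \<rat>"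
proof -
  interpret well "pw0 K" "pw1 K" "pw2 K" \<alpha> \<beta> by (rule well)
  define T where "T = well_period (pw2 K) \<alpha> \<beta>"
  obtain X X' where X: "\<And>t. (X has_real_derivative X' t) (at t)"
    "\<And>t. (X' has_real_derivative - pw1 K (X t)) (at t)" "\<And>t. X t \<in> {\<alpha>..\<beta>}"
    "\<exists>t. X t = \<alpha>" "\<exists>t. X t = \<beta>"
    "\<And>S. (\<forall>t. X (t + S) = X t) \<Longrightarrow> \<exists>n::int. S = of_int n * T"
    using period_motion unfolding T_def by metis
  obtain r \<phi> where r: "is_solution a b f V UNIV r \<phi>" "has_angular_momentum f UNIV r \<phi> K"
    "\<And>t. r t = R (X (\<phi> t))" "surj \<phi>"
    "closed_orbit r \<phi> \<longrightarrow> (\<exists>n::int. n \<noteq> 0 \<and> (\<forall>x. X (x + 2 * pi * of_int n) = X x))"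
    by (rule lift_motion[OF K sub X(1-3)], rule that)
  have ends: "\<alpha> \<in> J" "\<beta> \<in> J" using sub \<alpha>\<beta> by auto
  have bnd: "r t \<in> {R \<alpha>..R \<beta>}" for t
  proof -
    have x: "X (\<phi> t) \<in> {\<alpha>..\<beta>}" "X (\<phi> t) \<in> J" using X(3)[of "\<phi> t"] sub by blast+
    then have "R \<alpha> \<le> R (X (\<phi> t))" "R (X (\<phi> t)) \<le> R \<beta>"
      using R_mono'[OF ends(1) x(2)] R_mono'[OF x(2) ends(2)] by auto
    then show ?thesis by (simp add: r(3))
  qed
  then have orb: "orbit UNIV r \<phi> \<subseteq> {R \<alpha>..R \<beta>} \<times> sphere 0 1" by (auto simp: orbit_def)
  have "bounded_trajectory a b f V r \<phi>"
    unfolding bounded_trajectory_def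
    by (intro conjI exI[of _ "R \<alpha>"] exI[of _ "R \<beta>"] UNIV_trajectory[OF r(1)] orb
        einterval_Icc_subset[OF R_mem[OF ends(1)] R_mem[OF ends(2)]])
  moreover have "\<not> singular f UNIV r \<phi>"
    using r(2) K unfolding singular_def has_angular_momentum_def by auto
  ultimately have ns: "nonsingular_bounded a b f V r \<phi>" by (simp add: nonsingular_bounded_def)
  have "\<not> circular UNIV r \<phi>"
  proof
    assume "circular UNIV r \<phi>"
    then obtain \<rho> where "orbit UNIV r \<phi> = coordinate_circle \<rho>" by (auto simp: circular_def)
    then have "(r t, cis (\<phi> t)) \<in> coordinate_circle \<rho>" for t by (auto simp: orbit_def)
    then have const: "r t = \<rho>" for t by (simp add: coordinate_circle_def)
    obtain ta tb where "X (\<phi> ta) = \<alpha>" "X (\<phi> tb) = \<beta>" using X(4,5) r(4) by (metis surjD)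
    then have "R \<alpha> = R \<beta>" using r(3) const by metis
    then show False using R_mono[OF ends \<alpha>\<beta>] by simp
  qed
  moreover have "T / (2 * pi) \<in> \<rat>" if "closed_orbit r \<phi>"
  proof -
    have "\<exists>n::int. n \<noteq> 0 \<and> (\<forall>x. X (x + 2 * pi * of_int n) = X x)" by (rule mp[OF r(5) that])
    then obtain n :: int where n: "n \<noteq> 0" "\<And>x. X (x + 2 * pi * of_int n) = X x" by blast
    from n(2) have "\<forall>x. X (x + 2 * pi * of_int n) = X x" by (rule allI)
    from X(6)[OF this] obtain m :: int where m: "2 * pi * of_int n = of_int m * T" by auto
    then have "m \<noteq> 0" using n(1) by auto
    then have "T / (2 * pi) = of_int n / of_int m" using m by (simp add: field_simps)
    then show ?thesis by simp
  qed
  ultimately show ?thesis using that[OF ns r(2) orb] by (simp add: T_def)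
qed

end

lemma (in central_field) w_chart_exists:
  assumes "r0 \<in> I"
  obtains J R w where "w_chart a b f V J R w r0"
proof -
  have c: "continuous_on I (\<lambda>r. 1 / (f r)\<^sup>2)"
    by (intro smooth_continuous_on smooth_intros smooth_f) (simp add: f_nonzero)
  have p: "0 < 1 / (f r)\<^sup>2" if "r \<in> I" for r using f_nonzero[OF that] by simp
  obtain w R J where "open J" "is_interval J" "(0::real) \<in> J" "R 0 = r0" "w r0 = 0"
    "\<And>r. r \<in> I \<Longrightarrow> w r \<in> J" "\<And>r. r \<in> I \<Longrightarrow> R (w r) = r"
    "\<And>x. x \<in> J \<Longrightarrow> R x \<in> I" "\<And>x. x \<in> J \<Longrightarrow> w (R x) = x"
    "\<And>x y. x \<in> J \<Longrightarrow> y \<in> J \<Longrightarrow> x < y \<Longrightarrow> R x < R y"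
    "\<And>x. x \<in> J \<Longrightarrow> (R has_real_derivative 1 / (1 / (f (R x))\<^sup>2)) (at x)"
    by (rule einterval_chart[OF ab c p assms], assumption, rule that)
  then have "w_chart a b f V J R w r0" by unfold_locales auto
  then show ?thesis by (rule that)
qed

section \<open>Circular orbits and wells of the effective potential\<close>

text \<open>Gronwall's argument in both time directions: the weights exp (- C t) and exp (C t)
  prevent g from growing away from its zero. It stands in for uniqueness of solutions at an
  equilibrium.\<close>

lemma zero_of_growth_bound:
  fixes g g' :: "real \<Rightarrow> real"
  assumes "\<And>t. (g has_real_derivative g' t) (at t)" "\<And>t. \<bar>g' t\<bar> \<le> C * g t" "\<And>t. 0 \<le> g t" "g t0 = 0"
  shows "g t = 0"
proof (cases "t0 \<le> t")
  case True
  have "g t * exp (- C * t) \<le> g t0 * exp (- C * t0)"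
  proof (rule DERIV_nonpos_imp_nonincreasing[OF True])
    fix s
    have "((\<lambda>s. g s * exp (- C * s)) has_real_derivative (g' s - C * g s) * exp (- C * s)) (at s)"
      by (auto intro!: derivative_eq_intros assms(1)) (simp add: algebra_simps)
    moreover have "(g' s - C * g s) * exp (- C * s) \<le> 0"
      using assms(2)[of s] by (simp add: mult_le_0_iff abs_le_iff)
    ultimately show "\<exists>y. ((\<lambda>s. g s * exp (- C * s)) has_real_derivative y) (at s) \<and> y \<le> 0" by blast
  qed
  then show ?thesis using assms(3)[of t] assms(4) by (simp add: mult_le_0_iff)
next
  case False
  then have le: "t \<le> t0" by simp
  have "g t * exp (C * t) \<le> g t0 * exp (C * t0)"
  proof (rule DERIV_nonneg_imp_nondecreasing[OF le])
    fix s
    have "((\<lambda>s. g s * exp (C * s)) has_real_derivative (g' s + C * g s) * exp (C * s)) (at s)"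
      by (auto intro!: derivative_eq_intros assms(1)) (simp add: algebra_simps)
    moreover have "0 \<le> (g' s + C * g s) * exp (C * s)"
      using assms(2)[of s] by (simp add: abs_le_iff)
    ultimately show "\<exists>y. ((\<lambda>s. g s * exp (C * s)) has_real_derivative y) (at s) \<and> 0 \<le> y" by blast
  qed
  then show ?thesis using assms(3)[of t] assms(4) by (simp add: mult_le_0_iff)
qed

section \<open>Critical points of the effective potential, stable circles and bounded orbits\<close>

context central_field
begin

abbreviation "E \<equiv> effective_potential f V"

lemma smooth_E: "smooth_on_interval a b (E K)"
  unfolding effective_potential_def by (intro smooth_intros smooth_V smooth_f) (simp add: f_nonzero)

lemma deriv_E: "x \<in> I \<Longrightarrow> deriv (E K) x = V' x - K\<^sup>2 * f' x / f x ^ 3"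
  by (rule DERIV_imp_deriv[OF effective_potential_deriv])

lemma W1_E: "x \<in> I \<Longrightarrow> W1 K x = (f x)\<^sup>2 * deriv (E K) x / K\<^sup>2"
  by (simp add: W1_eq deriv_E)

lemma W1_zero_iff: "x \<in> I \<Longrightarrow> K \<noteq> 0 \<Longrightarrow> W1 K x = 0 \<longleftrightarrow> deriv (E K) x = 0"
  using f_nonzero by (simp add: W1_E)

text \<open>Passing from r to w adds a term with the first derivative, which vanishes at a critical
  point. Nondegeneracy and the sign of the second derivative therefore agree in both
  coordinates.\<close>

lemma W2_at_critical:
  assumes "x \<in> I" "K \<noteq> 0" "deriv (E K) x = 0"
  shows "W2 K x = f x ^ 4 * deriv (deriv (E K)) x / K\<^sup>2"
proof -
  have "((\<lambda>x. (f x)\<^sup>2 * deriv (E K) x / K\<^sup>2) has_real_derivative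
      (2 * f x * f' x * deriv (E K) x + (f x)\<^sup>2 * deriv (deriv (E K)) x) / K\<^sup>2) (at x)"
    using assms(1,2)
    by (intro DERIV_cdivide)
      (auto intro!: derivative_eq_intros f_deriv smooth_has_derivative smooth_deriv smooth_E)
  then have "deriv (\<lambda>x. (f x)\<^sup>2 * deriv (E K) x / K\<^sup>2) x
      = (2 * f x * f' x * deriv (E K) x + (f x)\<^sup>2 * deriv (deriv (E K)) x) / K\<^sup>2"
    by (rule DERIV_imp_deriv)
  moreover have "deriv (W1 K) x = deriv (\<lambda>x. (f x)\<^sup>2 * deriv (E K) x / K\<^sup>2) x"
    by (rule deriv_cong_open[OF open_einterval _ assms(1)]) (rule W1_E)
  ultimately show ?thesis
    unfolding W2_def D_def using assms(3) by (simp add: power2_eq_square power4_eq_xxxx)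
qed

lemma E_strict_local_min:
  assumes "r0 \<in> I" "K \<noteq> 0" "W1 K r0 = 0" "0 < W2 K r0"
  obtains d where "0 < d" "{r0 - d..r0 + d} \<subseteq> I"
    "\<And>x. x \<in> {r0 - d..r0 + d} \<Longrightarrow> x \<noteq> r0 \<Longrightarrow> E K r0 < E K x"
proof -
  have c: "deriv (E K) r0 = 0" using assms W1_zero_iff by simp
  have "0 < f r0 ^ 4 * deriv (deriv (E K)) r0 / K\<^sup>2"
    using assms W2_at_critical[OF assms(1,2) c] by simp
  then have p: "0 < deriv (deriv (E K)) r0"
    by (simp add: zero_less_divide_iff zero_less_mult_iff)
  show ?thesis
    by (rule strict_local_min[OF open_einterval assms(1) smooth_has_derivative[OF smooth_E] c
        smooth_has_derivative[OF smooth_deriv[OF smooth_E] assms(1)] p], assumption) (rule that)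
qed

text \<open>A local minimum with nonzero second derivative cannot have a negative one, since that
  would make it a strict local maximum. Stability thus becomes a condition on derivatives in w, the
  form used by the analysis of wells.\<close>

lemma strongly_stable_circular_iff:
  "strongly_stable_circular a b f V r0 K \<longleftrightarrow> r0 \<in> I \<and> K \<noteq> 0 \<and> W1 K r0 = 0 \<and> 0 < W2 K r0"
proof
  assume *: "strongly_stable_circular a b f V r0 K"
  then have r0: "r0 \<in> I" "K \<noteq> 0" and c: "deriv (E K) r0 = 0"
    and m: "\<forall>\<^sub>F r in nhds r0. E K r0 \<le> E K r" and nz: "deriv (deriv (E K)) r0 \<noteq> 0"
    by (auto simp: strongly_stable_circular_def circular_trajectory_iff deriv_E)
  note d1 = smooth_has_derivative[OF smooth_E, of _ K]
  note d2 = smooth_has_derivative[OF smooth_deriv[OF smooth_E] r0(1), of K]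
  have "\<not> deriv (deriv (E K)) r0 < 0"
  proof
    assume neg: "deriv (deriv (E K)) r0 < 0"
    obtain d where d: "0 < d"
      "\<And>x. x \<in> {r0 - d..r0 + d} \<Longrightarrow> x \<noteq> r0 \<Longrightarrow> - E K r0 < - E K x"
      by (rule strict_local_min[of I r0 "\<lambda>x. - E K x" "\<lambda>x. - deriv (E K) x" "- deriv (deriv (E K)) r0"])
        (use r0 c neg d1 d2 in \<open>auto intro!: derivative_eq_intros\<close>)
    obtain e where e: "0 < e" "\<And>x. \<bar>x - r0\<bar> < e \<Longrightarrow> E K r0 \<le> E K x"
      using m unfolding eventually_nhds_metric by (auto simp: dist_real_def)
    define x where "x = r0 + min d (e / 2)"
    have "x \<in> {r0 - d..r0 + d}" "x \<noteq> r0" "\<bar>x - r0\<bar> < e" using d(1) e(1) by (auto simp: x_def)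
    then show False using d(2)[of x] e(2)[of x] by simp
  qed
  then have "0 < deriv (deriv (E K)) r0" using nz by simp
  then show "r0 \<in> I \<and> K \<noteq> 0 \<and> W1 K r0 = 0 \<and> 0 < W2 K r0"
    using r0 c W2_at_critical[OF r0 c] W1_zero_iff[OF r0] f_nonzero[OF r0(1)] by simp
next
  assume *: "r0 \<in> I \<and> K \<noteq> 0 \<and> W1 K r0 = 0 \<and> 0 < W2 K r0"
  then have c: "deriv (E K) r0 = 0" using W1_zero_iff[of r0 K] by simp
  obtain d where d: "0 < d" "{r0 - d..r0 + d} \<subseteq> I"
    "\<And>x. x \<in> {r0 - d..r0 + d} \<Longrightarrow> x \<noteq> r0 \<Longrightarrow> E K r0 < E K x"
    using E_strict_local_min * by metis
  have "\<forall>\<^sub>F r in nhds r0. E K r0 \<le> E K r"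
    unfolding eventually_nhds_metric
  proof (intro exI[of _ d] conjI allI impI d(1))
    fix x assume "dist x r0 < d"
    then show "E K r0 \<le> E K x"
      using d(3)[of x] by (cases "x = r0") (auto simp: dist_real_def abs_less_iff)
  qed
  moreover have "deriv (deriv (E K)) r0 \<noteq> 0" using * W2_at_critical[OF _ _ c] by auto
  ultimately show "strongly_stable_circular a b f V r0 K"
    using * c unfolding strongly_stable_circular_def circular_trajectory_iff by (auto simp: deriv_E)
qed

lemma W_continuous_chart:
  assumes "w_chart a b f V J R w r0" "S \<subseteq> J"
  shows "continuous_on S (\<lambda>x. W2 K (R x))"
proof (intro continuous_at_imp_continuous_on ballI)
  fix x assume "x \<in> S"
  then have "x \<in> J" using assms(2) by blast
  from w_chart.pw_deriv(3)[OF assms(1) this] show "isCont (\<lambda>x. W2 K (R x)) x" by (rule DERIV_isCont)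
qed

lemma chart_neighbourhood:
  assumes "w_chart a b f V J R w r0" "0 < \<epsilon>"
  obtains \<delta> where "0 < \<delta>" "{-\<delta>..\<delta>} \<subseteq> J" "\<And>x. \<bar>x\<bar> \<le> \<delta> \<Longrightarrow> R x \<in> {r0 - \<epsilon>..r0 + \<epsilon>}"
proof -
  interpret w_chart a b f V J R w r0 by fact
  obtain d1 where d1: "0 < d1" "cball 0 d1 \<subseteq> J" using J(1) base(1) open_contains_cball by blast
  have "isCont R 0" using R_deriv[OF base(1)] by (rule DERIV_isCont)
  then have "\<exists>d>0. \<forall>y. dist y 0 < d \<longrightarrow> dist (R y) (R 0) < \<epsilon>"
    unfolding continuous_at_eps_delta using assms(2) by blast
  then obtain d2 where d2: "0 < d2" "\<And>y. \<bar>y\<bar> < d2 \<Longrightarrow> \<bar>R y - r0\<bar> < \<epsilon>"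
    by (auto simp: dist_real_def base)
  define \<delta> where "\<delta> = min d1 (d2 / 2)"
  have \<delta>: "0 < \<delta>" "\<delta> \<le> d1" "\<delta> < d2" using d1 d2 by (auto simp: \<delta>_def)
  have "x \<in> J" if "x \<in> {-\<delta>..\<delta>}" for x
    using \<delta> that by (intro subsetD[OF d1(2)]) (auto simp: dist_real_def abs_le_iff)
  moreover have "R x \<in> {r0 - \<epsilon>..r0 + \<epsilon>}" if "\<bar>x\<bar> \<le> \<delta>" for x
  proof -
    have "\<bar>x\<bar> < d2" using that \<delta>(3) by linarith
    from d2(2)[OF this] show ?thesis by (simp add: abs_less_iff)
  qed
  ultimately show ?thesis using that \<delta>(1) by blast
qed

text \<open>Small wells around the critical point carry orbits of exactly the momentum K inside the
  annulus of \<open>closed_near\<close>. Their periods are therefore rational multiples of 2 pi, and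
  the one-dimensional result applies.\<close>

lemma stable_circle_isochronous:
  assumes r0: "r0 \<in> I" "K \<noteq> 0" "W1 K r0 = 0" "0 < W2 K r0" and near: "closed_near a b f V r0 K"
  obtains \<omega> where "\<omega> \<in> \<rat>" "0 < \<omega>" "W2 K r0 = \<omega>\<^sup>2" "5 * (W3 K r0)\<^sup>2 = 3 * \<omega>\<^sup>2 * W4 K r0"
proof -
  obtain J R w where chart: "w_chart a b f V J R w r0" using w_chart_exists[OF r0(1)] by blast
  interpret w_chart a b f V J R w r0 by (rule chart)
  obtain \<epsilon> where \<epsilon>: "0 < \<epsilon>" "\<And>r \<phi> K'. nonsingular_bounded a b f V r \<phi> \<Longrightarrow>
      orbit UNIV r \<phi> \<subseteq> {r0 - \<epsilon>..r0 + \<epsilon>} \<times> sphere 0 1 \<Longrightarrow>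
      has_angular_momentum f UNIV r \<phi> K' \<Longrightarrow> K' \<in> {K - \<epsilon><..<K + \<epsilon>} \<Longrightarrow> closed_orbit r \<phi>"
    using near unfolding closed_near_def by blast
  obtain \<delta> where \<delta>: "0 < \<delta>" "{-\<delta>..\<delta>} \<subseteq> J" "\<And>x. \<bar>x\<bar> \<le> \<delta> \<Longrightarrow> R x \<in> {r0 - \<epsilon>..r0 + \<epsilon>}"
    using chart_neighbourhood[OF chart \<epsilon>(1)] by blast
  have inJ: "y \<in> J" if "\<bar>y\<bar> \<le> \<delta>" for y using \<delta>(2) that by (auto simp: abs_le_iff)
  have rat: "well_period (pw2 K) \<alpha> \<beta> / (2 * pi) \<in> \<rat>"
    if ab: "-\<delta> \<le> \<alpha>" "\<alpha> < 0" "0 < \<beta>" "\<beta> \<le> \<delta>" and well: "well (pw0 K) (pw1 K) (pw2 K) \<alpha> \<beta>" for \<alpha> \<beta>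
  proof -
    have sub: "{\<alpha>..\<beta>} \<subseteq> J" using \<delta>(2) ab by (auto simp: subset_iff)
    obtain r \<phi> where r: "nonsingular_bounded a b f V r \<phi>" "has_angular_momentum f UNIV r \<phi> K"
      "orbit UNIV r \<phi> \<subseteq> {R \<alpha>..R \<beta>} \<times> sphere 0 1" "\<not> circular UNIV r \<phi>"
      "closed_orbit r \<phi> \<longrightarrow> well_period (pw2 K) \<alpha> \<beta> / (2 * pi) \<in> \<rat>"
      by (rule well_orbit[OF r0(2) sub well], rule that)
    have "r0 - \<epsilon> \<le> R \<alpha>" "R \<beta> \<le> r0 + \<epsilon>" using \<delta>(3)[of \<alpha>] \<delta>(3)[of \<beta>] ab by auto
    then have "{R \<alpha>..R \<beta>} \<times> sphere 0 1 \<subseteq> {r0 - \<epsilon>..r0 + \<epsilon>} \<times> (sphere 0 1 :: complex set)" by auto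
    then have "closed_orbit r \<phi>" using \<epsilon>(2)[OF r(1) _ r(2)] r(3) \<epsilon>(1) by auto
    then show ?thesis using r(5) by blast
  qed
  obtain \<omega> where \<omega>: "\<omega> \<in> \<rat>" "0 < \<omega>" "pw2 K 0 = \<omega>\<^sup>2" "5 * (pw3 K 0)\<^sup>2 = 3 * \<omega>\<^sup>2 * W4 K (R 0)"
    by (rule isochronous_minimum[OF \<delta>(1) pw_deriv(1)[OF inJ] pw_deriv(2)[OF inJ] pw_deriv(3)[OF inJ]
          pw_deriv(4)[OF base(1)] _ _ rat]) (use r0 base in \<open>auto intro: that\<close>)
  then show ?thesis using that base by simp
qed

lemma stable_circle_noncircular_orbit:
  assumes r0: "r0 \<in> I" "K \<noteq> 0" "W1 K r0 = 0" "0 < W2 K r0"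
  obtains r \<phi> where "nonsingular_bounded a b f V r \<phi>" "\<not> circular UNIV r \<phi>"
proof -
  obtain J R w where chart: "w_chart a b f V J R w r0" using w_chart_exists[OF r0(1)] by blast
  interpret w_chart a b f V J R w r0 by (rule chart)
  obtain \<delta> where \<delta>: "0 < \<delta>" "{-\<delta>..\<delta>} \<subseteq> J"
    using chart_neighbourhood[OF chart zero_less_one] by metis
  have inJ: "y \<in> J" if "\<bar>y\<bar> \<le> \<delta>" for y using \<delta>(2) that by (auto simp: abs_le_iff)
  obtain \<alpha> \<beta> where ab: "-\<delta> \<le> \<alpha>" "\<beta> \<le> \<delta>" "well (pw0 K) (pw1 K) (pw2 K) \<alpha> \<beta>"
    by (rule well_around_minimum[OF \<delta>(1) pw_deriv(1)[OF inJ] pw_deriv(2)[OF inJ] W_continuous_chart[OF chart \<delta>(2)]])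
      (use r0 base in \<open>auto intro: that\<close>)
  then have "{\<alpha>..\<beta>} \<subseteq> J" using \<delta>(2) by (auto simp: subset_iff)
  then show ?thesis using well_orbit[OF r0(2) _ ab(3)] that by metis
qed

text \<open>Energy conservation bounds the squared radial velocity by 2 M times the squared distance
  from the critical radius, because the effective potential is quadratic there. The growth bound
  then keeps the distance zero.\<close>

lemma equilibrium_unique:
  assumes sol: "is_solution a b f V UNIV r \<phi>" and mom: "has_angular_momentum f UNIV r \<phi> K"
    and pq: "\<And>t. r t \<in> {p..q}" "{p..q} \<subseteq> I"
    and crit: "deriv (E K) (r t0) = 0" "deriv r t0 = 0"
  shows "r t = r t0"
proof -
  have cE: "continuous_on {p..q} (deriv (deriv (E K)))"
    by (rule continuous_on_subset[OF smooth_continuous_on pq(2)]) (intro smooth_deriv smooth_E)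
  obtain M where M: "0 < M" "\<And>x. x \<in> {p..q} \<Longrightarrow> \<bar>deriv (deriv (E K)) x\<bar> \<le> M"
    using continuous_on_Icc_bound[OF cE] by blast
  have v: "(deriv r t)\<^sup>2 \<le> 2 * M * (r t - r t0)\<^sup>2" for t
  proof -
    have "\<bar>E K (r t) - E K (r t0)\<bar> \<le> M * (r t - r t0)\<^sup>2"
      by (rule quadratic_bound[of p q "E K" "deriv (E K)" "deriv (deriv (E K))"])
        (use pq crit M in \<open>auto intro!: smooth_has_derivative smooth_deriv smooth_E\<close>)
    then show ?thesis using solution_energy[OF sol mom, of t t0] crit(2) by (simp add: abs_le_iff)
  qed
  have "(r t - r t0)\<^sup>2 = 0"
  proof (rule zero_of_growth_bound[of "\<lambda>t. (r t - r t0)\<^sup>2"])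
    show "((\<lambda>t. (r t - r t0)\<^sup>2) has_real_derivative 2 * (r t - r t0) * deriv r t) (at t)" for t
      by (auto intro!: derivative_eq_intros solution_r[OF sol mom])
    show "\<bar>2 * (r t - r t0) * deriv r t\<bar> \<le> (1 + 2 * M) * (r t - r t0)\<^sup>2" for t
    proof -
      have "\<bar>2 * x * y\<bar> \<le> x\<^sup>2 + y\<^sup>2" for x y :: real
        using sum_squares_bound[of x y] sum_squares_bound[of "-x" y] by (simp add: abs_le_iff)
      from this[of "r t - r t0" "deriv r t"] v[of t] show ?thesis by (simp add: distrib_right)
    qed
  qed auto
  then show ?thesis by simp
qed

lemma nonsingular_momentum:
  assumes "nonsingular_bounded a b f V r \<phi>"
  obtains K where "is_solution a b f V UNIV r \<phi>" "has_angular_momentum f UNIV r \<phi> K" "K \<noteq> 0"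
proof -
  have sol: "is_solution a b f V UNIV r \<phi>"
    using assms by (auto simp: nonsingular_bounded_def bounded_trajectory_def is_trajectory_def)
  moreover obtain K where "has_angular_momentum f UNIV r \<phi> K" using solution_angular_momentum[OF sol] .
  moreover from this have "K \<noteq> 0"
    using assms by (auto simp: nonsingular_bounded_def singular_def)
  ultimately show ?thesis using that by blast
qed

lemma constant_radius_circular:
  assumes sol: "is_solution a b f V UNIV r \<phi>" and mom: "has_angular_momentum f UNIV r \<phi> K"
    and "K \<noteq> 0" "\<And>t. r t = r0"
  shows "circular UNIV r \<phi>"
proof -
  define c where "c = K / (f r0)\<^sup>2"
  have r0: "r0 \<in> I" using solution_mem[OF sol mom, of 0] assms(4) by simp
  have c: "c \<noteq> 0" using assms(3) f_nonzero[OF r0] by (simp add: c_def)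
  have "\<phi> t - c * t = \<phi> 0 - c * 0" for t
  proof (rule derivative_zero_imp_eq[of UNIV "\<lambda>t. \<phi> t - c * t"])
    show "((\<lambda>t. \<phi> t - c * t) has_real_derivative 0) (at t)" for t
      using DERIV_diff[OF solution_\<phi>[OF sol mom, of t] DERIV_cmult_Id[of c t]] assms(4)
      by (simp add: c_def)
  qed auto
  note lin = this
  define p where "p = \<phi> 0 / c"
  have \<phi>: "\<phi> t = c * (t + p)" for t
  proof -
    have "c * (t + p) = c * t + \<phi> 0" using c by (simp add: distrib_left p_def)
    then show ?thesis using lin[of t] by linarith
  qed
  have "(\<lambda>t. cis (\<phi> t)) ` UNIV = (\<lambda>t. cis (c * t)) ` ((\<lambda>t. t + p) ` UNIV)"
    unfolding image_image by (simp only: \<phi>)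
  also have "(\<lambda>t. t + p) ` UNIV = UNIV" by (rule surj_plus_right)
  finally have "(\<lambda>t. cis (\<phi> t)) ` UNIV = sphere 0 1" using range_cis_linear[OF c] by simp
  moreover have "orbit UNIV r \<phi> = Pair r0 ` ((\<lambda>t. cis (\<phi> t)) ` UNIV)"
    unfolding orbit_def image_image using assms(4) by simp
  ultimately have "orbit UNIV r \<phi> = coordinate_circle r0"
    by (auto simp: coordinate_circle_def)
  then show ?thesis by (auto simp: circular_def)
qed

text \<open>The given orbit lies in its own annulus, so it is closed and its radius attains its
  extrema. Between these the effective potential lies below its common end value, with nonzero
  slopes at the ends, so they bound a well in w. Every well inside it carries an orbit of the same
  momentum in the same annulus, and \<open>isochronous_well_minimum\<close> supplies the
  circle.\<close>

lemma semilocal_stable_circle: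
  assumes ns: "nonsingular_bounded a b f V r \<phi>" and nc: "\<not> circular UNIV r \<phi>"
    and sloc: "cond_all_sloc a b f V r \<phi>"
  obtains r0 K where "r0 \<in> I" "K \<noteq> 0" "W1 K r0 = 0" "0 < W2 K r0"
proof -
  obtain K where sol: "is_solution a b f V UNIV r \<phi>" and mom: "has_angular_momentum f UNIV r \<phi> K"
    and K: "K \<noteq> 0" using nonsingular_momentum[OF ns] .
  obtain p q where pq: "{p..q} \<subseteq> I" "orbit UNIV r \<phi> \<subseteq> {p..q} \<times> sphere 0 1"
    using ns by (auto simp: nonsingular_bounded_def bounded_trajectory_def)
  have rpq: "r t \<in> {p..q}" for t
  proof -
    have "(r t, cis (\<phi> t)) \<in> orbit UNIV r \<phi>" by (auto simp: orbit_def)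
    then have "(r t, cis (\<phi> t)) \<in> {p..q} \<times> sphere 0 1" using pq(2) by blast
    then show ?thesis by simp
  qed
  have bdd: "bdd_below (range r)" "bdd_above (range r)"
    using rpq by (auto simp: bdd_below_def bdd_above_def)
  have "r t \<in> {(INF t. r t)..(SUP t. r t)}" for t
    using cINF_lower[OF bdd(1), of t] cSUP_upper[OF _ bdd(2), of t] by simp
  then have "orbit UNIV r \<phi> \<subseteq> {(INF t. r t)..(SUP t. r t)} \<times> sphere 0 1" by (auto simp: orbit_def)
  then have "closed_orbit r \<phi>" using sloc ns mom unfolding cond_all_sloc_def by blast
  then obtain T where T: "0 < T" "\<And>t. r (t + T) = r t" unfolding closed_orbit_def by blast
  \<comment> \<open>Reduction modulo the closing time T confines all values of r to those on a
    compact time interval, where extrema are attained.\<close>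
  have per: "\<exists>s\<in>{0..T}. r t = r s" for t
  proof -
    define n where "n = - \<lfloor>t / T\<rfloor>"
    have e: "r (t + of_int n * T) = r t"
      using shift_by_int_multiples[of r T 0 t n] T(2) by simp
    have "t + of_int n * T = (t / T - of_int \<lfloor>t / T\<rfloor>) * T" using T by (simp add: n_def field_simps)
    moreover have "0 \<le> t / T - of_int \<lfloor>t / T\<rfloor>" "t / T - of_int \<lfloor>t / T\<rfloor> \<le> 1" by linarith+
    ultimately have "t + of_int n * T \<in> {0..T}"
      using T(1) mult_right_mono[of "t / T - of_int \<lfloor>t / T\<rfloor>" 1 T] by simp
    then show ?thesis using e by metis
  qed
  note dr = solution_r[OF sol mom UNIV_I]
  have cr: "continuous_on S r" for S
    using dr DERIV_isCont continuous_at_imp_continuous_on by blast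
  have ne: "{0..T} \<noteq> {}" using T(1) by simp
  obtain t1 where t1: "\<And>s. s \<in> {0..T} \<Longrightarrow> r t1 \<le> r s"
    using continuous_attains_inf[OF compact_Icc ne cr] by blast
  obtain t2 where t2: "\<And>s. s \<in> {0..T} \<Longrightarrow> r s \<le> r t2"
    using continuous_attains_sup[OF compact_Icc ne cr] by blast
  define a' where "a' = r t1"
  define b' where "b' = r t2"
  have bnd: "a' \<le> r t" "r t \<le> b'" for t
    using per[of t] t1 t2 by (auto simp: a'_def b'_def)
  have "(INF t. r t) = a'" "(SUP t. r t) = b'"
    using cInf_eq_minimum[of a' "range r"] cSup_eq_maximum[of b' "range r"] bnd
    by (auto simp: a'_def b'_def)
  then have closed: "closed_orbit s \<psi>"
    if "nonsingular_bounded a b f V s \<psi>" "orbit UNIV s \<psi> \<subseteq> {a'..b'} \<times> sphere 0 1"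
      "has_angular_momentum f UNIV s \<psi> K" for s \<psi>
    using sloc that mom unfolding cond_all_sloc_def by metis
  have nonconst: "\<not> (\<forall>t. r t = x)" for x
    using constant_radius_circular[OF sol mom K] nc by blast
  have ab': "a' < b'"
  proof (rule ccontr)
    assume "\<not> a' < b'"
    then have "r t = a'" for t using bnd[of t] by simp
    then show False using nonconst by blast
  qed
  have mem': "a' \<in> I" "b' \<in> I" using rpq pq(1) unfolding a'_def b'_def by blast+
  then have sub': "{a'..b'} \<subseteq> I" by (rule einterval_Icc_subset)
  have v0: "deriv r t1 = 0" "deriv r t2 = 0"
    using DERIV_local_min[OF dr zero_less_one, of t1] DERIV_local_max[OF dr zero_less_one, of t2] bnd
    by (auto simp: a'_def b'_def)
  have level: "E K a' = E K b'"
    using solution_energy[OF sol mom UNIV_I UNIV_I, of t1 t2] v0 by (simp add: a'_def b'_def)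
  have attained: "\<exists>t. r t = x" if "x \<in> {a'..b'}" for x
  proof -
    have "connected (range r)" by (intro connected_continuous_image cr connected_UNIV)
    then have "{r t1..r t2} \<subseteq> range r" by (rule connected_contains_Icc) auto
    then show ?thesis using that by (auto simp: a'_def b'_def)
  qed
  have le: "E K x \<le> E K a'" if "x \<in> {a'..b'}" for x
  proof -
    obtain t where t: "r t = x" using attained \<open>x \<in> {a'..b'}\<close> by blast
    have "E K x \<le> (deriv r t)\<^sup>2 / 2 + E K (r t)" using t by simp
    also have "\<dots> = E K a'" using solution_energy[OF sol mom UNIV_I UNIV_I, of t t1] v0 by (simp add: a'_def)
    finally show ?thesis .
  qed
  \<comment> \<open>A critical point on the energy level of the orbit is reached with zero radial
    velocity, so the orbit would rest there and be circular.\<close>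
  have nz: "deriv (E K) x \<noteq> 0" if x: "x \<in> {a'..b'}" "E K x = E K a'" for x
  proof
    assume 0: "deriv (E K) x = 0"
    obtain t0 where t0: "r t0 = x" using attained x(1) by blast
    have "deriv r t0 = 0"
      using solution_energy[OF sol mom UNIV_I UNIV_I, of t0 t1] v0 x(2) t0 by (simp add: a'_def)
    then have "r t = r t0" for t
      using equilibrium_unique[OF sol mom rpq pq(1)] 0 t0 by blast
    then show False using nonconst by blast
  qed
  note dE = smooth_has_derivative[OF smooth_E, of _ K]
  have s1: "deriv (E K) a' < 0"
  proof (rule ccontr)
    assume "\<not> deriv (E K) a' < 0"
    then have "0 < deriv (E K) a'" using nz[of a'] ab' by simp
    from DERIV_pos_inc_right[OF dE[OF mem'(1)] this] obtain d where
      d: "0 < d" "\<And>h. 0 < h \<Longrightarrow> h < d \<Longrightarrow> E K a' < E K (a' + h)" by blast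
    define h where "h = min (d / 2) (b' - a')"
    have "0 < h" "h < d" "a' + h \<in> {a'..b'}" using d(1) ab' by (auto simp: h_def)
    then show False using d(2)[of h] le[of "a' + h"] by simp
  qed
  have s2: "0 < deriv (E K) b'"
  proof (rule ccontr)
    assume "\<not> 0 < deriv (E K) b'"
    then have "deriv (E K) b' < 0" using nz[of b'] ab' level by simp
    from DERIV_neg_dec_left[OF dE[OF mem'(2)] this] obtain d where
      d: "0 < d" "\<And>h. 0 < h \<Longrightarrow> h < d \<Longrightarrow> E K b' < E K (b' - h)" by blast
    define h where "h = min (d / 2) (b' - a')"
    have "0 < h" "h < d" "b' - h \<in> {a'..b'}" using d(1) ab' by (auto simp: h_def)
    then show False using d(2)[of h] le[of "b' - h"] level by simp
  qed
  have below: "E K x < E K a'" if x: "a' < x" "x < b'" for x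
  proof (rule ccontr)
    assume "\<not> E K x < E K a'"
    then have eq: "E K x = E K a'" using le[of x] x by simp
    have "deriv (E K) x = 0"
    proof (rule DERIV_local_max[OF dE])
      show "x \<in> I" using sub' x by auto
      show "0 < min (x - a') (b' - x)" using x by simp
      show "\<forall>y. \<bar>x - y\<bar> < min (x - a') (b' - x) \<longrightarrow> E K y \<le> E K x"
        unfolding eq by (intro allI impI le) (simp add: abs_less_iff)
    qed
    then show False using nz[of x] eq x by simp
  qed
  obtain J R w where chart: "w_chart a b f V J R w a'" using w_chart_exists[OF mem'(1)] by blast
  interpret w_chart a b f V J R w a' by (rule chart)
  have wJ: "w a' \<in> J" "w b' \<in> J" using w_mem mem' by auto
  have sub: "{w a'..w b'} \<subseteq> J" by (rule J_Icc[OF wJ])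
  have R': "R (w a') = a'" "R (w b') = b'" using R_w mem' by auto
  have wless: "w a' < w b'"
  proof (rule ccontr)
    assume "\<not> w a' < w b'"
    then have "R (w b') \<le> R (w a')" using R_mono'[OF wJ(2,1)] by simp
    then show False using ab' R' by simp
  qed
  have well: "well (pw0 K) (pw1 K) (pw2 K) (w a') (w b')"
  proof
    show "continuous_on {w a'..w b'} (pw2 K)" by (rule W_continuous_chart[OF chart sub])
    show "W0 K (R (w a')) = W0 K (R (w b'))" using level by (simp add: R' W0_def)
    show "W0 K (R x) < W0 K (R (w a'))" if "w a' < x" "x < w b'" for x
    proof -
      have x: "x \<in> J" using sub that by auto
      have "a' < R x" "R x < b'" using R_mono[OF wJ(1) x] R_mono[OF x wJ(2)] that R' by auto
      then show ?thesis using below[of "R x"] K by (simp add: R' W0_def divide_strict_right_mono)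
    qed
    show "W1 K (R (w a')) < 0" "0 < W1 K (R (w b'))"
      using s1 s2 K f_nonzero mem' by (simp_all add: R' W1_E divide_neg_pos mult_pos_neg)
  qed (use wless pw_deriv sub in auto)
  have rat: "well_period (pw2 K) \<alpha> \<beta> / (2 * pi) \<in> \<rat>"
    if "w a' \<le> \<alpha>" "\<beta> \<le> w b'" and w: "well (pw0 K) (pw1 K) (pw2 K) \<alpha> \<beta>" for \<alpha> \<beta>
  proof -
    have lt: "\<alpha> < \<beta>" by (rule well.\<alpha>\<beta>[OF w])
    have mem: "\<alpha> \<in> {w a'..w b'}" "\<beta> \<in> {w a'..w b'}" using that lt by auto
    then have J2: "\<alpha> \<in> J" "\<beta> \<in> J" using sub by blast+
    obtain s \<psi> where s: "nonsingular_bounded a b f V s \<psi>" "has_angular_momentum f UNIV s \<psi> K"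
      "orbit UNIV s \<psi> \<subseteq> {R \<alpha>..R \<beta>} \<times> sphere 0 1" "\<not> circular UNIV s \<psi>"
      "closed_orbit s \<psi> \<longrightarrow> well_period (pw2 K) \<alpha> \<beta> / (2 * pi) \<in> \<rat>"
      by (rule well_orbit[OF K J_Icc[OF J2] w], rule that)
    have "a' \<le> R \<alpha>" "R \<beta> \<le> b'" using R_mono'[OF wJ(1) J2(1)] R_mono'[OF J2(2) wJ(2)] that R' by auto
    then have "{R \<alpha>..R \<beta>} \<times> sphere 0 1 \<subseteq> {a'..b'} \<times> (sphere 0 1 :: complex set)" by auto
    then show ?thesis using closed[OF s(1) _ s(2)] s(3,5) by blast
  qed
  obtain c where c: "w a' < c" "c < w b'" "W1 K (R c) = 0" "0 < W2 K (R c)"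
    by (rule isochronous_well_minimum[OF well], erule (2) rat, rule that)
  have "c \<in> J" using sub c(1,2) by auto
  then show ?thesis using that[of "R c" K] R_mem K c by blast
qed

end

section \<open>Orbital stability of circular orbits\<close>

lemma dist_quadruple_le:
  fixes x x' v v' y y' :: real and z :: complex
  shows "dist (x, z, v, y) (x', z, v', y') \<le> \<bar>x - x'\<bar> + \<bar>v - v'\<bar> + \<bar>y - y'\<bar>"
proof -
  have 1: "dist (p, q) (p', q') \<le> dist p p' + dist q q'"
    for p p' :: "'p::metric_space" and q q' :: "'q::metric_space"
    using sqrt_sum_squares_le_sum_abs[of "dist p p'" "dist q q'"] by (simp add: dist_Pair_Pair)
  have "dist (x, z, v, y) (x', z, v', y') \<le> dist x x' + dist (z, v, y) (z, v', y')" by (rule 1)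
  also have "dist (z, v, y) (z, v', y') \<le> dist z z + dist (v, y) (v', y')" by (rule 1)
  also have "dist (v, y) (v', y') \<le> dist v v' + dist y y'" by (rule 1)
  finally show ?thesis by (simp add: dist_real_def)
qed

context central_field
begin

text \<open>The energy serves as a Lyapunov function: at fixed K the radius cannot cross the barrier
  around a strict minimum, the radial velocity is controlled by the energy excess, and the angular
  velocity K / f^2 follows the radius.\<close>

lemma stable_circle_orbitally_stable:
  assumes r0: "r0 \<in> I" "K \<noteq> 0" "W1 K r0 = 0" "0 < W2 K r0"
  shows "orbitally_stable_circular a b f V r0 K"
proof -
  define \<phi> where "\<phi> t = K / (f r0)\<^sup>2 * t" for t
  have c: "deriv (E K) r0 = 0" using W1_zero_iff r0 by simp
  then have "V' r0 = K\<^sup>2 * f' r0 / f r0 ^ 3" using deriv_E r0(1) by simp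
  from circular_trajectory[OF r0(1,2) this]
  have circ: "circular_trajectory_at a b f V r0 K UNIV (\<lambda>_. r0) \<phi>" by (simp add: \<phi>_def[abs_def])
  have d\<phi>: "deriv \<phi> t = K / (f r0)\<^sup>2" for t
    unfolding \<phi>_def by (rule DERIV_imp_deriv) (rule DERIV_cmult_Id)
  have phase: "phase_point (\<lambda>_. r0) \<phi> t = (r0, cis (\<phi> t), 0, K / (f r0)\<^sup>2)" for t
    by (simp add: phase_point_def d\<phi>)
  obtain d where d: "0 < d" "{r0 - d..r0 + d} \<subseteq> I"
    "\<And>x. x \<in> {r0 - d..r0 + d} \<Longrightarrow> x \<noteq> r0 \<Longrightarrow> E K r0 < E K x"
    using E_strict_local_min[OF r0] by blast
  have "orbitally_stable a b f V K UNIV (\<lambda>_. r0) \<phi>"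
    unfolding orbitally_stable_def
  proof (intro allI impI)
    fix U assume U: "open U \<and> phase_point (\<lambda>_. r0) \<phi> ` UNIV \<subseteq> U"
    \<comment> \<open>The whole phase curve as a compact circle, so that U contains a neighbourhood
      of it of uniform radius e.\<close>
    define C where "C = {r0} \<times> sphere (0::complex) 1 \<times> {0::real} \<times> {K / (f r0)\<^sup>2}"
    have "C \<subseteq> U"
    proof
      fix p assume "p \<in> C"
      then obtain z where z: "z \<in> sphere 0 1" "p = (r0, z, 0, K / (f r0)\<^sup>2)" by (auto simp: C_def)
      have "K / (f r0)\<^sup>2 \<noteq> 0" using r0 f_nonzero by simp
      from range_cis_linear[OF this] obtain t where "z = cis (K / (f r0)\<^sup>2 * t)"
        using z(1) by blast
      then have "p = phase_point (\<lambda>_. r0) \<phi> t" using z phase by (simp add: \<phi>_def)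
      then show "p \<in> U" using U by blast
    qed
    moreover have "compact C" unfolding C_def by (intro compact_Times) auto
    ultimately obtain e where e: "0 < e" "(\<Union>p\<in>C. ball p e) \<subseteq> U"
      using compact_subset_open_imp_ball_epsilon_subset[of C U] U by blast
    have "isCont (\<lambda>x. K / (f x)\<^sup>2) r0"
      using smooth_isCont[OF smooth_f r0(1)] f_nonzero[OF r0(1)] by (intro continuous_intros) auto
    moreover have "0 < e / 3" using e(1) by simp
    ultimately have "\<exists>s>0. \<forall>x. dist x r0 < s \<longrightarrow> dist (K / (f x)\<^sup>2) (K / (f r0)\<^sup>2) < e / 3"
      unfolding continuous_at_eps_delta by blast
    then obtain s where s: "0 < s" "\<And>x. \<bar>x - r0\<bar> < s \<Longrightarrow> \<bar>K / (f x)\<^sup>2 - K / (f r0)\<^sup>2\<bar> < e / 3"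
      by (auto simp: dist_real_def)
    define \<delta> where "\<delta> = min d (min (s / 2) (e / 4))"
    have \<delta>: "0 < \<delta>" "\<delta> \<le> d" "\<delta> < s" "\<delta> < e / 3" using d s e by (auto simp: \<delta>_def)
    have sub: "{r0 - \<delta>..r0 + \<delta>} \<subseteq> {r0 - d..r0 + d}" using \<delta> by auto
    \<comment> \<open>An energy excess below the two barrier heights at distance \<delta> prevents
      crossing, and one below \<delta>^2 / 2 keeps the radial speed under \<delta>.\<close>
    define \<epsilon> where "\<epsilon> = min (\<delta>\<^sup>2 / 2) (min (E K (r0 + \<delta>) - E K r0) (E K (r0 - \<delta>) - E K r0))"
    have \<epsilon>: "0 < \<epsilon>" using d(3)[of "r0 + \<delta>"] d(3)[of "r0 - \<delta>"] \<delta> by (simp add: \<epsilon>_def)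
    define S where "S = {p :: real \<times> complex \<times> real \<times> real. \<bar>fst p - r0\<bar> < \<delta>}"
    define g where "g p = (fst (snd (snd p)))\<^sup>2 / 2 + E K (fst p)" for p :: "real \<times> complex \<times> real \<times> real"
    define N where "N = S \<inter> g -` {..<E K r0 + \<epsilon>}"
    have "open S" unfolding S_def by (intro open_Collect_less continuous_intros)
    moreover have "continuous_on S g"
    proof -
      have "fst p \<in> I" if "p \<in> S" for p
      proof -
        have "fst p \<in> {r0 - d..r0 + d}" using that \<delta>(2) by (auto simp: S_def abs_less_iff)
        then show ?thesis using d(2) by blast
      qed
      then show ?thesis
        unfolding g_def
        by (intro continuous_intros continuous_on_compose2[OF smooth_continuous_on[OF smooth_E]]) auto
    qed
    ultimately have "open N" unfolding N_def by (intro continuous_open_preimage) auto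
    moreover have "phase_point (\<lambda>_. r0) \<phi> ` UNIV \<subseteq> N"
      using \<delta>(1) \<epsilon> by (auto simp: phase N_def S_def g_def)
    moreover have "phase_point s \<psi> t \<in> U"
      if tr: "is_trajectory a b f V J s \<psi>" and mom: "has_angular_momentum f J s \<psi> K"
        and t: "t0 \<in> J" "phase_point s \<psi> t0 \<in> N" "t \<in> J" "t0 \<le> t" for J s \<psi> t0 t
    proof -
      have sol: "is_solution a b f V J s \<psi>" using tr by (simp add: is_trajectory_def)
      have J: "{t0..t} \<subseteq> J" using mem_is_interval_1_I[OF solution_J(2)[OF sol mom] t(1,3)] by auto
      have start: "\<bar>s t0 - r0\<bar> < \<delta>" "(deriv s t0)\<^sup>2 / 2 + E K (s t0) < E K r0 + \<epsilon>"
        using t(2) by (auto simp: phase_point_def N_def S_def g_def)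
      have en: "(deriv s u)\<^sup>2 / 2 + E K (s u) < E K r0 + \<epsilon>" if "u \<in> J" for u
        using solution_energy[OF sol mom that t(1)] start(2) by simp
      have near: "\<bar>s t - r0\<bar> < \<delta>"
      proof (rule ccontr)
        assume "\<not> \<bar>s t - r0\<bar> < \<delta>"
        then have "\<exists>u\<ge>t0. u \<le> t \<and> \<bar>s u - r0\<bar> = \<delta>"
        proof (intro IVT')
          have "isCont s u" if "u \<in> {t0..t}" for u
            using DERIV_isCont[OF solution_r[OF sol mom]] J that by blast
          then show "continuous_on {t0..t} (\<lambda>u. \<bar>s u - r0\<bar>)"
            by (intro continuous_intros continuous_at_imp_continuous_on) auto
        qed (use start t in auto)
        then obtain u where u: "t0 \<le> u" "u \<le> t" "\<bar>s u - r0\<bar> = \<delta>" by blast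
        then have "s u = r0 + \<delta> \<or> s u = r0 - \<delta>" by (auto simp: abs_if split: if_splits)
        then have "E K r0 + \<epsilon> \<le> E K (s u)" by (auto simp: \<epsilon>_def)
        moreover have "u \<in> J" using u J by auto
        ultimately show False using en[of u] zero_le_power2[of "deriv s u"] by linarith
      qed
      have "E K r0 \<le> E K (s t)"
        using d(3)[of "s t"] near \<delta>(2) by (cases "s t = r0") (auto simp: abs_less_iff)
      then have "(deriv s t)\<^sup>2 / 2 < \<epsilon>" using en[OF t(3)] by linarith
      then have "(deriv s t)\<^sup>2 < \<delta>\<^sup>2" by (simp add: \<epsilon>_def)
      then have v: "\<bar>deriv s t\<bar> < \<delta>" using \<delta>(1) power2_less_imp_less[of "\<bar>deriv s t\<bar>" \<delta>] by simp
      have y: "\<bar>deriv \<psi> t - K / (f r0)\<^sup>2\<bar> < e / 3"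
        unfolding solution_deriv_\<phi>[OF sol mom t(3)] using s(2)[of "s t"] near \<delta>(3) by simp
      define p where "p = (r0, cis (\<psi> t), 0::real, K / (f r0)\<^sup>2)"
      have "dist (phase_point s \<psi> t) p < e"
        using dist_quadruple_le[of "s t" "cis (\<psi> t)" "deriv s t" "deriv \<psi> t" r0 0 "K / (f r0)\<^sup>2"] near v y \<delta>(4)
        by (simp add: phase_point_def p_def)
      moreover have "p \<in> C" by (simp add: p_def C_def)
      ultimately show ?thesis using e(2) by (force simp: dist_commute)
    qed
    ultimately show "\<exists>N. open N \<and> phase_point (\<lambda>_. r0) \<phi> ` UNIV \<subseteq> N \<and>
         (\<forall>J s \<psi> t0. is_trajectory a b f V J s \<psi> \<and> has_angular_momentum f J s \<psi> K \<and>
            t0 \<in> J \<and> phase_point s \<psi> t0 \<in> N \<longrightarrow>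
            (\<forall>t\<in>J. t0 \<le> t \<longrightarrow> phase_point s \<psi> t \<in> U))"
      by (intro exI[of _ N] conjI) blast+
  qed
  then show ?thesis using circ unfolding orbitally_stable_circular_def by blast
qed

text \<open>If the kinetic energy is bounded below along the whole interval, the trajectory sweeps out
  the whole interval; this already makes the solution found by quadrature maximal.\<close>

lemma sweeping_trajectory:
  assumes r0: "r0 \<in> I" and v: "0 < v" and max: "\<And>x. x \<in> I \<Longrightarrow> E K x \<le> E K r0"
  obtains J \<rho> \<psi> where "is_trajectory a b f V J \<rho> \<psi>" "has_angular_momentum f J \<rho> \<psi> K"
    "0 \<in> J" "\<rho> 0 = r0" "deriv \<rho> 0 = v" "\<psi> 0 = \<psi>0"
    "\<And>x. x \<in> I \<Longrightarrow> r0 \<le> x \<Longrightarrow> \<exists>t\<in>J. 0 \<le> t \<and> \<rho> t = x"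
proof -
  \<comment> \<open>Square of the radial speed belonging to the energy
    \<open>E K r0 + v\<^sup>2 / 2\<close>; its inverse root \<open>q\<close> is the time spent per
    unit of radius.\<close>
  define h where "h x = 2 * (E K r0 + v\<^sup>2 / 2 - E K x)" for x
  have h: "v\<^sup>2 \<le> h x" if "x \<in> I" for x using max[OF that] by (simp add: h_def)
  have h_pos: "0 < h x" if "x \<in> I" for x
  proof -
    have "0 < v\<^sup>2" using v by simp
    then show ?thesis using h[OF that] by linarith
  qed
  define q where "q x = 1 / sqrt (h x)" for x
  have cE: "continuous_on I (E K)" by (rule smooth_continuous_on[OF smooth_E])
  have q: "continuous_on I q" "\<And>x. x \<in> I \<Longrightarrow> 0 < q x"
  proof -
    show "continuous_on I q"
      unfolding q_def h_def using h_pos by (intro continuous_intros cE) (force simp: h_def)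
    show "0 < q x" if "x \<in> I" for x using h_pos[OF that] by (simp add: q_def)
  qed
  obtain \<tau> \<rho> J where chart: "open J" "is_interval J" "(0::real) \<in> J" "\<rho> 0 = r0" "\<tau> r0 = 0"
    "\<And>r. r \<in> I \<Longrightarrow> \<tau> r \<in> J" "\<And>r. r \<in> I \<Longrightarrow> \<rho> (\<tau> r) = r"
    "\<And>x. x \<in> J \<Longrightarrow> \<rho> x \<in> I" "\<And>x. x \<in> J \<Longrightarrow> \<tau> (\<rho> x) = x"
    "\<And>x y. x \<in> J \<Longrightarrow> y \<in> J \<Longrightarrow> x < y \<Longrightarrow> \<rho> x < \<rho> y"
    "\<And>x. x \<in> J \<Longrightarrow> (\<rho> has_real_derivative 1 / q (\<rho> x)) (at x)"
    by (rule einterval_chart[OF ab q r0], assumption, rule that)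
  have d\<rho>: "(\<rho> has_real_derivative sqrt (h (\<rho> t))) (at t)" if "t \<in> J" for t
    using chart(11)[OF that] by (simp add: q_def)
  have dh: "(h has_real_derivative - 2 * deriv (E K) x) (at x)" if "x \<in> I" for x
    unfolding h_def by (auto intro!: derivative_eq_intros smooth_has_derivative[OF smooth_E] that)
  have dv: "((\<lambda>t. sqrt (h (\<rho> t))) has_real_derivative K\<^sup>2 * f' (\<rho> t) / f (\<rho> t) ^ 3 - V' (\<rho> t)) (at t)" if "t \<in> J" for t
  proof -
    note \<rho>I = chart(8)[OF that]
    have "((\<lambda>t. sqrt (h (\<rho> t))) has_real_derivative
        inverse (sqrt (h (\<rho> t))) / 2 * ((- 2 * deriv (E K) (\<rho> t)) * sqrt (h (\<rho> t)))) (at t)"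
      by (rule DERIV_chain2[OF DERIV_real_sqrt[OF h_pos[OF \<rho>I]] DERIV_chain2[OF dh[OF \<rho>I] d\<rho>[OF that]]])
    moreover have "inverse (sqrt (h (\<rho> t))) / 2 * ((- 2 * deriv (E K) (\<rho> t)) * sqrt (h (\<rho> t))) = - deriv (E K) (\<rho> t)"
      using h_pos[OF \<rho>I] by (simp add: field_simps)
    ultimately have "((\<lambda>t. sqrt (h (\<rho> t))) has_real_derivative - deriv (E K) (\<rho> t)) (at t)" by (simp only:)
    then show ?thesis unfolding deriv_E[OF \<rho>I] by simp
  qed
  have "continuous_on I (\<lambda>x. K / (f x)\<^sup>2 * q x)"
    by (intro continuous_intros q smooth_continuous_on[OF smooth_f]) (simp add: f_nonzero)
  then obtain \<Phi> where \<Phi>: "\<And>x. x \<in> I \<Longrightarrow> (\<Phi> has_real_derivative K / (f x)\<^sup>2 * q x) (at x)"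
    using einterval_primitive[OF ab] by blast
  define \<psi> where "\<psi> t = \<Phi> (\<rho> t) - \<Phi> r0 + \<psi>0" for t
  have d\<psi>: "(\<psi> has_real_derivative K / (f (\<rho> t))\<^sup>2) (at t)" if "t \<in> J" for t
  proof -
    have "((\<lambda>t. \<Phi> (\<rho> t)) has_real_derivative K / (f (\<rho> t))\<^sup>2 * q (\<rho> t) * (1 / q (\<rho> t))) (at t)"
      by (rule DERIV_chain2[OF \<Phi>[OF chart(8)[OF that]] chart(11)[OF that]])
    moreover have "q (\<rho> t) \<noteq> 0" using q(2)[OF chart(8)[OF that]] by simp
    ultimately have "((\<lambda>t. \<Phi> (\<rho> t)) has_real_derivative K / (f (\<rho> t))\<^sup>2) (at t)" by simp
    then show ?thesis unfolding \<psi>_def by (auto intro!: derivative_eq_intros)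
  qed
  have "J \<noteq> {}" using chart(3) by blast
  note sol = solutionI[OF chart(1,2) this chart(8) d\<rho> dv d\<psi>]
  \<comment> \<open>On a compact time interval reaching beyond J, an extension has a radius with an
    extremum attained inside I. Points of I past this extremum are already visited at times of J
    within that interval, which is a contradiction.\<close>
  have "J' = J" if J': "is_solution a b f V J' s \<eta>" "J \<subseteq> J'" "\<forall>t\<in>J. s t = \<rho> t \<and> \<eta> t = \<psi> t" for J' s \<eta>
  proof (rule ccontr)
    assume "J' \<noteq> J"
    then obtain t where t: "t \<in> J'" "t \<notin> J" using J'(2) by blast
    obtain K' where mom': "has_angular_momentum f J' s \<eta> K'" using solution_angular_momentum[OF J'(1)] .
    have 0: "0 \<in> J'" using chart(3) J'(2) by blast
    have sub: "{x..y} \<subseteq> J'" if "x \<in> J'" "y \<in> J'" for x y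
      using mem_is_interval_1_I[OF solution_J(2)[OF J'(1) mom'] that] by auto
    have cs: "continuous_on A s" if "A \<subseteq> J'" for A
    proof (intro continuous_at_imp_continuous_on ballI)
      fix x assume "x \<in> A"
      then have "x \<in> J'" using that by blast
      from solution_r[OF J'(1) mom' this] show "isCont s x" by (rule DERIV_isCont)
    qed
    have order: "\<tau> x < \<tau> y" if "x \<in> I" "y \<in> I" "x < y" for x y
    proof (rule ccontr)
      assume "\<not> \<tau> x < \<tau> y"
      then have "\<tau> y = \<tau> x \<or> \<tau> y < \<tau> x" by linarith
      then have "\<rho> (\<tau> y) \<le> \<rho> (\<tau> x)" using chart(10)[OF chart(6) chart(6), OF that(2,1)] by auto
      then show False using chart(7)[OF that(1)] chart(7)[OF that(2)] that(3) by simp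
    qed
    have "t \<noteq> 0" using t(2) chart(3) by auto
    then consider "0 < t" | "t < 0" by linarith
    then show False
    proof cases
      case 1
      have "{0..t} \<noteq> {}" using 1 by simp
      then obtain m where m: "m \<in> {0..t}" "\<And>u. u \<in> {0..t} \<Longrightarrow> s u \<le> s m"
        using continuous_attains_sup[OF compact_Icc _ cs[OF sub[OF 0 t(1)]]] by metis
      have "s m \<in> I" using solution_mem[OF J'(1) mom'] sub[OF 0 t(1)] m(1) by blast
      then obtain e where e: "0 < e" "{s m - e..s m + e} \<subseteq> I"
        using einterval_obtain_Icc[of "s m" a b 1] by auto
      define x where "x = s m + e"
      have x: "x \<in> I" using e by (auto simp: x_def intro!: subsetD[OF e(2)])
      have "r0 \<le> s m" using m(2)[of 0] 1 J'(3) chart(3,4) by simp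
      then have "0 < \<tau> x" using order[OF r0 x] e(1) chart(5) by (simp add: x_def)
      moreover have "\<tau> x < t"
        using t(2) mem_is_interval_1_I[OF chart(2,3) chart(6)[OF x], of t] 1 by (cases "\<tau> x < t") auto
      ultimately have "s (\<tau> x) \<le> s m" by (intro m(2)) auto
      moreover have "s (\<tau> x) = x" using J'(3) chart(6,7) x by simp
      ultimately show False using e(1) by (simp add: x_def)
    next
      case 2
      have "{t..0} \<noteq> {}" using 2 by simp
      then obtain m where m: "m \<in> {t..0}" "\<And>u. u \<in> {t..0} \<Longrightarrow> s m \<le> s u"
        using continuous_attains_inf[OF compact_Icc _ cs[OF sub[OF t(1) 0]]] by metis
      have "s m \<in> I" using solution_mem[OF J'(1) mom'] sub[OF t(1) 0] m(1) by blast
      then obtain e where e: "0 < e" "{s m - e..s m + e} \<subseteq> I"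
        using einterval_obtain_Icc[of "s m" a b 1] by auto
      define x where "x = s m - e"
      have x: "x \<in> I" using e by (auto simp: x_def intro!: subsetD[OF e(2)])
      have "s m \<le> r0" using m(2)[of 0] 2 J'(3) chart(3,4) by simp
      then have "\<tau> x < 0" using order[OF x r0] e(1) chart(5) by (simp add: x_def)
      moreover have "t < \<tau> x"
        using t(2) mem_is_interval_1_I[OF chart(2) chart(6)[OF x] chart(3), of t] 2 by (cases "t < \<tau> x") auto
      ultimately have "s m \<le> s (\<tau> x)" by (intro m(2)) auto
      moreover have "s (\<tau> x) = x" using J'(3) chart(6,7) x by simp
      ultimately show False using e(1) by (simp add: x_def)
    qed
  qed
  then have "is_trajectory a b f V J \<rho> \<psi>" using sol(1) unfolding is_trajectory_def by blast
  moreover have "deriv \<rho> 0 = v"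
    using DERIV_imp_deriv[OF d\<rho>[OF chart(3)]] v by (simp add: chart(4) h_def)
  moreover have "\<psi> 0 = \<psi>0" by (simp add: \<psi>_def chart(4))
  moreover have "\<exists>t\<in>J. 0 \<le> t \<and> \<rho> t = x" if "x \<in> I" "r0 \<le> x" for x
  proof (intro bexI[of _ "\<tau> x"] conjI)
    show "0 \<le> \<tau> x"
    proof (rule ccontr)
      assume "\<not> 0 \<le> \<tau> x"
      then have "\<rho> (\<tau> x) < \<rho> 0" using chart(10)[OF chart(6)[OF that(1)] chart(3)] by simp
      then show False using chart(4) chart(7)[OF that(1)] that(2) by simp
    qed
  qed (use chart(6,7) that in auto)
  ultimately show ?thesis using that[of J \<rho> \<psi>] sol(2) chart(3,4) by blast
qed

text \<open>At a global maximum of the effective potential an outward start, however slow, never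
  loses kinetic energy below its initial value. The trajectory sweeps through all larger radii and
  leaves a fixed annulus.\<close>

lemma maximum_unstable:
  assumes circ: "circular_trajectory_at a b f V r0 K J r \<phi>"
    and max: "\<And>x. x \<in> I \<Longrightarrow> E K x \<le> E K r0"
  shows "\<not> orbitally_stable a b f V K J r \<phi>"
proof
  assume stable: "orbitally_stable a b f V K J r \<phi>"
  note c = circular_trajectory_imp[OF circ]
  have sol: "is_solution a b f V J r \<phi>" and mom: "has_angular_momentum f J r \<phi> K"
    using circ by (auto simp: circular_trajectory_at_def is_trajectory_def)
  obtain t0 where t0: "t0 \<in> J" using solution_J(3)[OF sol mom] by blast
  obtain d where d: "0 < d" "{r0 - d..r0 + d} \<subseteq> I"
    using einterval_obtain_Icc[OF c(1) zero_less_one] by metis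
  define U where "U = {p :: real \<times> complex \<times> real \<times> real. \<bar>fst p - r0\<bar> < d}"
  have "open U" unfolding U_def by (intro open_Collect_less continuous_intros)
  moreover have "phase_point r \<phi> ` J \<subseteq> U"
    using c(4) d(1) by (auto simp: U_def phase_point_def)
  ultimately obtain N where N: "open N" "phase_point r \<phi> ` J \<subseteq> N"
    "\<And>J s \<psi> t0 t. is_trajectory a b f V J s \<psi> \<Longrightarrow> has_angular_momentum f J s \<psi> K \<Longrightarrow>
       t0 \<in> J \<Longrightarrow> phase_point s \<psi> t0 \<in> N \<Longrightarrow> t \<in> J \<Longrightarrow> t0 \<le> t \<Longrightarrow> phase_point s \<psi> t \<in> U"
    using stable[unfolded orbitally_stable_def, rule_format, of U] by metis
  have p: "phase_point r \<phi> t0 = (r0, cis (\<phi> t0), 0, K / (f r0)\<^sup>2)"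
    using c(4,5)[OF t0] solution_deriv_\<phi>[OF sol mom t0] by (simp add: phase_point_def)
  obtain e where e: "0 < e" "ball (phase_point r \<phi> t0) e \<subseteq> N"
    using N(1,2) t0 open_contains_ball by blast
  \<comment> \<open>The perturbed start differs from the circle in the radial velocity alone, and by
    less than e.\<close>
  define v where "v = e / 2"
  have v: "0 < v" using e by (simp add: v_def)
  obtain J' \<rho> \<psi> where s: "is_trajectory a b f V J' \<rho> \<psi>" "has_angular_momentum f J' \<rho> \<psi> K"
    "0 \<in> J'" "\<rho> 0 = r0" "deriv \<rho> 0 = v" "\<psi> 0 = \<phi> t0"
    "\<And>x. x \<in> I \<Longrightarrow> r0 \<le> x \<Longrightarrow> \<exists>t\<in>J'. 0 \<le> t \<and> \<rho> t = x"
    by (rule sweeping_trajectory[OF c(1) v max], assumption, rule that)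
  have sol': "is_solution a b f V J' \<rho> \<psi>" using s(1) by (simp add: is_trajectory_def)
  have p': "phase_point \<rho> \<psi> 0 = (r0, cis (\<phi> t0), v, K / (f r0)\<^sup>2)"
    using s solution_deriv_\<phi>[OF sol' s(2,3)] by (simp add: phase_point_def)
  have "dist (phase_point r \<phi> t0) (phase_point \<rho> \<psi> 0) < e"
    using dist_quadruple_le[of r0 "cis (\<phi> t0)" 0 "K / (f r0)\<^sup>2" r0 v "K / (f r0)\<^sup>2"] e(1)
    unfolding p p' by (simp add: v_def)
  then have "phase_point \<rho> \<psi> 0 \<in> N" using e(2) by auto
  moreover have "r0 + d \<in> I" using d by (auto intro!: subsetD[OF d(2)])
  then obtain t where "t \<in> J'" "0 \<le> t" "\<rho> t = r0 + d" using s(7)[of "r0 + d"] d(1) by auto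
  ultimately have "phase_point \<rho> \<psi> t \<in> U" "\<rho> t = r0 + d" using N(3)[OF s(1-3)] by auto
  then show False using d(1) by (simp add: U_def phase_point_def)
qed

end

section \<open>Isochronous fields are oscillators\<close>

locale bertrand_field = central_field +
  assumes f'_nonzero: "\<And>r. r \<in> I \<Longrightarrow> f' r \<noteq> 0"
    and no_constant_curvature_form: "\<not> (\<exists>\<xi> \<in> \<rat>. \<xi> > 0 \<and>
       (\<forall>r \<in> I. deriv (deriv f) r * f r - (deriv f r)\<^sup>2 = - (\<xi>\<^sup>2)))"
begin

text \<open>This is the derivative of 1 / (2 f^2) in w. The slope of the potential in w is then
  \<open>U1 r / K\<^sup>2 + P r\<close>, and every further derivative splits in the same way into a
  part from V and a part from the metric.\<close>

definition P :: "real \<Rightarrow> real" where "P r = - f' r / f r"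
definition s :: "real \<Rightarrow> real" where "s r = (f' r)\<^sup>2 - f r * deriv f' r"
definition "s1 = D s"
definition "s2 = D s1"
definition "U1 = D V"
definition "U2 = D U1"
definition "U3 = D U2"
definition "U4 = D U3"
definition \<nu> :: "real \<Rightarrow> real" where "\<nu> r = - U1 r / P r"

lemma P_nonzero: "r \<in> I \<Longrightarrow> P r \<noteq> 0"
  using f'_nonzero f_nonzero by (simp add: P_def)

lemma smooth_P: "smooth_on_interval a b P"
  unfolding P_def[abs_def] by (intro smooth_intros smooth_f) (simp add: f_nonzero)

lemma smooth_s: "smooth_on_interval a b s"
  unfolding s_def[abs_def] by (intro smooth_intros smooth_f)

lemma smooth_U: "smooth_on_interval a b U1" "smooth_on_interval a b U2"
  "smooth_on_interval a b U3" "smooth_on_interval a b U4"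
  unfolding U1_def U2_def U3_def U4_def by (intro smooth_D smooth_V)+

lemma smooth_\<nu>: "smooth_on_interval a b \<nu>"
  unfolding \<nu>_def[abs_def] by (intro smooth_intros smooth_U smooth_P P_nonzero)

lemma D_derivs:
  assumes "r \<in> I"
  shows "(P has_real_derivative s r / (f r)\<^sup>2) (at r)"
    "(s has_real_derivative s1 r / (f r)\<^sup>2) (at r)"
    "(s1 has_real_derivative s2 r / (f r)\<^sup>2) (at r)"
    "(V has_real_derivative U1 r / (f r)\<^sup>2) (at r)"
    "(U1 has_real_derivative U2 r / (f r)\<^sup>2) (at r)"
    "(U2 has_real_derivative U3 r / (f r)\<^sup>2) (at r)"
    "(U3 has_real_derivative U4 r / (f r)\<^sup>2) (at r)"
proof -
  have "(P has_real_derivative (- deriv f' r * f r - - f' r * f' r) / (f r * f r)) (at r)"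
    unfolding P_def[abs_def]
    by (intro DERIV_divide DERIV_minus f_deriv smooth_has_derivative[OF smooth_deriv[OF smooth_f]] assms f_nonzero)
  moreover have "- deriv f' r * f r - - f' r * f' r = s r"
    by (simp add: s_def power2_eq_square)
  ultimately show "(P has_real_derivative s r / (f r)\<^sup>2) (at r)" by (simp add: power2_eq_square)
qed (use assms in \<open>simp_all add: s1_def s2_def U1_def U2_def U3_def U4_def D_deriv smooth_s
      smooth_V smooth_D\<close>)

lemma D_eqI':
  "r \<in> I \<Longrightarrow> (g has_real_derivative d) (at r) \<Longrightarrow> d = g' / (f r)\<^sup>2 \<Longrightarrow> D g r = g'"
  using D_eqI by blast

lemma D_zero_imp_const:
  assumes "\<And>r. r \<in> I \<Longrightarrow> (g has_real_derivative 0) (at r)" "r \<in> I" "r' \<in> I"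
  shows "g r = g r'"
  by (rule derivative_zero_imp_eq[OF is_interval_einterval assms])

text \<open>For K = 0 all quotients by \<open>K\<^sup>2\<close> take the value 0, and the metric
  part disappears with them; hence the case distinction.\<close>

lemma W1_U: "r \<in> I \<Longrightarrow> W1 K r = U1 r * inverse (K\<^sup>2) + (if K = 0 then 0 else P r)"
  using f_nonzero[of r] unfolding W1_eq U1_def D_def P_def
  by (auto simp: field_simps power2_eq_square power3_eq_cube)

lemma W_U:
  assumes "r \<in> I" "K \<noteq> 0"
  shows "W1 K r = U1 r / K\<^sup>2 + P r" "W2 K r = U2 r / K\<^sup>2 + s r"
    "W3 K r = U3 r / K\<^sup>2 + s1 r" "W4 K r = U4 r / K\<^sup>2 + s2 r"
proof -
  have step: "D g r = h' r / K\<^sup>2 + q' r"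
    if "\<And>r. r \<in> I \<Longrightarrow> g r = h r / K\<^sup>2 + q r" "\<And>r. r \<in> I \<Longrightarrow> (h has_real_derivative h' r / (f r)\<^sup>2) (at r)"
      "\<And>r. r \<in> I \<Longrightarrow> (q has_real_derivative q' r / (f r)\<^sup>2) (at r)" "r \<in> I" for g h q h' q' r
  proof -
    have "((\<lambda>r. h r / K\<^sup>2 + q r) has_real_derivative h' r / (f r)\<^sup>2 / K\<^sup>2 + q' r / (f r)\<^sup>2) (at r)"
      by (intro DERIV_add DERIV_cdivide that)
    moreover have "h' r / (f r)\<^sup>2 / K\<^sup>2 + q' r / (f r)\<^sup>2 = (h' r / K\<^sup>2 + q' r) / (f r)\<^sup>2"
      by (simp add: add_divide_distrib)
    ultimately have "D (\<lambda>r. h r / K\<^sup>2 + q r) r = h' r / K\<^sup>2 + q' r"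
      by (rule D_eqI'[OF that(4)])
    then show ?thesis using D_cong[of g "\<lambda>r. h r / K\<^sup>2 + q r" r] that(1,4) by simp
  qed
  have 1: "W1 K r = U1 r / K\<^sup>2 + P r" if "r \<in> I" for r
    using W1_U[OF that] assms(2) by (simp add: divide_inverse)
  have 2: "W2 K r = U2 r / K\<^sup>2 + s r" if "r \<in> I" for r
    unfolding W2_def by (rule step[OF 1 D_derivs(5) D_derivs(1) that])
  have 3: "W3 K r = U3 r / K\<^sup>2 + s1 r" if "r \<in> I" for r
    unfolding W3_def by (rule step[OF 2 D_derivs(6) D_derivs(2) that])
  have 4: "W4 K r = U4 r / K\<^sup>2 + s2 r" if "r \<in> I" for r
    unfolding W4_def by (rule step[OF 3 D_derivs(7) D_derivs(3) that])
  show "W1 K r = U1 r / K\<^sup>2 + P r" "W2 K r = U2 r / K\<^sup>2 + s r"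
    "W3 K r = U3 r / K\<^sup>2 + s1 r" "W4 K r = U4 r / K\<^sup>2 + s2 r"
    using 1 2 3 4 assms(1) by auto
qed

lemma W1_zero_iff_\<nu>: "r \<in> I \<Longrightarrow> K \<noteq> 0 \<Longrightarrow> W1 K r = 0 \<longleftrightarrow> K\<^sup>2 = \<nu> r"
  using P_nonzero[of r] by (auto simp: W_U \<nu>_def field_simps)

text \<open>The bracket is \<nu> times the second derivative of the potential in w at the circular
  orbit. Where that derivative is a constant \<omega>^2, a linear equation for \<nu> results; where
  it is nonpositive, the sign of P fixes the direction in which \<nu> varies.\<close>

lemma \<nu>_deriv:
  assumes "r \<in> I"
  shows "(\<nu> has_real_derivative - (U2 r + \<nu> r * s r) / P r / (f r)\<^sup>2) (at r)"
proof -
  have p: "P r \<noteq> 0" "(f r)\<^sup>2 \<noteq> 0" using P_nonzero f_nonzero assms by auto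
  have "(\<nu> has_real_derivative (- (U2 r / (f r)\<^sup>2) * P r - - U1 r * (s r / (f r)\<^sup>2)) / (P r * P r)) (at r)"
    unfolding \<nu>_def[abs_def] by (intro DERIV_divide DERIV_minus D_derivs assms p)
  moreover have "(- (U2 r / (f r)\<^sup>2) * P r - - U1 r * (s r / (f r)\<^sup>2)) / (P r * P r) = - (U2 r + \<nu> r * s r) / P r / (f r)\<^sup>2"
    unfolding \<nu>_def using p by (simp add: field_simps)
  ultimately show ?thesis by simp
qed

lemma P_same_sign: "(\<forall>r\<in>I. 0 < P r) \<or> (\<forall>r\<in>I. P r < 0)"
proof (rule ccontr)
  assume "\<not> ?thesis"
  then obtain x y where xy: "x \<in> I" "y \<in> I" "P x < 0" "0 < P y"
    using P_nonzero by (metis linorder_neqE_linordered_idom)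
  have "connected (P ` I)"
    by (intro connected_continuous_image smooth_continuous_on smooth_P)
      (simp add: is_interval_einterval is_interval_connected)
  then have "0 \<in> P ` I" using xy connectedD_interval[of "P ` I" "P x" "P y" 0] by auto
  then show False using P_nonzero by auto
qed

end

text \<open>The local analysis with K eliminated by K^2 = \<nu>: \<open>U2 r / \<nu> r + s r\<close>
  is the squared frequency of small oscillations at r, and the last equation is the fourth order
  condition there.\<close>

locale isochronous_field = bertrand_field +
  assumes some_stable: "\<exists>r\<in>I. 0 < \<nu> r \<and> 0 < U2 r / \<nu> r + s r"
    and stable_isochronous: "\<And>r. r \<in> I \<Longrightarrow> 0 < \<nu> r \<Longrightarrow> 0 < U2 r / \<nu> r + s r \<Longrightarrow>
       \<exists>\<omega>\<in>\<rat>. 0 < \<omega> \<and> U2 r / \<nu> r + s r = \<omega>\<^sup>2 \<and>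
         5 * (U3 r / \<nu> r + s1 r)\<^sup>2 = 3 * \<omega>\<^sup>2 * (U4 r / \<nu> r + s2 r)"
begin

lemma constant_frequency:
  obtains \<omega> where "\<omega> \<in> \<rat>" "0 < \<omega>" "\<And>r. r \<in> I \<Longrightarrow> 0 < \<nu> r"
    "\<And>r. r \<in> I \<Longrightarrow> U2 r + \<nu> r * s r = \<omega>\<^sup>2 * \<nu> r"
proof -
  obtain r0 where r0: "r0 \<in> I" "0 < \<nu> r0" "0 < U2 r0 / \<nu> r0 + s r0" using some_stable by blast
  obtain \<omega> where \<omega>: "\<omega> \<in> \<rat>" "0 < \<omega>" "U2 r0 / \<nu> r0 + s r0 = \<omega>\<^sup>2"
    using stable_isochronous[OF r0] by blast
  have "continuous_on I (\<lambda>r. \<omega>\<^sup>2 / (P r * (f r)\<^sup>2))"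
    by (intro smooth_continuous_on smooth_intros smooth_P smooth_f) (simp add: P_nonzero f_nonzero)
  then obtain Q where Q: "\<And>r. r \<in> I \<Longrightarrow> (Q has_real_derivative \<omega>\<^sup>2 / (P r * (f r)\<^sup>2)) (at r)"
    using einterval_primitive[OF ab] by blast
  \<comment> \<open>As long as the squared frequency is \<omega>^2, the product
    \<open>\<nu> r * exp (Q r)\<close> is conserved; C is its positive value at the initial stable
    circle.\<close>
  define C where "C = \<nu> r0 * exp (Q r0)"
  have C: "0 < C" using r0 by (simp add: C_def)
  \<comment> \<open>On the set where the frequency is \<open>\<omega>\<close>, \<open>\<nu>\<close> solves a linear equation, so it cannot
    vanish at the end points of this set.\<close>
  define S where "S = {r \<in> I. \<nu> r * exp (Q r) = C} \<inter> {r \<in> I. U2 r + \<nu> r * s r - \<omega>\<^sup>2 * \<nu> r = 0}"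
  note c\<nu> = smooth_continuous_on[OF smooth_\<nu>]
  have cQ: "continuous_on I Q" using Q DERIV_isCont continuous_at_imp_continuous_on by blast
  have clS: "closedin (top_of_set I) S"
    unfolding S_def
    by (intro closedin_Int continuous_closedin_preimage_constant continuous_intros c\<nu> cQ
        smooth_continuous_on[OF smooth_U(2)] smooth_continuous_on[OF smooth_s])
  have "open S"
  proof (unfold open_contains_ball, intro ballI)
    fix r assume "r \<in> S"
    then have r: "r \<in> I" "\<nu> r * exp (Q r) = C" "U2 r + \<nu> r * s r = \<omega>\<^sup>2 * \<nu> r" by (auto simp: S_def)
    have \<nu>r: "0 < \<nu> r" using r(2) C by (metis exp_gt_zero zero_less_mult_pos2)
    have fr: "U2 r / \<nu> r + s r = \<omega>\<^sup>2" using r(3) \<nu>r by (simp add: field_simps)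
    define g where "g r = U2 r + \<nu> r * s r" for r
    have cg: "continuous_on I g" unfolding g_def
      by (intro continuous_intros c\<nu> smooth_continuous_on[OF smooth_U(2)] smooth_continuous_on[OF smooth_s])
    have "open ((I \<inter> \<nu> -` {0<..}) \<inter> (I \<inter> g -` {0<..}))"
      by (intro open_Int continuous_open_preimage c\<nu> cg) auto
    moreover have "r \<in> (I \<inter> \<nu> -` {0<..}) \<inter> (I \<inter> g -` {0<..})"
      using r \<nu>r \<omega>(2) by (simp add: g_def)
    ultimately obtain e where e: "0 < e" "ball r e \<subseteq> (I \<inter> \<nu> -` {0<..}) \<inter> (I \<inter> g -` {0<..})"
      using open_contains_ball by metis
    have B: "x \<in> I" "0 < \<nu> x" "0 < U2 x / \<nu> x + s x" if "x \<in> ball r e" for x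
    proof -
      have x: "x \<in> I" "0 < \<nu> x" "0 < g x" using e(2) that by auto
      then show "x \<in> I" "0 < \<nu> x" by auto
      have "0 < g x / \<nu> x" using x by simp
      then show "0 < U2 x / \<nu> x + s x" using x(2) by (simp add: g_def field_simps)
    qed
    have freq: "U2 x + \<nu> x * s x = \<omega>\<^sup>2 * \<nu> x" if x: "x \<in> ball r e" for x
    proof -
      \<comment> \<open>Near r the circles are still stable, so the frequency is a continuous
        function with rational values.\<close>
      have "sqrt (U2 x / \<nu> x + s x) = sqrt (U2 r / \<nu> r + s r)"
      proof (rule rational_valued_imp_constant[of "ball r e" "\<lambda>x. sqrt (U2 x / \<nu> x + s x)"])
        show "connected (ball r e)" by simp
        have ch: "continuous_on (ball r e) h" if "smooth_on_interval a b h" for h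
          using continuous_on_subset[OF smooth_continuous_on[OF that]] B(1) by blast
        then show "continuous_on (ball r e) (\<lambda>x. sqrt (U2 x / \<nu> x + s x))"
          using B(2) by (intro continuous_intros ch smooth_U smooth_s smooth_\<nu>) force
        show "sqrt (U2 y / \<nu> y + s y) \<in> \<rat>" if "y \<in> ball r e" for y
          using stable_isochronous[OF B[OF that]] by (auto simp: real_sqrt_abs)
      qed (use x e in auto)
      then have "U2 x / \<nu> x + s x = \<omega>\<^sup>2" by (simp only: fr real_sqrt_eq_iff)
      then show ?thesis using B(2)[OF x] by (simp add: field_simps)
    qed
    have "\<nu> x * exp (Q x) = C" if "x \<in> ball r e" for x
    proof -
      have "\<nu> x * exp (Q x) = \<nu> r * exp (Q r)"
      proof (rule derivative_zero_imp_eq[of "ball r e" "\<lambda>x. \<nu> x * exp (Q x)"])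
        show "is_interval (ball r e)" by (simp add: is_interval_ball_real)
        fix y assume y: "y \<in> ball r e"
        note yI = B(1)[OF y]
        have d\<nu>: "(\<nu> has_real_derivative - (\<omega>\<^sup>2 * \<nu> y) / P y / (f y)\<^sup>2) (at y)"
          using \<nu>_deriv[OF yI] freq[OF y] by simp
        have "((\<lambda>x. \<nu> x * exp (Q x)) has_real_derivative
            (- (\<omega>\<^sup>2 * \<nu> y) / P y / (f y)\<^sup>2) * exp (Q y) + exp (Q y) * (\<omega>\<^sup>2 / (P y * (f y)\<^sup>2)) * \<nu> y) (at y)"
          by (intro DERIV_mult d\<nu> DERIV_fun_exp Q yI)
        then show "((\<lambda>x. \<nu> x * exp (Q x)) has_real_derivative 0) (at y)" by simp
      qed (use that e in auto)
      then show ?thesis using r(2) by simp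
    qed
    then have "ball r e \<subseteq> S" unfolding S_def using freq B(1) by auto
    then show "\<exists>e>0. ball r e \<subseteq> S" using e(1) by blast
  qed
  then have "openin (top_of_set I) S" by (auto simp: openin_open_eq S_def)
  moreover have "r0 \<in> S" using r0 \<omega>(3) by (auto simp: S_def C_def field_simps)
  moreover have "connected I" by (simp add: is_interval_einterval is_interval_connected)
  ultimately have "S = I" using clS unfolding connected_clopen by blast
  have "0 < \<nu> r" if "r \<in> I" for r
  proof -
    have "\<nu> r * exp (Q r) = C" using that \<open>S = I\<close> by (auto simp: S_def)
    then show ?thesis using C by (metis exp_gt_zero zero_less_mult_pos2)
  qed
  moreover have "U2 r + \<nu> r * s r = \<omega>\<^sup>2 * \<nu> r" if "r \<in> I" for r
    using that \<open>S = I\<close> by (auto simp: S_def)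
  ultimately show ?thesis using that \<omega>(1,2) by blast
qed

text \<open>Inserting U2 = \<nu> (\<omega>^2 - s) and the linear equation for \<nu> expresses U3 and
  U4 through s, s1 and s2. In the fourth order condition s2 cancels and a factor \<omega>^2 - s
  splits off, so a first order equation for the metric alone remains.\<close>

lemma curvature_equation:
  assumes \<omega>: "0 < \<omega>" and \<nu>_pos: "\<And>r. r \<in> I \<Longrightarrow> 0 < \<nu> r"
    and freq: "\<And>r. r \<in> I \<Longrightarrow> U2 r + \<nu> r * s r = \<omega>\<^sup>2 * \<nu> r" and r: "r \<in> I"
  shows "3 * P r * s1 r = (4 * s r - \<omega>\<^sup>2) * (s r - \<omega>\<^sup>2)"
proof -
  have U2_eq: "U2 r = \<nu> r * (\<omega>\<^sup>2 - s r)" if "r \<in> I" for r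
    using freq[OF that] by (simp add: algebra_simps)
  have d\<nu>: "(\<nu> has_real_derivative - (\<omega>\<^sup>2 * \<nu> r) / P r / (f r)\<^sup>2) (at r)" if "r \<in> I" for r
    using \<nu>_deriv[OF that] freq[OF that] by simp
  have U3_eq: "U3 r = - (\<omega>\<^sup>2 * \<nu> r) / P r * (\<omega>\<^sup>2 - s r) - \<nu> r * s1 r" if "r \<in> I" for r
  proof -
    have "((\<lambda>r. \<nu> r * (\<omega>\<^sup>2 - s r)) has_real_derivative
       - (\<omega>\<^sup>2 * \<nu> r) / P r / (f r)\<^sup>2 * (\<omega>\<^sup>2 - s r) + (0 - s1 r / (f r)\<^sup>2) * \<nu> r) (at r)"
      by (intro DERIV_mult d\<nu> DERIV_diff DERIV_const D_derivs that)
    moreover have "- (\<omega>\<^sup>2 * \<nu> r) / P r / (f r)\<^sup>2 * (\<omega>\<^sup>2 - s r) + (0 - s1 r / (f r)\<^sup>2) * \<nu> r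
      = (- (\<omega>\<^sup>2 * \<nu> r) / P r * (\<omega>\<^sup>2 - s r) - \<nu> r * s1 r) / (f r)\<^sup>2"
      by (simp add: diff_divide_distrib)
    ultimately have "D (\<lambda>r. \<nu> r * (\<omega>\<^sup>2 - s r)) r = - (\<omega>\<^sup>2 * \<nu> r) / P r * (\<omega>\<^sup>2 - s r) - \<nu> r * s1 r"
      by (rule D_eqI'[OF that])
    then show ?thesis unfolding U3_def using D_cong[OF U2_eq that] by simp
  qed
  define p where "p = P r"
  define y where "y = \<omega>\<^sup>2 - s r"
  have p: "p \<noteq> 0" using P_nonzero[OF r] by (simp add: p_def)
  have U4_eq: "U4 r = - (\<omega>\<^sup>2 * \<nu> r) * (- \<omega>\<^sup>2 * y / p\<^sup>2 - s1 r / p - y * s r / p\<^sup>2) + \<omega>\<^sup>2 * \<nu> r / p * s1 r - \<nu> r * s2 r"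
  proof -
    have "((\<lambda>r. - (\<omega>\<^sup>2 * \<nu> r) / P r * (\<omega>\<^sup>2 - s r) - \<nu> r * s1 r) has_real_derivative
       ((- (\<omega>\<^sup>2 * (- (\<omega>\<^sup>2 * \<nu> r) / P r / (f r)\<^sup>2)) * P r - - (\<omega>\<^sup>2 * \<nu> r) * (s r / (f r)\<^sup>2)) / (P r * P r)) * (\<omega>\<^sup>2 - s r)
        + (0 - s1 r / (f r)\<^sup>2) * (- (\<omega>\<^sup>2 * \<nu> r) / P r)
        - (- (\<omega>\<^sup>2 * \<nu> r) / P r / (f r)\<^sup>2 * s1 r + s2 r / (f r)\<^sup>2 * \<nu> r)) (at r)"
      by (intro DERIV_mult DERIV_divide DERIV_minus DERIV_cmult d\<nu> DERIV_diff DERIV_const D_derivs r P_nonzero)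
    moreover have "((- (\<omega>\<^sup>2 * (- (\<omega>\<^sup>2 * \<nu> r) / P r / (f r)\<^sup>2)) * P r - - (\<omega>\<^sup>2 * \<nu> r) * (s r / (f r)\<^sup>2)) / (P r * P r)) * (\<omega>\<^sup>2 - s r)
        + (0 - s1 r / (f r)\<^sup>2) * (- (\<omega>\<^sup>2 * \<nu> r) / P r)
        - (- (\<omega>\<^sup>2 * \<nu> r) / P r / (f r)\<^sup>2 * s1 r + s2 r / (f r)\<^sup>2 * \<nu> r)
      = (- (\<omega>\<^sup>2 * \<nu> r) * (- \<omega>\<^sup>2 * y / p\<^sup>2 - s1 r / p - y * s r / p\<^sup>2) + \<omega>\<^sup>2 * \<nu> r / p * s1 r - \<nu> r * s2 r) / (f r)\<^sup>2"
      unfolding p_def[symmetric] y_def[symmetric] using p f_nonzero[OF r] by (simp add: power2_eq_square field_simps)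
    ultimately have "D (\<lambda>r. - (\<omega>\<^sup>2 * \<nu> r) / P r * (\<omega>\<^sup>2 - s r) - \<nu> r * s1 r) r
       = - (\<omega>\<^sup>2 * \<nu> r) * (- \<omega>\<^sup>2 * y / p\<^sup>2 - s1 r / p - y * s r / p\<^sup>2) + \<omega>\<^sup>2 * \<nu> r / p * s1 r - \<nu> r * s2 r"
      by (rule D_eqI'[OF r])
    then show ?thesis unfolding U4_def using D_cong[OF U3_eq r] by simp
  qed
  note \<nu>r = \<nu>_pos[OF r]
  have W2: "U2 r / \<nu> r + s r = \<omega>\<^sup>2" using U2_eq[OF r] \<nu>r by simp
  have W3: "U3 r / \<nu> r + s1 r = - \<omega>\<^sup>2 * y / p"
    unfolding U3_eq[OF r] p_def[symmetric] y_def[symmetric] using \<nu>r p by (simp add: field_simps)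
  have W4: "U4 r / \<nu> r + s2 r = \<omega>\<^sup>2 * ((\<omega>\<^sup>2 + s r) * y / p\<^sup>2 + 2 * s1 r / p)"
    unfolding U4_eq using \<nu>r p by (simp add: power2_eq_square field_simps)
  have "0 < U2 r / \<nu> r + s r" using W2 \<omega> by simp
  from stable_isochronous[OF r \<nu>r this]
  have "5 * (- \<omega>\<^sup>2 * y / p)\<^sup>2 = 3 * \<omega>\<^sup>2 * (\<omega>\<^sup>2 * ((\<omega>\<^sup>2 + s r) * y / p\<^sup>2 + 2 * s1 r / p))"
    unfolding W2 W3 W4 by auto
  moreover have "5 * (- \<omega>\<^sup>2 * y / p)\<^sup>2 = \<omega>\<^sup>2 * \<omega>\<^sup>2 / p\<^sup>2 * (5 * y\<^sup>2)"
    by (simp add: power2_eq_square)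
  moreover have "3 * \<omega>\<^sup>2 * (\<omega>\<^sup>2 * ((\<omega>\<^sup>2 + s r) * y / p\<^sup>2 + 2 * s1 r / p))
      = \<omega>\<^sup>2 * \<omega>\<^sup>2 / p\<^sup>2 * (3 * ((\<omega>\<^sup>2 + s r) * y + 2 * s1 r * p))"
    using p by (simp add: power2_eq_square field_simps)
  moreover have "\<omega>\<^sup>2 * \<omega>\<^sup>2 / p\<^sup>2 \<noteq> 0" using \<omega> p by simp
  ultimately have "5 * y\<^sup>2 = 3 * ((\<omega>\<^sup>2 + s r) * y + 2 * s1 r * p)"
    using mult_cancel_left by metis
  then show ?thesis unfolding p_def[symmetric] y_def by (simp add: power2_eq_square algebra_simps)
qed

text \<open>Both \<omega>^2 and \<omega>^2 / 4 are constant solutions of the equation for s. By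
  uniqueness s can meet one of them only by being equal to it throughout, which is an excluded
  metric with \<xi> = \<omega> or \<xi> = \<omega> / 2; both are rational.\<close>

lemma s_avoids:
  assumes eq: "\<And>r. r \<in> I \<Longrightarrow> 3 * P r * s1 r = (4 * s r - \<omega>\<^sup>2) * (s r - \<omega>\<^sup>2)"
    and \<omega>: "\<omega> \<in> \<rat>" "0 < \<omega>" and r: "r \<in> I"
  shows "s r \<noteq> \<omega>\<^sup>2" "4 * s r \<noteq> \<omega>\<^sup>2"
proof -
  have s1_eq: "s1 r = (4 * s r - \<omega>\<^sup>2) * (s r - \<omega>\<^sup>2) / (3 * P r)" if "r \<in> I" for r
    using eq[OF that] P_nonzero[OF that] by (simp add: field_simps)
  have excluded: False if "\<And>r. r \<in> I \<Longrightarrow> s r = \<xi>\<^sup>2" "\<xi> \<in> \<rat>" "0 < \<xi>" for \<xi>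
    using no_constant_curvature_form that by (auto simp: s_def algebra_simps)
  show "s r \<noteq> \<omega>\<^sup>2"
  proof
    assume 0: "s r = \<omega>\<^sup>2"
    have "s x - \<omega>\<^sup>2 = 0" if "x \<in> I" for x
    proof (rule linear_ode_unique[OF ab _ _ r _ that, of "\<lambda>r. (4 * s r - \<omega>\<^sup>2) / (3 * P r) / (f r)\<^sup>2"])
      show "continuous_on I (\<lambda>r. (4 * s r - \<omega>\<^sup>2) / (3 * P r) / (f r)\<^sup>2)"
        by (intro smooth_continuous_on smooth_intros smooth_P smooth_f smooth_s) (auto simp: P_nonzero f_nonzero)
      fix x assume x: "x \<in> I"
      have "((\<lambda>x. s x - \<omega>\<^sup>2) has_real_derivative s1 x / (f x)\<^sup>2 - 0) (at x)"
        by (intro DERIV_diff DERIV_const D_derivs x)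
      then show "((\<lambda>x. s x - \<omega>\<^sup>2) has_real_derivative (4 * s x - \<omega>\<^sup>2) / (3 * P x) / (f x)\<^sup>2 * (s x - \<omega>\<^sup>2)) (at x)"
        by (simp add: s1_eq[OF x])
    qed (use 0 in simp)
    then show False using excluded[of \<omega>] \<omega> by simp
  qed
  show "4 * s r \<noteq> \<omega>\<^sup>2"
  proof
    assume 0: "4 * s r = \<omega>\<^sup>2"
    have z: "4 * s x - \<omega>\<^sup>2 = 0" if "x \<in> I" for x
    proof (rule linear_ode_unique[OF ab _ _ r _ that, of "\<lambda>r. 4 * (s r - \<omega>\<^sup>2) / (3 * P r) / (f r)\<^sup>2"])
      show "continuous_on I (\<lambda>r. 4 * (s r - \<omega>\<^sup>2) / (3 * P r) / (f r)\<^sup>2)"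
        by (intro smooth_continuous_on smooth_intros smooth_P smooth_f smooth_s) (auto simp: P_nonzero f_nonzero)
      fix x assume x: "x \<in> I"
      have "((\<lambda>x. 4 * s x - \<omega>\<^sup>2) has_real_derivative 4 * (s1 x / (f x)\<^sup>2) - 0) (at x)"
        by (intro DERIV_diff DERIV_cmult DERIV_const D_derivs x)
      moreover have "4 * (u * v / (3 * p) / q) - 0 = 4 * v / (3 * p) / q * u" for u v p q :: real by simp
      ultimately show "((\<lambda>x. 4 * s x - \<omega>\<^sup>2) has_real_derivative 4 * (s x - \<omega>\<^sup>2) / (3 * P x) / (f x)\<^sup>2 * (4 * s x - \<omega>\<^sup>2)) (at x)"
        by (simp only: s1_eq[OF x])
    qed (use 0 in simp)
    have "s x = (\<omega> / 2)\<^sup>2" if "x \<in> I" for x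
      using z[OF that] by (simp add: power_divide)
    then show False using excluded[of "\<omega> / 2"] \<omega> by simp
  qed
qed

text \<open>Each constant is an expression in the metric functions, \<nu> and V whose derivative
  vanishes by the curvature equation or the equation for \<nu>. That the values avoided by s are
  really avoided gives the denominator of \<theta> and the condition on d.\<close>

lemma normal_form:
  obtains \<theta> \<mu> c d A B where "metric_normal_form a b f \<theta> \<mu> c d"
    "\<And>r. r \<in> I \<Longrightarrow> 0 < A * (\<theta> r ^ 4 + d)"
    "\<And>r. r \<in> I \<Longrightarrow> V r = oscillator_potential \<theta> A B r"
proof -
  obtain \<omega> where \<omega>: "\<omega> \<in> \<rat>" "0 < \<omega>" and \<nu>_pos: "\<And>r. r \<in> I \<Longrightarrow> 0 < \<nu> r"
    and freq: "\<And>r. r \<in> I \<Longrightarrow> U2 r + \<nu> r * s r = \<omega>\<^sup>2 * \<nu> r"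
    by (rule constant_frequency, rule that)
  have eq: "3 * P r * s1 r = (4 * s r - \<omega>\<^sup>2) * (s r - \<omega>\<^sup>2)" if "r \<in> I" for r
    by (rule curvature_equation[OF \<omega>(2) _ _ that]) (simp_all add: \<nu>_pos freq)
  have avoid: "s r \<noteq> \<omega>\<^sup>2" "4 * s r \<noteq> \<omega>\<^sup>2" if "r \<in> I" for r
    by (rule s_avoids[OF _ \<omega> that], simp add: eq)+
  \<comment> \<open>Oscillations have frequency \<omega> in the angle, and their angular period 2 pi
    / \<omega> is to be pi \<mu>.\<close>
  define \<mu> where "\<mu> = 2 / \<omega>"
  have \<mu>: "0 < \<mu>" "\<mu> \<in> \<rat>" "\<mu>\<^sup>2 * \<omega>\<^sup>2 = 4" using \<omega> by (auto simp: \<mu>_def power_divide)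
  have \<omega>2: "\<omega>\<^sup>2 = 4 / \<mu>\<^sup>2" using \<mu> by (simp add: field_simps)
  \<comment> \<open>In the normal form d\<theta>/dw = 1 / \<mu>^2, whence P = \<theta> + d /
    \<theta>^3 and \<mu>^2 s = 1 - 3 d / \<theta>^4. Eliminating d leaves 3 P = \<theta> (4 -
    \<mu>^2 s).\<close>
  define \<theta> where "\<theta> r = 3 * P r / (4 - \<mu>\<^sup>2 * s r)" for r
  have den: "4 - \<mu>\<^sup>2 * s r \<noteq> 0" if "r \<in> I" for r
  proof
    assume "4 - \<mu>\<^sup>2 * s r = 0"
    then have "\<mu>\<^sup>2 * s r = \<mu>\<^sup>2 * \<omega>\<^sup>2" using \<mu>(3) by simp
    then show False using avoid(1)[OF that] \<mu>(1) by simp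
  qed
  have smooth_\<theta>: "smooth_on_interval a b \<theta>"
    unfolding \<theta>_def[abs_def] by (intro smooth_intros smooth_P smooth_s den)
  have \<theta>_nz: "\<theta> r \<noteq> 0" if "r \<in> I" for r using P_nonzero[OF that] den[OF that] by (simp add: \<theta>_def)
  have P_\<theta>: "3 * P r = \<theta> r * (4 - \<mu>\<^sup>2 * s r)" if "r \<in> I" for r using den[OF that] by (simp add: \<theta>_def)
  have s1_\<theta>: "s1 r * \<theta> r = 4 / \<mu> ^ 4 * (1 - \<mu>\<^sup>2 * s r)" if "r \<in> I" for r
  proof -
    have "3 * P r * s1 r = 4 / \<mu> ^ 4 * (1 - \<mu>\<^sup>2 * s r) * (4 - \<mu>\<^sup>2 * s r)"
      using eq[OF that] \<mu>(1) unfolding \<omega>2 by (simp add: field_simps power2_eq_square power4_eq_xxxx)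
    then have "s1 r * \<theta> r = 4 / \<mu> ^ 4 * (1 - \<mu>\<^sup>2 * s r) * (4 - \<mu>\<^sup>2 * s r) / (4 - \<mu>\<^sup>2 * s r)"
      unfolding \<theta>_def by (simp only: times_divide_eq_right mult.commute[of "s1 r"])
    also have "\<dots> = 4 / \<mu> ^ 4 * (1 - \<mu>\<^sup>2 * s r)" using den[OF that] by (rule nonzero_mult_div_cancel_right)
    finally show ?thesis .
  qed
  have d\<theta>: "(\<theta> has_real_derivative 1 / \<mu>\<^sup>2 / (f r)\<^sup>2) (at r)" if "r \<in> I" for r
  proof -
    define y where "y = 4 - \<mu>\<^sup>2 * s r"
    have y: "y \<noteq> 0" using den[OF that] by (simp add: y_def)
    have "(\<theta> has_real_derivative (3 * (s r / (f r)\<^sup>2) * y - 3 * P r * (0 - \<mu>\<^sup>2 * (s1 r / (f r)\<^sup>2))) / (y * y)) (at r)"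
      unfolding \<theta>_def[abs_def] y_def
      by (intro DERIV_divide DERIV_cmult DERIV_diff DERIV_const D_derivs that den)
    moreover have "(3 * (s r / (f r)\<^sup>2) * y - 3 * P r * (0 - \<mu>\<^sup>2 * (s1 r / (f r)\<^sup>2))) / (y * y)
       = (3 * s r * y + \<mu>\<^sup>2 * (3 * P r * s1 r)) / (y * y) / (f r)\<^sup>2"
      by (simp add: add_divide_distrib mult_ac)
    moreover have "3 * s r * y + \<mu>\<^sup>2 * (3 * P r * s1 r) = y * y / \<mu>\<^sup>2"
      unfolding eq[OF that] \<omega>2 y_def using \<mu>(1) by (simp add: field_simps power2_eq_square)
    ultimately show ?thesis using y by simp
  qed
  obtain r0 where r0: "r0 \<in> I" using einterval_nonempty[OF ab] by blast
  \<comment> \<open>The expected relation \<mu>^2 s = 1 - 3 d / \<theta>^4 solved for d.\<close>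
  define \<Delta> where "\<Delta> r = (1 - \<mu>\<^sup>2 * s r) * \<theta> r ^ 4 / 3" for r
  have d\<Delta>: "(\<Delta> has_real_derivative 0) (at r)" if "r \<in> I" for r
  proof -
    have "(\<Delta> has_real_derivative ((0 - \<mu>\<^sup>2 * (s1 r / (f r)\<^sup>2)) * \<theta> r ^ 4
        + of_nat 4 * (1 / \<mu>\<^sup>2 / (f r)\<^sup>2 * \<theta> r ^ (4 - Suc 0)) * (1 - \<mu>\<^sup>2 * s r)) / 3) (at r)"
      unfolding \<Delta>_def[abs_def]
      by (intro DERIV_cdivide DERIV_mult DERIV_diff DERIV_const DERIV_cmult DERIV_power D_derivs that d\<theta>)
    moreover have "((0 - \<mu>\<^sup>2 * (s1 r / (f r)\<^sup>2)) * \<theta> r ^ 4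
        + of_nat 4 * (1 / \<mu>\<^sup>2 / (f r)\<^sup>2 * \<theta> r ^ (4 - Suc 0)) * (1 - \<mu>\<^sup>2 * s r)) / 3
      = (- \<mu>\<^sup>2 * (s1 r * \<theta> r) + 4 / \<mu>\<^sup>2 * (1 - \<mu>\<^sup>2 * s r)) * \<theta> r ^ 3 / (f r)\<^sup>2 / 3"
    proof -
      have "((0 - m * (x / F)) * (t * T) + 4 * (1 / m / F * T) * y) / 3 = (- m * (x * t) + 4 / m * y) * T / F / 3"
        if "m \<noteq> 0" "F \<noteq> 0" for m x F t T y :: real
        using that by (simp add: field_simps)
      from this[of "\<mu>\<^sup>2" "(f r)\<^sup>2" "s1 r" "\<theta> r" "\<theta> r ^ 3" "1 - \<mu>\<^sup>2 * s r"] show ?thesis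
        using \<mu>(1) f_nonzero[OF that] by (simp add: power3_eq_cube power4_eq_xxxx)
    qed
    moreover have "- \<mu>\<^sup>2 * (s1 r * \<theta> r) + 4 / \<mu>\<^sup>2 * (1 - \<mu>\<^sup>2 * s r) = 0"
      unfolding s1_\<theta>[OF that] using \<mu>(1) by (simp add: power2_eq_square power4_eq_xxxx)
    ultimately show ?thesis by simp
  qed
  define d where "d = \<Delta> r0"
  have \<Delta>_d: "\<Delta> r = d" if "r \<in> I" for r
    unfolding d_def by (rule D_zero_imp_const[OF d\<Delta> that r0])
  have d_nz: "d \<noteq> 0"
  proof
    assume "d = 0"
    then have "\<mu>\<^sup>2 * s r0 = 1" using \<theta>_nz[OF r0] by (simp add: d_def \<Delta>_def)
    then have "\<mu>\<^sup>2 * (4 * s r0) = \<mu>\<^sup>2 * \<omega>\<^sup>2" using \<mu>(3) by simp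
    then show False using avoid(2)[OF r0] \<mu>(1) by simp
  qed
  have P_eq: "P r = \<theta> r + d / \<theta> r ^ 3" if "r \<in> I" for r
  proof -
    have "d / \<theta> r ^ 3 = (1 - \<mu>\<^sup>2 * s r) * \<theta> r / 3"
      unfolding \<Delta>_d[OF that, symmetric] \<Delta>_def using \<theta>_nz[OF that]
      by (simp add: power3_eq_cube power4_eq_xxxx)
    then show ?thesis using P_\<theta>[OF that] by (simp add: algebra_simps)
  qed
  have P_eq': "P r * \<theta> r ^ 3 = \<theta> r ^ 4 + d" if "r \<in> I" for r
    unfolding P_eq[OF that] using \<theta>_nz[OF that] by (simp add: power3_eq_cube power4_eq_xxxx field_simps)
  \<comment> \<open>The expected relation 1 / (\<mu>^2 f^2) = \<theta>^2 + c - d / \<theta>^2 solved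
    for c.\<close>
  define \<Gamma> where "\<Gamma> r = 1 / \<mu>\<^sup>2 * inverse ((f r)\<^sup>2) - (\<theta> r)\<^sup>2 + d * inverse ((\<theta> r)\<^sup>2)" for r
  have d\<Gamma>: "(\<Gamma> has_real_derivative 0) (at r)" if "r \<in> I" for r
  proof -
    have fn: "f r \<noteq> 0" "\<theta> r \<noteq> 0" using f_nonzero \<theta>_nz that by auto
    have df2: "((\<lambda>r. inverse ((f r)\<^sup>2)) has_real_derivative 2 * P r / (f r)\<^sup>2) (at r)"
      using fn(1) by (auto intro!: derivative_eq_intros f_deriv that simp: P_def)
        (simp add: field_simps power2_eq_square)
    have d\<theta>2: "((\<lambda>r. inverse ((\<theta> r)\<^sup>2)) has_real_derivative - 2 / \<theta> r ^ 3 / \<mu>\<^sup>2 / (f r)\<^sup>2) (at r)"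
      using fn(2) by (auto intro!: derivative_eq_intros d\<theta> that)
        (simp add: field_simps power2_eq_square power3_eq_cube)
    have "(\<Gamma> has_real_derivative 1 / \<mu>\<^sup>2 * (2 * P r / (f r)\<^sup>2) - of_nat 2 * (1 / \<mu>\<^sup>2 / (f r)\<^sup>2 * \<theta> r ^ (2 - Suc 0))
        + d * (- 2 / \<theta> r ^ 3 / \<mu>\<^sup>2 / (f r)\<^sup>2)) (at r)"
      unfolding \<Gamma>_def[abs_def]
      by (intro DERIV_add DERIV_diff DERIV_cmult DERIV_power df2 d\<theta>2 d\<theta> that)
    moreover have "1 / \<mu>\<^sup>2 * (2 * P r / (f r)\<^sup>2) - of_nat 2 * (1 / \<mu>\<^sup>2 / (f r)\<^sup>2 * \<theta> r ^ (2 - Suc 0))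
        + d * (- 2 / \<theta> r ^ 3 / \<mu>\<^sup>2 / (f r)\<^sup>2) = 0"
      unfolding P_eq[OF that] by (simp add: add_divide_distrib algebra_simps)
    ultimately show ?thesis by simp
  qed
  define c where "c = \<Gamma> r0"
  have \<Gamma>_c: "\<Gamma> r = c" if "r \<in> I" for r
    unfolding c_def by (rule D_zero_imp_const[OF d\<Gamma> that r0])
  have h_eq: "(\<theta> r)\<^sup>2 + c - d / (\<theta> r)\<^sup>2 = 1 / \<mu>\<^sup>2 / (f r)\<^sup>2" if "r \<in> I" for r
    using \<Gamma>_c[OF that] by (simp add: \<Gamma>_def inverse_eq_divide)
  have nf: "metric_normal_form a b f \<theta> \<mu> c d"
    unfolding metric_normal_form_def
  proof (intro conjI ballI allI smooth_\<theta> \<mu> d_nz)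
    fix r assume r: "r \<in> I"
    show "\<theta> r \<noteq> 0" by (rule \<theta>_nz[OF r])
    have dd: "deriv \<theta> r = 1 / \<mu>\<^sup>2 / (f r)\<^sup>2" by (rule DERIV_imp_deriv[OF d\<theta>[OF r]])
    then show "0 < deriv \<theta> r" using \<mu>(1) f_nonzero[OF r] by simp
    fix u v :: real
    show "u\<^sup>2 + (f r)\<^sup>2 * v\<^sup>2 = (deriv \<theta> r * u)\<^sup>2 / ((\<theta> r)\<^sup>2 + c - d / (\<theta> r)\<^sup>2)\<^sup>2 +
          v\<^sup>2 / (\<mu>\<^sup>2 * ((\<theta> r)\<^sup>2 + c - d / (\<theta> r)\<^sup>2))"
      unfolding h_eq[OF r] dd using \<mu>(1) f_nonzero[OF r] by (simp add: power_divide power_mult_distrib mult.commute)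
  qed
  \<comment> \<open>Both \<nu> and 1 / (\<theta>^4 + d) solve the same linear equation in w, so this
    product is constant. It also encodes the squared momentum \<nu> of the circular orbits.\<close>
  define \<A> where "\<A> r = \<nu> r * \<mu>\<^sup>2 * (\<theta> r ^ 4 + d)" for r
  have \<theta>d_nz: "\<theta> r ^ 4 + d \<noteq> 0" if "r \<in> I" for r
    using P_eq'[OF that] P_nonzero[OF that] \<theta>_nz[OF that] by (metis mult_eq_0_iff power_not_zero)
  have d\<A>: "(\<A> has_real_derivative 0) (at r)" if "r \<in> I" for r
  proof -
    have "(\<nu> has_real_derivative - (\<omega>\<^sup>2 * \<nu> r) / P r / (f r)\<^sup>2) (at r)"
      using \<nu>_deriv[OF that] freq[OF that] by simp
    then have "(\<A> has_real_derivative (- (\<omega>\<^sup>2 * \<nu> r) / P r / (f r)\<^sup>2 * \<mu>\<^sup>2) * (\<theta> r ^ 4 + d)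
        + (of_nat 4 * (1 / \<mu>\<^sup>2 / (f r)\<^sup>2 * \<theta> r ^ (4 - Suc 0)) + 0) * (\<nu> r * \<mu>\<^sup>2)) (at r)"
      unfolding \<A>_def[abs_def]
      by (intro DERIV_mult DERIV_cmult_right DERIV_add DERIV_const DERIV_power d\<theta> that)
    moreover have "(- (\<omega>\<^sup>2 * \<nu> r) / P r / (f r)\<^sup>2 * \<mu>\<^sup>2) * (\<theta> r ^ 4 + d)
        + (of_nat 4 * (1 / \<mu>\<^sup>2 / (f r)\<^sup>2 * \<theta> r ^ (4 - Suc 0)) + 0) * (\<nu> r * \<mu>\<^sup>2)
      = (- (\<mu>\<^sup>2 * \<omega>\<^sup>2) * (P r * \<theta> r ^ 3) / P r + 4 * \<theta> r ^ 3) * \<nu> r / (f r)\<^sup>2"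
    proof -
      have "(- (w * n) / p / F * m) * X + (4 * (1 / m / F * T) + 0) * (n * m) = (- (m * w) * X / p + 4 * T) * n / F"
        if "m \<noteq> 0" "F \<noteq> 0" "p \<noteq> 0" for w n p F m X T :: real
        using that by (simp add: field_simps)
      from this[of "\<mu>\<^sup>2" "(f r)\<^sup>2" "P r"] show ?thesis
        unfolding P_eq'[OF that] using \<mu>(1) f_nonzero[OF that] P_nonzero[OF that] by simp
    qed
    moreover have "- (\<mu>\<^sup>2 * \<omega>\<^sup>2) * (P r * \<theta> r ^ 3) / P r + 4 * \<theta> r ^ 3 = 0"
      unfolding \<mu>(3) using P_nonzero[OF that] by simp
    ultimately show ?thesis by simp
  qed
  define A where "A = \<A> r0"
  have \<A>_A: "\<A> r = A" if "r \<in> I" for r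
    unfolding A_def by (rule D_zero_imp_const[OF d\<A> that r0])
  have A_pos: "0 < A * (\<theta> r ^ 4 + d)" if "r \<in> I" for r
  proof -
    have "A * (\<theta> r ^ 4 + d) = \<nu> r * \<mu>\<^sup>2 * (\<theta> r ^ 4 + d)\<^sup>2"
      using \<A>_A[OF that] by (simp add: \<A>_def power2_eq_square mult_ac)
    then show ?thesis using \<nu>_pos[OF that] \<mu>(1) \<theta>d_nz[OF that] by simp
  qed
  \<comment> \<open>With A fixed, V and A / (2 \<theta>^2) have the same derivative - \<nu> P / f^2,
    and B is their difference.\<close>
  define \<B> where "\<B> r = V r - A / 2 * inverse ((\<theta> r)\<^sup>2)" for r
  have d\<B>: "(\<B> has_real_derivative 0) (at r)" if "r \<in> I" for r
  proof -
    have d\<theta>2: "((\<lambda>r. inverse ((\<theta> r)\<^sup>2)) has_real_derivative - 2 / \<theta> r ^ 3 / \<mu>\<^sup>2 / (f r)\<^sup>2) (at r)"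
      using \<theta>_nz[OF that] by (auto intro!: derivative_eq_intros d\<theta> that)
        (simp add: field_simps power2_eq_square power3_eq_cube)
    have "(\<B> has_real_derivative U1 r / (f r)\<^sup>2 - A / 2 * (- 2 / \<theta> r ^ 3 / \<mu>\<^sup>2 / (f r)\<^sup>2)) (at r)"
      unfolding \<B>_def[abs_def] by (intro DERIV_diff DERIV_cmult D_derivs that d\<theta>2)
    moreover have "U1 r / (f r)\<^sup>2 - A / 2 * (- 2 / \<theta> r ^ 3 / \<mu>\<^sup>2 / (f r)\<^sup>2) = (U1 r + A / \<mu>\<^sup>2 / \<theta> r ^ 3) / (f r)\<^sup>2"
      by (simp add: add_divide_distrib mult_ac)
    moreover have "U1 r = - (\<nu> r * P r)" using P_nonzero[OF that] by (simp add: \<nu>_def)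
    moreover have "A / \<mu>\<^sup>2 / \<theta> r ^ 3 = \<nu> r * P r"
      unfolding \<A>_A[OF that, symmetric] \<A>_def P_eq'[OF that, symmetric] using \<mu>(1) \<theta>_nz[OF that] by simp
    ultimately show ?thesis by simp
  qed
  define B where "B = \<B> r0"
  have "V r = oscillator_potential \<theta> A B r" if "r \<in> I" for r
  proof -
    have "\<B> r = B" unfolding B_def by (rule D_zero_imp_const[OF d\<B> that r0])
    then have "V r = A / 2 * inverse ((\<theta> r)\<^sup>2) + B" unfolding \<B>_def by linarith
    then show ?thesis by (simp add: oscillator_potential_def inverse_eq_divide)
  qed
  note osc = this
  show ?thesis by (rule that[OF nf A_pos osc])
qed

end

section \<open>From the closing conditions to isochronous circles\<close>

context bertrand_field
begin

text \<open>Closedness near the circle is asked for one of the two signs of K: the resulting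
  relations contain K only through K^2 = \<nu>.\<close>

lemma isochronous_fieldI:
  assumes "r0 \<in> I" "0 < \<nu> r0" "0 < U2 r0 / \<nu> r0 + s r0"
    and near: "\<And>r. r \<in> I \<Longrightarrow> 0 < \<nu> r \<Longrightarrow> 0 < U2 r / \<nu> r + s r \<Longrightarrow>
      \<exists>K. K\<^sup>2 = \<nu> r \<and> closed_near a b f V r K"
  shows "isochronous_field a b f V"
proof unfold_locales
  show "\<exists>r\<in>I. 0 < \<nu> r \<and> 0 < U2 r / \<nu> r + s r" using assms(1-3) by blast
  fix r assume r: "r \<in> I" "0 < \<nu> r" "0 < U2 r / \<nu> r + s r"
  obtain K where K: "K\<^sup>2 = \<nu> r" "closed_near a b f V r K" using near[OF r] by blast
  have K0: "K \<noteq> 0" using K(1) r(2) by auto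
  have "W1 K r = 0" "0 < W2 K r" using W1_zero_iff_\<nu>[OF r(1) K0] W_U(2)[OF r(1) K0] K(1) r(3) by simp_all
  from stable_circle_isochronous[OF r(1) K0 this K(2)] obtain \<omega> where
    "\<omega> \<in> \<rat>" "0 < \<omega>" "W2 K r = \<omega>\<^sup>2" "5 * (W3 K r)\<^sup>2 = 3 * \<omega>\<^sup>2 * W4 K r" .
  then show "\<exists>\<omega>\<in>\<rat>. 0 < \<omega> \<and> U2 r / \<nu> r + s r = \<omega>\<^sup>2 \<and>
         5 * (U3 r / \<nu> r + s1 r)\<^sup>2 = 3 * \<omega>\<^sup>2 * (U4 r / \<nu> r + s2 r)"
    using W_U[OF r(1) K0] K(1) by auto
qed

lemma stable_circle_iff_\<nu>:
  assumes "r \<in> I" "K \<noteq> 0"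
  shows "W1 K r = 0 \<and> 0 < W2 K r \<longleftrightarrow> K\<^sup>2 = \<nu> r \<and> 0 < U2 r / \<nu> r + s r"
  using W1_zero_iff_\<nu>[OF assms] W_U(2)[OF assms] by auto

lemma locally_closing_isochronous:
  assumes "r0 \<in> I" "K \<noteq> 0" "W1 K r0 = 0" "0 < W2 K r0" and loc: "cond_all_loc a b f V"
  shows "isochronous_field a b f V"
proof (rule isochronous_fieldI[OF assms(1)])
  have K: "K\<^sup>2 = \<nu> r0" "0 < U2 r0 / \<nu> r0 + s r0" using stable_circle_iff_\<nu>[OF assms(1,2)] assms(3,4) by auto
  show "0 < \<nu> r0" using K(1) assms(2) by (metis zero_less_power2)
  show "0 < U2 r0 / \<nu> r0 + s r0" by (rule K)
  fix r assume r: "r \<in> I" "0 < \<nu> r" "0 < U2 r / \<nu> r + s r"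
  have "strongly_stable_circular a b f V r (sqrt (\<nu> r))"
    unfolding strongly_stable_circular_iff using stable_circle_iff_\<nu>[of r "sqrt (\<nu> r)"] r by simp
  then have "closed_near a b f V r (sqrt (\<nu> r))" using loc by (simp add: cond_all_loc_def)
  then show "\<exists>K. K\<^sup>2 = \<nu> r \<and> closed_near a b f V r K" using r(2) by (intro exI[of _ "sqrt (\<nu> r)"]) simp
qed

text \<open>Orbital stability does not by itself make the minimum nondegenerate. If the second
  derivative were nonpositive on all circles, \<nu> would be monotone in the direction that puts
  every circle at a global maximum of its effective potential, and such circles are
  unstable.\<close>

lemma weakly_closing_isochronous:
  assumes "weakly_closing a b f V"
  shows "isochronous_field a b f V"
proof -
  have circ: "\<exists>K. orbitally_stable_circular a b f V r K \<and> K \<noteq> 0 \<and> K\<^sup>2 = \<nu> r \<and> closed_near a b f V r K"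
    if rI: "r \<in> I" for r
  proof -
    have all: "\<forall>r\<in>I. \<exists>K. orbitally_stable_circular a b f V r K" and loc: "cond_all_weak_loc a b f V"
      using assms unfolding weakly_closing_def by (rule conjunct2, rule conjunct1)
    obtain K where K1: "orbitally_stable_circular a b f V r K" using bspec[OF all rI] ..
    note K = K1 loc[unfolded cond_all_weak_loc_def, rule_format, OF K1]
    obtain J \<rho> \<phi> where circ: "circular_trajectory_at a b f V r K J \<rho> \<phi>"
      using K(1)[unfolded orbitally_stable_circular_def] by (elim exE conjE) (rule that)
    have K0: "K \<noteq> 0" and "V' r = K\<^sup>2 * f' r / f r ^ 3"
      by (rule circular_trajectory_imp[OF circ])+
    then have "W1 K r = 0" using W1_zero_iff[OF rI K0] deriv_E[OF rI] by simp
    then have "K\<^sup>2 = \<nu> r" using W1_zero_iff_\<nu>[OF rI K0] by simp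
    then show ?thesis using K K0 by blast
  qed
  have \<nu>_pos: "0 < \<nu> r" if "r \<in> I" for r using circ[OF that] by (metis zero_less_power2)
  show ?thesis
  proof (cases "\<exists>r\<in>I. 0 < U2 r / \<nu> r + s r")
    case True
    then obtain r0 where "r0 \<in> I" "0 < U2 r0 / \<nu> r0 + s r0" by blast
    then show ?thesis using isochronous_fieldI[of r0] \<nu>_pos circ by blast
  next
    case False
    then have np: "U2 r + \<nu> r * s r \<le> 0" if "r \<in> I" for r
      using \<nu>_pos[OF that] that by (force simp: field_simps not_less)
    obtain r0 where r0: "r0 \<in> I" using einterval_nonempty[OF ab] by blast
    obtain K where K: "orbitally_stable_circular a b f V r0 K" "K\<^sup>2 = \<nu> r0" using circ[OF r0] by blast
    obtain J r \<phi> where J: "circular_trajectory_at a b f V r0 K J r \<phi>" "orbitally_stable a b f V K J r \<phi>"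
      using K(1) by (auto simp: orbitally_stable_circular_def)
    \<comment> \<open>For the momentum of the circle r0 the force has the sign of P times a
      difference of values of \<nu>, so the shape of the effective potential follows from the
      monotonicity of \<nu>.\<close>
    have Eder: "(E K has_real_derivative P x * (\<nu> r0 - \<nu> x) / (f x)\<^sup>2) (at x)" if "x \<in> I" for x
    proof -
      have "V' x - K\<^sup>2 * f' x / f x ^ 3 = P x * (\<nu> r0 - \<nu> x) / (f x)\<^sup>2"
        unfolding K(2) \<nu>_def[of x] U1_def D_def P_def using f_nonzero[OF that] f'_nonzero[OF that]
        by (simp add: field_simps power2_eq_square power3_eq_cube)
      then show ?thesis using effective_potential_deriv[OF that, of K] by simp
    qed
    \<comment> \<open>The direction of monotonicity of \<nu> depends on the sign of P; the product
      with P has one sign in both cases.\<close>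
    have mono: "0 \<le> P z * (\<nu> y - \<nu> x)" if xy: "x \<in> I" "y \<in> I" "x \<le> y" and z: "z \<in> I" for x y z
    proof -
      have sub: "u \<in> I" if "x \<le> u" "u \<le> y" for u using einterval_Icc_subset[OF xy(1,2)] that by auto
      from P_same_sign show ?thesis
      proof
        assume pos: "\<forall>r\<in>I. 0 < P r"
        have "\<nu> x \<le> \<nu> y"
        proof (rule DERIV_nonneg_imp_nondecreasing[OF xy(3)])
          fix u assume u: "x \<le> u" "u \<le> y"
          have "0 \<le> - (U2 u + \<nu> u * s u) / P u / (f u)\<^sup>2"
            using np[OF sub[OF u]] pos sub[OF u] by (intro divide_nonneg_nonneg) (auto simp: less_imp_le)
          then show "\<exists>D. (\<nu> has_real_derivative D) (at u) \<and> 0 \<le> D" using \<nu>_deriv[OF sub[OF u]] by blast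
        qed
        then show ?thesis using pos z by (simp add: less_imp_le)
      next
        assume neg: "\<forall>r\<in>I. P r < 0"
        have "\<nu> y \<le> \<nu> x"
        proof (rule DERIV_nonpos_imp_nonincreasing[OF xy(3)])
          fix u assume u: "x \<le> u" "u \<le> y"
          have "- (U2 u + \<nu> u * s u) / P u / (f u)\<^sup>2 \<le> 0"
            using np[OF sub[OF u]] neg sub[OF u]
            by (intro divide_nonpos_nonneg divide_nonneg_nonpos) (auto simp: less_imp_le)
          then show "\<exists>D. (\<nu> has_real_derivative D) (at u) \<and> D \<le> 0" using \<nu>_deriv[OF sub[OF u]] by blast
        qed
        then show ?thesis using neg z by (simp add: less_imp_le mult_nonpos_nonpos)
      qed
    qed
    have "E K x \<le> E K r0" if x: "x \<in> I" for x
    proof (cases "r0 \<le> x")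
      case True
      show ?thesis
      proof (rule DERIV_nonpos_imp_nonincreasing[OF True])
        fix u assume u: "r0 \<le> u" "u \<le> x"
        then have uI: "u \<in> I" using einterval_Icc_subset[OF r0 x] by auto
        have "P u * (\<nu> r0 - \<nu> u) / (f u)\<^sup>2 \<le> 0"
          using mono[OF r0 uI u(1) uI] by (intro divide_nonpos_nonneg) (auto simp: algebra_simps)
        then show "\<exists>y. (E K has_real_derivative y) (at u) \<and> y \<le> 0" using Eder[OF uI] by blast
      qed
    next
      case False
      then have "x \<le> r0" by simp
      then show ?thesis
      proof (rule DERIV_nonneg_imp_nondecreasing)
        fix u assume u: "x \<le> u" "u \<le> r0"
        then have uI: "u \<in> I" using einterval_Icc_subset[OF x r0] by auto
        have "0 \<le> P u * (\<nu> r0 - \<nu> u) / (f u)\<^sup>2"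
          using mono[OF uI r0 u(2) uI] by (intro divide_nonneg_nonneg) auto
        then show "\<exists>y. (E K has_real_derivative y) (at u) \<and> 0 \<le> y" using Eder[OF uI] by blast
      qed
    qed
    then show ?thesis using maximum_unstable[OF J(1)] J(2) by blast
  qed
qed

text \<open>A closing potential is semilocally closing, and on the nonempty interval a strongly
  closing one is locally closing. The five notions thus reduce to the local, the semilocal and the
  weak case.\<close>

lemma closing_isochronous:
  assumes "Q \<in> {semilocally_closing a b f, locally_closing a b f, closing a b f,
            strongly_closing a b f, weakly_closing a b f}" "Q V"
  shows "isochronous_field a b f V"
proof -
  have loc: "isochronous_field a b f V" if "cond_exists_loc a b f V" "cond_all_loc a b f V"
    using that locally_closing_isochronous by (auto simp: cond_exists_loc_def strongly_stable_circular_iff)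
  have semi: "isochronous_field a b f V" if "semilocally_closing a b f V"
  proof -
    obtain r \<phi> where "nonsingular_bounded a b f V r \<phi>" "\<not> circular UNIV r \<phi>" "cond_all_sloc a b f V r \<phi>"
      and "cond_all_loc a b f V" using \<open>semilocally_closing a b f V\<close> by (auto simp: semilocally_closing_def)
    then show ?thesis using semilocal_stable_circle locally_closing_isochronous by metis
  qed
  have closing: "semilocally_closing a b f V" if "closing a b f V"
    using that unfolding closing_def semilocally_closing_def cond_exists_def cond_all_def cond_all_sloc_def
      cond_all_loc_def closed_near_def using zero_less_one by blast
  have strong: "cond_exists_loc a b f V" if "strongly_closing a b f V"
    using that einterval_nonempty[OF ab] unfolding strongly_closing_def cond_exists_loc_def by blast
  show ?thesis
    using assms loc semi closing strong weakly_closing_isochronous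
    by (auto simp: locally_closing_def strongly_closing_def)
qed

end

section \<open>The normal form of the metric\<close>

text \<open>Near the end the function falls to or below each single one of its values and never
  falls below the infimum. Argued in the extended reals, this covers infinite end points and
  infinite limits alike.\<close>

lemma boundary_limit_INF:
  assumes "\<And>x0. x0 \<in> einterval a b \<Longrightarrow>
    \<forall>\<^sub>F x in at r0 within {a<..<b}. real_of_ereal x \<in> einterval a b \<and> g (real_of_ereal x) \<le> g x0"
    and "a < b"
  shows "boundary_limit a b r0 g (INF r \<in> einterval a b. ereal (g r))"
  unfolding boundary_limit_def
proof (rule order_tendstoI)
  obtain x0 where x0: "x0 \<in> einterval a b" using einterval_nonempty[OF assms(2)] by blast
  fix e assume e: "e < (INF r \<in> einterval a b. ereal (g r))"
  show "\<forall>\<^sub>F x in at r0 within {a<..<b}. e < ereal (g (real_of_ereal x))"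
    using assms(1)[OF x0]
  proof eventually_elim
    case (elim x)
    then show ?case using e INF_lower[of "real_of_ereal x" "einterval a b" "\<lambda>r. ereal (g r)"]
      by (meson less_le_trans)
  qed
next
  fix e assume "(INF r \<in> einterval a b. ereal (g r)) < e"
  then obtain x0 where x0: "x0 \<in> einterval a b" "ereal (g x0) < e" by (auto simp: INF_less_iff)
  show "\<forall>\<^sub>F x in at r0 within {a<..<b}. ereal (g (real_of_ereal x)) < e"
    using assms(1)[OF x0(1)]
  proof eventually_elim
    case (elim x)
    then have "ereal (g (real_of_ereal x)) \<le> ereal (g x0)" by simp
    then show ?case using x0(2) by (rule le_less_trans)
  qed
qed

lemma boundary_limit_SUP:
  assumes "\<And>x0. x0 \<in> einterval a b \<Longrightarrow>
    \<forall>\<^sub>F x in at r0 within {a<..<b}. real_of_ereal x \<in> einterval a b \<and> g x0 \<le> g (real_of_ereal x)"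
    and "a < b"
  shows "boundary_limit a b r0 g (SUP r \<in> einterval a b. ereal (g r))"
  unfolding boundary_limit_def
proof (rule order_tendstoI)
  obtain x0 where x0: "x0 \<in> einterval a b" using einterval_nonempty[OF assms(2)] by blast
  fix e assume e: "(SUP r \<in> einterval a b. ereal (g r)) < e"
  show "\<forall>\<^sub>F x in at r0 within {a<..<b}. ereal (g (real_of_ereal x)) < e"
    using assms(1)[OF x0]
  proof eventually_elim
    case (elim x)
    then show ?case using e SUP_upper[of "real_of_ereal x" "einterval a b" "\<lambda>r. ereal (g r)"]
      by (meson le_less_trans)
  qed
next
  fix e assume "e < (SUP r \<in> einterval a b. ereal (g r))"
  then obtain x0 where x0: "x0 \<in> einterval a b" "e < ereal (g x0)" by (auto simp: less_SUP_iff)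
  show "\<forall>\<^sub>F x in at r0 within {a<..<b}. e < ereal (g (real_of_ereal x))"
    using assms(1)[OF x0(1)]
  proof eventually_elim
    case (elim x)
    then have "ereal (g x0) \<le> ereal (g (real_of_ereal x))" by simp
    with x0(2) show ?case by (rule less_le_trans)
  qed
qed

lemma eventually_near_left_end:
  assumes "x0 \<in> einterval a b"
  shows "\<forall>\<^sub>F x in at a within {a<..<b}. real_of_ereal x \<in> einterval a b \<and> real_of_ereal x \<le> x0"
  unfolding eventually_at_topological
proof (intro exI[of _ "{..<ereal x0}"] conjI ballI impI)
  show "a \<in> {..<ereal x0}" using assms by (simp add: einterval_iff)
  fix x assume "x \<in> {..<ereal x0}" "x \<in> {a<..<b}"
  then have x: "a < x" "x < b" "x < ereal x0" by auto
  then obtain y where "x = ereal y" by (cases x) auto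
  then show "real_of_ereal x \<in> einterval a b" "real_of_ereal x \<le> x0"
    using x by (auto simp: einterval_iff)
qed simp

lemma eventually_near_right_end:
  assumes "x0 \<in> einterval a b"
  shows "\<forall>\<^sub>F x in at b within {a<..<b}. real_of_ereal x \<in> einterval a b \<and> x0 \<le> real_of_ereal x"
  unfolding eventually_at_topological
proof (intro exI[of _ "{ereal x0<..}"] conjI ballI impI)
  show "b \<in> {ereal x0<..}" using assms by (simp add: einterval_iff)
  fix x assume "x \<in> {ereal x0<..}" "x \<in> {a<..<b}"
  then have x: "a < x" "x < b" "ereal x0 < x" by auto
  then obtain y where "x = ereal y" by (cases x) auto
  then show "real_of_ereal x \<in> einterval a b" "x0 \<le> real_of_ereal x"
    using x by (auto simp: einterval_iff)
qed simp

lemma boundary_limit_unique: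
  assumes "a < b" "r0 \<in> {a, b}" "boundary_limit a b r0 g l" "boundary_limit a b r0 g l'"
  shows "l = l'"
proof (rule tendsto_unique[OF _ assms(3,4)[unfolded boundary_limit_def]])
  have "r0 islimpt {a<..<b}"
    using assms(1,2) islimpt_greaterThanLessThan1 islimpt_greaterThanLessThan2 by auto
  then show "at r0 within {a<..<b} \<noteq> bot" by (simp add: trivial_limit_within)
qed

lemma INF_less_SUP:
  assumes "x \<in> S" "y \<in> S" "(g x :: real) \<noteq> g y"
  shows "(INF r \<in> S. ereal (g r)) \<noteq> (SUP r \<in> S. ereal (g r))"
proof
  assume *: "(INF r \<in> S. ereal (g r)) = (SUP r \<in> S. ereal (g r))"
  have "ereal (g u) \<le> ereal (g v)" if "u \<in> S" "v \<in> S" for u v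
    using SUP_upper[OF that(1), of "\<lambda>r. ereal (g r)"] INF_lower[OF that(2), of "\<lambda>r. ereal (g r)"] *
    by (metis order_trans)
  from this[of x y] this[of y x] show False using assms by simp
qed

text \<open>A strictly monotone function tends to its infimum at one end and to its supremum at the
  other. These differ, and limits at the ends are unique, so each extremum belongs to exactly one
  end.\<close>

lemma monotone_attained_at:
  fixes a b :: ereal
  assumes ab: "a < b"
  shows increasing_inf_attained_at: "(\<And>x y. x \<in> einterval a b \<Longrightarrow> y \<in> einterval a b \<Longrightarrow> x < y \<Longrightarrow> g x < g y) \<Longrightarrow>
      inf_attained_at a b g r0 \<longleftrightarrow> r0 = a"
    and increasing_sup_attained_at: "(\<And>x y. x \<in> einterval a b \<Longrightarrow> y \<in> einterval a b \<Longrightarrow> x < y \<Longrightarrow> g x < g y) \<Longrightarrow>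
      sup_attained_at a b g r0 \<longleftrightarrow> r0 = b"
    and decreasing_inf_attained_at: "(\<And>x y. x \<in> einterval a b \<Longrightarrow> y \<in> einterval a b \<Longrightarrow> x < y \<Longrightarrow> g y < g x) \<Longrightarrow>
      inf_attained_at a b g r0 \<longleftrightarrow> r0 = b"
    and decreasing_sup_attained_at: "(\<And>x y. x \<in> einterval a b \<Longrightarrow> y \<in> einterval a b \<Longrightarrow> x < y \<Longrightarrow> g y < g x) \<Longrightarrow>
      sup_attained_at a b g r0 \<longleftrightarrow> r0 = a"
proof -
  obtain x where x: "x \<in> einterval a b" using einterval_nonempty[OF ab] by blast
  obtain e where e: "0 < e" "{x - e..x + e} \<subseteq> einterval a b"
    by (rule einterval_obtain_Icc[OF x zero_less_one], rule that)
  have y: "x + e \<in> einterval a b" "x < x + e" using e(1) by (auto intro: subsetD[OF e(2)])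
  {
    assume inc: "\<And>x y. x \<in> einterval a b \<Longrightarrow> y \<in> einterval a b \<Longrightarrow> x < y \<Longrightarrow> g x < g y"
    then have le: "u \<in> einterval a b \<Longrightarrow> v \<in> einterval a b \<Longrightarrow> u \<le> v \<Longrightarrow> g u \<le> g v" for u v
      by (cases "u = v") (auto simp: less_imp_le)
    have 1: "boundary_limit a b a g (INF r \<in> einterval a b. ereal (g r))"
    proof (rule boundary_limit_INF[OF _ ab])
      fix x0 assume x0: "x0 \<in> einterval a b"
      show "\<forall>\<^sub>F x in at a within {a<..<b}. real_of_ereal x \<in> einterval a b \<and> g (real_of_ereal x) \<le> g x0"
        using eventually_near_left_end[OF x0] by eventually_elim (use x0 in \<open>auto intro: le\<close>)
    qed
    have 2: "boundary_limit a b b g (SUP r \<in> einterval a b. ereal (g r))"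
    proof (rule boundary_limit_SUP[OF _ ab])
      fix x0 assume x0: "x0 \<in> einterval a b"
      show "\<forall>\<^sub>F x in at b within {a<..<b}. real_of_ereal x \<in> einterval a b \<and> g x0 \<le> g (real_of_ereal x)"
        using eventually_near_right_end[OF x0] by eventually_elim (use x0 in \<open>auto intro: le\<close>)
    qed
    have ne: "(INF r \<in> einterval a b. ereal (g r)) \<noteq> (SUP r \<in> einterval a b. ereal (g r))"
      by (rule INF_less_SUP[OF x y(1)]) (use inc[OF x y] in simp)
    show "inf_attained_at a b g r0 \<longleftrightarrow> r0 = a"
      using 1 boundary_limit_unique[OF ab _ 2] ne by (auto simp: inf_attained_at_def)
    show "sup_attained_at a b g r0 \<longleftrightarrow> r0 = b"
      using 2 boundary_limit_unique[OF ab _ 1] ne by (auto simp: sup_attained_at_def)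
  }
  {
    assume dec: "\<And>x y. x \<in> einterval a b \<Longrightarrow> y \<in> einterval a b \<Longrightarrow> x < y \<Longrightarrow> g y < g x"
    then have le: "u \<in> einterval a b \<Longrightarrow> v \<in> einterval a b \<Longrightarrow> u \<le> v \<Longrightarrow> g v \<le> g u" for u v
      by (cases "u = v") (auto simp: less_imp_le)
    have 1: "boundary_limit a b b g (INF r \<in> einterval a b. ereal (g r))"
    proof (rule boundary_limit_INF[OF _ ab])
      fix x0 assume x0: "x0 \<in> einterval a b"
      show "\<forall>\<^sub>F x in at b within {a<..<b}. real_of_ereal x \<in> einterval a b \<and> g (real_of_ereal x) \<le> g x0"
        using eventually_near_right_end[OF x0] by eventually_elim (use x0 in \<open>auto intro: le\<close>)
    qed
    have 2: "boundary_limit a b a g (SUP r \<in> einterval a b. ereal (g r))"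
    proof (rule boundary_limit_SUP[OF _ ab])
      fix x0 assume x0: "x0 \<in> einterval a b"
      show "\<forall>\<^sub>F x in at a within {a<..<b}. real_of_ereal x \<in> einterval a b \<and> g x0 \<le> g (real_of_ereal x)"
        using eventually_near_left_end[OF x0] by eventually_elim (use x0 in \<open>auto intro: le\<close>)
    qed
    have ne: "(INF r \<in> einterval a b. ereal (g r)) \<noteq> (SUP r \<in> einterval a b. ereal (g r))"
      by (rule INF_less_SUP[OF x y(1)]) (use dec[OF x y] in simp)
    show "inf_attained_at a b g r0 \<longleftrightarrow> r0 = b"
      using 1 boundary_limit_unique[OF ab _ 2] ne by (auto simp: inf_attained_at_def)
    show "sup_attained_at a b g r0 \<longleftrightarrow> r0 = a"
      using 2 boundary_limit_unique[OF ab _ 1] ne by (auto simp: sup_attained_at_def)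
  }
qed

lemma einterval_deriv_increasing:
  fixes g :: "real \<Rightarrow> real"
  assumes "\<And>x. x \<in> einterval a b \<Longrightarrow> (g has_real_derivative g' x) (at x)"
    "\<And>x. x \<in> einterval a b \<Longrightarrow> 0 < g' x" "x \<in> einterval a b" "y \<in> einterval a b" "x < y"
  shows "g x < g y"
proof (rule DERIV_pos_imp_increasing[OF assms(5)])
  fix z assume "x \<le> z" "z \<le> y"
  then have "z \<in> einterval a b" using einterval_Icc_subset[OF assms(3,4)] by auto
  then show "\<exists>d. (g has_real_derivative d) (at z) \<and> 0 < d" using assms(1,2) by blast
qed

lemma einterval_deriv_decreasing:
  fixes g :: "real \<Rightarrow> real"
  assumes "\<And>x. x \<in> einterval a b \<Longrightarrow> (g has_real_derivative g' x) (at x)"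
    "\<And>x. x \<in> einterval a b \<Longrightarrow> g' x < 0" "x \<in> einterval a b" "y \<in> einterval a b" "x < y"
  shows "g y < g x"
proof -
  have "- g x < - g y"
    by (rule einterval_deriv_increasing[of a b "\<lambda>x. - g x" "\<lambda>x. - g' x", OF DERIV_minus[OF assms(1)] _ assms(3-5)])
      (use assms(2) in auto)
  then show ?thesis by simp
qed

lemma nonzero_same_sign:
  fixes g :: "real \<Rightarrow> real"
  assumes "continuous_on (einterval a b) g" "\<And>x. x \<in> einterval a b \<Longrightarrow> g x \<noteq> 0"
  shows "(\<forall>x\<in>einterval a b. 0 < g x) \<or> (\<forall>x\<in>einterval a b. g x < 0)"
proof (rule ccontr)
  assume "\<not> ?thesis"
  then obtain x y where xy: "x \<in> einterval a b" "y \<in> einterval a b" "g x < 0" "0 < g y"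
    using assms(2) by (metis linorder_neqE_linordered_idom)
  have "connected (g ` einterval a b)"
    by (intro connected_continuous_image assms)
      (simp add: is_interval_einterval is_interval_connected)
  then have "0 \<in> g ` einterval a b" using xy connectedD_interval[of "g ` einterval a b" "g x" "g y" 0] by auto
  then show False using assms(2) by auto
qed

section \<open>Consequences of a given normal form, and its uniqueness\<close>

locale normal_form_field = bertrand_field +
  fixes \<theta> :: "real \<Rightarrow> real" and \<mu> c d :: real
  assumes nf: "metric_normal_form a b f \<theta> \<mu> c d"
begin

lemma \<mu>: "0 < \<mu>" "\<mu> \<in> \<rat>" and d_nonzero: "d \<noteq> 0"
  and \<theta>_nonzero: "r \<in> I \<Longrightarrow> \<theta> r \<noteq> 0"
  and smooth_\<theta>: "smooth_on_interval a b \<theta>"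
  using nf by (auto simp: metric_normal_form_def)

definition "h r = (\<theta> r)\<^sup>2 + c - d / (\<theta> r)\<^sup>2"

text \<open>The two quadratic forms are compared on the vectors (0, 1) and (1, 0). Positivity of f^2
  gives the sign of h, and positivity of the derivative of \<theta> selects the root of their
  equality of squares.\<close>

lemma h_f:
  assumes "r \<in> I"
  shows "0 < h r" "\<mu>\<^sup>2 * h r = 1 / (f r)\<^sup>2" "deriv \<theta> r = h r"
proof -
  have eq: "u\<^sup>2 + (f r)\<^sup>2 * v\<^sup>2 = (deriv \<theta> r * u)\<^sup>2 / (h r)\<^sup>2 + v\<^sup>2 / (\<mu>\<^sup>2 * h r)" for u v
    using nf assms by (auto simp: metric_normal_form_def h_def)
  have pos: "0 < deriv \<theta> r" using nf assms by (auto simp: metric_normal_form_def)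
  have 1: "(f r)\<^sup>2 = 1 / (\<mu>\<^sup>2 * h r)" using eq[of 0 1] by simp
  have f2: "0 < (f r)\<^sup>2" using f_nonzero[OF assms] by simp
  then have "0 < 1 / (\<mu>\<^sup>2 * h r)" using 1 by simp
  then show h: "0 < h r" using \<mu>(1) by (simp add: zero_less_divide_iff zero_less_mult_iff)
  show "\<mu>\<^sup>2 * h r = 1 / (f r)\<^sup>2" unfolding 1 using \<mu>(1) h by simp
  have "1 = (deriv \<theta> r)\<^sup>2 / (h r)\<^sup>2" using eq[of 1 0] pos by simp
  then have "(deriv \<theta> r)\<^sup>2 = (h r)\<^sup>2" using h unfolding eq_divide_eq by simp
  then show "deriv \<theta> r = h r" using pos h by (simp add: power2_eq_iff_nonneg less_imp_le)
qed

lemma \<theta>_deriv: "r \<in> I \<Longrightarrow> (\<theta> has_real_derivative h r) (at r)"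
  using smooth_has_derivative[OF smooth_\<theta>] h_f(3) by simp

lemma h_eq: "r \<in> I \<Longrightarrow> h r = 1 / \<mu>\<^sup>2 / (f r)\<^sup>2"
proof -
  assume r: "r \<in> I"
  have "h r = \<mu>\<^sup>2 * h r / \<mu>\<^sup>2" using \<mu>(1) by simp
  then show ?thesis unfolding h_f(2)[OF r] by simp
qed

lemma inverse_\<theta>_power_deriv:
  assumes "r \<in> I"
  shows "((\<lambda>r. inverse (\<theta> r ^ n)) has_real_derivative - real n * inverse (\<theta> r ^ Suc n) * h r) (at r)"
proof -
  have "((\<lambda>r. inverse (\<theta> r) ^ n) has_real_derivative
      of_nat n * (- (inverse (\<theta> r) * h r * inverse (\<theta> r)) * inverse (\<theta> r) ^ (n - Suc 0))) (at r)"
    by (intro DERIV_power DERIV_inverse' \<theta>_deriv \<theta>_nonzero assms)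
  moreover have "of_nat n * (- (inverse (\<theta> r) * h r * inverse (\<theta> r)) * inverse (\<theta> r) ^ (n - Suc 0))
      = - real n * inverse (\<theta> r ^ Suc n) * h r"
    by (cases n) (auto simp: power_inverse algebra_simps)
  ultimately show ?thesis by (simp only: power_inverse)
qed

text \<open>Both sides of 1 / f^2 = \<mu>^2 h are differentiated: the left one produces P, the right
  one only \<theta> and d.\<close>

lemma P_\<theta>:
  assumes "r \<in> I"
  shows "P r = \<theta> r + d * inverse (\<theta> r ^ 3)"
proof -
  have "((\<lambda>r. inverse ((f r)\<^sup>2)) has_real_derivative 2 * P r / (f r)\<^sup>2) (at r)"
    using f_nonzero[OF assms] by (auto intro!: derivative_eq_intros f_deriv assms simp: P_def)
      (simp add: field_simps power2_eq_square)
  moreover have "((\<lambda>r. inverse ((f r)\<^sup>2)) has_real_derivative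
      \<mu>\<^sup>2 * (2 * (\<theta> r + d * inverse (\<theta> r ^ 3)) * h r)) (at r)"
  proof (rule has_field_derivative_transform_within_open[OF _ open_einterval assms])
    have "((\<lambda>r. \<mu>\<^sup>2 * ((\<theta> r)\<^sup>2 + c - d * inverse ((\<theta> r)\<^sup>2))) has_real_derivative
       \<mu>\<^sup>2 * (of_nat 2 * (h r * \<theta> r ^ (2 - Suc 0)) + 0 - d * (- real 2 * inverse (\<theta> r ^ Suc 2) * h r))) (at r)"
      by (intro DERIV_cmult DERIV_diff DERIV_add DERIV_power DERIV_const \<theta>_deriv inverse_\<theta>_power_deriv assms)
    moreover have "\<mu>\<^sup>2 * (of_nat 2 * (h r * \<theta> r ^ (2 - Suc 0)) + 0 - d * (- real 2 * inverse (\<theta> r ^ Suc 2) * h r))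
       = \<mu>\<^sup>2 * (2 * (\<theta> r + d * inverse (\<theta> r ^ 3)) * h r)"
      by (simp add: algebra_simps)
    ultimately show "((\<lambda>r. \<mu>\<^sup>2 * ((\<theta> r)\<^sup>2 + c - d * inverse ((\<theta> r)\<^sup>2))) has_real_derivative
       \<mu>\<^sup>2 * (2 * (\<theta> r + d * inverse (\<theta> r ^ 3)) * h r)) (at r)" by (simp only:)
    show "\<mu>\<^sup>2 * ((\<theta> x)\<^sup>2 + c - d * inverse ((\<theta> x)\<^sup>2)) = inverse ((f x)\<^sup>2)" if "x \<in> I" for x
      using h_f(2)[OF that] by (simp add: h_def inverse_eq_divide)
  qed
  ultimately have "2 * P r / (f r)\<^sup>2 = \<mu>\<^sup>2 * (2 * (\<theta> r + d * inverse (\<theta> r ^ 3)) * h r)" by (rule DERIV_unique)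
  also have "\<dots> = 2 * (\<theta> r + d * inverse (\<theta> r ^ 3)) * (\<mu>\<^sup>2 * h r)" by simp
  also have "\<dots> = 2 * (\<theta> r + d * inverse (\<theta> r ^ 3)) / (f r)\<^sup>2" unfolding h_f(2)[OF assms] by simp
  finally show ?thesis using f_nonzero[OF assms] by simp
qed

lemma P_\<theta>':
  assumes "r \<in> I"
  shows "P r * \<theta> r ^ 3 = \<theta> r ^ 4 + d" "\<theta> r ^ 4 + d \<noteq> 0"
proof -
  show 1: "P r * \<theta> r ^ 3 = \<theta> r ^ 4 + d"
  proof -
    have "\<theta> r * \<theta> r ^ 3 = \<theta> r ^ 4" by (simp add: power3_eq_cube power4_eq_xxxx)
    then show ?thesis unfolding P_\<theta>[OF assms] using \<theta>_nonzero[OF assms] by (simp add: distrib_right)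
  qed
  show "\<theta> r ^ 4 + d \<noteq> 0" unfolding 1[symmetric] using P_nonzero[OF assms] \<theta>_nonzero[OF assms] by simp
qed

lemma s_\<theta>:
  assumes "r \<in> I"
  shows "s r = (1 - 3 * d * inverse (\<theta> r ^ 4)) / \<mu>\<^sup>2"
proof -
  have "(P has_real_derivative h r + d * (- real 3 * inverse (\<theta> r ^ Suc 3) * h r)) (at r)"
  proof (rule has_field_derivative_transform_within_open[OF _ open_einterval assms])
    show "((\<lambda>r. \<theta> r + d * inverse (\<theta> r ^ 3)) has_real_derivative h r + d * (- real 3 * inverse (\<theta> r ^ Suc 3) * h r)) (at r)"
      by (intro DERIV_add DERIV_cmult \<theta>_deriv inverse_\<theta>_power_deriv assms)
  qed (simp add: P_\<theta>)
  from DERIV_unique[OF D_derivs(1)[OF assms] this]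
  have "s r / (f r)\<^sup>2 = (1 - 3 * d * inverse (\<theta> r ^ 4)) * h r"
    by (simp add: algebra_simps)
  also have "\<dots> = (1 - 3 * d * inverse (\<theta> r ^ 4)) / \<mu>\<^sup>2 / (f r)\<^sup>2" unfolding h_eq[OF assms] by simp
  finally show ?thesis using f_nonzero[OF assms] unfolding divide_cancel_right by simp
qed

lemma s1_\<theta>:
  assumes "r \<in> I"
  shows "s1 r = 12 * d * inverse (\<theta> r ^ 5) / \<mu> ^ 4"
proof -
  have "(s has_real_derivative (0 - 3 * d * (- real 4 * inverse (\<theta> r ^ Suc 4) * h r)) / \<mu>\<^sup>2) (at r)"
  proof (rule has_field_derivative_transform_within_open[OF _ open_einterval assms])
    show "((\<lambda>r. (1 - 3 * d * inverse (\<theta> r ^ 4)) / \<mu>\<^sup>2) has_real_derivative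
        (0 - 3 * d * (- real 4 * inverse (\<theta> r ^ Suc 4) * h r)) / \<mu>\<^sup>2) (at r)"
      by (intro DERIV_cdivide DERIV_diff DERIV_const DERIV_cmult inverse_\<theta>_power_deriv assms)
  qed (simp add: s_\<theta>)
  from DERIV_unique[OF D_derivs(2)[OF assms] this]
  have "s1 r / (f r)\<^sup>2 = 12 * d * inverse (\<theta> r ^ Suc 4) * h r / \<mu>\<^sup>2" by simp
  also have "\<dots> = 12 * d * inverse (\<theta> r ^ 5) / \<mu> ^ 4 / (f r)\<^sup>2"
    unfolding h_eq[OF assms] by (simp add: power2_eq_square power4_eq_xxxx)
  finally show ?thesis using f_nonzero[OF assms] unfolding divide_cancel_right by simp
qed

text \<open>The curvature equation with \<omega>^2 = 4 / \<mu>^2. With y = d / \<theta>^4 one has P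
  / \<theta> = 1 + y, while the two differences on the right are 3 y / \<mu>^2 and 3 (1 + y) /
  \<mu>^2. Since d is nonzero, s is nowhere stationary, which is what uniqueness needs.\<close>

lemma s_equation:
  assumes "r \<in> I"
  shows "3 * P r * s1 r = 4 * (1 / \<mu>\<^sup>2 - s r) * (4 / \<mu>\<^sup>2 - s r)" "s1 r \<noteq> 0"
proof -
  define y where "y = d * inverse (\<theta> r ^ 4)"
  have t: "\<theta> r \<noteq> 0" by (rule \<theta>_nonzero[OF assms])
  have "3 * P r * s1 r = 36 * ((P r * inverse (\<theta> r)) * (d * inverse (\<theta> r ^ 4))) / \<mu> ^ 4"
    unfolding s1_\<theta>[OF assms] by (simp add: power_Suc[of _ 4, simplified] eval_nat_numeral)
  also have "P r * inverse (\<theta> r) = 1 + y"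
    unfolding P_\<theta>[OF assms] y_def using t by (simp add: field_simps eval_nat_numeral)
  also have "36 * ((1 + y) * (d * inverse (\<theta> r ^ 4))) / \<mu> ^ 4 = 36 * (y / \<mu>\<^sup>2) * ((1 + y) / \<mu>\<^sup>2)"
    unfolding y_def[symmetric] by (simp add: power2_eq_square power4_eq_xxxx mult_ac)
  also have "\<dots> = 4 * (1 / \<mu>\<^sup>2 - s r) * (4 / \<mu>\<^sup>2 - s r)"
  proof -
    have "1 / \<mu>\<^sup>2 - s r = 3 * (y / \<mu>\<^sup>2)" "4 / \<mu>\<^sup>2 - s r = 3 * ((1 + y) / \<mu>\<^sup>2)"
      unfolding s_\<theta>[OF assms] y_def by (simp_all add: diff_divide_distrib add_divide_distrib)
    then show ?thesis by simp
  qed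
  finally show "3 * P r * s1 r = 4 * (1 / \<mu>\<^sup>2 - s r) * (4 / \<mu>\<^sup>2 - s r)" .
  show "s1 r \<noteq> 0" unfolding s1_\<theta>[OF assms] using d_nonzero t \<mu>(1) by simp
qed

end

text \<open>The product P s1 depends on f alone, so two values of \<mu> would make s constant,
  against \<open>s1 r \<noteq> 0\<close>. Once \<mu> is fixed, s determines d / \<theta>^4, then P
  determines \<theta>, and finally h determines c.\<close>

lemma (in bertrand_field) normal_form_unique:
  assumes "metric_normal_form a b f \<theta>1 \<mu>1 c1 d1" "metric_normal_form a b f \<theta>2 \<mu>2 c2 d2"
  shows "\<forall>r\<in>I. \<theta>1 r = \<theta>2 r" "(\<mu>1, c1, d1) = (\<mu>2, c2, d2)"
proof -
  interpret n1: normal_form_field a b f V \<theta>1 \<mu>1 c1 d1 by unfold_locales (rule assms)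
  interpret n2: normal_form_field a b f V \<theta>2 \<mu>2 c2 d2 by unfold_locales (rule assms)
  define p where "p = 1 / \<mu>1\<^sup>2"
  define q where "q = 1 / \<mu>2\<^sup>2"
  obtain r0 where r0: "r0 \<in> I" using einterval_nonempty[OF ab] by blast
  \<comment> \<open>The squares of s cancel between the two equations, leaving a relation linear in
    s.\<close>
  have eq: "4 * (p * p - q * q) = 5 * s r * (p - q)" if "r \<in> I" for r
  proof -
    have "4 * (p - s r) * (4 * p - s r) = 4 * (q - s r) * (4 * q - s r)"
      using n1.s_equation(1)[OF that] n2.s_equation(1)[OF that] by (simp add: p_def q_def)
    then show ?thesis by (simp add: algebra_simps)
  qed
  have "p = q"
  proof (rule ccontr)
    assume "p \<noteq> q"
    then have "s r = 4 / 5 * (p + q)" if "r \<in> I" for r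
    proof -
      have "(p - q) * (4 * (p + q)) = (p - q) * (5 * s r)" using eq[OF that] by (simp add: algebra_simps)
      then show ?thesis using \<open>p \<noteq> q\<close> by simp
    qed
    then have "(s has_real_derivative 0) (at r0)"
      by (intro has_field_derivative_transform_within_open[OF DERIV_const[of "4 / 5 * (p + q)"] open_einterval r0]) simp
    from DERIV_unique[OF this D_derivs(2)[OF r0]] show False
      using n1.s_equation(2)[OF r0] f_nonzero[OF r0] by simp
  qed
  then have "\<mu>1\<^sup>2 = \<mu>2\<^sup>2" by (simp add: p_def q_def)
  then have \<mu>: "\<mu>1 = \<mu>2" using n1.\<mu>(1) n2.\<mu>(1) by (simp add: power2_eq_iff_nonneg less_imp_le)
  have y: "d1 * inverse (\<theta>1 r ^ 4) = d2 * inverse (\<theta>2 r ^ 4)" and \<theta>: "\<theta>1 r = \<theta>2 r" if "r \<in> I" for r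
  proof -
    show y: "d1 * inverse (\<theta>1 r ^ 4) = d2 * inverse (\<theta>2 r ^ 4)"
      using n1.s_\<theta>[OF that] n2.s_\<theta>[OF that] n1.\<mu>(1) by (simp add: \<mu>)
    have P1: "P r = \<theta>1 r * (1 + d1 * inverse (\<theta>1 r ^ 4))"
      unfolding n1.P_\<theta>[OF that] using n1.\<theta>_nonzero[OF that] by (simp add: field_simps eval_nat_numeral)
    have P2: "P r = \<theta>2 r * (1 + d2 * inverse (\<theta>2 r ^ 4))"
      unfolding n2.P_\<theta>[OF that] using n2.\<theta>_nonzero[OF that] by (simp add: field_simps eval_nat_numeral)
    show "\<theta>1 r = \<theta>2 r" using P1 P2 P_nonzero[OF that] by (simp add: y)
  qed
  show "\<forall>r\<in>I. \<theta>1 r = \<theta>2 r" using \<theta> by blast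
  have d: "d1 = d2" using y[OF r0] \<theta>[OF r0] n2.\<theta>_nonzero[OF r0] by simp
  have "n1.h r0 = n2.h r0" using n1.h_eq[OF r0] n2.h_eq[OF r0] by (simp add: \<mu>)
  from this[unfolded n1.h_def n2.h_def] have "c1 = c2" using \<theta>[OF r0] d by simp
  then show "(\<mu>1, c1, d1) = (\<mu>2, c2, d2)" using \<mu> d by simp
qed

section \<open>The oscillator potential\<close>

locale oscillator_field = normal_form_field +
  fixes A B :: real
  assumes A_pos: "\<And>r. r \<in> I \<Longrightarrow> 0 < A * (\<theta> r ^ 4 + d)"
    and V_eq: "\<And>r. r \<in> I \<Longrightarrow> V r = oscillator_potential \<theta> A B r"
begin

lemma V_\<theta>: "r \<in> I \<Longrightarrow> V r = A / 2 * inverse ((\<theta> r)\<^sup>2) + B"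
  by (simp add: V_eq oscillator_potential_def inverse_eq_divide)

lemma V_osc_deriv:
  assumes "r \<in> I"
  shows "(V has_real_derivative - A * inverse (\<theta> r ^ 3) * h r) (at r)"
proof (rule has_field_derivative_transform_within_open[OF _ open_einterval assms])
  have "((\<lambda>r. A / 2 * inverse ((\<theta> r)\<^sup>2) + B) has_real_derivative
      A / 2 * (- real 2 * inverse (\<theta> r ^ Suc 2) * h r) + 0) (at r)"
    by (intro DERIV_add DERIV_cmult DERIV_const inverse_\<theta>_power_deriv assms)
  moreover have "A / 2 * (- real 2 * inverse (\<theta> r ^ Suc 2) * h r) + 0 = - A * inverse (\<theta> r ^ 3) * h r" by simp
  ultimately show "((\<lambda>r. A / 2 * inverse ((\<theta> r)\<^sup>2) + B) has_real_derivative
      - A * inverse (\<theta> r ^ 3) * h r) (at r)" by (simp only:)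
qed (simp add: V_\<theta>)

lemma U1_osc: "r \<in> I \<Longrightarrow> U1 r = - A * inverse (\<theta> r ^ 3) / \<mu>\<^sup>2"
  unfolding U1_def by (rule D_eqI'[OF _ V_osc_deriv]) (simp_all add: h_eq)

lemma U2_osc:
  assumes "r \<in> I"
  shows "U2 r = 3 * A * inverse (\<theta> r ^ 4) / \<mu> ^ 4"
proof -
  have "((\<lambda>r. - A * inverse (\<theta> r ^ 3) / \<mu>\<^sup>2) has_real_derivative
      - A * (- real 3 * inverse (\<theta> r ^ Suc 3) * h r) / \<mu>\<^sup>2) (at r)"
    by (intro DERIV_cdivide DERIV_cmult inverse_\<theta>_power_deriv assms)
  moreover have "- A * (- real 3 * inverse (\<theta> r ^ Suc 3) * h r) / \<mu>\<^sup>2 = 3 * A * inverse (\<theta> r ^ 4) / \<mu> ^ 4 / (f r)\<^sup>2"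
    unfolding h_eq[OF assms] by (simp add: power2_eq_square power4_eq_xxxx mult_ac)
  ultimately have "D (\<lambda>r. - A * inverse (\<theta> r ^ 3) / \<mu>\<^sup>2) r = 3 * A * inverse (\<theta> r ^ 4) / \<mu> ^ 4"
    by (rule D_eqI'[OF assms])
  then show ?thesis unfolding U2_def using D_cong[OF U1_osc assms] by simp
qed

text \<open>The sign condition on A amounts to positivity of \<nu>, that is, to a circular orbit at
  every radius. The squared frequency is the same for all circles because the terms with d /
  \<theta>^4 in its two summands cancel.\<close>

lemma \<nu>_osc:
  assumes "r \<in> I"
  shows "\<nu> r = A / (\<theta> r ^ 4 + d) / \<mu>\<^sup>2" "0 < \<nu> r" "U2 r / \<nu> r + s r = 4 / \<mu>\<^sup>2"
proof -
  define T where "T = \<theta> r ^ 4 + d"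
  note t = \<theta>_nonzero[OF assms] and T = P_\<theta>'[OF assms, folded T_def]
  have A: "0 < A * T" "A \<noteq> 0" using A_pos[OF assms] by (auto simp: T_def)
  have P: "P r = T / \<theta> r ^ 3" unfolding T(1)[symmetric] using t by simp
  show \<nu>: "\<nu> r = A / (\<theta> r ^ 4 + d) / \<mu>\<^sup>2"
    unfolding \<nu>_def U1_osc[OF assms] P T_def[symmetric] using t T(2) \<mu>(1) by (simp add: field_simps)
  have AT: "0 < A / T" using A(1) by (simp add: zero_less_mult_iff zero_less_divide_iff)
  show "0 < \<nu> r" unfolding \<nu> T_def[symmetric] by (rule divide_pos_pos[OF AT]) (use \<mu>(1) in simp)
  have "U2 r / \<nu> r = 3 * (T * inverse (\<theta> r ^ 4)) / \<mu>\<^sup>2"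
    unfolding U2_osc[OF assms] \<nu> T_def[symmetric] using t T(2) A(2) \<mu>(1)
    by (simp add: power2_eq_square power4_eq_xxxx)
  also have "T * inverse (\<theta> r ^ 4) = 1 + d * inverse (\<theta> r ^ 4)"
    unfolding T_def using t by (simp add: distrib_right)
  finally show "U2 r / \<nu> r + s r = 4 / \<mu>\<^sup>2"
    unfolding s_\<theta>[OF assms] by (simp add: add_divide_distrib[symmetric])
qed

lemma circle_stable:
  assumes "r \<in> I"
  shows "strongly_stable_circular a b f V r (sqrt (\<nu> r))" "orbitally_stable_circular a b f V r (sqrt (\<nu> r))"
    "W1 (sqrt (\<nu> r)) r = 0" "0 < W2 (sqrt (\<nu> r)) r" "sqrt (\<nu> r) \<noteq> 0"
proof -
  show K: "sqrt (\<nu> r) \<noteq> 0" using \<nu>_osc(2)[OF assms] by simp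
  have "0 < U2 r / \<nu> r + s r" unfolding \<nu>_osc(3)[OF assms] using \<mu>(1) by simp
  then have "W1 (sqrt (\<nu> r)) r = 0 \<and> 0 < W2 (sqrt (\<nu> r)) r"
    unfolding stable_circle_iff_\<nu>[OF assms K] using \<nu>_osc(2)[OF assms] by simp
  then show *: "W1 (sqrt (\<nu> r)) r = 0" "0 < W2 (sqrt (\<nu> r)) r" by auto
  show "strongly_stable_circular a b f V r (sqrt (\<nu> r))"
    unfolding strongly_stable_circular_iff using assms K * by blast
  show "orbitally_stable_circular a b f V r (sqrt (\<nu> r))"
    by (rule stable_circle_orbitally_stable[OF assms K *])
qed

text \<open>In the angle \<open>\<phi>\<close>, the function \<open>\<theta>\<^sup>2\<close> performs harmonic oscillations of frequency \<open>2 / \<mu>\<close>.\<close>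

lemma harmonic:
  assumes sol: "is_solution a b f V UNIV r \<phi>" and mom: "has_angular_momentum f UNIV r \<phi> K" and K: "K \<noteq> 0"
  obtains m p q where "\<And>t. (\<theta> (r t))\<^sup>2 = m + p * cos (2 / \<mu> * \<phi> t) + q * sin (2 / \<mu> * \<phi> t)"
proof -
  define e where "e = (deriv r 0)\<^sup>2 / 2 + E K (r 0)"
  \<comment> \<open>The mean value of the oscillation: when energy conservation eliminates the
    radial velocity from the derivative of \<open>Y\<close>, the expression left is a multiple of m
    - \<theta>^2. The pair (\<open>Z\<close>, \<open>Y\<close>) then rotates with the angular
    velocity of \<open>\<eta>\<close>.\<close>
  define m where "m = (2 * e - 2 * B - K\<^sup>2 * \<mu>\<^sup>2 * c) / (2 * \<mu>\<^sup>2 * K\<^sup>2)"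
  define Z where "Z t = (\<theta> (r t))\<^sup>2 - m" for t
  define Y where "Y t = \<theta> (r t) * deriv r t / (\<mu> * K)" for t
  define \<eta> where "\<eta> t = 2 / \<mu> * \<phi> t" for t
  have mem: "r t \<in> I" for t using solution_mem[OF sol mom] by simp
  have d\<theta>: "((\<lambda>t. \<theta> (r t)) has_real_derivative h (r t) * deriv r t) (at t)" for t
    by (rule DERIV_chain2[OF \<theta>_deriv[OF mem] solution_r[OF sol mom UNIV_I]])
  have d\<eta>: "(\<eta> has_real_derivative 2 * \<mu> * K * h (r t)) (at t)" for t
  proof -
    have "(\<eta> has_real_derivative 2 / \<mu> * (K / (f (r t))\<^sup>2)) (at t)"
      unfolding \<eta>_def by (intro DERIV_cmult solution_\<phi>[OF sol mom UNIV_I])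
    moreover have "2 / \<mu> * (K / (f (r t))\<^sup>2) = 2 * \<mu> * K * h (r t)"
      unfolding h_eq[OF mem] using \<mu>(1) by (simp add: power2_eq_square)
    ultimately show ?thesis by simp
  qed
  have dZ: "(Z has_real_derivative 2 * \<mu> * K * h (r t) * Y t) (at t)" for t
  proof -
    have "(Z has_real_derivative of_nat 2 * (h (r t) * deriv r t * \<theta> (r t) ^ (2 - Suc 0)) - 0) (at t)"
      unfolding Z_def[abs_def] by (intro DERIV_diff DERIV_power DERIV_const d\<theta>)
    moreover have "of_nat 2 * (h (r t) * deriv r t * \<theta> (r t) ^ (2 - Suc 0)) - 0 = 2 * \<mu> * K * h (r t) * Y t"
      unfolding Y_def using K \<mu>(1) by simp
    ultimately show ?thesis by (simp only:)
  qed
  have dY: "(Y has_real_derivative - (2 * \<mu> * K * h (r t) * Z t)) (at t)" for t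
  proof -
    define x where "x = r t"
    define v where "v = deriv r t"
    define i2 where "i2 = inverse ((\<theta> x)\<^sup>2)"
    note xI = mem[of t, folded x_def]
    have t: "\<theta> x \<noteq> 0" by (rule \<theta>_nonzero[OF xI])
    have acc: "K\<^sup>2 * f' x / f x ^ 3 - V' x = h x * (A * inverse (\<theta> x ^ 3) - K\<^sup>2 * \<mu>\<^sup>2 * (\<theta> x + d * inverse (\<theta> x ^ 3)))"
    proof -
      have "V' x = - A * inverse (\<theta> x ^ 3) * h x" by (rule DERIV_imp_deriv[OF V_osc_deriv[OF xI]])
      moreover have "K\<^sup>2 * f' x / f x ^ 3 = - (K\<^sup>2 * P x * (1 / (f x)\<^sup>2))"
        unfolding P_def using f_nonzero[OF xI] by (simp add: power2_eq_square power3_eq_cube)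
      ultimately show ?thesis
        unfolding h_f(2)[OF xI, symmetric] P_\<theta>[OF xI] by (simp add: algebra_simps)
    qed
    have en: "v\<^sup>2 = 2 * e - A * i2 - 2 * B - K\<^sup>2 * \<mu>\<^sup>2 * h x"
    proof -
      have "v\<^sup>2 / 2 + E K x = e"
        unfolding e_def v_def x_def by (rule solution_energy[OF sol mom UNIV_I UNIV_I])
      moreover have "E K x = A / 2 * i2 + B + K\<^sup>2 * (\<mu>\<^sup>2 * h x) / 2"
        unfolding effective_potential_def V_\<theta>[OF xI] h_f(2)[OF xI] i2_def by simp
      ultimately show ?thesis by simp
    qed
    have hx: "h x = (\<theta> x)\<^sup>2 + c - d * i2" by (simp add: h_def i2_def inverse_eq_divide)
    have "(Y has_real_derivative (h x * v * v + (K\<^sup>2 * f' x / f x ^ 3 - V' x) * \<theta> x) / (\<mu> * K)) (at t)"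
      unfolding Y_def[abs_def] x_def v_def
      by (intro DERIV_cdivide DERIV_mult d\<theta> solution_v[OF sol mom UNIV_I])
    moreover have "h x * v * v + (K\<^sup>2 * f' x / f x ^ 3 - V' x) * \<theta> x = h x * - (2 * \<mu>\<^sup>2 * K\<^sup>2 * Z t)"
    proof -
      have i3: "inverse (\<theta> x ^ 3) * \<theta> x = i2"
        using t by (simp add: i2_def power2_eq_square power3_eq_cube)
      have "h x * v * v + (K\<^sup>2 * f' x / f x ^ 3 - V' x) * \<theta> x
        = h x * (v\<^sup>2 + A * (inverse (\<theta> x ^ 3) * \<theta> x) - K\<^sup>2 * \<mu>\<^sup>2 * ((\<theta> x)\<^sup>2 + d * (inverse (\<theta> x ^ 3) * \<theta> x)))"
        unfolding acc by (simp add: algebra_simps power2_eq_square)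
      also have "v\<^sup>2 + A * (inverse (\<theta> x ^ 3) * \<theta> x) - K\<^sup>2 * \<mu>\<^sup>2 * ((\<theta> x)\<^sup>2 + d * (inverse (\<theta> x ^ 3) * \<theta> x))
        = (2 * e - 2 * B - K\<^sup>2 * \<mu>\<^sup>2 * c) - 2 * \<mu>\<^sup>2 * K\<^sup>2 * (\<theta> x)\<^sup>2"
        unfolding i3 en hx by (simp add: algebra_simps)
      also have "2 * e - 2 * B - K\<^sup>2 * \<mu>\<^sup>2 * c = 2 * \<mu>\<^sup>2 * K\<^sup>2 * m"
        unfolding m_def using K \<mu>(1) by simp
      finally show ?thesis by (simp add: Z_def x_def algebra_simps)
    qed
    moreover have "h x * - (2 * \<mu>\<^sup>2 * K\<^sup>2 * Z t) / (\<mu> * K) = - (2 * \<mu> * K * h (r t) * Z t)"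
      using K \<mu>(1) by (simp add: x_def power2_eq_square)
    ultimately show ?thesis by (simp only:)
  qed
  \<comment> \<open>Rotating the pair (\<open>Z\<close>, \<open>Y\<close>) back by the angle
    \<open>\<eta>\<close> gives two constants, the amplitudes of the oscillation.\<close>
  define p where "p t = Z t * cos (\<eta> t) - Y t * sin (\<eta> t)" for t
  define q where "q t = Z t * sin (\<eta> t) + Y t * cos (\<eta> t)" for t
  have "(p has_real_derivative 0) (at t)" "(q has_real_derivative 0) (at t)" for t
    unfolding p_def[abs_def] q_def[abs_def]
    by (auto intro!: derivative_eq_intros dZ dY d\<eta> simp: algebra_simps)
  then have const: "p t = p 0" "q t = q 0" for t
    using derivative_zero_imp_eq[of UNIV p t 0] derivative_zero_imp_eq[of UNIV q t 0] by auto
  have "(\<theta> (r t))\<^sup>2 = m + p 0 * cos (2 / \<mu> * \<phi> t) + q 0 * sin (2 / \<mu> * \<phi> t)" for t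
  proof -
    have "p t * cos (\<eta> t) + q t * sin (\<eta> t) = Z t * (cos (\<eta> t) * cos (\<eta> t) + sin (\<eta> t) * sin (\<eta> t))"
      unfolding p_def q_def by (simp add: algebra_simps del: sin_cos_squared_add3)
    also have "\<dots> = Z t" by (simp only: sin_cos_squared_add3 mult_1_right)
    finally have "Z t = p 0 * cos (\<eta> t) + q 0 * sin (\<eta> t)"
      using const(1)[of t] const(2)[of t] by simp
    then show ?thesis by (simp add: Z_def \<eta>_def)
  qed
  then show ?thesis by (rule that)
qed

text \<open>\<theta> is increasing and keeps one sign, so its square still determines the radius;
  the harmonic law controls \<theta> only through its square.\<close>

lemma \<theta>_square_inj:
  assumes "x \<in> I" "y \<in> I" "(\<theta> x)\<^sup>2 = (\<theta> y)\<^sup>2"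
  shows "x = y"
proof -
  have "\<theta> x = \<theta> y \<or> \<theta> x = - \<theta> y" using assms(3) by (simp add: power2_eq_iff)
  moreover have "(0 < \<theta> x \<and> 0 < \<theta> y) \<or> (\<theta> x < 0 \<and> \<theta> y < 0)"
    using nonzero_same_sign[OF smooth_continuous_on[OF smooth_\<theta>] \<theta>_nonzero] assms(1,2) by blast
  ultimately have eq: "\<theta> x = \<theta> y" by auto
  show ?thesis
  proof (rule ccontr)
    assume "x \<noteq> y"
    then consider "x < y" | "y < x" by linarith
    then show False
      using einterval_deriv_increasing[OF \<theta>_deriv h_f(1) assms(1,2)]
        einterval_deriv_increasing[OF \<theta>_deriv h_f(1) assms(2,1)] eq by cases auto
  qed
qed

text \<open>The angle is a bijective function of time, so r is a function \<rho> of the angle, with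
  \<theta>^2 along \<rho> a harmonic oscillation of period pi \<mu>. Rationality of \<mu> makes a
  multiple of this period a whole number of turns, which closes the orbit.\<close>

lemma orbit_function:
  assumes ns: "nonsingular_bounded a b f V r \<phi>"
  obtains \<rho> where "\<And>t. r t = \<rho> (\<phi> t)" "\<And>x. \<rho> (x + pi * \<mu>) = \<rho> x" "closed_orbit r \<phi>"
    "\<not> circular UNIV r \<phi> \<longrightarrow> minimal_positive_period \<rho> (pi * \<mu>)"
proof -
  obtain K where sol: "is_solution a b f V UNIV r \<phi>" and mom: "has_angular_momentum f UNIV r \<phi> K"
    and K: "K \<noteq> 0" using nonsingular_momentum[OF ns] .
  have mem: "r t \<in> I" for t using solution_mem[OF sol mom] by simp
  obtain m p q where u: "\<And>t. (\<theta> (r t))\<^sup>2 = m + p * cos (2 / \<mu> * \<phi> t) + q * sin (2 / \<mu> * \<phi> t)"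
    using harmonic[OF sol mom K] by blast
  obtain r1 r2 where r12: "{r1..r2} \<subseteq> I" "orbit UNIV r \<phi> \<subseteq> {r1..r2} \<times> sphere 0 1"
    using ns by (auto simp: nonsingular_bounded_def bounded_trajectory_def)
  have r_mem: "r t \<in> {r1..r2}" for t
  proof -
    have "(r t, cis (\<phi> t)) \<in> orbit UNIV r \<phi>" by (auto simp: orbit_def)
    then have "(r t, cis (\<phi> t)) \<in> {r1..r2} \<times> sphere 0 1" using r12(2) by blast
    then show ?thesis by simp
  qed
  have cf2: "continuous_on I (\<lambda>x. (f x)\<^sup>2)"
    by (rule smooth_continuous_on) (intro smooth_intros smooth_f)
  \<comment> \<open>On the compact range of radii f^2 is bounded above, so the angular speed stays
    away from zero and the angle runs over the whole line.\<close>
  obtain M where M: "0 < M" "\<And>x. x \<in> {r1..r2} \<Longrightarrow> \<bar>(f x)\<^sup>2\<bar> \<le> M"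
    using continuous_on_Icc_bound[OF continuous_on_subset[OF cf2 r12(1)]] by blast
  define \<sigma> where "\<sigma> = sgn K"
  have \<sigma>: "\<sigma> * \<sigma> = 1" "\<sigma> * K = \<bar>K\<bar>" "\<sigma> * \<bar>K\<bar> = K" using K by (auto simp: \<sigma>_def sgn_if)
  define g where "g t = \<bar>K\<bar> / (f (r t))\<^sup>2" for t
  have fr: "f (r t) \<noteq> 0" for t by (rule f_nonzero[OF mem])
  have cr: "continuous_on UNIV r"
    using solution_r[OF sol mom UNIV_I] DERIV_isCont continuous_at_imp_continuous_on by blast
  have cg: "continuous_on UNIV g"
    unfolding g_def using fr
    by (intro continuous_on_divide continuous_on_const continuous_on_compose2[OF cf2 cr]) (auto simp: mem)
  have g_bound: "0 < \<bar>K\<bar> / M" "\<And>t. \<bar>K\<bar> / M \<le> g t"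
    unfolding g_def using K M(1) M(2)[OF r_mem] fr by (auto intro!: divide_left_mono mult_pos_pos)
  obtain H Hi where H: "\<And>x. (H has_real_derivative g x) (at x)" "H 0 = 0" "strict_mono H"
    "\<And>x. Hi (H x) = x" "\<And>y. H (Hi y) = y" "\<And>y. (Hi has_real_derivative 1 / g (Hi y)) (at y)"
    by (rule positive_primitive_bij[OF cg g_bound], rule that)
  have \<phi>_H: "\<phi> t = \<sigma> * H t + \<phi> 0" for t
  proof -
    have "\<phi> t - \<sigma> * H t = \<phi> 0 - \<sigma> * H 0"
    proof (rule derivative_zero_imp_eq[of UNIV "\<lambda>t. \<phi> t - \<sigma> * H t"])
      show "((\<lambda>t. \<phi> t - \<sigma> * H t) has_real_derivative 0) (at t)" for t
        using DERIV_diff[OF solution_\<phi>[OF sol mom, of t] DERIV_cmult[OF H(1), of \<sigma>]] \<sigma>(3) by (simp add: g_def)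
    qed auto
    then show ?thesis using H(2) by simp
  qed
  define \<phi>i where "\<phi>i x = Hi (\<sigma> * (x - \<phi> 0))" for x
  have \<phi>\<phi>i: "\<phi> (\<phi>i x) = x" for x
    using \<phi>_H[of "\<phi>i x"] \<sigma>(1) by (simp add: \<phi>i_def H(5) flip: mult.assoc)
  have \<phi>i\<phi>: "\<phi>i (\<phi> t) = t" for t
  proof -
    have "\<sigma> * (\<phi> t - \<phi> 0) = H t" using \<phi>_H[of t] \<sigma>(1) by (simp flip: mult.assoc)
    then show ?thesis by (simp add: \<phi>i_def H(4))
  qed
  define \<rho> where "\<rho> x = r (\<phi>i x)" for x
  define U where "U x = m + p * cos (2 / \<mu> * x) + q * sin (2 / \<mu> * x)" for x
  have \<rho>I: "\<rho> x \<in> I" for x unfolding \<rho>_def by (rule mem)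
  have \<rho>U: "(\<theta> (\<rho> x))\<^sup>2 = U x" for x unfolding \<rho>_def u \<phi>\<phi>i U_def ..
  have r\<rho>: "r t = \<rho> (\<phi> t)" for t by (simp add: \<rho>_def \<phi>i\<phi>)
  have per: "\<rho> (x + pi * \<mu>) = \<rho> x" for x
  proof (rule \<theta>_square_inj[OF \<rho>I \<rho>I])
    have "2 / \<mu> * (x + pi * \<mu>) = 2 / \<mu> * x + 2 * pi" using \<mu>(1) by (simp add: field_simps)
    then show "(\<theta> (\<rho> (x + pi * \<mu>)))\<^sup>2 = (\<theta> (\<rho> x))\<^sup>2" unfolding \<rho>U U_def by simp
  qed
  have "closed_orbit r \<phi>"
  proof -
    \<comment> \<open>With \<mu> = k / l, the angle 2 pi k is at once k full turns and 2 l periods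
      pi \<mu> of \<rho>; N is this angle with the sign of the rotation.\<close>
    obtain k l :: nat where kl: "l \<noteq> 0" "\<bar>\<mu>\<bar> = real k / real l"
      using Rats_abs_nat_div_natE[OF \<mu>(2)] by metis
    have kl': "\<mu> = real k / real l" "0 < k"
      using kl \<mu>(1) by (auto intro: Nat.gr0I)
    define N where "N = \<sigma> * (2 * pi * real k)"
    have "N = of_int (2 * int l * (if 0 < K then 1 else -1)) * (pi * \<mu>)"
      using kl(1) K unfolding N_def kl'(1) \<sigma>_def by (simp add: sgn_if)
    then obtain j :: int where j: "N = of_int j * (pi * \<mu>)" by blast
    have \<rho>N: "\<rho> (x + N) = \<rho> x" for x
      unfolding j using shift_by_int_multiples[of \<rho> "pi * \<mu>" 0 x j] per by simp
    have "N = 2 * pi * of_int (int k * (if 0 < K then 1 else -1))"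
      using K by (simp add: N_def \<sigma>_def sgn_if)
    then obtain n :: int where n: "N = 2 * pi * of_int n" by blast
    have cisN: "cis (x + N) = cis x" for x
      unfolding n by (simp add: cis_mult[symmetric] cis_multiple_2pi)
    \<comment> \<open>Time at which the angle has advanced by N. The angular speed depends on the
      radius alone, which repeats, so S has unit derivative and is a shift by a fixed positive
      time.\<close>
    define S where "S t = \<phi>i (\<phi> t + N)" for t
    have \<phi>S: "\<phi> (S t) = \<phi> t + N" for t by (simp add: S_def \<phi>\<phi>i)
    have rS: "r (S t) = r t" for t unfolding r\<rho>[of "S t"] \<phi>S \<rho>N by (simp add: r\<rho>)
    have HS: "H (S t) = H t + 2 * pi * real k" for t
    proof -
      have "\<sigma> * (\<sigma> * H (S t)) = \<sigma> * (\<sigma> * H t + N)" using \<phi>S[of t] \<phi>_H[of "S t"] \<phi>_H[of t] by simp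
      moreover have "\<sigma> * N = 2 * pi * real k" using \<sigma>(1) by (simp add: N_def flip: mult.assoc)
      ultimately show ?thesis using \<sigma>(1) by (simp add: distrib_left flip: mult.assoc)
    qed
    then have S_Hi: "S t = Hi (H t + 2 * pi * real k)" for t using H(4)[of "S t"] by simp
    have dS: "(S has_real_derivative 1) (at t)" for t
    proof -
      have "((\<lambda>t. Hi (H t + 2 * pi * real k)) has_real_derivative 1 / g (Hi (H t + 2 * pi * real k)) * (g t + 0)) (at t)"
        by (rule DERIV_chain2[OF H(6)]) (intro DERIV_add DERIV_const H(1))
      moreover have "g (Hi (H t + 2 * pi * real k)) = g t"
        unfolding S_Hi[symmetric] g_def rS ..
      moreover have "g t \<noteq> 0" using K fr by (simp add: g_def)
      ultimately show ?thesis by (simp add: S_Hi[abs_def])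
    qed
    have St: "S t = t + S 0" for t
    proof -
      have "S t - t = S 0 - 0"
      proof (rule derivative_zero_imp_eq[of UNIV "\<lambda>t. S t - t"])
        show "((\<lambda>t. S t - t) has_real_derivative 0) (at t)" for t
          using DERIV_diff[OF dS DERIV_ident, of t] by simp
      qed auto
      then show ?thesis by simp
    qed
    have "H 0 < H (S 0)" using HS[of 0] kl'(2) by simp
    then have "0 < S 0" by (simp add: strict_mono_less[OF H(3)])
    moreover have "r (t + S 0) = r t" "cis (\<phi> (t + S 0)) = cis (\<phi> t)" for t
      using rS[of t] \<phi>S[of t] cisN by (simp_all add: St[of t])
    ultimately show ?thesis unfolding closed_orbit_def by blast
  qed
  moreover have "minimal_positive_period \<rho> (pi * \<mu>)" if nc: "\<not> circular UNIV r \<phi>"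
    unfolding minimal_positive_period_def
  proof (intro conjI allI impI per)
    show "0 < pi * \<mu>" using \<mu>(1) by simp
    fix T :: real assume T: "0 < T" "\<forall>x. \<rho> (x + T) = \<rho> x"
    have UT: "U (x + T) = U x" for x using T(2) \<rho>U by metis
    define e where "e = 2 / \<mu> * T"
    \<comment> \<open>Periodicity is evaluated at 0 and at a quarter of the period, where cos and
      sin exchange their parts: rotation by e fixes (p, q). As the orbit is not circular this vector
      is nonzero, so cos e = 1.\<close>
    have 1: "p * cos e + q * sin e = p" using UT[of 0] by (simp add: U_def e_def)
    have "2 / \<mu> * (pi * \<mu> / 4 + T) = pi / 2 + e" "2 / \<mu> * (pi * \<mu> / 4) = pi / 2"
      using \<mu>(1) by (simp_all add: e_def field_simps)
    then have 2: "q * cos e - p * sin e = q"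
      using UT[of "pi * \<mu> / 4"] by (simp add: U_def cos_add sin_add)
    have "p * (p * cos e + q * sin e) + q * (q * cos e - p * sin e) = p * p + q * q" unfolding 1 2 ..
    then have "(p * p + q * q) * cos e = (p * p + q * q) * 1" by (simp add: algebra_simps)
    moreover have "p * p + q * q \<noteq> 0"
    proof
      assume "p * p + q * q = 0"
      then have pq: "p = 0" "q = 0" by (simp_all add: sum_squares_eq_zero_iff)
      have "r t = r 0" for t
        by (rule \<theta>_square_inj[OF mem mem]) (simp add: u pq)
      then show False using constant_radius_circular[OF sol mom K] nc by blast
    qed
    ultimately have "cos e = 1" by (metis mult_cancel_left)
    then obtain n :: int where n: "e = of_int n * 2 * pi" using cos_one_2pi_int by blast
    have "0 < e" using T(1) \<mu>(1) by (simp add: e_def)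
    then have "0 < n" using n by (simp add: zero_less_mult_iff)
    then have n1: "1 \<le> real_of_int n" by linarith
    have "T = of_int n * (pi * \<mu>)" using n \<mu>(1) by (simp add: e_def field_simps)
    then show "pi * \<mu> \<le> T" using mult_right_mono[OF n1, of "pi * \<mu>"] \<mu>(1) by simp
  qed
  ultimately show ?thesis using that r\<rho> per by blast
qed

text \<open>Every nonsingular bounded orbit is closed, which settles all universal conditions at
  once; the existence conditions come from the stable circle at each radius and the orbits
  oscillating around it.\<close>

lemma closing_all:
  assumes "Q \<in> {semilocally_closing a b f, locally_closing a b f, closing a b f,
            strongly_closing a b f, weakly_closing a b f}"
  shows "Q V"
proof -
  obtain r0 where r0: "r0 \<in> I" using einterval_nonempty[OF ab] by blast
  note st = circle_stable[OF r0]
  have closed: "closed_orbit r \<phi>" if "nonsingular_bounded a b f V r \<phi>" for r \<phi>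
    using orbit_function[OF that] by metis
  obtain r \<phi> where orb: "nonsingular_bounded a b f V r \<phi>" "\<not> circular UNIV r \<phi>"
    using stable_circle_noncircular_orbit[OF r0 st(5,3,4)] by blast
  have near: "closed_near a b f V r K" for r K
    unfolding closed_near_def using closed zero_less_one by blast
  have loc: "cond_all_loc a b f V" "cond_all_weak_loc a b f V"
    unfolding cond_all_loc_def cond_all_weak_loc_def using near by blast+
  have "semilocally_closing a b f V"
    unfolding semilocally_closing_def cond_all_sloc_def using orb closed loc(1) by blast
  moreover have "locally_closing a b f V"
    unfolding locally_closing_def cond_exists_loc_def using st(1) loc(1) by blast
  moreover have "closing a b f V"
    unfolding closing_def cond_exists_def cond_all_def using orb closed by blast
  moreover have "strongly_closing a b f V"
    unfolding strongly_closing_def using loc(1) circle_stable(1) by blast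
  moreover have "weakly_closing a b f V"
    unfolding weakly_closing_def using loc(2) circle_stable(2) by blast
  ultimately show ?thesis using assms by auto
qed

lemma circular_momentum:
  assumes "r0 \<in> I"
  shows "(\<exists>J r \<phi>. circular_trajectory_at a b f V r0 K J r \<phi>) \<longleftrightarrow>
    K = 1 / \<mu> * sqrt (A / (\<theta> r0 ^ 4 + d)) \<or> K = - (1 / \<mu> * sqrt (A / (\<theta> r0 ^ 4 + d)))"
proof -
  have pos: "0 < \<nu> r0" by (rule \<nu>_osc[OF assms])
  have "(\<exists>J r \<phi>. circular_trajectory_at a b f V r0 K J r \<phi>) \<longleftrightarrow> K \<noteq> 0 \<and> K\<^sup>2 = \<nu> r0"
    unfolding circular_trajectory_iff
    using assms W1_zero_iff_\<nu>[OF assms, of K] W1_zero_iff[OF assms, of K] deriv_E[OF assms, of K] by auto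
  also have "\<dots> \<longleftrightarrow> K\<^sup>2 = (sqrt (\<nu> r0))\<^sup>2" using pos by auto
  also have "\<dots> \<longleftrightarrow> K = sqrt (\<nu> r0) \<or> K = - sqrt (\<nu> r0)" by (rule power2_eq_iff)
  also have "sqrt (\<nu> r0) = 1 / \<mu> * sqrt (A / (\<theta> r0 ^ 4 + d))"
  proof -
    have "sqrt (x / \<mu>\<^sup>2) = 1 / \<mu> * sqrt x" for x using \<mu>(1) by (simp add: real_sqrt_divide)
    then show ?thesis unfolding \<nu>_osc(1)[OF assms] .
  qed
  finally show ?thesis .
qed

text \<open>The derivatives of f and of V are negative multiples of P, and by the sign condition on
  A the derivative of A |\<theta>| has the sign of P. All three are strictly monotone, so f and V
  approach their infimum at the end where A |\<theta>| approaches its supremum.\<close>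

lemma boundary:
  shows "\<exists>!r0. inf_attained_at a b f r0"
    and "inf_attained_at a b f r0 \<longleftrightarrow> sup_attained_at a b (\<lambda>r. A * \<bar>\<theta> r\<bar>) r0"
    and "inf_attained_at a b f r0 \<Longrightarrow> attracting_centre a b V r0"
proof -
  have df: "(f has_real_derivative - f r * P r) (at r)" if "r \<in> I" for r
    using f_deriv[OF that] f_nonzero[OF that] by (simp add: P_def)
  have dV: "(V has_real_derivative - (\<nu> r * P r) / (f r)\<^sup>2) (at r)" if "r \<in> I" for r
    using D_derivs(4)[OF that] P_nonzero[OF that] by (simp add: \<nu>_def)
  \<comment> \<open>The constant sign of \<theta>, which turns its absolute value into a
    differentiable expression.\<close>
  obtain \<sigma> :: real where \<sigma>: "\<And>r. r \<in> I \<Longrightarrow> \<bar>\<theta> r\<bar> = \<sigma> * \<theta> r" "\<And>r. r \<in> I \<Longrightarrow> 0 < \<sigma> * \<theta> r"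
  proof -
    from nonzero_same_sign[OF smooth_continuous_on[OF smooth_\<theta>] \<theta>_nonzero]
    show ?thesis
    proof
      assume "\<forall>x\<in>I. 0 < \<theta> x"
      then show ?thesis by (intro that[of 1]) auto
    next
      assume "\<forall>x\<in>I. \<theta> x < 0"
      then show ?thesis by (intro that[of "-1"]) auto
    qed
  qed
  have d\<theta>: "((\<lambda>r. A * \<bar>\<theta> r\<bar>) has_real_derivative A * (\<sigma> * h r)) (at r)" if "r \<in> I" for r
    by (rule has_field_derivative_transform_within_open[OF DERIV_cmult[OF DERIV_cmult[OF \<theta>_deriv[OF that]]] open_einterval that])
      (simp add: \<sigma>)
  \<comment> \<open>Since A (\<theta>^4 + d) = A P \<theta>^3, the product of A, P and \<theta> is
    positive, and \<theta> may be replaced by its sign.\<close>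
  have A\<sigma>P: "0 < (A * \<sigma>) * P r" if "r \<in> I" for r
  proof -
    have "0 < A * (P r * \<theta> r ^ 3)" unfolding P_\<theta>'(1)[OF that] by (rule A_pos[OF that])
    also have "A * (P r * \<theta> r ^ 3) = A * P r * \<theta> r * (\<theta> r)\<^sup>2" by (simp add: power2_eq_square power3_eq_cube)
    finally have "0 < A * P r * \<theta> r" by (rule zero_less_mult_pos2) (simp add: \<theta>_nonzero[OF that])
    then have "0 < (A * P r * \<theta> r) * (\<sigma> * \<theta> r)" using \<sigma>(2)[OF that] by (rule mult_pos_pos)
    also have "(A * P r * \<theta> r) * (\<sigma> * \<theta> r) = (A * \<sigma> * P r) * (\<theta> r)\<^sup>2" by (simp add: power2_eq_square)
    finally show ?thesis by (rule zero_less_mult_pos2) (simp add: \<theta>_nonzero[OF that])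
  qed
  have "(\<exists>!r0. inf_attained_at a b f r0) \<and>
    (inf_attained_at a b f r0 \<longleftrightarrow> sup_attained_at a b (\<lambda>r. A * \<bar>\<theta> r\<bar>) r0) \<and>
    (inf_attained_at a b f r0 \<longrightarrow> attracting_centre a b V r0)"
    using P_same_sign
  proof
    assume pos: "\<forall>r\<in>I. 0 < P r"
    have 1: "inf_attained_at a b f r0 \<longleftrightarrow> r0 = b" for r0
      by (rule decreasing_inf_attained_at[OF ab], rule einterval_deriv_decreasing[OF df])
        (use pos f_pos in auto)
    have 2: "inf_attained_at a b V r0 \<longleftrightarrow> r0 = b" for r0
      by (rule decreasing_inf_attained_at[OF ab], rule einterval_deriv_decreasing[OF dV])
        (use pos \<nu>_osc(2) f_nonzero in \<open>auto intro!: divide_pos_pos\<close>)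
    have p: "0 < A * (\<sigma> * h r)" if "r \<in> I" for r
    proof -
      have "0 < A * \<sigma>" by (rule zero_less_mult_pos2[OF A\<sigma>P[OF that]]) (use pos that in blast)
      then show ?thesis using h_f(1)[OF that] by (simp flip: mult.assoc)
    qed
    have 3: "sup_attained_at a b (\<lambda>r. A * \<bar>\<theta> r\<bar>) r0 \<longleftrightarrow> r0 = b" for r0
      by (rule increasing_sup_attained_at[OF ab], rule einterval_deriv_increasing[OF d\<theta> p])
    show ?thesis unfolding attracting_centre_def 1 2 3 by simp
  next
    assume neg: "\<forall>r\<in>I. P r < 0"
    have 1: "inf_attained_at a b f r0 \<longleftrightarrow> r0 = a" for r0
      by (rule increasing_inf_attained_at[OF ab], rule einterval_deriv_increasing[OF df])
        (use neg f_pos in \<open>auto intro!: mult_pos_neg\<close>)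
    have 2: "inf_attained_at a b V r0 \<longleftrightarrow> r0 = a" for r0
      by (rule increasing_inf_attained_at[OF ab], rule einterval_deriv_increasing[OF dV])
        (use neg \<nu>_osc(2) f_nonzero in \<open>auto intro!: divide_neg_pos mult_pos_neg\<close>)
    have p: "A * (\<sigma> * h r) < 0" if "r \<in> I" for r
    proof -
      have "x < 0" if "0 < x * y" "y < 0" for x y :: real using that by (simp add: zero_less_mult_iff)
      from this[OF A\<sigma>P[OF that]] have "A * \<sigma> < 0" using neg that by blast
      then show ?thesis using h_f(1)[OF that] by (simp add: mult_neg_pos flip: mult.assoc)
    qed
    have 3: "sup_attained_at a b (\<lambda>r. A * \<bar>\<theta> r\<bar>) r0 \<longleftrightarrow> r0 = a" for r0
      by (rule decreasing_sup_attained_at[OF ab], rule einterval_deriv_decreasing[OF d\<theta> p])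
    show ?thesis unfolding attracting_centre_def 1 2 3 by simp
  qed
  then show "\<exists>!r0. inf_attained_at a b f r0"
    and "inf_attained_at a b f r0 \<longleftrightarrow> sup_attained_at a b (\<lambda>r. A * \<bar>\<theta> r\<bar>) r0"
    and "inf_attained_at a b f r0 \<Longrightarrow> attracting_centre a b V r0" by blast+
qed

end

section \<open>The theorem\<close>

theorem mainTheorem2:
  fixes a b :: ereal and f :: "real \<Rightarrow> real"
  assumes "a < b"
    and "smooth_on_interval a b f"
    and "\<forall>r \<in> einterval a b. f r > 0"
    and "\<not> (\<exists>\<xi> \<in> \<rat>. \<xi> > 0 \<and>
               (\<forall>r \<in> einterval a b. deriv (deriv f) r * f r - (deriv f r)\<^sup>2 = - (\<xi>\<^sup>2)))"
    and "\<forall>r \<in> einterval a b. deriv f r \<noteq> 0"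
  shows
    "(\<forall>P \<in> {semilocally_closing a b f, locally_closing a b f, closing a b f,
            strongly_closing a b f, weakly_closing a b f}.
        at_most_one_potential a b P \<and>
        (exactly_one_potential a b P \<longleftrightarrow> (\<exists>\<theta> \<mu> c d. metric_normal_form a b f \<theta> \<mu> c d)) \<and>
        (\<forall>\<theta> \<mu> c d V. metric_normal_form a b f \<theta> \<mu> c d \<and> central_potential a b V \<longrightarrow>
           (P V \<longleftrightarrow>
             (\<exists>A B. (\<forall>r \<in> einterval a b. A * ((\<theta> r)^4 + d) > 0) \<and>
                    (\<forall>r \<in> einterval a b. V r = oscillator_potential \<theta> A B r))))) \<and>
     (\<forall>\<theta>1 \<mu>1 c1 d1 \<theta>2 \<mu>2 c2 d2.
        metric_normal_form a b f \<theta>1 \<mu>1 c1 d1 \<and> metric_normal_form a b f \<theta>2 \<mu>2 c2 d2 \<longrightarrow>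
        (\<forall>r \<in> einterval a b. \<theta>1 r = \<theta>2 r) \<and> (\<mu>1, c1, d1) = (\<mu>2, c2, d2)) \<and>
     (\<forall>\<theta> \<mu> c d A B.
        metric_normal_form a b f \<theta> \<mu> c d \<and>
        (\<forall>r \<in> einterval a b. A * ((\<theta> r)^4 + d) > 0) \<longrightarrow>
        (\<forall>r \<phi>. nonsingular_bounded a b f (oscillator_potential \<theta> A B) r \<phi> \<and>
                \<not> circular UNIV r \<phi> \<longrightarrow>
           (\<exists>\<rho>. (\<forall>t. r t = \<rho> (\<phi> t)) \<and> minimal_positive_period \<rho> (pi * \<mu>))) \<and>
        (\<forall>r0 \<in> einterval a b. \<forall>K.
           (\<exists>I r \<phi>. circular_trajectory_at a b f (oscillator_potential \<theta> A B) r0 K I r \<phi>) \<longleftrightarrow>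
           K = 1 / \<mu> * sqrt (A / ((\<theta> r0)^4 + d)) \<or>
           K = - (1 / \<mu> * sqrt (A / ((\<theta> r0)^4 + d)))) \<and>
        (\<exists>!r0. inf_attained_at a b f r0) \<and>
        (\<forall>r0. (inf_attained_at a b f r0 \<longleftrightarrow> sup_attained_at a b (\<lambda>r. A * \<bar>\<theta> r\<bar>) r0) \<and>
              (inf_attained_at a b f r0 \<longrightarrow>
                 attracting_centre a b (oscillator_potential \<theta> A B) r0)))"
proof -
  let ?I = "einterval a b"
  let ?\<C> = "{semilocally_closing a b f, locally_closing a b f, closing a b f,
            strongly_closing a b f, weakly_closing a b f}"
  have field: "bertrand_field a b f V" if "central_potential a b V" for V
    using assms that
    by (intro bertrand_field.intro central_field.intro bertrand_field_axioms.intro)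
      (simp_all add: central_potential_def)
  have oscillator: "oscillator_field a b f V \<theta> \<mu> c d A B"
    if "central_potential a b V" "metric_normal_form a b f \<theta> \<mu> c d"
      "\<forall>r \<in> ?I. A * ((\<theta> r)^4 + d) > 0" "\<forall>r \<in> ?I. V r = oscillator_potential \<theta> A B r" for V \<theta> \<mu> c d A B
    using field[OF that(1)] that(2-4)
    by (intro oscillator_field.intro normal_form_field.intro normal_form_field_axioms.intro
        oscillator_field_axioms.intro) simp_all
  have nf_unique: "(\<forall>r \<in> ?I. \<theta>1 r = \<theta>2 r) \<and> (\<mu>1, c1, d1) = (\<mu>2, c2, d2)"
    if "metric_normal_form a b f \<theta>1 \<mu>1 c1 d1" "metric_normal_form a b f \<theta>2 \<mu>2 c2 d2"
    for \<theta>1 \<mu>1 c1 d1 \<theta>2 \<mu>2 c2 d2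
  proof -
    \<comment> \<open>The normal form concerns f alone; the zero potential serves to enter the
      setting in which it is analysed.\<close>
    have "central_potential a b (\<lambda>_. 0)" by (simp add: central_potential_def smooth_const)
    then interpret bertrand_field a b f "\<lambda>_. 0" by (rule field)
    show ?thesis using normal_form_unique[OF that] by blast
  qed
  have smooth_oscillator: "central_potential a b (oscillator_potential \<theta> A B)"
    if "metric_normal_form a b f \<theta> \<mu> c d" for \<theta> \<mu> c d A B
    unfolding central_potential_def oscillator_potential_def[abs_def]
    by (intro smooth_intros) (use that in \<open>auto simp: metric_normal_form_def\<close>)
  have necessary: "\<exists>\<theta> \<mu> c d A B. metric_normal_form a b f \<theta> \<mu> c d \<and>
      (\<forall>r \<in> ?I. A * ((\<theta> r)^4 + d) > 0) \<and> (\<forall>r \<in> ?I. V r = oscillator_potential \<theta> A B r)"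
    if "Q \<in> ?\<C>" "central_potential a b V" "Q V" for Q V
  proof -
    interpret bertrand_field a b f V by (rule field[OF that(2)])
    interpret isochronous_field a b f V by (rule closing_isochronous[OF that(1,3)])
    show ?thesis by (rule normal_form) blast
  qed
  have characterization: "Q V \<longleftrightarrow>
      (\<exists>A B. (\<forall>r \<in> ?I. A * ((\<theta> r)^4 + d) > 0) \<and> (\<forall>r \<in> ?I. V r = oscillator_potential \<theta> A B r))"
    if Q: "Q \<in> ?\<C>" and nf: "metric_normal_form a b f \<theta> \<mu> c d" and V: "central_potential a b V" for Q \<theta> \<mu> c d V
  proof
    assume "Q V"
    from necessary[OF Q V this] obtain \<theta>' \<mu>' c' d' A B where nf': "metric_normal_form a b f \<theta>' \<mu>' c' d'"
      and *: "\<forall>r \<in> ?I. A * ((\<theta>' r)^4 + d') > 0" "\<forall>r \<in> ?I. V r = oscillator_potential \<theta>' A B r" by blast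
    \<comment> \<open>Any given normal form agrees with the one extracted from V, so the potential
      can be expressed through the given \<theta>.\<close>
    from nf_unique[OF nf nf'] have "\<forall>r \<in> ?I. \<theta> r = \<theta>' r" "d = d'" by auto
    then show "\<exists>A B. (\<forall>r \<in> ?I. A * ((\<theta> r)^4 + d) > 0) \<and> (\<forall>r \<in> ?I. V r = oscillator_potential \<theta> A B r)"
      using * by (intro exI[of _ A] exI[of _ B]) (simp add: oscillator_potential_def)
  next
    assume "\<exists>A B. (\<forall>r \<in> ?I. A * ((\<theta> r)^4 + d) > 0) \<and> (\<forall>r \<in> ?I. V r = oscillator_potential \<theta> A B r)"
    then obtain A B where "\<forall>r \<in> ?I. A * ((\<theta> r)^4 + d) > 0" "\<forall>r \<in> ?I. V r = oscillator_potential \<theta> A B r" by blast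
    from oscillator_field.closing_all[OF oscillator[OF V nf this] Q] show "Q V" .
  qed
  have at_most_one: "at_most_one_potential a b Q" if Q: "Q \<in> ?\<C>" for Q
    unfolding at_most_one_potential_def
  proof (intro allI impI)
    fix V W assume VW: "central_potential a b V \<and> Q V \<and> central_potential a b W \<and> Q W"
    then obtain \<theta> \<mu> c d A B where nf: "metric_normal_form a b f \<theta> \<mu> c d"
      and V: "\<forall>r \<in> ?I. A * ((\<theta> r)^4 + d) > 0" "\<forall>r \<in> ?I. V r = oscillator_potential \<theta> A B r"
      using necessary[OF Q, of V] by blast
    have "central_potential a b W" "Q W" using VW by auto
    with characterization[OF Q nf this(1)] obtain A' B' where
      W: "\<forall>r \<in> ?I. A' * ((\<theta> r)^4 + d) > 0" "\<forall>r \<in> ?I. W r = oscillator_potential \<theta> A' B' r" by blast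
    obtain r0 where r0: "r0 \<in> ?I" using einterval_nonempty[OF assms(1)] by blast
    \<comment> \<open>A and A' both have the sign of \<theta>^4 + d, so their quotient is an
      admissible positive factor.\<close>
    have "A * ((\<theta> r0)^4 + d) > 0" "A' * ((\<theta> r0)^4 + d) > 0" using V(1) W(1) r0 by auto
    then have "A \<noteq> 0" "0 < A' / A" by (auto simp: zero_less_mult_iff zero_less_divide_iff)
    moreover from this have "W r = A' / A * V r + (B' - A' / A * B)" if "r \<in> ?I" for r
      using V(2) W(2) that by (simp add: oscillator_potential_def distrib_left)
    ultimately show "potentials_equivalent a b V W" unfolding potentials_equivalent_def by blast
  qed
  have exactly_one: "exactly_one_potential a b Q \<longleftrightarrow> (\<exists>\<theta> \<mu> c d. metric_normal_form a b f \<theta> \<mu> c d)"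
    if Q: "Q \<in> ?\<C>" for Q
  proof
    assume "exactly_one_potential a b Q"
    then obtain V where "central_potential a b V" "Q V" by (auto simp: exactly_one_potential_def)
    then show "\<exists>\<theta> \<mu> c d. metric_normal_form a b f \<theta> \<mu> c d" using necessary[OF Q] by blast
  next
    assume "\<exists>\<theta> \<mu> c d. metric_normal_form a b f \<theta> \<mu> c d"
    then obtain \<theta> \<mu> c d where nf: "metric_normal_form a b f \<theta> \<mu> c d" by blast
    have "central_potential a b (\<lambda>_. 0)" by (simp add: central_potential_def smooth_const)
    then interpret normal_form_field a b f "\<lambda>_. 0" \<theta> \<mu> c d
      by (intro normal_form_field.intro normal_form_field_axioms.intro field nf)
    \<comment> \<open>The expression \<theta>^4 + d has no zero because P has none; its constant
      sign decides between A = 1 and A = -1.\<close>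
    have "continuous_on ?I (\<lambda>r. \<theta> r ^ 4 + d)"
      by (intro continuous_intros smooth_continuous_on[OF smooth_\<theta>])
    from nonzero_same_sign[OF this P_\<theta>'(2)]
    obtain A :: real where A: "\<forall>r \<in> ?I. A * ((\<theta> r)^4 + d) > 0"
    proof
      assume "\<forall>r \<in> ?I. 0 < \<theta> r ^ 4 + d"
      then show ?thesis by (intro that[of 1]) simp
    next
      assume neg: "\<forall>r \<in> ?I. \<theta> r ^ 4 + d < 0"
      show ?thesis
      proof (rule that[of "-1"], rule ballI)
        fix r assume "r \<in> ?I"
        then have "\<theta> r ^ 4 + d < 0" using neg by blast
        then show "-1 * ((\<theta> r)^4 + d) > 0" by simp
      qed
    qed
    let ?V = "oscillator_potential \<theta> A 0"
    have "central_potential a b ?V" by (rule smooth_oscillator[OF nf])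
    moreover from this have "Q ?V" using characterization[OF Q nf] A by blast
    ultimately show "exactly_one_potential a b Q"
      using at_most_one[OF Q] unfolding exactly_one_potential_def by blast
  qed
  have orbits: "(\<forall>r \<phi>. nonsingular_bounded a b f (oscillator_potential \<theta> A B) r \<phi> \<and> \<not> circular UNIV r \<phi> \<longrightarrow>
           (\<exists>\<rho>. (\<forall>t. r t = \<rho> (\<phi> t)) \<and> minimal_positive_period \<rho> (pi * \<mu>))) \<and>
        (\<forall>r0 \<in> ?I. \<forall>K.
           (\<exists>I r \<phi>. circular_trajectory_at a b f (oscillator_potential \<theta> A B) r0 K I r \<phi>) \<longleftrightarrow>
           K = 1 / \<mu> * sqrt (A / ((\<theta> r0)^4 + d)) \<or> K = - (1 / \<mu> * sqrt (A / ((\<theta> r0)^4 + d)))) \<and>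
        (\<exists>!r0. inf_attained_at a b f r0) \<and>
        (\<forall>r0. (inf_attained_at a b f r0 \<longleftrightarrow> sup_attained_at a b (\<lambda>r. A * \<bar>\<theta> r\<bar>) r0) \<and>
              (inf_attained_at a b f r0 \<longrightarrow> attracting_centre a b (oscillator_potential \<theta> A B) r0))"
    if nf: "metric_normal_form a b f \<theta> \<mu> c d" and A: "\<forall>r \<in> ?I. A * ((\<theta> r)^4 + d) > 0" for \<theta> \<mu> c d A B
  proof -
    interpret oscillator_field a b f "oscillator_potential \<theta> A B" \<theta> \<mu> c d A B
      by (rule oscillator[OF smooth_oscillator[OF nf] nf A]) simp
    have "\<exists>\<rho>. (\<forall>t. r t = \<rho> (\<phi> t)) \<and> minimal_positive_period \<rho> (pi * \<mu>)"
      if "nonsingular_bounded a b f (oscillator_potential \<theta> A B) r \<phi>" "\<not> circular UNIV r \<phi>" for r \<phi>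
      by (rule orbit_function[OF that(1)]) (use that(2) in blast)
    then show ?thesis using circular_momentum boundary by blast
  qed
  show ?thesis
  proof (intro conjI ballI)
    fix Q assume Q: "Q \<in> ?\<C>"
    show "at_most_one_potential a b Q" by (rule at_most_one[OF Q])
    show "exactly_one_potential a b Q \<longleftrightarrow> (\<exists>\<theta> \<mu> c d. metric_normal_form a b f \<theta> \<mu> c d)"
      by (rule exactly_one[OF Q])
    show "\<forall>\<theta> \<mu> c d V. metric_normal_form a b f \<theta> \<mu> c d \<and> central_potential a b V \<longrightarrow>
           (Q V \<longleftrightarrow>
             (\<exists>A B. (\<forall>r \<in> ?I. A * ((\<theta> r)^4 + d) > 0) \<and>
                    (\<forall>r \<in> ?I. V r = oscillator_potential \<theta> A B r)))"
      using characterization[OF Q] by blast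
  next
    show "\<forall>\<theta>1 \<mu>1 c1 d1 \<theta>2 \<mu>2 c2 d2.
        metric_normal_form a b f \<theta>1 \<mu>1 c1 d1 \<and> metric_normal_form a b f \<theta>2 \<mu>2 c2 d2 \<longrightarrow>
        (\<forall>r \<in> ?I. \<theta>1 r = \<theta>2 r) \<and> (\<mu>1, c1, d1) = (\<mu>2, c2, d2)"
      using nf_unique by blast
  next
    show "\<forall>\<theta> \<mu> c d A B.
        metric_normal_form a b f \<theta> \<mu> c d \<and>
        (\<forall>r \<in> ?I. A * ((\<theta> r)^4 + d) > 0) \<longrightarrow>
        (\<forall>r \<phi>. nonsingular_bounded a b f (oscillator_potential \<theta> A B) r \<phi> \<and>
                \<not> circular UNIV r \<phi> \<longrightarrow>
           (\<exists>\<rho>. (\<forall>t. r t = \<rho> (\<phi> t)) \<and> minimal_positive_period \<rho> (pi * \<mu>))) \<and>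
        (\<forall>r0 \<in> ?I. \<forall>K.
           (\<exists>I r \<phi>. circular_trajectory_at a b f (oscillator_potential \<theta> A B) r0 K I r \<phi>) \<longleftrightarrow>
           K = 1 / \<mu> * sqrt (A / ((\<theta> r0)^4 + d)) \<or>
           K = - (1 / \<mu> * sqrt (A / ((\<theta> r0)^4 + d)))) \<and>
        (\<exists>!r0. inf_attained_at a b f r0) \<and>
        (\<forall>r0. (inf_attained_at a b f r0 \<longleftrightarrow> sup_attained_at a b (\<lambda>r. A * \<bar>\<theta> r\<bar>) r0) \<and>
              (inf_attained_at a b f r0 \<longrightarrow>
                 attracting_centre a b (oscillator_potential \<theta> A B) r0))"
      using orbits by (intro allI impI) (elim conjE, rule orbits)
  qed
qed

end
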